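(* Let $G$ be a finite group which is neither cyclic nor isomorphic to a dihedral group of order $2n$ with $n$ odd. Then $$\mathsf D(G)\leq \frac34|G|.$$
   Context: A sequence over a finite group $G$ is a finite unordered list of elements of $G$ with repetition allowed; its length is its number of terms with multiplicity. It is product-one if its terms can be ordered so that their product is the identity. A minimal product-one sequence is a nonempty product-one sequence that cannot be partitioned into two nonempty product-one subsequences. $\mathsf D(G)$ (the large Davenport constant) is the maximal length of a minimal product-one sequence over $G$. *)

theory Defs
  imports "HOL-Algebra.Algebra" "HOL-Library.Multiset"
begin

definition seq_over :: "('a, 'b) monoid_scheme \<Rightarrow> 'a multiset \<Rightarrow> bool" where
  "seq_over G S \<longleftrightarrow> set_mset S \<subseteq> carrier G"

text \<open>Product of the terms of a list, in the given order (the empty list has product one).\<close>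

definition ordered_product :: "('a, 'b) monoid_scheme \<Rightarrow> 'a list \<Rightarrow> 'a" where
  "ordered_product G xs = foldr (\<otimes>\<^bsub>G\<^esub>) xs \<one>\<^bsub>G\<^esub>"

definition product_one :: "('a, 'b) monoid_scheme \<Rightarrow> 'a multiset \<Rightarrow> bool" where
  "product_one G S \<longleftrightarrow>
     seq_over G S \<and> (\<exists>xs. mset xs = S \<and> ordered_product G xs = \<one>\<^bsub>G\<^esub>)"

definition minimal_product_one :: "('a, 'b) monoid_scheme \<Rightarrow> 'a multiset \<Rightarrow> bool" where
  "minimal_product_one G S \<longleftrightarrow>
     S \<noteq> {#} \<and> product_one G S \<and>
     \<not> (\<exists>A B. S = A + B \<and> A \<noteq> {#} \<and> B \<noteq> {#} \<and> product_one G A \<and> product_one G B)"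

text \<open>For a finite group the set of lengths below is finite and nonempty, see
  \<open>finite_minimal_lengths\<close> and \<open>minimal_lengths_nonempty\<close>, so that \<^const>\<open>Max\<close> is
  a genuine maximum.\<close>

definition large_davenport :: "('a, 'b) monoid_scheme \<Rightarrow> nat" where
  "large_davenport G = Max {size S | S. minimal_product_one G S}"

text \<open>The dihedral group of order \<open>2 * n\<close> for \<open>n > 0\<close>: the semidirect product of the
  integers modulo \<open>n\<close> with a group of order two acting by inversion. The pair \<open>(a, s)\<close>
  stands for the rotation \<open>r\<close> to the power \<open>a\<close>, times the reflection \<open>t\<close> if \<open>s\<close> holds,
  where \<open>t r = r\<^sup>-\<^sup>1 t\<close>.\<close>

definition dihedral_group :: "nat \<Rightarrow> (int \<times> bool) monoid" where
  "dihedral_group n =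
     \<lparr>carrier = {0..<int n} \<times> UNIV,
      monoid.mult = (\<lambda>(a, s) (b, t). ((if s then a - b else a + b) mod int n, s \<noteq> t)),
      one = (0, False)\<rparr>"

lemma dihedral_group_is_group:
  assumes "n > 0"
  shows "group (dihedral_group n)"
proof (rule groupI)
  fix x assume x: "x \<in> carrier (dihedral_group n)"
  obtain a s where [simp]: "x = (a, s)" by (cases x)
  have a: "0 \<le> a" "a < int n" using x by (auto simp: dihedral_group_def)
  then show "\<one>\<^bsub>dihedral_group n\<^esub> \<otimes>\<^bsub>dihedral_group n\<^esub> x = x"
    by (simp add: dihedral_group_def)
  show "\<exists>y\<in>carrier (dihedral_group n).
          y \<otimes>\<^bsub>dihedral_group n\<^esub> x = \<one>\<^bsub>dihedral_group n\<^esub>"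
    using assms a
    by (intro bexI[of _ "if s then x else ((- a) mod int n, False)"])
       (auto simp: dihedral_group_def mod_simps)
qed (use assms in \<open>auto simp: dihedral_group_def mod_simps algebra_simps\<close>)

lemma order_dihedral_group: "order (dihedral_group n) = 2 * n"
  by (simp add: order_def dihedral_group_def card_cartesian_product)

context group
begin

lemma ordered_product_closed:
  "set xs \<subseteq> carrier G \<Longrightarrow> ordered_product G xs \<in> carrier G"
  by (induction xs) (auto simp: ordered_product_def)

lemma ordered_product_append:
  "set xs \<subseteq> carrier G \<Longrightarrow> set ys \<subseteq> carrier G \<Longrightarrow>
   ordered_product G (xs @ ys) = ordered_product G xs \<otimes> ordered_product G ys"
proof (induction xs)
  case Nil
  then show ?case using ordered_product_closed[of ys] by (simp add: ordered_product_def)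
next
  case (Cons x xs)
  then show ?case
    using ordered_product_closed[of xs] ordered_product_closed[of ys]
    by (simp add: ordered_product_def m_assoc)
qed

lemma minimal_product_one_size_le:
  assumes fin: "finite (carrier G)" and S: "minimal_product_one G S"
  shows "size S \<le> order G"
proof (rule ccontr)
  assume "\<not> size S \<le> order G"
  moreover obtain xs where xs: "mset xs = S" "ordered_product G xs = \<one>"
    using S by (auto simp: minimal_product_one_def product_one_def)
  moreover have sub: "set xs \<subseteq> carrier G"
    using S xs by (auto simp: minimal_product_one_def product_one_def seq_over_def)
  ultimately have len: "card (carrier G) < length xs"
    by (auto simp: order_def)
  define q where "q i = ordered_product G (drop i xs)" for i
  have dsub: "set (drop i xs) \<subseteq> carrier G" for i
    using sub set_drop_subset by (meson subset_trans)
  have tsub: "set (take i (drop j xs)) \<subseteq> carrier G" for i j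
    using dsub[of j] set_take_subset by (meson subset_trans)
  have tsub0: "set (take i xs) \<subseteq> carrier G" for i
    using tsub[of i 0] by simp
  have "\<not> inj_on q {..<length xs}"
  proof
    assume "inj_on q {..<length xs}"
    moreover have "q ` {..<length xs} \<subseteq> carrier G"
      using ordered_product_closed dsub by (auto simp: q_def)
    ultimately have "card {..<length xs} \<le> card (carrier G)"
      using fin by (rule card_inj_on_le)
    with len show False by simp
  qed
  then obtain i j where ij: "i < j" "j < length xs" "q i = q j"
    by (auto simp: inj_on_def) (metis nat_neq_iff)
  define b where "b = take (j - i) (drop i xs)"
  define r where "r = take i xs @ drop j xs"
  have dec: "drop i xs = b @ drop j xs"
    using ij append_take_drop_id[of "j - i" "drop i xs"] by (simp add: b_def)
  have full: "xs = take i xs @ b @ drop j xs"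
    using dec append_take_drop_id[of i xs] by simp
  have bsub: "set b \<subseteq> carrier G" using tsub by (simp add: b_def)
  have "q i = ordered_product G b \<otimes> q j"
    unfolding q_def dec by (rule ordered_product_append) (use bsub dsub in auto)
  then have b1: "ordered_product G b = \<one>"
    using ij ordered_product_closed[OF bsub] ordered_product_closed[OF dsub[of j]]
    by (metis q_def r_cancel_one')
  have "ordered_product G r = ordered_product G (take i xs) \<otimes> q j"
    unfolding r_def q_def by (rule ordered_product_append) (use tsub0 dsub in auto)
  also have "\<dots> = ordered_product G (take i xs @ drop i xs)"
    using ordered_product_append[OF tsub0 dsub] ij(3) by (simp add: q_def del: append_take_drop_id)
  finally have r1: "ordered_product G r = \<one>" using xs by simp
  have "S = mset b + mset r"
    using arg_cong[OF full, of mset] xs(1) by (simp add: r_def)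
  moreover have "mset b \<noteq> {#}" "mset r \<noteq> {#}"
    using ij by (auto simp: b_def r_def)
  moreover have "set r \<subseteq> carrier G"
    using tsub0 dsub by (simp add: r_def)
  then have "product_one G (mset b)" "product_one G (mset r)"
    using b1 r1 bsub unfolding product_one_def seq_over_def set_mset_mset by blast+
  ultimately show False
    using S unfolding minimal_product_one_def by blast
qed

lemma finite_minimal_lengths:
  assumes "finite (carrier G)"
  shows "finite {size S | S. minimal_product_one G S}"
  by (rule finite_subset[of _ "{..order G}"])
     (use minimal_product_one_size_le[OF assms] in auto)

lemma minimal_lengths_nonempty: "{size S | S. minimal_product_one G S} \<noteq> {}"
proof -
  have "product_one G {#\<one>#}"
    unfolding product_one_def seq_over_def ordered_product_def
    by (auto intro!: exI[of _ "[\<one>]"])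
  then have "minimal_product_one G {#\<one>#}"
    by (auto simp: minimal_product_one_def single_is_union)
  then show ?thesis by blast
qed

end

end

theory Submission
  imports Defs
begin

text \<open>
  If every product-one sequence over a subgroup \<open>H\<close> of length more than \<open>3/4 |H|\<close> splits into two
  product-one sequences, then the same holds for \<open>G\<close>, by cutting a long sequence over \<open>G\<close> into blocks with
  products in \<open>H\<close>. It therefore suffices to find one good subgroup. Three kinds are used:
  a group \<open>\<langle>x, w\<rangle>\<close> where \<open>x\<close> has prime order and \<open>w\<close> normalises but does not centralise \<open>\<langle>x\<rangle>\<close> and
  \<open>w\<^sup>2\<close> is not \<open>1\<close>; a product of two groups of order \<open>p\<close>; and the quaternion group of order 8.
  The first kind is, modulo its centre, a Frobenius group whose kernel \<open>N\<close> has prime order. There, by the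
  Cauchy-Davenport theorem, a short subsequence with enough noncommuting pairs or triples already attains
  every product in a coset of \<open>N\<close>, and so absorbs the defect of any decomposition modulo \<open>N\<close>.

  In a group without good subgroups every subgroup is cyclic or dihedral of order \<open>2n\<close> with \<open>n\<close> odd. By induction
  the centralisers of noncentral elements are cyclic and have index at most 2 in their normalisers unless these
  are the whole group, and counting conjugates shows that one of them is normal. A noncentral
  element of prime order in it gives the dihedral case; otherwise commutators are central of prime order and a
  descent on the orders of a noncommuting pair ends in the quaternion group.
\<close>

text \<open>The bound is carried by \<open>three_quarters\<close>: every product-one sequence longer
  than 3/4 of the order splits. The constant is sharp, since the three involutions of the Klein four
  group form a minimal sequence. The obstacle that shapes the first kind of subgroup is index two.
  Modulo its centre the group may then be dihedral of order \<open>2q\<close>, an excluded group,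
  where the bound 3/4 is not at hand. A weaker fact replaces it: beyond length \<open>3q\<close> a
  product-one factor of length at most \<open>q\<close> can be removed with product-one complement.
  This gives \<open>z + 1\<close> parts from more than \<open>3qz/2\<close> terms, but only for
  \<open>z \<ge> 2\<close>; the hypothesis that the square of \<open>w\<close> is not 1 supplies a
  centre of order at least 2. Decompositions are lifted from a quotient by counting: if the image
  has more parts than the kernel has elements, then the products of the lifted parts contain a
  proper block with product one, provided that the identity is the only product of the whole
  sequence in the kernel.\<close>

definition prods :: "('a, 'b) monoid_scheme \<Rightarrow> 'a multiset \<Rightarrow> 'a set" where
  "prods G S = {ordered_product G xs | xs. mset xs = S}"

definition splits :: "('a, 'b) monoid_scheme \<Rightarrow> 'a multiset \<Rightarrow> bool" where
  "splits G S \<longleftrightarrow> (\<exists>A B. S = A + B \<and> A \<noteq> {#} \<and> B \<noteq> {#} \<and> product_one G A \<and> product_one G B)"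

lemma mset_eq_image_msetD:
  "mset ys = image_mset f M \<Longrightarrow> \<exists>xs. mset xs = M \<and> map f xs = ys"
proof (induction ys arbitrary: M)
  case Nil then show ?case by auto
next
  case (Cons y ys)
  then have "y \<in># image_mset f M" by (metis list.set_intros(1) set_mset_mset)
  then obtain x where x: "x \<in># M" "y = f x" by auto
  then obtain M' where M: "M = add_mset x M'" by (metis multi_member_split)
  with Cons.prems x have "mset ys = image_mset f M'" by simp
  from Cons.IH[OF this] obtain xs where "mset xs = M'" "map f xs = ys" by blast
  with M x show ?case by (intro exI[of _ "x # xs"]) auto
qed

text \<open>The \<open>k\<close> terms violating \<open>P\<close> cut the list into
  \<open>k + 1\<close> runs. If all of them were shorter than \<open>r\<close>, the list would have
  at most \<open>k + (k + 1)(r - 1) = rk + r - 1\<close> terms.\<close>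

lemma exists_run:
  assumes "r > 0" "r * length (filter (\<lambda>x. \<not> P x) xs) + r \<le> length xs"
  shows "\<exists>as bs cs. xs = as @ bs @ cs \<and> length bs = r \<and> list_all P bs"
  using assms
proof (induction xs rule: length_induct)
  case (1 xs)
  show ?case
  proof (cases "list_all P (take r xs)")
    case True
    have "xs = [] @ take r xs @ drop r xs" by simp
    moreover have "length (take r xs) = r" using 1 by simp
    ultimately show ?thesis using True by blast
  next
    case False
    then obtain i where i: "i < r" "i < length xs" "\<not> P (xs ! i)"
      by (auto simp: list_all_length)
    define ys where "ys = drop (Suc i) xs"
    have dec: "xs = take i xs @ xs ! i # ys" using i by (simp add: id_take_nth_drop ys_def)
    have "length (filter (\<lambda>x. \<not> P x) xs) \<ge> Suc (length (filter (\<lambda>x. \<not> P x) ys))"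
      by (subst dec) (use i in simp)
    then have "r * length (filter (\<lambda>x. \<not> P x) ys) + r \<le> r * length (filter (\<lambda>x. \<not> P x) xs)"
      by (metis mult_Suc_right mult_le_mono2 add.commute)
    then have "r * length (filter (\<lambda>x. \<not> P x) ys) + r \<le> length ys"
      using 1(3) i by (simp add: ys_def)
    moreover have "length ys < length xs" using i by (simp add: ys_def)
    ultimately obtain as bs cs where "ys = as @ bs @ cs" "length bs = r" "list_all P bs"
      using 1 by blast
    then have "xs = (take i xs @ xs ! i # as) @ bs @ cs" using dec by simp
    then show ?thesis using \<open>length bs = r\<close> \<open>list_all P bs\<close> by blast
  qed
qed

section \<open>Product sets and product-one sequences in a group\<close>

context group
begin

lemma cancel_inv [simp]:
  assumes "x \<in> carrier G" "y \<in> carrier G"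
  shows "x \<otimes> (inv x \<otimes> y) = y" and "inv x \<otimes> (x \<otimes> y) = y"
  using assms by (simp_all flip: m_assoc)

lemma product_one_iff: "product_one G S \<longleftrightarrow> set_mset S \<subseteq> carrier G \<and> \<one> \<in> prods G S"
  unfolding product_one_def seq_over_def prods_def by (auto intro: sym) metis?

lemma product_one_over: "product_one G S \<Longrightarrow> set_mset S \<subseteq> carrier G"
  by (simp add: product_one_iff)

lemma prods_mult:
  assumes "set_mset A \<subseteq> carrier G" "set_mset B \<subseteq> carrier G" "x \<in> prods G A" "y \<in> prods G B"
  shows "x \<otimes> y \<in> prods G (A + B)"
proof -
  obtain xs ys where "mset xs = A" "mset ys = B" "x = ordered_product G xs" "y = ordered_product G ys"
    using assms by (auto simp: prods_def)
  moreover from this have "set xs \<subseteq> carrier G" "set ys \<subseteq> carrier G"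
    using assms by auto
  ultimately have "mset (xs @ ys) = A + B" "x \<otimes> y = ordered_product G (xs @ ys)"
    by (auto simp: ordered_product_append)
  then show ?thesis unfolding prods_def by blast
qed

lemma prods_closed: "set_mset A \<subseteq> carrier G \<Longrightarrow> x \<in> prods G A \<Longrightarrow> x \<in> carrier G"
  by (auto simp: prods_def intro!: ordered_product_closed)

lemma prods_empty [simp]: "prods G {#} = {\<one>}"
  by (auto simp: prods_def ordered_product_def)

lemma prods_single [simp]: "g \<in> carrier G \<Longrightarrow> prods G {#g#} = {g}"
  by (auto simp: prods_def ordered_product_def)

lemma prods_nonempty: "\<exists>x. x \<in> prods G A"
  using ex_mset[of A] by (auto simp: prods_def)

lemma prods_finite: "finite (prods G A)"
proof -
  have "prods G A = ordered_product G ` {xs. mset xs = A}" by (auto simp: prods_def)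
  moreover have "finite {xs. mset xs = A}"
    by (rule finite_subset[OF _ finite_lists_length_eq[of "set_mset A" "size A"]]) auto
  ultimately show ?thesis by simp
qed

lemma ordered_product_Nil [simp]: "ordered_product G [] = \<one>"
  by (simp add: ordered_product_def)

lemma ordered_product_Cons [simp]: "ordered_product G (x # xs) = x \<otimes> ordered_product G xs"
  by (simp add: ordered_product_def)

lemma ordered_product_in_subgroup:
  "subgroup H G \<Longrightarrow> set xs \<subseteq> H \<Longrightarrow> ordered_product G xs \<in> H"
  by (induction xs) (auto simp: subgroup.one_closed subgroup.m_closed)

lemma ordered_product_rotate:
  assumes "set xs \<subseteq> carrier G" "set ys \<subseteq> carrier G" "ordered_product G (xs @ ys) = \<one>"
  shows "ordered_product G (ys @ xs) = \<one>"
  using assms by (metis inv_comm ordered_product_append ordered_product_closed)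

lemma ordered_product_concat:
  "set (concat xss) \<subseteq> carrier G \<Longrightarrow>
   ordered_product G (concat xss) = ordered_product G (map (ordered_product G) xss)"
  by (induction xss) (auto simp: ordered_product_append)

text \<open>An ordering of the block products is expanded into an ordering of all terms. In this way
  a splitting found among products of blocks becomes a splitting of the original sequence.\<close>

lemma product_one_concat:
  assumes "product_one G (image_mset (ordered_product G) M)"
    and "\<And>xs. xs \<in># M \<Longrightarrow> set xs \<subseteq> carrier G"
  shows "product_one G (\<Sum>\<^sub># (image_mset mset M))"
proof -
  obtain ys where ys: "mset ys = image_mset (ordered_product G) M" "ordered_product G ys = \<one>"
    using assms(1) by (auto simp: product_one_def)
  from mset_eq_image_msetD[OF ys(1)] obtain xss
    where xss: "mset xss = M" "map (ordered_product G) xss = ys" by blast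
  have sub: "set (concat xss) \<subseteq> carrier G"
  proof
    fix x assume "x \<in> set (concat xss)"
    then obtain xs where "xs \<in> set xss" "x \<in> set xs" by auto
    with xss assms(2)[of xs] show "x \<in> carrier G" by auto
  qed
  have "mset (concat xss) = \<Sum>\<^sub># (image_mset mset M)"
    using xss by (simp add: mset_concat sum_mset_sum_list[symmetric])
  moreover have "ordered_product G (concat xss) = \<one>"
    using ordered_product_concat[OF sub] xss ys by simp
  ultimately show ?thesis
    using sub unfolding product_one_def seq_over_def by (metis set_mset_mset)
qed

text \<open>Among the \<open>card D + 1\<close> prefixes of length at most \<open>card D\<close> two
  have the same image. With \<open>f\<close> the identity this yields blocks of product one, with
  \<open>f\<close> the coset map blocks whose product lies in a normal subgroup.\<close>

lemma prefix_pigeonhole: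
  assumes "finite D" "card D \<le> length xs"
    and "\<And>i. i \<le> length xs \<Longrightarrow> f (ordered_product G (take i xs)) \<in> D"
  shows "\<exists>as bs cs. xs = as @ bs @ cs \<and> bs \<noteq> [] \<and> length bs \<le> card D \<and>
           f (ordered_product G as) = f (ordered_product G (as @ bs))"
proof -
  define g where "g i = f (ordered_product G (take i xs))" for i
  have "\<not> inj_on g {..card D}"
  proof
    assume "inj_on g {..card D}"
    moreover have "g ` {..card D} \<subseteq> D" using assms by (auto simp: g_def)
    ultimately have "card {..card D} \<le> card D" using assms(1) by (rule card_inj_on_le)
    then show False by simp
  qed
  then obtain i j where ij: "i < j" "j \<le> card D" "g i = g j"
    by (auto simp: inj_on_def) (metis nat_neq_iff)
  define bs where "bs = take (j - i) (drop i xs)"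
  have "take i xs @ bs = take j xs" using ij by (simp add: bs_def flip: take_add)
  moreover have "bs \<noteq> []" "length bs \<le> card D" using ij assms by (auto simp: bs_def)
  moreover have "xs = take i xs @ bs @ drop j xs"
    using append_take_drop_id[of j xs] calculation(1) by (metis append.assoc)
  ultimately show ?thesis
    using ij unfolding g_def by metis
qed

lemma subgroup_block:
  assumes "subgroup C G" "finite C" "card C \<le> length xs" "set xs \<subseteq> C"
  shows "\<exists>as bs cs. xs = as @ bs @ cs \<and> bs \<noteq> [] \<and> length bs \<le> card C \<and> ordered_product G bs = \<one>"
proof -
  have "ordered_product G (take i xs) \<in> C" for i
    using ordered_product_in_subgroup[OF assms(1), of "take i xs"] assms(4) set_take_subset[of i xs] by auto
  from prefix_pigeonhole[OF assms(2,3), of id] this obtain as bs cs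
    where *: "xs = as @ bs @ cs" "bs \<noteq> []" "length bs \<le> card C"
     "ordered_product G as = ordered_product G (as @ bs)" by auto
  have "set as \<subseteq> carrier G" "set bs \<subseteq> carrier G"
    using assms(1,4) *(1) subgroup.subset[of C G] by auto
  then have "ordered_product G bs = \<one>"
    using *(4) ordered_product_closed by (auto simp: ordered_product_append)
  with * show ?thesis by blast
qed

lemma remove_block:
  assumes "set (as @ bs @ cs) \<subseteq> carrier G" "ordered_product G (as @ bs @ cs) = \<one>" "ordered_product G bs = \<one>"
  shows "product_one G (mset bs)" "product_one G (mset (as @ cs))"
proof -
  show "product_one G (mset bs)"
    using assms unfolding product_one_def seq_over_def set_mset_mset by (intro conjI exI[of _ bs]) auto
  have "ordered_product G (as @ cs) = \<one>"
    using assms ordered_product_closed[of cs] by (auto simp: ordered_product_append)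
  then show "product_one G (mset (as @ cs))"
    using assms unfolding product_one_def seq_over_def set_mset_mset by (intro conjI exI[of _ "as @ cs"]) auto
qed

text \<open>If a subgroup contains almost all terms, some cyclic rotation of a product-one ordering has
  a run of \<open>card C\<close> terms from \<open>C\<close>, and two of its partial products coincide.\<close>

lemma short_factor_of_run:
  assumes po: "product_one G S" and C: "subgroup C G" "finite C"
    and big: "size S > card C * max 1 (size (filter_mset (\<lambda>x. x \<notin> C) S))"
  shows "\<exists>U. U \<subseteq># S \<and> U \<noteq> {#} \<and> size U \<le> card C \<and> set_mset U \<subseteq> C \<and> product_one G U \<and> product_one G (S - U)"
proof -
  obtain xs where xs: "mset xs = S" "ordered_product G xs = \<one>" and sub: "set xs \<subseteq> carrier G"
    using po by (auto simp: product_one_def seq_over_def)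
  have c0: "card C > 0" using C subgroup.one_closed card_gt_0_iff by blast
  have "\<exists>as bs cs. mset (as @ bs @ cs) = S \<and> ordered_product G (as @ bs @ cs) = \<one> \<and> length bs = card C
           \<and> set bs \<subseteq> C"
  proof (cases "list_all (\<lambda>x. x \<in> C) xs")
    case True
    then have "set (take (card C) xs) \<subseteq> C" using set_take_subset by (fastforce simp: list_all_iff)
    moreover have "length xs > card C" using big xs(1)
      by (metis (no_types, lifting) max.cobounded1 mult_le_mono2 nat_mult_1_right not_le order_trans size_mset)
    ultimately show ?thesis using xs
      by (intro exI[of _ "[]"] exI[of _ "take (card C) xs"] exI[of _ "drop (card C) xs"]) auto
  next
    case False
    \<comment> \<open>Rotating a term outside \<open>C\<close> to the front leaves a list with one
      bad term fewer. Hence a length above \<open>card C\<close> times the number of bad terms is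
      enough for a run of \<open>card C\<close> good ones.\<close>
    then obtain us a vs where dec: "xs = us @ a # vs" "a \<notin> C"
      by (metis (no_types, lifting) list_all_iff split_list)
    let ?ys = "vs @ us"
    let ?w = "size (filter_mset (\<lambda>x. x \<notin> C) S)"
    have "mset xs = add_mset a (mset ?ys)" using dec by simp
    then have m: "S = add_mset a (mset ?ys)" using xs by simp
    then have "?w = Suc (length (filter (\<lambda>x. x \<notin> C) ?ys))"
      using dec by (simp del: mset_append flip: mset_filter)
    moreover have "size S = Suc (length ?ys)" unfolding m by simp
    ultimately have "card C * length (filter (\<lambda>x. x \<notin> C) ?ys) + card C \<le> length ?ys"
      using big by simp
    from exists_run[OF c0 this] obtain as bs cs
      where r: "?ys = as @ bs @ cs" "length bs = card C" "list_all (\<lambda>x. x \<in> C) bs" by blast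
    have "ordered_product G ((a # vs) @ us) = \<one>"
      by (rule ordered_product_rotate) (use sub xs dec in auto)
    then have "ordered_product G ((a # as) @ bs @ cs) = \<one>" using r by simp
    moreover have "mset ((a # as) @ bs @ cs) = S" unfolding m r by simp
    ultimately show ?thesis using r by (metis list_all_iff subsetI)
  qed
  then obtain as bs cs where r: "mset (as @ bs @ cs) = S" "ordered_product G (as @ bs @ cs) = \<one>"
    "length bs = card C" "set bs \<subseteq> C" by blast
  from subgroup_block[OF C _ r(4)] r(3) obtain b1 b2 b3
    where b: "bs = b1 @ b2 @ b3" "b2 \<noteq> []" "length b2 \<le> card C" "ordered_product G b2 = \<one>" by auto
  have e: "mset ((as @ b1) @ b2 @ (b3 @ cs)) = S" using r b by simp
  have s: "set ((as @ b1) @ b2 @ (b3 @ cs)) \<subseteq> carrier G"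
    using e sub xs by (metis set_mset_mset)
  have "product_one G (mset b2)" "product_one G (mset ((as @ b1) @ (b3 @ cs)))"
    using remove_block[OF s _ b(4)] r b by simp_all
  moreover have "S - mset b2 = mset ((as @ b1) @ (b3 @ cs))"
    unfolding e[symmetric] by simp
  moreover have "mset b2 \<subseteq># S" unfolding e[symmetric] by (simp add: mset_subset_eq_add_right)
  moreover have "set b2 \<subseteq> C" using r b by auto
  ultimately show ?thesis using b by (intro exI[of _ "mset b2"]) auto
qed

text \<open>The word is cut at every index where \<open>g\<close> times the partial product lies in
  \<open>H\<close>. Blocks between consecutive cuts have products in \<open>H\<close>; the segment
  \<open>b\<close> before the first cut and the last block, which no cut closes, are the two ends
  that a cyclic reading joins. The index \<open>length ys\<close> is not counted because cyclically
  it is the index 0 again.\<close>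

lemma coset_blocks:
  assumes "subgroup H G"
  shows "g \<in> carrier G \<Longrightarrow> set ys \<subseteq> carrier G \<Longrightarrow>
    \<exists>b bss. ys = b @ concat bss \<and> (\<forall>c\<in>set bss. c \<noteq> []) \<and> (\<forall>c\<in>set (butlast bss). ordered_product G c \<in> H) \<and>
      (bss \<noteq> [] \<longrightarrow> g \<otimes> ordered_product G b \<in> H) \<and>
      length bss = card {i. i < length ys \<and> g \<otimes> ordered_product G (take i ys) \<in> H}"
proof (induction ys arbitrary: g)
  case Nil then show ?case by (intro exI[of _ "[]"]) auto
next
  case (Cons y ys)
  have gy: "g \<otimes> y \<in> carrier G" "set ys \<subseteq> carrier G" "y \<in> carrier G" using Cons.prems by auto
  from Cons.IH[OF gy(1,2)] obtain b bss where IH: "ys = b @ concat bss" "\<forall>c\<in>set bss. c \<noteq> []"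
    "\<forall>c\<in>set (butlast bss). ordered_product G c \<in> H" "bss \<noteq> [] \<longrightarrow> g \<otimes> y \<otimes> ordered_product G b \<in> H"
    "length bss = card {i. i < length ys \<and> g \<otimes> y \<otimes> ordered_product G (take i ys) \<in> H}" by blast
  have tk: "ordered_product G (take i ys) \<in> carrier G" for i
    using gy(2) set_take_subset[of i ys] by (intro ordered_product_closed) auto
  have bc: "ordered_product G b \<in> carrier G" using IH(1) gy(2) by (intro ordered_product_closed) auto
  let ?I = "{i. i < length ys \<and> g \<otimes> y \<otimes> ordered_product G (take i ys) \<in> H}"
  have fin: "finite ?I" by simp
  have set_eq: "{i. i < length (y # ys) \<and> g \<otimes> ordered_product G (take i (y # ys)) \<in> H} =
     (if g \<in> H then {0} else {}) \<union> Suc ` ?I" (is "?L = ?R")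
  proof (rule Set.set_eqI)
    fix i show "i \<in> ?L \<longleftrightarrow> i \<in> ?R"
      using gy Cons.prems tk by (cases i) (auto simp: m_assoc)
  qed
  have cd: "card ?R = (if g \<in> H then 1 else 0) + card ?I"
    using fin by (simp add: card_insert_if card_image)
  show ?case
  proof (cases "g \<in> H")
    case True
    have "bss \<noteq> [] \<Longrightarrow> ordered_product G (y # b) \<in> H"
    proof -
      assume "bss \<noteq> []"
      then have "inv g \<otimes> (g \<otimes> y \<otimes> ordered_product G b) \<in> H"
        using IH(4) True assms by (metis subgroup.m_closed subgroup.m_inv_closed)
      then show ?thesis using gy bc Cons.prems by (simp add: m_assoc)
    qed
    then have "\<forall>c\<in>set (butlast ((y # b) # bss)). ordered_product G c \<in> H" using IH(3) by auto
    moreover have "length ((y # b) # bss) = card ?L" unfolding set_eq cd using True IH(5) by simp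
    moreover have "y # ys = [] @ concat ((y # b) # bss)" using IH(1) by simp
    moreover have "\<forall>c\<in>set ((y # b) # bss). c \<noteq> []" using IH(2) by simp
    moreover have "g \<otimes> ordered_product G [] \<in> H" using True Cons.prems by simp
    ultimately show ?thesis by blast
  next
    case False
    then have "length bss = card ?L" unfolding set_eq cd using IH(5) by simp
    moreover have "y # ys = (y # b) @ concat bss" using IH(1) by simp
    moreover have "bss \<noteq> [] \<longrightarrow> g \<otimes> ordered_product G (y # b) \<in> H"
      using IH(4) gy bc Cons.prems by (simp add: m_assoc)
    ultimately show ?thesis using IH(2,3) by blast
  qed
qed

text \<open>Since the whole product is one, the open last block followed by the initial segment also
  has its product in \<open>H\<close>. So the blocks give a product-one sequence over
  \<open>H\<close> with exactly \<open>r\<close> terms, and a splitting of it expands to one of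
  \<open>S\<close>.\<close>

lemma splits_of_coset_blocks:
  assumes "subgroup H G" and S: "product_one G S"
    and xs: "mset xs = S" "ordered_product G xs = \<one>" and g: "g \<in> carrier G"
    and r: "r = card {i. i < length xs \<and> g \<otimes> ordered_product G (take i xs) \<in> H}" "r > 0"
    and bound: "\<And>T. set_mset T \<subseteq> H \<Longrightarrow> product_one G T \<Longrightarrow> size T = r \<Longrightarrow> splits G T"
  shows "splits G S"
proof -
  have sub: "set xs \<subseteq> carrier G" using S xs by (auto simp: product_one_def seq_over_def)
  from coset_blocks[OF assms(1) g sub] obtain b bss where
   B: "xs = b @ concat bss" "\<forall>c\<in>set bss. c \<noteq> []" "\<forall>c\<in>set (butlast bss). ordered_product G c \<in> H"
      "length bss = r" unfolding r(1) by blast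
  have ne: "bss \<noteq> []" using B(4) r(2) by fastforce
  define css where "css = butlast bss @ [last bss @ b]"
  have bss: "bss = butlast bss @ [last bss]" using ne by simp
  have cc: "concat css = concat bss @ b" unfolding css_def by (subst (3) bss) (simp add: concat_append del: append_butlast_last_id)
  have csub: "set (concat css) \<subseteq> carrier G" using cc B sub by auto
  have c1: "ordered_product G (concat css) = \<one>"
    unfolding cc by (rule ordered_product_rotate) (use B xs sub in auto)
  have csub': "set c \<subseteq> carrier G" if "c \<in> set css" for c using csub that by auto
  have inH: "ordered_product G c \<in> H" if "c \<in> set (butlast bss)" for c using B that by auto
  have "ordered_product G (concat css) =
     ordered_product G (map (ordered_product G) (butlast bss)) \<otimes> ordered_product G (last bss @ b)"
    using csub ordered_product_concat[of "butlast bss"] by (auto simp: css_def ordered_product_append)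
  moreover have "ordered_product G (map (ordered_product G) (butlast bss)) \<in> H"
    using inH by (intro ordered_product_in_subgroup[OF assms(1)]) auto
  moreover have "ordered_product G (last bss @ b) \<in> carrier G"
    by (intro ordered_product_closed csub') (simp add: css_def)
  ultimately have lastH: "ordered_product G (last bss @ b) \<in> H"
    using c1 subgroup.m_inv_closed[OF assms(1)] subgroup.mem_carrier[OF assms(1)]
    by (metis inv_char inv_comm)
  define T where "T = image_mset (ordered_product G) (mset css)"
  have TH: "set_mset T \<subseteq> H" using inH lastH by (auto simp: T_def css_def)
  have "ordered_product G (map (ordered_product G) css) = \<one>" using ordered_product_concat[OF csub] c1 by simp
  then have "product_one G T"
    using TH subgroup.subset[OF assms(1)]
    unfolding product_one_def seq_over_def T_def by (intro conjI exI[of _ "map (ordered_product G) css"]) auto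
  moreover have "size T = r" using B(4) r(2) by (simp add: T_def css_def)
  ultimately have "splits G T" using bound TH by blast
  then obtain A1 A2 where A: "T = A1 + A2" "A1 \<noteq> {#}" "A2 \<noteq> {#}" "product_one G A1" "product_one G A2"
    by (auto simp: splits_def)
  from image_mset_eq_plusD[OF A(1)[unfolded T_def]] obtain M1 M2
    where M: "mset css = M1 + M2" "A1 = image_mset (ordered_product G) M1" "A2 = image_mset (ordered_product G) M2"
    by auto
  have Msub: "set c \<subseteq> carrier G" if "c \<in># M1 + M2" for c
    using csub' that M(1) by (metis set_mset_mset)
  have css_ne: "c \<noteq> []" if "c \<in> set css" for c
    using that B ne last_in_set[OF ne] by (auto simp: css_def dest: in_set_butlastD)
  have nz: "\<Sum>\<^sub># (image_mset mset M) \<noteq> {#}" if "M \<noteq> {#}" "M \<subseteq># mset css" for M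
  proof -
    obtain c where c: "c \<in># M" using \<open>M \<noteq> {#}\<close> by blast
    then have "c \<noteq> []" using css_ne that(2) by (metis mset_subset_eqD set_mset_mset)
    moreover obtain M' where "M = add_mset c M'" using c by (metis multi_member_split)
    ultimately show ?thesis by simp
  qed
  have "S = mset (concat css)" using cc B(1) xs(1) by (simp add: union_commute)
  also have "\<dots> = \<Sum>\<^sub># (image_mset mset (mset css))"
    by (simp add: mset_concat sum_mset_sum_list[symmetric])
  also have "\<dots> = \<Sum>\<^sub># (image_mset mset M1) + \<Sum>\<^sub># (image_mset mset M2)"
    unfolding M(1) by simp
  finally have S_eq: "S = \<Sum>\<^sub># (image_mset mset M1) + \<Sum>\<^sub># (image_mset mset M2)" .
  have "M1 \<noteq> {#}" "M2 \<noteq> {#}" using A(2,3) M(2,3) by auto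
  then have "\<Sum>\<^sub># (image_mset mset M1) \<noteq> {#}" "\<Sum>\<^sub># (image_mset mset M2) \<noteq> {#}"
    using nz M(1) by (simp_all add: mset_subset_eq_add_left mset_subset_eq_add_right)
  moreover have "product_one G (\<Sum>\<^sub># (image_mset mset M1))" "product_one G (\<Sum>\<^sub># (image_mset mset M2))"
    using A(4,5) Msub unfolding M(2,3) by (auto intro!: product_one_concat)
  ultimately show ?thesis unfolding splits_def using S_eq by blast
qed

text \<open>Some coset of \<open>H\<close> contains at least an average number of the partial products of a product-one
  ordering of \<open>S\<close>; cutting the cyclic word there gives a product-one sequence over \<open>H\<close>.\<close>

lemma splits_of_subgroup:
  assumes fin: "finite (carrier G)" and H: "subgroup H G"
    and bound: "\<And>T. set_mset T \<subseteq> H \<Longrightarrow> product_one G T \<Longrightarrow> 3 * card H < 4 * size T \<Longrightarrow> splits G T"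
    and S: "product_one G S" "3 * order G < 4 * size S"
  shows "splits G S"
proof -
  obtain xs where xs: "mset xs = S" "ordered_product G xs = \<one>" and sub: "set xs \<subseteq> carrier G"
    using S by (auto simp: product_one_def seq_over_def)
  \<comment> \<open>With inverses, equality of the right cosets of \<open>p i\<close> and
    \<open>p i0\<close> becomes the condition
    \<open>p i0 \<otimes> ordered_product G (take i xs) \<in> H\<close>, which is the cutting rule
    of \<open>coset_blocks\<close> for \<open>g = p i0\<close>.\<close>
  define p where "p i = inv (ordered_product G (take i xs))" for i
  have tk: "ordered_product G (take i xs) \<in> carrier G" for i
    using sub set_take_subset[of i xs] by (intro ordered_product_closed) auto
  have pc: "p i \<in> carrier G" for i using tk by (simp add: p_def)
  define f where "f i = H #> p i" for i
  let ?R = "rcosets H"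
  have finR: "finite ?R" using fin rcosets_finite by (simp add: RCOSETS_def)
  have cardR: "card ?R * card H = order G" using lagrange[OF H] by simp
  have fR: "f ` {..<length xs} \<subseteq> ?R" using pc H subgroup.subset[OF H] by (auto simp: f_def intro!: rcosetsI)
  have "\<exists>D\<in>?R. length xs \<le> card ?R * card {i. i < length xs \<and> f i = D}"
  proof (rule ccontr)
    assume *: "\<not> ?thesis"
    have "length xs = (\<Sum>D\<in>?R. card {i. i < length xs \<and> f i = D})"
      using sum_fun_comp[OF _ finR fR, of "\<lambda>_. 1 :: nat"] by (simp add: lessThan_def)
    then have "card ?R * length xs = card ?R * (\<Sum>D\<in>?R. card {i. i < length xs \<and> f i = D})"
      by simp
    also have "\<dots> = (\<Sum>D\<in>?R. card ?R * card {i. i < length xs \<and> f i = D})"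
      by (simp add: sum_distrib_left)
    also have "\<dots> < (\<Sum>D\<in>?R. length xs)"
    proof (rule sum_strict_mono)
      show "?R \<noteq> {}" using cardR fin by (metis card.empty mult_0 order_gt_0_iff_finite less_numeral_extra(3))
    qed (use finR * in auto)
    finally show False by simp
  qed
  then obtain D where D: "D \<in> ?R" "length xs \<le> card ?R * card {i. i < length xs \<and> f i = D}" by blast
  have "length xs > 0" using S xs by auto
  then have "card {i. i < length xs \<and> f i = D} > 0" using D by (metis gr_zeroI mult_0_right not_le)
  then obtain i0 where i0: "i0 < length xs" "f i0 = D" by (metis (mono_tags, lifting) Collect_empty_eq card.empty less_numeral_extra(3))
  have "f i = D \<longleftrightarrow> p i0 \<otimes> ordered_product G (take i xs) \<in> H" for i
  proof -
    have "f i = D \<longleftrightarrow> p i0 \<in> H #> p i"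
      using i0 pc H by (metis f_def repr_independence rcos_self)
    also have "\<dots> \<longleftrightarrow> p i0 \<otimes> inv (p i) \<in> H"
      using pc H by (metis subgroup.rcos_module is_group)
    finally show ?thesis using tk by (simp add: p_def)
  qed
  then have eq: "{i. i < length xs \<and> f i = D} = {i. i < length xs \<and> p i0 \<otimes> ordered_product G (take i xs) \<in> H}"
    by auto
  define r where "r = card {i. i < length xs \<and> p i0 \<otimes> ordered_product G (take i xs) \<in> H}"
  have len: "length xs \<le> card ?R * r" "r > 0"
    using D eq \<open>card {i. i < length xs \<and> f i = D} > 0\<close> by (simp_all add: r_def)
  have "3 * order G < 4 * (card ?R * r)" using len S xs by (metis mult_le_mono2 order_less_le_trans size_mset)
  then have "card ?R * (3 * card H) < card ?R * (4 * r)" using cardR by (simp only: mult.assoc mult.left_commute mult.commute)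
  then have "3 * card H < 4 * r" using nat_mult_less_cancel_disj by blast
  then show ?thesis
    by (intro splits_of_coset_blocks[OF H S(1) xs pc r_def len(2)] bound) auto
qed

end

section \<open>Disjoint non-monochromatic parts of a multiset\<close>

lemma exists_submultiset:
  fixes S :: "'a multiset"
  assumes "n \<le> size S"
  shows "\<exists>T. T \<subseteq># S \<and> size T = n"
proof -
  obtain xs where "mset xs = S" using ex_mset by blast
  then have "mset (take n xs) + mset (drop n xs) = S" "size (mset (take n xs)) = n"
    using assms by (auto simp flip: mset_append)
  then show ?thesis by (metis mset_subset_eq_add_left)
qed

text \<open>A largest family of disjoint non-monochromatic \<open>r\<close>-subsets has \<open>k\<close> members: otherwise the
  remaining terms all have the same colour, and a member with two terms of other colours can be
  traded, together with remaining terms, for two new members.\<close>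

lemma disjoint_nonmonochromatic:
  fixes S :: "'a multiset" and c :: "'a \<Rightarrow> 'c"
  assumes "r \<ge> 2" "r * k \<le> size S"
    and co: "\<And>x. x \<in># S \<Longrightarrow> k \<le> size (filter_mset (\<lambda>y. c y \<noteq> c x) S)"
  shows "\<exists>Fs. length Fs = k \<and> sum_list Fs \<subseteq># S \<and>
           (\<forall>F\<in>set Fs. size F = r \<and> (\<exists>a b R. F = add_mset a (add_mset b R) \<and> c a \<noteq> c b))"
proof -
  define nm where "nm F \<longleftrightarrow> size F = r \<and> (\<exists>a b R. F = add_mset a (add_mset b R) \<and> c a \<noteq> c b)" for F
  have nmI: "nm F" if F: "size F = r" "a \<in># F" "b \<in># F" "c a \<noteq> c b" for F a b
  proof -
    obtain R where "F = add_mset a R" using F by (metis multi_member_split)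
    moreover obtain R' where "R = add_mset b R'" using F calculation by (metis insert_noteq_member multi_member_split)
    ultimately show ?thesis using F unfolding nm_def by blast
  qed
  have "\<exists>Fs. length Fs = j \<and> sum_list Fs \<subseteq># S \<and> (\<forall>F\<in>set Fs. nm F)" if "j \<le> k" for j
    using that
  proof (induction j)
    case 0
    show ?case by (intro exI[of _ "[]"]) auto
  next
    case (Suc j)
    then obtain Fs where Fs: "length Fs = j" "sum_list Fs \<subseteq># S" "\<forall>F\<in>set Fs. nm F" by auto
    define L where "L = S - sum_list Fs"
    have S: "S = L + sum_list Fs" using Fs(2) by (simp add: L_def)
    have "size (sum_list Fs) = r * j"
      using Fs(1,3) by (induction Fs arbitrary: j) (auto simp: nm_def)
    moreover have "r * Suc j \<le> r * k" using Suc.prems by (rule mult_le_mono2)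
    ultimately have L: "size L \<ge> r" using assms(2) arg_cong[OF S, of size] by simp
    show ?case
    proof (cases "\<exists>a\<in>#L. \<exists>b\<in>#L. c a \<noteq> c b")
      case True
      then obtain a b where ab: "a \<in># L" "b \<in># L" "c a \<noteq> c b" by blast
      then obtain R where R: "L = add_mset a R" by (metis multi_member_split)
      with ab obtain R' where R': "R = add_mset b R'" by (metis insert_noteq_member multi_member_split)
      have "size R' \<ge> r - 2" using L R R' by simp
      then obtain W where W: "size W = r - 2" "W \<subseteq># R'" using exists_submultiset by blast
      let ?F = "add_mset a (add_mset b W)"
      have "?F \<subseteq># L" using W R R' by simp
      then have "sum_list (?F # Fs) \<subseteq># S"
        unfolding S sum_list.Cons by (rule subset_mset.add_right_mono)
      moreover have "nm ?F" using W assms(1) ab(3) by (intro nmI[of _ a b]) auto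
      ultimately show ?thesis using Fs by (intro exI[of _ "?F # Fs"]) auto
    next
      case False
      have "L \<noteq> {#}" using L assms(1) by auto
      then obtain x where x: "x \<in># L" by blast
      have mono: "c y = c x" if "y \<in># L" for y using False x that by blast
      let ?p = "\<lambda>y. c y \<noteq> c x"
      have "x \<in># S" using S x by simp
      then have "k \<le> size (filter_mset ?p S)" using co by blast
      also have "filter_mset ?p S = filter_mset ?p L + filter_mset ?p (sum_list Fs)" by (subst S) simp
      also have "filter_mset ?p L = {#}" using mono by simp
      finally have "k \<le> size (filter_mset ?p (sum_list Fs))" by simp
      \<comment> \<open>The at least \<open>k\<close> terms of other colours all lie in the
        \<open>j < k\<close> members, so some member holds two of them.\<close>
      moreover have "size (filter_mset ?p (sum_list Fs)) \<le> j" if "\<forall>F\<in>set Fs. size (filter_mset ?p F) \<le> 1"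
        using that Fs(1) by (induction Fs arbitrary: j) fastforce+
      ultimately have "\<not> (\<forall>F\<in>set Fs. size (filter_mset ?p F) \<le> 1)" using Suc.prems by force
      then obtain F where F: "F \<in> set Fs" "size (filter_mset ?p F) \<ge> 2" by force
      then have "filter_mset ?p F \<noteq> {#}" by (metis not_numeral_le_zero size_empty)
      then obtain a where a: "a \<in># filter_mset ?p F" by blast
      then obtain W where W: "filter_mset ?p F = add_mset a W" by (metis multi_member_split)
      then have "W \<noteq> {#}" using F by auto
      then obtain b where b: "b \<in># W" by blast
      then obtain Y where Y: "W = add_mset b Y" by (metis multi_member_split)
      have "add_mset a (add_mset b Y) \<subseteq># F" using W Y by (metis multiset_filter_subset)
      then obtain R where R: "F = add_mset a (add_mset b R)"
        by (metis mset_subset_eq_exists_conv union_mset_add_mset_left)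
      have "b \<in># filter_mset ?p F" using b W by simp
      then have ab: "c a \<noteq> c x" "c b \<noteq> c x" using a by simp_all
      obtain L1 where L1: "L1 \<subseteq># L" "size L1 = r" using L exists_submultiset by blast
      then have "L1 \<noteq> {#}" using assms(1) by auto
      then obtain y where y: "y \<in># L1" by blast
      then obtain L2 where L2: "L1 = add_mset y L2" by (metis multi_member_split)
      have cy: "c y = c x" using mono y L1 by (meson mset_subset_eqD)
      have "L2 \<noteq> {#}" using L1 L2 assms(1) by auto
      then obtain y' where y': "y' \<in># L2" by blast
      have "y' \<in># L1" using y' L2 by simp
      then have cy': "c y' = c x" using mono L1 by (meson mset_subset_eqD)
      let ?F1 = "add_mset a L2" and ?F2 = "add_mset y (add_mset b R)"
      have sF: "size F = r" using Fs(3) F(1) by (simp add: nm_def)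
      have "nm ?F1" using L1 L2 ab y' cy' by (intro nmI[of _ a y']) auto
      moreover have "nm ?F2" using ab cy R sF by (intro nmI[of _ b y]) auto
      moreover obtain Gs Hs where GH: "Fs = Gs @ F # Hs" using F(1) by (metis split_list)
      moreover have "sum_list (?F1 # ?F2 # Gs @ Hs) = L1 + sum_list Fs" using L2 R GH by (simp add: ac_simps)
      then have "sum_list (?F1 # ?F2 # Gs @ Hs) \<subseteq># S" using L1 by (simp add: S)
      ultimately show ?thesis using Fs by (intro exI[of _ "?F1 # ?F2 # Gs @ Hs"]) auto
    qed
  qed
  from this[of k] show ?thesis by (simp add: nm_def)
qed

section \<open>Product sets modulo a normal subgroup of prime order\<close>

text \<open>The assumption \<open>comm_mod\<close> says that the quotient by \<open>N\<close> is
  abelian. Therefore all orderings of a sequence have products in one coset of \<open>N\<close>, and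
  \<open>q \<le> card (prods G S)\<close> means that the whole coset is attained.\<close>

locale prime_normal = group G for G (structure) +
  fixes N :: "'a set" and q :: nat
  assumes fin: "finite (carrier G)" and N: "N \<lhd> G" and cardN: "card N = q" and q: "Factorial_Ring.prime q"
    and comm_mod: "a \<in> carrier G \<Longrightarrow> b \<in> carrier G \<Longrightarrow> a \<otimes> b \<otimes> inv (b \<otimes> a) \<in> N"
begin

lemma subN: "subgroup N G"
  using N by (rule normal_imp_subgroup)

lemma N_carrier: "u \<in> N \<Longrightarrow> u \<in> carrier G"
  using subN by (rule subgroup.mem_carrier)

lemma finN: "finite N"
  using N_carrier fin by (meson finite_subset subsetI)

lemma N_mult: "u \<in> N \<Longrightarrow> v \<in> N \<Longrightarrow> u \<otimes> v \<in> N"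
  using subN by (rule subgroup.m_closed)

lemma N_inv: "u \<in> N \<Longrightarrow> inv u \<in> N"
  using subN by (rule subgroup.m_inv_closed)

lemma N_one [simp]: "\<one> \<in> N"
  using subN by (rule subgroup.one_closed)

lemma N_generated:
  assumes "u \<in> N" "u \<noteq> \<one>"
  shows "N = generate G {u}"
proof -
  have sub: "generate G {u} \<subseteq> N" using assms by (intro generate_subgroup_incl subN) auto
  have s: "subgroup (generate G {u}) (G\<lparr>carrier := N\<rparr>)"
    using subgroup_incl[OF generate_is_subgroup subN sub] assms N_carrier by auto
  have "group (G\<lparr>carrier := N\<rparr>)" using subN by (rule subgroup_imp_group)
  from group.lagrange[OF this s] have "card (generate G {u}) dvd q"
    using cardN by (metis dvd_triv_right order_def partial_object.select_convs(1) partial_object.update_convs(1) partial_object.cases_scheme)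
  moreover have "card (generate G {u}) \<noteq> 1"
  proof
    assume "card (generate G {u}) = 1"
    then obtain v where "generate G {u} = {v}" by (auto simp: card_Suc_eq)
    moreover have "u \<in> generate G {u}" "\<one> \<in> generate G {u}" by (auto intro: generate.intros)
    ultimately show False using assms by auto
  qed
  ultimately have "card (generate G {u}) = q" using q by (auto simp: prime_nat_iff)
  then show ?thesis using card_subset_eq[OF finN sub] cardN by simp
qed

lemma N_pow:
  assumes "u \<in> N" "u \<noteq> \<one>" "v \<in> N"
  obtains k :: nat where "v = u [^] k"
  using generate_pow_on_finite_carrier[OF fin N_carrier[OF assms(1)]] N_generated[OF assms(1,2)] assms(3) by blast

lemma N_comm:
  assumes "u \<in> N" "v \<in> N"
  shows "u \<otimes> v = v \<otimes> u"
proof (cases "u = \<one>")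
  case False
  obtain k :: nat where "v = u [^] k" using N_pow[OF assms(1) False assms(2)] .
  then show ?thesis using N_carrier[OF assms(1)] by (metis nat_pow_Suc nat_pow_Suc2)
qed (use assms N_carrier in simp)

text \<open>A nontrivial \<open>d\<close> generates \<open>N\<close> because \<open>q\<close> is
  prime. This is how primality enters the Cauchy-Davenport theorem.\<close>

lemma translate_N:
  assumes "A \<subseteq> N" "A \<noteq> {}" "d \<in> N" "d \<noteq> \<one>" "\<And>a. a \<in> A \<Longrightarrow> a \<otimes> d \<in> A"
  shows "A = N"
proof -
  obtain a where a: "a \<in> A" using assms by blast
  have "a \<otimes> d [^] (k :: nat) \<in> A" for k
  proof (induction k)
    case 0 then show ?case using a assms N_carrier by auto
  next
    case (Suc k)
    have "a \<otimes> d [^] k \<otimes> d \<in> A" using Suc assms(5) by blast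
    then show ?case using a assms(1,3) N_carrier by (simp add: m_assoc subset_eq)
  qed
  moreover have "\<exists>k :: nat. v = a \<otimes> d [^] k" if "v \<in> N" for v
  proof -
    have aN: "a \<in> N" using a assms(1) by blast
    then have "inv a \<otimes> v \<in> N" using that by (intro N_mult N_inv)
    then obtain k :: nat where k: "inv a \<otimes> v = d [^] k" using N_pow[OF assms(3,4)] by blast
    have "v = a \<otimes> d [^] k" unfolding k[symmetric] using aN that N_carrier by simp
    then show ?thesis ..
  qed
  ultimately show ?thesis using assms(1) by blast
qed

lemma set_multI: "a \<in> A \<Longrightarrow> b \<in> B \<Longrightarrow> a \<otimes> b \<in> A <#> B"
  by (auto simp: set_mult_def)

lemma set_mult_N: "A \<subseteq> N \<Longrightarrow> B \<subseteq> N \<Longrightarrow> A <#> B \<subseteq> N"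
  using N_mult by (fastforce simp: set_mult_def)

text \<open>Induction on \<open>card B\<close> with the Dyson transform, which replaces \<open>(A, B)\<close> by
  \<open>(A \<union> eB, B \<inter> e\<^sup>-\<^sup>1A)\<close>.\<close>

lemma cauchy_davenport:
  assumes "A \<subseteq> N" "B \<subseteq> N" "A \<noteq> {}" "B \<noteq> {}"
  shows "min q (card A + card B - 1) \<le> card (A <#> B)"
  using assms
proof (induction "card B" arbitrary: A B rule: less_induct)
  case less
  have f: "finite A" "finite B" "finite (A <#> B)"
    using less.prems finN set_mult_N finite_subset by metis+
  have cr: "a \<in> carrier G" if "a \<in> A \<union> B" for a using that less.prems N_carrier by blast
  show ?case
  proof (cases "card B = 1 \<or> A = N")
    case True
    then show ?thesis
    proof
      assume "card B = 1"
      then obtain b where b: "B = {b}" by (auto simp: card_Suc_eq)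
      have "A <#> B = (\<lambda>a. a \<otimes> b) ` A" using b by (auto simp: set_mult_def)
      moreover have "inj_on (\<lambda>a. a \<otimes> b) A"
        using inj_on_multc[of b] cr b by (meson Un_iff inj_on_subset insertI1 subsetI)
      ultimately show ?thesis using b by (simp add: card_image)
    next
      assume A: "A = N"
      obtain b where b: "b \<in> B" using less.prems by blast
      have "(\<lambda>a. a \<otimes> b) ` A \<subseteq> A <#> B" using b by (auto simp: set_mult_def)
      then have "card ((\<lambda>a. a \<otimes> b) ` A) \<le> card (A <#> B)" using f by (intro card_mono)
      moreover have "inj_on (\<lambda>a. a \<otimes> b) A"
        using inj_on_multc[of b] cr b by (meson Un_iff inj_on_subset subsetI)
      ultimately show ?thesis using A cardN by (simp add: card_image)
    qed
  next
    case False
    have "card B \<noteq> 0" using f less.prems by simp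
    with False have "card B > 1" by linarith
    then obtain b b' where bb: "b \<in> B" "b' \<in> B" "b \<noteq> b'"
      using f by (metis card_le_Suc0_iff_eq One_nat_def not_less)
    define d where "d = inv b \<otimes> b'"
    have dN: "d \<in> N" unfolding d_def using bb less.prems(2) by (intro N_mult N_inv) auto
    have d1: "d \<noteq> \<one>" using bb cr unfolding d_def by (metis UnCI inv_solve_left' inv_closed r_one one_closed)
    have "\<exists>a\<in>A. a \<otimes> d \<notin> A" using translate_N[OF _ _ dN d1] less.prems False by blast
    then obtain a where a: "a \<in> A" "a \<otimes> d \<notin> A" by blast
    \<comment> \<open>This \<open>e\<close> maps \<open>b\<close> into \<open>A\<close> but
      \<open>b'\<close> outside \<open>A\<close>, so the transformed second set is nonempty and
      strictly smaller than \<open>B\<close>.\<close>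
    define e where "e = a \<otimes> inv b"
    have e: "e \<in> N" unfolding e_def using a bb less.prems(1,2) by (intro N_mult N_inv) auto
    have ec: "e \<in> carrier G" using e N_carrier by simp
    have eb: "e \<otimes> b = a" "e \<otimes> b' = a \<otimes> d"
      using cr a bb by (simp_all add: e_def d_def m_assoc)
    define A' where "A' = A \<union> (\<lambda>x. e \<otimes> x) ` B"
    define B' where "B' = {x \<in> B. e \<otimes> x \<in> A}"
    have "b \<in> B'" "b' \<notin> B'" using eb a bb by (auto simp: B'_def)
    then have B': "B' \<subset> B" "B' \<noteq> {}" using bb by (auto simp: B'_def)
    then have "card B' < card B" using f by (simp add: psubset_card_mono)
    moreover have "A' \<subseteq> N" using e less.prems N_mult by (auto simp: A'_def)
    ultimately have IH: "min q (card A' + card B' - 1) \<le> card (A' <#> B')"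
      using less.hyps[of B' A'] B' less.prems by (auto simp: A'_def)
    have inj: "inj_on (\<lambda>x. e \<otimes> x) B"
      using inj_on_cmult[OF ec] cr by (meson Un_iff inj_on_subset subsetI)
    have "card A' = card A + card ((\<lambda>x. e \<otimes> x) ` B - A)"
    proof -
      have "A' = A \<union> ((\<lambda>x. e \<otimes> x) ` B - A)" by (auto simp: A'_def)
      then show ?thesis using f by (metis Diff_disjoint card_Un_disjoint finite_Diff finite_imageI)
    qed
    moreover have "(\<lambda>x. e \<otimes> x) ` B - A = (\<lambda>x. e \<otimes> x) ` (B - B')" by (auto simp: B'_def)
    then have "card ((\<lambda>x. e \<otimes> x) ` B - A) = card (B - B')"
      using inj by (metis (no_types, lifting) card_image Diff_subset inj_on_subset)
    moreover have "card (B - B') = card B - card B'" using B'(1) f(2) by (intro card_Diff_subset) (auto intro: finite_subset)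
    moreover have "card B' \<le> card B" using B' f by (simp add: card_mono psubset_imp_subset)
    ultimately have sum: "card A' + card B' = card A + card B" by linarith
    have "A' <#> B' \<subseteq> A <#> B"
    proof
      fix z assume "z \<in> A' <#> B'"
      then obtain x y where xy: "z = x \<otimes> y" "x \<in> A'" "y \<in> B'" by (auto simp: set_mult_def)
      show "z \<in> A <#> B"
      proof (cases "x \<in> A")
        case True then show ?thesis using xy by (auto simp: set_mult_def B'_def)
      next
        case False
        then obtain x' where x': "x = e \<otimes> x'" "x' \<in> B" using xy by (auto simp: A'_def)
        have yB: "y \<in> B" "e \<otimes> y \<in> A" using xy by (auto simp: B'_def)
        have "z = e \<otimes> (x' \<otimes> y)" using xy x' yB ec cr by (simp add: m_assoc)
        also have "x' \<otimes> y = y \<otimes> x'" using x' yB less.prems by (intro N_comm) auto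
        also have "e \<otimes> (y \<otimes> x') = (e \<otimes> y) \<otimes> x'" using x' yB ec cr by (simp add: m_assoc)
        finally show ?thesis using x' yB by (auto simp: set_mult_def)
      qed
    qed
    then have "card (A' <#> B') \<le> card (A <#> B)" using f by (intro card_mono)
    then show ?thesis using IH sum by linarith
  qed
qed

definition coset_set :: "'a set \<Rightarrow> bool" where
  "coset_set W \<longleftrightarrow> W \<subseteq> carrier G \<and> W \<noteq> {} \<and> (\<forall>x\<in>W. \<forall>y\<in>W. x \<otimes> inv y \<in> N)"

lemma conj_N: "u \<in> N \<Longrightarrow> g \<in> carrier G \<Longrightarrow> g \<otimes> u \<otimes> inv g \<in> N" "u \<in> N \<Longrightarrow> g \<in> carrier G \<Longrightarrow> inv g \<otimes> u \<otimes> g \<in> N"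
  using normal.inv_op_closed2[OF N] normal.inv_op_closed1[OF N] by auto

lemma mod_N_sym:
  assumes "x \<in> carrier G" "y \<in> carrier G"
  shows "x \<otimes> inv y \<in> N \<longleftrightarrow> inv y \<otimes> x \<in> N"
proof
  assume "x \<otimes> inv y \<in> N"
  from conj_N(2)[OF this assms(2)] show "inv y \<otimes> x \<in> N" using assms by (simp add: m_assoc)
next
  assume "inv y \<otimes> x \<in> N"
  from conj_N(1)[OF this assms(2)] show "x \<otimes> inv y \<in> N" using assms by (simp flip: m_assoc)
qed

text \<open>A translation of \<open>W\<close> from the left and one of \<open>Y\<close> from the
  right move both sets into \<open>N\<close>, and neither interferes with the inner
  multiplication.\<close>

lemma cauchy_davenport_cosets:
  assumes W: "coset_set W" and Y: "coset_set Y"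
  shows "min q (card W + card Y - 1) \<le> card (W <#> Y)"
proof -
  obtain x0 y0 where x0: "x0 \<in> W" "x0 \<in> carrier G" and y0: "y0 \<in> Y" "y0 \<in> carrier G"
    using W Y by (auto simp: coset_set_def)
  define A where "A = (\<lambda>x. inv x0 \<otimes> x) ` W"
  define B where "B = (\<lambda>y. y \<otimes> inv y0) ` Y"
  have WY: "W \<subseteq> carrier G" "Y \<subseteq> carrier G" using W Y by (auto simp: coset_set_def)
  have A: "A \<subseteq> N" using W x0 mod_N_sym unfolding A_def coset_set_def by blast
  have B: "B \<subseteq> N" using Y y0 unfolding B_def coset_set_def by blast
  have "card A = card W" unfolding A_def using WY x0
    by (intro card_image inj_on_subset[OF inj_on_cmult]) auto
  moreover have "card B = card Y" unfolding B_def using WY y0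
    by (intro card_image inj_on_subset[OF inj_on_multc]) auto
  ultimately have "min q (card W + card Y - 1) \<le> card (A <#> B)"
    using cauchy_davenport[OF A B] x0 y0 by (auto simp: A_def B_def)
  moreover have "card (A <#> B) \<le> card (W <#> Y)"
  proof (rule card_inj_on_le[of "\<lambda>z. x0 \<otimes> z \<otimes> y0"])
    have "A <#> B \<subseteq> carrier G" using A B set_mult_N N_carrier by blast
    then show "inj_on (\<lambda>z. x0 \<otimes> z \<otimes> y0) (A <#> B)"
      using x0 y0 by (auto simp: inj_on_def subset_eq)
    show "(\<lambda>z. x0 \<otimes> z \<otimes> y0) ` (A <#> B) \<subseteq> W <#> Y"
    proof
      fix z assume "z \<in> (\<lambda>z. x0 \<otimes> z \<otimes> y0) ` (A <#> B)"
      then obtain x y where "x \<in> W" "y \<in> Y" "z = x0 \<otimes> ((inv x0 \<otimes> x) \<otimes> (y \<otimes> inv y0)) \<otimes> y0"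
        by (auto simp: A_def B_def set_mult_def)
      moreover from this have "z = x \<otimes> y" using WY x0 y0 by (simp add: m_assoc subset_eq)
      ultimately have "z = x \<otimes> y" "x \<in> W" "y \<in> Y" by blast+
      then show "z \<in> W <#> Y" using set_multI by simp
    qed
    show "finite (W <#> Y)" using WY fin setmult_subset_G finite_subset by metis
  qed
  ultimately show ?thesis by linarith
qed

end

context group
begin

lemma commutes_mult:
  assumes "a \<in> carrier G" "b \<in> carrier G" "g \<in> carrier G" "a \<otimes> g = g \<otimes> a" "b \<otimes> g = g \<otimes> b"
  shows "(a \<otimes> b) \<otimes> g = g \<otimes> (a \<otimes> b)"
  using assms by (metis m_assoc)

lemma commutes_inv:
  assumes "a \<in> carrier G" "g \<in> carrier G" "a \<otimes> g = g \<otimes> a"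
  shows "inv a \<otimes> g = g \<otimes> inv a"
  using assms by (metis inv_closed inv_solve_left inv_solve_right m_assoc m_closed)

lemma conj_eq_iff_commutes:
  assumes "u \<in> carrier G" "g \<in> carrier G"
  shows "inv g \<otimes> u \<otimes> g = u \<longleftrightarrow> u \<otimes> g = g \<otimes> u"
  using assms by (metis inv_closed inv_solve_left m_assoc m_closed)

lemma conj_pow:
  assumes "y \<in> carrier G" "u \<in> carrier G"
  shows "(y \<otimes> u \<otimes> inv y) [^] (i :: nat) = y \<otimes> u [^] i \<otimes> inv y"
proof (induction i)
  case (Suc i)
  have "(y \<otimes> u \<otimes> inv y) [^] Suc i = (y \<otimes> u [^] i \<otimes> inv y) \<otimes> (y \<otimes> u \<otimes> inv y)" using Suc by simp
  also have "\<dots> = y \<otimes> u [^] Suc i \<otimes> inv y" using assms by (simp add: m_assoc)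
  finally show ?case .
qed (use assms in simp)

lemma two_le_card_prods:
  assumes "a \<in> carrier G" "b \<in> carrier G" "a \<otimes> b \<noteq> b \<otimes> a"
  shows "2 \<le> card (prods G {#a, b#})"
proof -
  have "a \<otimes> b \<in> prods G {#a, b#}" "b \<otimes> a \<in> prods G {#a, b#}"
    using prods_mult[of "{#a#}" "{#b#}" a b] prods_mult[of "{#b#}" "{#a#}" b a] assms
    by (simp_all add: add_mset_commute)
  then have "card {a \<otimes> b, b \<otimes> a} \<le> card (prods G {#a, b#})"
    by (intro card_mono prods_finite) auto
  then show ?thesis using assms by simp
qed

end

context prime_normal
begin

lemma coset_eq_iff:
  assumes "x \<in> carrier G" "y \<in> carrier G"
  shows "N #> x = N #> y \<longleftrightarrow> x \<otimes> inv y \<in> N"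
  using assms by (metis is_group rcos_self repr_independence subN subgroup.rcos_module)

lemma coset_swap:
  assumes "a \<in> carrier G" "x \<in> carrier G" "b \<in> carrier G"
  shows "N #> (a \<otimes> (x \<otimes> b)) = N #> (x \<otimes> (a \<otimes> b))"
  using assms comm_mod[of a x] by (simp add: coset_eq_iff inv_mult_group m_assoc)

lemma coset_mult_cong:
  assumes "N #> u = N #> v" "x \<in> carrier G" "u \<in> carrier G" "v \<in> carrier G"
  shows "N #> (x \<otimes> u) = N #> (x \<otimes> v)"
proof -
  have "x \<otimes> (u \<otimes> inv v) \<otimes> inv x \<in> N" using assms conj_N(1) by (simp add: coset_eq_iff)
  then show ?thesis using assms by (simp add: coset_eq_iff inv_mult_group m_assoc)
qed

lemma coset_ordered_product:
  "mset xs = mset ys \<Longrightarrow> set xs \<subseteq> carrier G \<Longrightarrow> N #> ordered_product G xs = N #> ordered_product G ys"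
proof (induction xs arbitrary: ys)
  case Nil then show ?case by simp
next
  case (Cons x xs)
  then have "x \<in> set ys" by (metis list.set_intros(1) mset_eq_setD)
  then obtain as bs where ys: "ys = as @ x # bs" by (metis split_list)
  have eq: "mset xs = mset (as @ bs)" using Cons.prems ys by simp
  have sub: "set ys \<subseteq> carrier G" using Cons.prems by (metis set_mset_mset)
  have c: "x \<in> carrier G" "ordered_product G xs \<in> carrier G" "ordered_product G as \<in> carrier G"
    "ordered_product G bs \<in> carrier G" "set as \<subseteq> carrier G" "set bs \<subseteq> carrier G"
    using Cons.prems sub ys by (auto intro!: ordered_product_closed)
  have "N #> ordered_product G xs = N #> ordered_product G (as @ bs)" using Cons.IH[OF eq] Cons.prems by simp
  moreover have "ordered_product G (as @ bs) \<in> carrier G" using c by (intro ordered_product_closed) auto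
  ultimately have "N #> (x \<otimes> ordered_product G xs) = N #> (x \<otimes> ordered_product G (as @ bs))"
    using c by (intro coset_mult_cong)
  then have "N #> ordered_product G (x # xs) = N #> (x \<otimes> ordered_product G (as @ bs))" by simp
  also have "\<dots> = N #> ordered_product G ys"
    using c coset_swap[of "ordered_product G as" x "ordered_product G bs"] by (simp add: ys ordered_product_append)
  finally show ?case .
qed

lemma prods_coset_eq:
  assumes "set_mset S \<subseteq> carrier G" "x \<in> prods G S" "y \<in> prods G S"
  shows "N #> x = N #> y"
proof -
  obtain xs ys where xs: "mset xs = S" "x = ordered_product G xs" and ys: "mset ys = S" "y = ordered_product G ys"
    using assms(2,3) unfolding prods_def by blast
  have "set xs \<subseteq> carrier G" using assms(1) xs(1) by auto
  then show ?thesis unfolding xs(2) ys(2) using xs(1) ys(1) by (intro coset_ordered_product) simp_all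
qed

lemma coset_set_prods: "set_mset S \<subseteq> carrier G \<Longrightarrow> coset_set (prods G S)"
  using prods_coset_eq prods_nonempty prods_closed unfolding coset_set_def
  by (metis coset_eq_iff empty_iff subsetI)

lemma set_mult_prods:
  "set_mset A \<subseteq> carrier G \<Longrightarrow> set_mset B \<subseteq> carrier G \<Longrightarrow> prods G A <#> prods G B \<subseteq> prods G (A + B)"
  using prods_mult by (auto simp: set_mult_def)

lemma card_prods_add:
  assumes "set_mset A \<subseteq> carrier G" "set_mset B \<subseteq> carrier G"
  shows "min q (card (prods G A) + card (prods G B) - 1) \<le> card (prods G (A + B))"
proof -
  have "min q (card (prods G A) + card (prods G B) - 1) \<le> card (prods G A <#> prods G B)"
    by (intro cauchy_davenport_cosets coset_set_prods assms)
  also have "\<dots> \<le> card (prods G (A + B))"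
    by (intro card_mono prods_finite set_mult_prods assms)
  finally show ?thesis .
qed

text \<open>The gain \<open>g\<close> is 1 for noncommuting pairs and 2 for suitable triples, so
  \<open>q - 1\<close> pairs or \<open>(q - 1) / 2\<close> triples fill a whole coset of
  \<open>N\<close>.\<close>

lemma card_prods_sum_list:
  assumes "\<And>F. F \<in> set Fs \<Longrightarrow> set_mset F \<subseteq> carrier G \<and> g < card (prods G F)"
  shows "min q (1 + length Fs * g) \<le> card (prods G (sum_list Fs)) \<and> set_mset (sum_list Fs) \<subseteq> carrier G"
  using assms
proof (induction Fs)
  case Nil then show ?case by simp
next
  case (Cons F Fs)
  then have IH: "min q (1 + length Fs * g) \<le> card (prods G (sum_list Fs))" "set_mset (sum_list Fs) \<subseteq> carrier G" by auto
  have F: "set_mset F \<subseteq> carrier G" "g < card (prods G F)" using Cons.prems by auto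
  have "min q (card (prods G F) + card (prods G (sum_list Fs)) - 1) \<le> card (prods G (F + sum_list Fs))"
    using F IH by (intro card_prods_add)
  then show ?case using F IH by auto
qed

text \<open>The terms outside \<open>T\<close> and \<open>U\<close> may be multiplied in any order,
  with some product \<open>v\<close>. The products of \<open>T\<close> multiplied by
  \<open>v\<close> run through all of \<open>N\<close>, so one of them is the identity.\<close>

lemma product_one_of_full:
  assumes po: "product_one G S" and T: "T \<subseteq># S" "q \<le> card (prods G T)"
    and U: "U \<subseteq># S - T" "product_one G U"
  shows "product_one G (S - U)"
proof -
  define R where "R = S - T - U"
  have S: "S = T + U + R" using T(1) U(1) unfolding R_def
    by (metis add.assoc subset_mset.add_diff_inverse)
  have SU: "S - U = T + R" by (simp add: S)
  have sub: "set_mset T \<subseteq> carrier G" "set_mset U \<subseteq> carrier G" "set_mset R \<subseteq> carrier G"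
    using product_one_over[OF po] by (auto simp: S)
  obtain v where v: "v \<in> prods G R" using prods_nonempty by blast
  have vc: "v \<in> carrier G" using v sub prods_closed by blast
  have tc: "t \<in> carrier G" if "t \<in> prods G T" for t using that sub prods_closed by blast
  have "t \<otimes> v \<in> N" if t: "t \<in> prods G T" for t
  proof -
    have "\<one> \<in> prods G U" using U by (simp add: product_one_iff)
    from prods_mult[OF sub(1,2) t this] have "t \<in> prods G (T + U)" using tc[OF t] by simp
    from prods_mult[OF _ sub(3) this v] have "t \<otimes> v \<in> prods G S" using sub by (simp add: S)
    moreover have "\<one> \<in> prods G S" using po by (simp add: product_one_iff)
    ultimately have "N #> (t \<otimes> v) = N #> \<one>" using prods_coset_eq product_one_over[OF po] by blast
    then show ?thesis using tc[OF t] vc by (simp add: coset_eq_iff)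
  qed
  then have "(\<lambda>t. t \<otimes> v) ` prods G T \<subseteq> N" by blast
  moreover have "card ((\<lambda>t. t \<otimes> v) ` prods G T) = card (prods G T)"
    using tc vc by (intro card_image inj_on_subset[OF inj_on_multc]) auto
  ultimately have "(\<lambda>t. t \<otimes> v) ` prods G T = N" using T(2) cardN finN by (intro card_seteq) auto
  then obtain t where t: "t \<in> prods G T" "t \<otimes> v = \<one>" using N_one by (metis imageE)
  from prods_mult[OF sub(1,3) t(1) v] show ?thesis
    using sub t by (simp add: product_one_iff SU)
qed

lemma splits_of_full:
  assumes "product_one G S" "T \<subseteq># S" "q \<le> card (prods G T)" "T \<noteq> {#}"
    and "U \<subseteq># S - T" "U \<noteq> {#}" "product_one G U"
  shows "splits G S"
proof -
  have "product_one G (S - U)" using assms by (intro product_one_of_full[of S T U])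
  moreover have "U \<subseteq># S" using assms(5) by (meson diff_subset_eq_self subset_mset.order_trans)
  then have "S = U + (S - U)" by simp
  moreover have "S - U \<noteq> {#}"
  proof
    assume "S - U = {#}"
    then have "S \<subseteq># U" by (simp add: Diff_eq_empty_iff_mset)
    then have "S \<subseteq># S - T" using assms(5) by (rule subset_mset.order_trans)
    then have "size S \<le> size (S - T)" by (rule size_mset_mono)
    moreover have "size S = size T + size (S - T)" using assms(2) by (metis size_union subset_mset.add_diff_inverse)
    ultimately show False using assms(4) by (simp)
  qed
  ultimately show ?thesis unfolding splits_def using assms by blast
qed

lemma ordered_product_N: "set xs \<subseteq> N \<Longrightarrow> ordered_product G xs \<in> N"
  using ordered_product_in_subgroup[OF subN] .

lemma conj_move:
  assumes "n \<in> N" "a \<in> N" "y \<in> carrier G"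
  shows "n \<otimes> y \<otimes> (inv y \<otimes> a \<otimes> y) = n \<otimes> a \<otimes> y"
  using assms N_carrier by (simp add: m_assoc)

text \<open>Putting a term \<open>a\<close> of \<open>N\<close> behind or in front of a product
  \<open>w\<close> multiplies \<open>w\<close> from the right by \<open>a\<close> or by its
  conjugate under \<open>y\<close>. These differ, so Cauchy-Davenport with a two-element set adds
  one product for each term.\<close>

lemma card_prods_with_N_terms:
  assumes y: "y \<in> carrier G" and A: "set_mset A \<subseteq> N" "\<And>a. a \<in># A \<Longrightarrow> a \<otimes> y \<noteq> y \<otimes> a"
  shows "min q (size A + 1) \<le> card (prods G (add_mset y A))"
  using A
proof (induction A)
  case empty
  then show ?case using y by simp
next
  case (add a A)
  let ?W = "prods G (add_mset y A)" and ?a = "inv y \<otimes> a \<otimes> y"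
  have aN: "a \<in> N" "set_mset A \<subseteq> N" using add.prems by auto
  have sub: "set_mset (add_mset y A) \<subseteq> carrier G" using aN y N_carrier by auto
  have move: "a \<otimes> w = w \<otimes> ?a" if w: "w \<in> ?W" for w
  proof -
    obtain as where as: "mset as = A" using ex_mset by blast
    have asN: "ordered_product G as \<in> N" using as aN by (intro ordered_product_N) auto
    have "mset (y # as) = add_mset y A" using as by simp
    then have "ordered_product G (y # as) \<in> ?W" unfolding prods_def by blast
    then have "N #> w = N #> (y \<otimes> ordered_product G as)" using prods_coset_eq[OF sub w] by simp
    also have "\<dots> = N #> y" using y asN N_carrier conj_N(1) by (simp add: coset_eq_iff)
    finally have n: "w \<otimes> inv y \<in> N" using y prods_closed[OF sub w] by (simp add: coset_eq_iff)
    define n where "n = w \<otimes> inv y"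
    have w_eq: "w = n \<otimes> y" using y prods_closed[OF sub w] by (simp add: n_def m_assoc)
    have nN: "n \<in> N" using n by (simp add: n_def)
    have "a \<otimes> w = a \<otimes> n \<otimes> y" using w_eq aN nN y N_carrier by (simp add: m_assoc)
    also have "a \<otimes> n = n \<otimes> a" using aN nN by (intro N_comm)
    also have "n \<otimes> a \<otimes> y = w \<otimes> ?a" using conj_move[OF nN aN(1) y] w_eq by simp
    finally show ?thesis .
  qed
  have "?W <#> {a, ?a} \<subseteq> prods G (add_mset y (add_mset a A))"
  proof
    fix z assume "z \<in> ?W <#> {a, ?a}"
    then obtain w where w: "w \<in> ?W" "z = w \<otimes> a \<or> z = w \<otimes> ?a" by (auto simp: set_mult_def)
    have ac: "a \<in> carrier G" using aN N_carrier by simp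
    have "w \<otimes> a \<in> prods G (add_mset y A + {#a#})" "a \<otimes> w \<in> prods G ({#a#} + add_mset y A)"
      using w ac by (intro prods_mult sub; simp)+
    then show "z \<in> prods G (add_mset y (add_mset a A))"
      using w move[of w] by (auto simp: add_mset_commute)
  qed
  then have "card (?W <#> {a, ?a}) \<le> card (prods G (add_mset y (add_mset a A)))"
    by (intro card_mono prods_finite)
  moreover have "coset_set {a, ?a}"
    using aN(1) conj_N(2)[OF aN(1) y] N_carrier unfolding coset_set_def by (auto intro!: N_mult N_inv)
  then have "min q (card ?W + card {a, ?a} - 1) \<le> card (?W <#> {a, ?a})"
    by (intro cauchy_davenport_cosets coset_set_prods sub)
  moreover have "a \<noteq> ?a" using add.prems(2)[of a] conj_eq_iff_commutes[of a y] y aN N_carrier by auto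
  moreover have "min q (size A + 1) \<le> card ?W" using add.IH add.prems by auto
  ultimately show ?case by auto
qed

end

section \<open>Frobenius groups with kernel of prime order\<close>

text \<open>Only the kernel is recorded. Complements are replaced by the centralisers of elements
  outside \<open>N\<close>.\<close>

locale frobenius = prime_normal +
  fixes m :: nat
  assumes order_eq: "order G = q * m" and m: "m \<ge> 2"
    and fixed_point_free: "\<lbrakk>u \<in> N; u \<noteq> \<one>; g \<in> carrier G; u \<otimes> g = g \<otimes> u\<rbrakk> \<Longrightarrow> g \<in> N"
begin

text \<open>If \<open>g\<close> is outside \<open>N\<close>, the commutator of \<open>a\<close> and
  \<open>b\<close> is an element of \<open>N\<close> commuting with \<open>g\<close>, hence trivial.
  If \<open>g\<close> is in \<open>N\<close>, then so are \<open>a\<close> and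
  \<open>b\<close>.\<close>

lemma commute_trans:
  assumes "a \<in> carrier G" "b \<in> carrier G" "g \<in> carrier G" "g \<noteq> \<one>"
    and "a \<otimes> g = g \<otimes> a" "b \<otimes> g = g \<otimes> b"
  shows "a \<otimes> b = b \<otimes> a"
proof (cases "g \<in> N")
  case True
  then have "a \<in> N" "b \<in> N" using assms fixed_point_free by metis+
  then show ?thesis by (rule N_comm)
next
  case False
  let ?c = "a \<otimes> b \<otimes> inv (b \<otimes> a)"
  have "?c \<in> N" using comm_mod assms by blast
  moreover have "?c \<otimes> g = g \<otimes> ?c"
    using assms by (intro commutes_mult commutes_inv) auto
  ultimately have "?c = \<one>" using fixed_point_free[of ?c g] assms False by metis
  then show ?thesis using assms by (metis inv_closed inv_equality inv_inv m_closed)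
qed

lemma card_rcosets: "card (rcosets N) = m"
proof -
  have "card (rcosets N) * q = q * m" using lagrange[OF subN] order_eq cardN by simp
  then show ?thesis using q prime_gt_0_nat by (metis mult.commute mult_cancel1 not_gr_zero)
qed

lemma fin_rcosets: "finite (rcosets N)"
  using card_rcosets m by (metis card.infinite not_numeral_le_zero)

lemma block_mod_N:
  assumes "set xs \<subseteq> carrier G" "m \<le> length xs"
  shows "\<exists>as bs cs. xs = as @ bs @ cs \<and> bs \<noteq> [] \<and> ordered_product G bs \<in> N"
proof -
  have tk: "ordered_product G (take i xs) \<in> carrier G" for i
    using assms(1) set_take_subset[of i xs] by (intro ordered_product_closed) auto
  have "N #> ordered_product G (take i xs) \<in> rcosets N" for i
    using tk subgroup.subset[OF subN] by (intro rcosetsI)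
  then obtain as bs cs where *: "xs = as @ bs @ cs" "bs \<noteq> []"
     "N #> ordered_product G as = N #> ordered_product G (as @ bs)"
    using prefix_pigeonhole[OF fin_rcosets, of xs "\<lambda>g. N #> g"] assms(2) card_rcosets by auto
  have c: "ordered_product G as \<in> carrier G" "ordered_product G bs \<in> carrier G"
    using * assms(1) by (auto intro!: ordered_product_closed)
  have "ordered_product G (as @ bs) \<otimes> inv (ordered_product G as) \<in> N"
    using * assms(1) coset_eq_iff c by (metis le_sup_iff m_closed ordered_product_append set_append)
  then have "inv (ordered_product G as) \<otimes> ordered_product G (as @ bs) \<in> N"
    using mod_N_sym c * assms(1) by (metis le_sup_iff m_closed ordered_product_append set_append)
  then have "ordered_product G bs \<in> N" using c * assms(1) by (simp add: ordered_product_append)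
  with * show ?thesis by blast
qed

text \<open>The cyclic rotations of a minimal zero-sum block modulo \<open>N\<close> have distinct products: they are
  conjugates of one element of \<open>N\<close> under elements from different cosets of \<open>N\<close>.\<close>

lemma card_rotations:
  assumes sub: "set_mset B \<subseteq> carrier G" and B: "prods G B \<inter> N \<noteq> {}" "\<one> \<notin> prods G B"
    and minimal: "\<And>B'. B' \<subset># B \<Longrightarrow> B' \<noteq> {#} \<Longrightarrow> prods G B' \<inter> N = {}"
  shows "size B \<le> card (prods G B \<inter> N)"
proof -
  obtain xs where xs: "mset xs = B" "ordered_product G xs \<in> N" using B by (auto simp: prods_def)
  have xsub: "set xs \<subseteq> carrier G" using sub xs by auto
  define p where "p i = ordered_product G (take i xs)" for i
  define s where "s i = ordered_product G (drop i xs)" for i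
  define u where "u = ordered_product G xs"
  have pc: "p i \<in> carrier G" and sc: "s i \<in> carrier G" for i
    using xsub set_take_subset[of i xs] set_drop_subset[of i xs]
    by (auto simp: p_def s_def intro!: ordered_product_closed)
  have ps: "u = p i \<otimes> s i" for i
    using xsub set_take_subset[of i xs] set_drop_subset[of i xs]
      ordered_product_append[of "take i xs" "drop i xs"]
    unfolding p_def s_def u_def append_take_drop_id by (meson subset_trans)
  have "u \<in> prods G B" using xs(1) unfolding u_def prods_def by blast
  then have uN: "u \<in> N" "u \<noteq> \<one>" using xs(2) B(2) by (auto simp: u_def)
  have uc: "u \<in> carrier G" using uN N_carrier by simp
  define f where "f i = inv (p i) \<otimes> u \<otimes> p i" for i
  have f_eq: "f i = s i \<otimes> p i" for i unfolding f_def using ps[of i] pc sc by simp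
  have fN: "f i \<in> N" for i unfolding f_def using conj_N(2) uN pc by blast
  have "f i \<in> prods G B" for i
  proof -
    have "mset (drop i xs @ take i xs) = B" using xs by (metis append_take_drop_id mset_append union_commute)
    moreover have "ordered_product G (drop i xs @ take i xs) = f i"
      unfolding f_eq s_def p_def using xsub set_take_subset[of i xs] set_drop_subset[of i xs]
      by (intro ordered_product_append) auto
    ultimately show ?thesis unfolding prods_def by (metis (mono_tags, lifting) mem_Collect_eq)
  qed
  then have img: "f ` {..<length xs} \<subseteq> prods G B \<inter> N" using fN by auto
  have ne: "f i \<noteq> f j" if ij: "i < j" "j < length xs" for i j
  proof
    assume "f i = f j"
    let ?g = "p j \<otimes> inv (p i)"
    have fc: "f i \<in> carrier G" using fN N_carrier by blast
    have "?g \<otimes> u = p j \<otimes> (f i \<otimes> inv (p i))" using uc pc by (simp add: f_def m_assoc)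
    also have "\<dots> = (p j \<otimes> f j) \<otimes> inv (p i)" using pc fc \<open>f i = f j\<close> by (simp add: m_assoc)
    also have "p j \<otimes> f j = u \<otimes> p j" using uc pc by (simp add: f_def m_assoc)
    finally have "?g \<otimes> u = u \<otimes> ?g" using uc pc by (simp add: m_assoc)
    then have "?g \<in> N" using fixed_point_free[OF uN, of ?g] pc by simp
    then have gN: "inv (p i) \<otimes> p j \<in> N" using mod_N_sym pc by simp
    define bs where "bs = take (j - i) (drop i xs)"
    have tj: "take j xs = take i xs @ bs" using ij by (simp add: bs_def flip: take_add)
    have bsub: "set bs \<subseteq> set xs" unfolding bs_def by (meson set_drop_subset set_take_subset subset_trans)
    have bc: "ordered_product G bs \<in> carrier G" using bsub xsub by (intro ordered_product_closed) auto
    have "set (take i xs) \<subseteq> carrier G" using xsub set_take_subset[of i xs] by auto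
    then have "p j = p i \<otimes> ordered_product G bs"
      unfolding p_def tj using bsub xsub by (intro ordered_product_append) auto
    then have bN: "ordered_product G bs \<in> N" using gN pc bc by simp
    have "xs = take i xs @ bs @ drop j xs" using tj by (metis append.assoc append_take_drop_id)
    then have "B = mset bs + (mset (take i xs) + mset (drop j xs))" using xs(1)
      by (metis mset_append union_lcomm)
    moreover have "drop j xs \<noteq> []" using ij by simp
    ultimately have "mset bs \<subset># B" by (simp add: subset_mset.less_le)
    moreover have "bs \<noteq> []" using ij by (simp add: bs_def)
    moreover have "ordered_product G bs \<in> prods G (mset bs)" unfolding prods_def by blast
    ultimately show False using minimal[of "mset bs"] bN by auto
  qed
  then have "inj_on f {..<length xs}" by (auto simp: inj_on_def) (metis nat_neq_iff)
  then have "card {..<length xs} \<le> card (prods G B \<inter> N)"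
    using img prods_finite by (intro card_inj_on_le) auto
  then show ?thesis using xs by auto
qed

section \<open>Product-one subsequences in a Frobenius group\<close>

definition subproducts :: "'a multiset \<Rightarrow> 'a set" where
  "subproducts A = {v \<in> N. \<exists>U. U \<subseteq># A \<and> v \<in> prods G U}"

text \<open>Suppose there is none, and take a largest \<open>A\<close> with more than
  \<open>size A\<close> subproducts in \<open>N\<close>. As \<open>size A < q\<close>, at least
  \<open>m\<close> terms remain, and they contain a shortest block \<open>B\<close> with a product
  in \<open>N\<close>. By \<open>card_rotations\<close> it has at least \<open>size B\<close> such
  products. Cauchy-Davenport makes \<open>A + B\<close> a larger example, unless the count exceeds
  \<open>q\<close>.\<close>

lemma product_one_subsequence:
  assumes sub: "set_mset R \<subseteq> carrier G" and size: "q + m - 1 \<le> size R"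
  shows "\<exists>U. U \<subseteq># R \<and> U \<noteq> {#} \<and> product_one G U"
proof (rule ccontr)
  assume "\<not> ?thesis"
  then have zf: "\<one> \<notin> prods G U" if "U \<subseteq># R" "U \<noteq> {#}" for U
    using that sub by (meson product_one_iff set_mset_mono subset_trans)
  define good where "good A \<longleftrightarrow> A \<subseteq># R \<and> size A < card (subproducts A)" for A
  have finS: "finite (subproducts A)" for A using finN by (simp add: subproducts_def)
  have le_q: "card (subproducts A) \<le> q" for A
    unfolding cardN[symmetric] using finN by (intro card_mono) (auto simp: subproducts_def)
  have "subproducts {#} = {\<one>}" by (auto simp: subproducts_def)
  then have good0: "good {#}" by (simp add: good_def)
  have bounded: "good A \<Longrightarrow> size A \<le> q" for A using le_q[of A] by (simp add: good_def)
  obtain A where A: "good A" and max: "\<And>A'. good A' \<Longrightarrow> size A' \<le> size A"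
    using ex_has_greatest_nat[of good "{#}" size "Suc q"] good0 bounded by (metis less_Suc_eq_le)
  have AR: "A \<subseteq># R" "size A < card (subproducts A)" using A by (auto simp: good_def)
  have "size A < q" using le_q[of A] AR(2) by simp
  then have "m \<le> size (R - A)" using size AR(1) m by (simp add: size_Diff_submset)
  moreover obtain xs where xs: "mset xs = R - A" using ex_mset by blast
  moreover have "set_mset (R - A) \<subseteq> carrier G" using sub by (meson in_diffD subset_iff)
  ultimately have "set xs \<subseteq> carrier G" "m \<le> length xs" by (metis set_mset_mset, metis size_mset)
  from block_mod_N[OF this] obtain as bs cs
    where bs: "xs = as @ bs @ cs" "bs \<noteq> []" "ordered_product G bs \<in> N" by blast
  define isb where "isb B \<longleftrightarrow> B \<subseteq># R - A \<and> B \<noteq> {#} \<and> prods G B \<inter> N \<noteq> {}" for B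
  have "mset bs \<subseteq># R - A" unfolding xs[symmetric] bs(1) by (simp add: mset_subset_eq_add_right)
  moreover have "ordered_product G bs \<in> prods G (mset bs)" unfolding prods_def by blast
  ultimately have "isb (mset bs)" using bs by (auto simp: isb_def)
  then obtain B where B: "isb B" and least: "\<And>B'. isb B' \<Longrightarrow> size B \<le> size B'"
    using ex_has_least_nat[of isb _ size] by blast
  have BR: "B \<subseteq># R - A" "B \<noteq> {#}" "prods G B \<inter> N \<noteq> {}" using B by (auto simp: isb_def)
  have BR': "B \<subseteq># R" using BR(1) by (meson diff_subset_eq_self subset_mset.order_trans)
  have AB: "A + B \<subseteq># R" using BR(1) AR(1) by (metis subset_mset.le_diff_conv2 union_commute)
  have Bsub: "set_mset B \<subseteq> carrier G" using BR' sub by (meson set_mset_mono subset_trans)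
  have Bsize: "size B \<le> card (prods G B \<inter> N)"
  proof (rule card_rotations[OF Bsub BR(3) zf[OF BR' BR(2)]])
    fix B' assume *: "B' \<subset># B" "B' \<noteq> {#}"
    then have "size B' < size B" by (simp add: mset_subset_size)
    then have "\<not> isb B'" using least[of B'] by linarith
    then show "prods G B' \<inter> N = {}" using * BR(1) unfolding isb_def
      by (meson subset_mset.less_imp_le subset_mset.order_trans)
  qed
  \<comment> \<open>Including \<open>\<one>\<close>, which stands for omitting \<open>B\<close>,
    makes this set larger than \<open>size B\<close>, so that the product with
    \<open>subproducts A\<close> gains at least \<open>size B\<close> elements.\<close>
  let ?C = "insert \<one> (prods G B \<inter> N)"
  have C: "?C \<subseteq> N" "finite ?C" "card ?C \<ge> Suc (size B)"
    using zf[OF BR' BR(2)] Bsize finN by auto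
  have SAB: "subproducts A <#> ?C \<subseteq> subproducts (A + B)"
  proof
    fix z assume "z \<in> subproducts A <#> ?C"
    then obtain v c where z: "z = v \<otimes> c" "v \<in> subproducts A" "c \<in> ?C" by (auto simp: set_mult_def)
    then obtain U where U: "U \<subseteq># A" "v \<in> prods G U" "v \<in> N" by (auto simp: subproducts_def)
    have Usub: "set_mset U \<subseteq> carrier G" using U AR(1) sub by (meson set_mset_mono subset_trans)
    have cN: "c \<in> N" using z C by auto
    show "z \<in> subproducts (A + B)"
    proof (cases "c = \<one>")
      case True
      have "U \<subseteq># A + B" using U by (simp add: subset_mset.add_increasing2)
      then show ?thesis using z(1) U True N_carrier unfolding subproducts_def by auto
    next
      case False
      then have "c \<in> prods G B" using z by auto
      then have "z \<in> prods G (U + B)" unfolding z(1) using U by (intro prods_mult Usub Bsub)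
      moreover have "U + B \<subseteq># A + B" using U by simp
      moreover have "z \<in> N" unfolding z(1) using U cN by (intro N_mult)
      ultimately show ?thesis unfolding subproducts_def by blast
    qed
  qed
  have "subproducts A \<subseteq> N" "subproducts A \<noteq> {}" using AR(2) by (auto simp: subproducts_def intro!: exI[of _ "\<one>"] exI[of _ "{#}"])
  then have "min q (card (subproducts A) + card ?C - 1) \<le> card (subproducts A <#> ?C)"
    using C(1) by (intro cauchy_davenport) auto
  also have "\<dots> \<le> card (subproducts (A + B))" using SAB finS by (intro card_mono)
  finally have grow: "min q (card (subproducts A) + size B) \<le> card (subproducts (A + B))" using C by linarith
  show False
  proof (cases "card (subproducts A) + size B \<le> q")
    case True
    then have "good (A + B)" using AB AR(2) grow by (simp add: good_def)
    then show False using max[of "A + B"] BR(2) by simp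
  next
    case False
    \<comment> \<open>When the counts add up to more than \<open>q\<close>, the subproducts of
      \<open>A\<close> and the inverses of the products of \<open>B\<close> overlap inside
      \<open>N\<close>, which exhibits a product-one subsequence containing
      \<open>B\<close>.\<close>
    let ?I = "(\<lambda>v. inv v) ` (prods G B \<inter> N)"
    have "card ?I = card (prods G B \<inter> N)"
      using N_carrier by (intro card_image inj_onI) (metis IntD2 inv_inv)
    moreover have "card (subproducts A \<union> ?I) \<le> q"
      unfolding cardN[symmetric] using finN N_inv by (intro card_mono) (auto simp: subproducts_def)
    moreover have "card (subproducts A) + card ?I = card (subproducts A \<union> ?I) + card (subproducts A \<inter> ?I)"
      using finS finN by (intro card_Un_Int) auto
    ultimately have "card (subproducts A \<inter> ?I) > 0" using False Bsize by linarith
    then obtain v where v: "v \<in> subproducts A" "v \<in> ?I" by (metis Int_iff card_gt_0_iff ex_in_conv)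
    then obtain w where w: "v = inv w" "w \<in> prods G B" "w \<in> N" by auto
    obtain U where U: "U \<subseteq># A" "v \<in> prods G U" using v by (auto simp: subproducts_def)
    have Usub: "set_mset U \<subseteq> carrier G" using U AR(1) sub by (meson set_mset_mono subset_trans)
    have "v \<otimes> w \<in> prods G (U + B)" using U w by (intro prods_mult Usub Bsub)
    moreover have "v \<otimes> w = \<one>" using w N_carrier by simp
    moreover have "U + B \<subseteq># R" using U AB by (meson subset_mset.add_right_mono subset_mset.order_trans)
    ultimately show False using zf[of "U + B"] BR(2) by auto
  qed
qed

end

context frobenius
begin

lemma commutes_in_N:
  assumes "a \<in> N" "a \<noteq> \<one>" "y \<in> carrier G" "y \<notin> N"
  shows "a \<otimes> y \<noteq> y \<otimes> a"
  using assms fixed_point_free by blast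

text \<open>A term of \<open>N\<close> can be inserted before \<open>y\<close>, between \<open>y\<close> and \<open>z\<close>, or after \<open>z\<close>, which amounts
  to multiplying by one of three conjugates.\<close>

lemma card_prods_two_with_N_terms:
  assumes y: "y \<in> carrier G" "y \<notin> N" and z: "z \<in> carrier G" "z \<notin> N" and yz: "y \<otimes> z \<notin> N"
    and A: "set_mset A \<subseteq> N" "\<one> \<notin># A"
  shows "min q (2 * size A + 1) \<le> card (prods G (add_mset y (add_mset z A)))"
proof -
  define f where "f l1 l2 l3 = ordered_product G l1 \<otimes> y \<otimes> ordered_product G l2 \<otimes> z \<otimes> ordered_product G l3" for l1 l2 l3
  \<comment> \<open>Only orderings with \<open>y\<close> before \<open>z\<close> are counted. Within
    each of the three slots around them the order is irrelevant because \<open>N\<close> is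
    abelian.\<close>
  define W where "W A = {f l1 l2 l3 | l1 l2 l3. mset (l1 @ l2 @ l3) = A}" for A
  have sub: "W A \<subseteq> prods G (add_mset y (add_mset z A))" if "set_mset A \<subseteq> N" for A
  proof
    fix w assume "w \<in> W A"
    then obtain l1 l2 l3 where l: "w = f l1 l2 l3" "mset (l1 @ l2 @ l3) = A" by (auto simp: W_def)
    have "set (l1 @ l2 @ l3) \<subseteq> N" using l(2) that by (metis set_mset_mset)
    then have "set l1 \<subseteq> carrier G" "set l2 \<subseteq> carrier G" "set l3 \<subseteq> carrier G" using N_carrier by auto
    then have "w = ordered_product G (l1 @ y # l2 @ z # l3)"
      using y z unfolding l(1) f_def by (simp add: ordered_product_append ordered_product_closed m_assoc)
    moreover have "mset (l1 @ y # l2 @ z # l3) = add_mset y (add_mset z A)" unfolding l(2)[symmetric] by simp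
    ultimately show "w \<in> prods G (add_mset y (add_mset z A))" unfolding prods_def by blast
  qed
  have Asub: "set_mset (add_mset y (add_mset z A)) \<subseteq> carrier G" if "set_mset A \<subseteq> N" for A
    using that y z N_carrier by auto
  have fin: "finite (W A)" if "set_mset A \<subseteq> N" for A
    using sub[OF that] prods_finite finite_subset by blast
  have "min q (2 * size A + 1) \<le> card (W A)"
    using A
  proof (induction A)
    case empty
    have "f [] [] [] \<in> W {#}" unfolding W_def by (intro CollectI exI[of _ "[]"]) auto
    then have "card (W {#}) > 0" using fin[of "{#}"] by (auto simp: card_gt_0_iff)
    then show ?case by simp
  next
    case (add a A)
    have a: "a \<in> N" "a \<noteq> \<one>" and AN: "set_mset A \<subseteq> N" using add.prems by auto
    have ac: "a \<in> carrier G" using a N_carrier by simp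
    let ?b = "inv z \<otimes> a \<otimes> z" and ?c = "inv (y \<otimes> z) \<otimes> a \<otimes> (y \<otimes> z)"
    have bc: "?b \<in> N" "?c \<in> N" using a y z by (auto intro!: conj_N(2))
    \<comment> \<open>The three conjugators \<open>\<one>\<close>, \<open>z\<close> and
      \<open>y \<otimes> z\<close> must lie in different cosets of \<open>N\<close>; this is where
      \<open>y \<otimes> z \<notin> N\<close> enters.\<close>
    have dist: "a \<noteq> ?b" "a \<noteq> ?c" "?b \<noteq> ?c"
    proof -
      show "a \<noteq> ?b" using conj_eq_iff_commutes[OF ac z(1)] commutes_in_N[OF a z] by metis
      show "a \<noteq> ?c" using conj_eq_iff_commutes[OF ac, of "y \<otimes> z"] commutes_in_N[OF a _ yz] y z by (metis m_closed)
      show "?b \<noteq> ?c"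
      proof
        assume "?b = ?c"
        then have "inv z \<otimes> a \<otimes> z = inv z \<otimes> (inv y \<otimes> a \<otimes> y) \<otimes> z"
          using ac y z by (simp add: inv_mult_group m_assoc)
        then have "a = inv y \<otimes> a \<otimes> y" using ac y z by simp
        then show False using conj_eq_iff_commutes[OF ac y(1)] commutes_in_N[OF a y] by metis
      qed
    qed
    have "W A <#> {a, ?b, ?c} \<subseteq> W (add_mset a A)"
    proof
      fix v assume "v \<in> W A <#> {a, ?b, ?c}"
      then obtain w e where v: "v = w \<otimes> e" "w \<in> W A" "e = a \<or> e = ?b \<or> e = ?c" by (auto simp: set_mult_def)
      then obtain l1 l2 l3 where l: "w = f l1 l2 l3" "mset (l1 @ l2 @ l3) = A" by (auto simp: W_def)
      have "set (l1 @ l2 @ l3) \<subseteq> N" using l(2) AN by (metis set_mset_mset)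
      then have s: "set l1 \<subseteq> N" "set l2 \<subseteq> N" "set l3 \<subseteq> N" by auto
      define n1 where "n1 = ordered_product G l1"
      define n2 where "n2 = ordered_product G l2"
      define n3 where "n3 = ordered_product G l3"
      have n: "n1 \<in> N" "n2 \<in> N" "n3 \<in> N" using s by (auto simp: n1_def n2_def n3_def intro!: ordered_product_N)
      have nc: "n1 \<in> carrier G" "n2 \<in> carrier G" "n3 \<in> carrier G" using n N_carrier by auto
      have w: "w = n1 \<otimes> y \<otimes> n2 \<otimes> z \<otimes> n3" by (simp add: l f_def n1_def n2_def n3_def)
      have snoc: "ordered_product G (xs @ [a]) = ordered_product G xs \<otimes> a" if "set xs \<subseteq> N" for xs
        using that N_carrier ac ordered_product_append[of xs "[a]"] by auto
      have "v = f l1 l2 (l3 @ [a]) \<or> v = f l1 (l2 @ [a]) l3 \<or> v = f (l1 @ [a]) l2 l3"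
        using v(3)
      proof (elim disjE)
        assume "e = a"
        then have "v = f l1 l2 (l3 @ [a])"
          using nc ac y z by (simp add: v w f_def snoc[OF s(3)] m_assoc flip: n1_def n2_def n3_def)
        then show ?thesis by simp
      next
        assume e: "e = ?b"
        have "v = n1 \<otimes> y \<otimes> n2 \<otimes> z \<otimes> (n3 \<otimes> ?b)" using nc ac y z by (simp add: v w e m_assoc)
        also have "n3 \<otimes> ?b = ?b \<otimes> n3" using n bc by (intro N_comm)
        also have "n1 \<otimes> y \<otimes> n2 \<otimes> z \<otimes> (?b \<otimes> n3) = n1 \<otimes> y \<otimes> (n2 \<otimes> a) \<otimes> z \<otimes> n3"
          using nc ac y z by (simp add: m_assoc)
        also have "\<dots> = f l1 (l2 @ [a]) l3" by (simp add: f_def snoc[OF s(2)] flip: n1_def n2_def n3_def)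
        finally show ?thesis by simp
      next
        assume e: "e = ?c"
        let ?d = "inv y \<otimes> a \<otimes> y"
        have dN: "?d \<in> N" using a y by (intro conj_N(2))
        have "v = n1 \<otimes> y \<otimes> n2 \<otimes> z \<otimes> (n3 \<otimes> ?c)" using nc ac y z by (simp add: v w e m_assoc)
        also have "n3 \<otimes> ?c = ?c \<otimes> n3" using n bc by (intro N_comm)
        also have "n1 \<otimes> y \<otimes> n2 \<otimes> z \<otimes> (?c \<otimes> n3) = n1 \<otimes> y \<otimes> (n2 \<otimes> ?d) \<otimes> z \<otimes> n3"
          using nc ac y z by (simp add: m_assoc inv_mult_group)
        also have "n2 \<otimes> ?d = ?d \<otimes> n2" using n dN by (intro N_comm)
        also have "n1 \<otimes> y \<otimes> (?d \<otimes> n2) \<otimes> z \<otimes> n3 = (n1 \<otimes> a) \<otimes> y \<otimes> n2 \<otimes> z \<otimes> n3"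
          using nc ac y z by (simp add: m_assoc)
        also have "\<dots> = f (l1 @ [a]) l2 l3" by (simp add: f_def snoc[OF s(1)] flip: n1_def n2_def n3_def)
        finally show ?thesis by simp
      qed
      moreover have "mset (l1 @ l2 @ (l3 @ [a])) = add_mset a A" "mset (l1 @ (l2 @ [a]) @ l3) = add_mset a A"
        "mset ((l1 @ [a]) @ l2 @ l3) = add_mset a A" using l(2) by (simp_all add: ac_simps)
      ultimately show "v \<in> W (add_mset a A)" unfolding W_def by blast
    qed
    then have "card (W A <#> {a, ?b, ?c}) \<le> card (W (add_mset a A))"
      using fin add.prems by (intro card_mono) auto
    moreover have "coset_set {a, ?b, ?c}"
      using a bc N_carrier unfolding coset_set_def by (auto simp del: inv_mult_group intro!: N_mult N_inv)
    moreover have "W A \<noteq> {}"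
    proof -
      obtain l where "mset l = A" using ex_mset by blast
      then have "f l [] [] \<in> W A" unfolding W_def by (intro CollectI exI[of _ l] exI[of _ "[]"]) auto
      then show ?thesis by blast
    qed
    then have "coset_set (W A)"
      using sub[OF AN] coset_set_prods[OF Asub[OF AN]] unfolding coset_set_def by blast
    ultimately have "min q (card (W A) + card {a, ?b, ?c} - 1) \<le> card (W (add_mset a A))"
      using cauchy_davenport_cosets le_trans by blast
    moreover have "card {a, ?b, ?c} = 3" using dist by simp
    moreover have "min q (2 * size A + 1) \<le> card (W A)" using add by auto
    ultimately show ?case by auto
  qed
  also have "card (W A) \<le> card (prods G (add_mset y (add_mset z A)))"
    using sub A by (intro card_mono prods_finite) auto
  finally show ?thesis .
qed

section \<open>Triples with at least three products\<close>

lemma prods_triple: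
  assumes "g \<in> carrier G" "h \<in> carrier G" "k \<in> carrier G"
  shows "g \<otimes> h \<otimes> k \<in> prods G {#g, h, k#}" "g \<otimes> k \<otimes> h \<in> prods G {#g, h, k#}"
    "h \<otimes> g \<otimes> k \<in> prods G {#g, h, k#}" "h \<otimes> k \<otimes> g \<in> prods G {#g, h, k#}"
    "k \<otimes> g \<otimes> h \<in> prods G {#g, h, k#}" "k \<otimes> h \<otimes> g \<in> prods G {#g, h, k#}"
proof -
  have *: "mset [x, y, z] = {#g, h, k#} \<Longrightarrow> x \<in> carrier G \<Longrightarrow> y \<in> carrier G \<Longrightarrow> z \<in> carrier G \<Longrightarrow>
    x \<otimes> y \<otimes> z \<in> prods G {#g, h, k#}" for x y z
    unfolding prods_def by (intro CollectI exI[of _ "[x, y, z]"]) (simp add: m_assoc)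
  show "g \<otimes> h \<otimes> k \<in> prods G {#g, h, k#}" "g \<otimes> k \<otimes> h \<in> prods G {#g, h, k#}"
    "h \<otimes> g \<otimes> k \<in> prods G {#g, h, k#}" "h \<otimes> k \<otimes> g \<in> prods G {#g, h, k#}"
    "k \<otimes> g \<otimes> h \<in> prods G {#g, h, k#}" "k \<otimes> h \<otimes> g \<in> prods G {#g, h, k#}"
    by (rule *; use assms in \<open>simp add: ac_simps add_mset_commute\<close>)+
qed

lemma three_le_card:
  assumes "a \<in> A" "b \<in> A" "c \<in> A" "a \<noteq> b" "b \<noteq> c" "a \<noteq> c" "finite A"
  shows "2 < card A"
proof -
  have "card {a, b, c} \<le> card A" using assms by (intro card_mono) auto
  then show ?thesis using assms by simp
qed

text \<open>If \<open>h \<otimes> k\<close> is not 1, moving \<open>g\<close> past \<open>h\<close>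
  and then past \<open>k\<close> changes the product twice and never returns. Otherwise
  \<open>g\<close> and its conjugates by \<open>h\<close> and by \<open>inv h\<close> are three
  products. The hypothesis \<open>inv\<close> excludes the case that \<open>h = k\<close> is an
  involution, where only \<open>g\<close> and one conjugate occur.\<close>

lemma card_prods_triple_commuting:
  assumes g: "g \<in> carrier G" and h: "h \<in> carrier G" "h \<noteq> \<one>" and k: "k \<in> carrier G" "k \<noteq> \<one>"
    and hk: "h \<otimes> k = k \<otimes> h" and gh: "g \<otimes> h \<noteq> h \<otimes> g" and inv: "h \<otimes> k \<noteq> \<one> \<or> h \<otimes> h \<noteq> \<one>"
  shows "2 < card (prods G {#g, h, k#})"
proof -
  have gk: "g \<otimes> k \<noteq> k \<otimes> g" using commute_trans[OF g h(1) k] hk gh by metis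
  show ?thesis
  proof (cases "h \<otimes> k = \<one>")
    case False
    have "g \<otimes> (h \<otimes> k) \<noteq> (h \<otimes> k) \<otimes> g"
    proof
      assume "g \<otimes> (h \<otimes> k) = (h \<otimes> k) \<otimes> g"
      moreover have "h \<otimes> (h \<otimes> k) = (h \<otimes> k) \<otimes> h" using hk h k by (metis m_assoc)
      ultimately show False using commute_trans[OF g h(1), of "h \<otimes> k"] False gh h k by auto
    qed
    then have "g \<otimes> h \<otimes> k \<noteq> h \<otimes> k \<otimes> g" using g h k by (simp add: m_assoc)
    moreover have "g \<otimes> h \<otimes> k \<noteq> h \<otimes> g \<otimes> k" using gh g h k by simp
    moreover have "h \<otimes> g \<otimes> k \<noteq> h \<otimes> k \<otimes> g" using gk g h k by (simp add: m_assoc)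
    ultimately show ?thesis
      using prods_triple[OF g h(1) k(1)] three_le_card[of "g \<otimes> h \<otimes> k" _ "h \<otimes> g \<otimes> k" "h \<otimes> k \<otimes> g"] prods_finite by blast
  next
    case True
    then have hh: "h \<otimes> h \<noteq> \<one>" using inv by simp
    have kinv: "k = inv h" using True h k by (metis inv_equality inv_inv inv_closed)
    have g1: "g \<otimes> h \<otimes> k = g" using g h kinv by (simp add: m_assoc)
    have n1: "h \<otimes> g \<otimes> k \<noteq> g" using gh g h kinv by (metis inv_solve_right m_closed)
    have n2: "k \<otimes> g \<otimes> h \<noteq> g" using gh g h kinv conj_eq_iff_commutes by metis
    have n3: "h \<otimes> g \<otimes> k \<noteq> k \<otimes> g \<otimes> h"
    proof
      assume "h \<otimes> g \<otimes> k = k \<otimes> g \<otimes> h"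
      then have "h \<otimes> (h \<otimes> g \<otimes> inv h) \<otimes> h = h \<otimes> (inv h \<otimes> g \<otimes> h) \<otimes> h" using kinv by simp
      then have "(h \<otimes> h) \<otimes> g = g \<otimes> (h \<otimes> h)" using g h by (simp add: m_assoc)
      moreover have "h \<otimes> (h \<otimes> h) = (h \<otimes> h) \<otimes> h" using h by (simp add: m_assoc)
      ultimately show False using commute_trans[OF g h(1), of "h \<otimes> h"] hh gh h by auto
    qed
    show ?thesis
      using prods_triple[OF g h(1) k(1)] g1 n1 n2 n3 three_le_card[of g _ "h \<otimes> g \<otimes> k" "k \<otimes> g \<otimes> h"] prods_finite by metis
  qed
qed

text \<open>Neighbours in the chain \<open>ghk, hgk, hkg, khg, kgh, gkh\<close> differ by one
  exchange, so with only two values they alternate. Then \<open>g\<close> commutes with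
  \<open>hk\<close> and \<open>kh\<close>, hence with a nontrivial commutator in \<open>N\<close>,
  and so lies in \<open>N\<close>. The same holds for \<open>h\<close>, although \<open>g\<close>
  and \<open>h\<close> do not commute.\<close>

lemma card_prods_triple_noncommuting:
  assumes g: "g \<in> carrier G" and h: "h \<in> carrier G" and k: "k \<in> carrier G"
    and gh: "g \<otimes> h \<noteq> h \<otimes> g" and gk: "g \<otimes> k \<noteq> k \<otimes> g" and hk: "h \<otimes> k \<noteq> k \<otimes> h"
  shows "2 < card (prods G {#g, h, k#})"
proof (rule ccontr)
  assume not: "\<not> ?thesis"
  note P = prods_triple[OF g h k]
  have two: "c = a \<or> c = b" if "a \<in> prods G {#g, h, k#}" "b \<in> prods G {#g, h, k#}" "c \<in> prods G {#g, h, k#}" "a \<noteq> b" for a b c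
    using not three_le_card[OF that(1,2,3,4)] prods_finite by metis
  have ne: "g \<otimes> h \<otimes> k \<noteq> h \<otimes> g \<otimes> k" "h \<otimes> g \<otimes> k \<noteq> h \<otimes> k \<otimes> g" "h \<otimes> k \<otimes> g \<noteq> k \<otimes> h \<otimes> g"
    "k \<otimes> h \<otimes> g \<noteq> k \<otimes> g \<otimes> h" "k \<otimes> g \<otimes> h \<noteq> g \<otimes> k \<otimes> h"
    using g h k gh gk hk by (simp_all add: m_assoc) (simp_all flip: m_assoc)
  have e1: "h \<otimes> k \<otimes> g = g \<otimes> h \<otimes> k" using two[OF P(1,3,4) ne(1)] ne by metis
  have e2: "k \<otimes> h \<otimes> g = h \<otimes> g \<otimes> k" using two[OF P(1,3,6) ne(1)] ne e1 by metis
  have e3: "k \<otimes> g \<otimes> h = g \<otimes> h \<otimes> k" using two[OF P(1,3,5) ne(1)] ne e2 by metis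
  have e4: "g \<otimes> k \<otimes> h = h \<otimes> g \<otimes> k" using two[OF P(1,3,2) ne(1)] ne e3 by metis
  have c1: "(h \<otimes> k) \<otimes> g = g \<otimes> (h \<otimes> k)" using e1 g h k by (simp add: m_assoc)
  have c2: "(k \<otimes> h) \<otimes> g = g \<otimes> (k \<otimes> h)" using e2 e4 g h k by (simp add: m_assoc)
  have c3: "(k \<otimes> g) \<otimes> h = h \<otimes> (k \<otimes> g)" using e3 e1 g h k by (simp add: m_assoc)
  have c4: "(g \<otimes> k) \<otimes> h = h \<otimes> (g \<otimes> k)" using e4 g h k by (simp add: m_assoc)
  have inN: "x \<in> N" if "a \<in> carrier G" "b \<in> carrier G" "x \<in> carrier G" "a \<otimes> b \<noteq> b \<otimes> a"
     "(a \<otimes> b) \<otimes> x = x \<otimes> (a \<otimes> b)" "(b \<otimes> a) \<otimes> x = x \<otimes> (b \<otimes> a)" for a b x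
  proof -
    let ?c = "a \<otimes> b \<otimes> inv (b \<otimes> a)"
    have "?c \<noteq> \<one>" using that by (metis inv_closed inv_equality inv_inv m_closed)
    moreover have "?c \<otimes> x = x \<otimes> ?c" using that(1-3) by (intro commutes_mult[OF _ _ _ that(5) commutes_inv[OF _ _ that(6)]]) auto
    ultimately show ?thesis using fixed_point_free[of ?c x] comm_mod that by blast
  qed
  have "g \<in> N" using inN[OF h k g hk c1 c2] .
  moreover have "h \<in> N" using inN[OF g k h gk c4 c3] .
  ultimately show False using N_comm gh by blast
qed

end

section \<open>Counting terms, and unsplittable sequences against small subgroups\<close>

lemma size_sum_list_const:
  fixes Fs :: "'a multiset list"
  shows "(\<And>F. F \<in> set Fs \<Longrightarrow> size F = r) \<Longrightarrow> size (sum_list Fs) = r * length Fs"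
  by (induction Fs) auto

lemma size_filter_add: "size (filter_mset P S) + size (filter_mset (\<lambda>x. \<not> P x) S) = size S"
  by (metis multiset_partition size_union)

lemma size_filter_mono: "(\<And>x. x \<in># S \<Longrightarrow> P x \<Longrightarrow> Q x) \<Longrightarrow> size (filter_mset P S) \<le> size (filter_mset Q S)"
  by (intro size_mset_mono filter_mset_mono_strong) simp_all

lemma size_filter_diff: "size (filter_mset P S) \<le> size (filter_mset P (S - T)) + size T"
proof -
  have "size (filter_mset P S) \<le> size (filter_mset P (S - T) + filter_mset P T)"
    by (intro size_mset_mono) (auto simp: subseteq_mset_def)
  also have "\<dots> \<le> size (filter_mset P (S - T)) + size T"
    by (simp add: size_filter_mset_lesseq)
  finally show ?thesis .
qed

context group
begin

definition centralizer :: "'a \<Rightarrow> 'a set" where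
  "centralizer g = {x \<in> carrier G. x \<otimes> g = g \<otimes> x}"

lemma subgroup_centralizer:
  assumes "g \<in> carrier G"
  shows "subgroup (centralizer g) G"
proof (rule subgroupI)
  show "centralizer g \<noteq> {}" using assms by (auto simp: centralizer_def)
qed (use assms in \<open>auto simp: centralizer_def commutes_inv commutes_mult\<close>)

lemma splits_of_part:
  assumes "product_one G S" "U \<subseteq># S" "U \<noteq> {#}" "size U < size S" "product_one G U" "product_one G (S - U)"
  shows "splits G S"
proof -
  have "S = U + (S - U)" using assms(2) by simp
  moreover have "S - U \<noteq> {#}" using assms(2,4) by (metis add_cancel_right_right calculation less_irrefl)
  ultimately show ?thesis unfolding splits_def using assms by blast
qed

text \<open>Contrapositive of \<open>short_factor_of_run\<close>, and the source of lower bounds on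
  the number of terms outside a small subgroup. The bound \<open>r\<close> replaces
  \<open>card C\<close> because the orders of centralisers are only estimated.\<close>

lemma size_le_of_not_splits:
  assumes "product_one G S" "\<not> splits G S" and C: "subgroup C G" "finite C" "card C \<le> r" and "r < size S"
  shows "size S \<le> r * max 1 (size (filter_mset (\<lambda>x. x \<notin> C) S))"
proof (rule ccontr)
  assume "\<not> ?thesis"
  then have "card C * max 1 (size (filter_mset (\<lambda>x. x \<notin> C) S)) < size S"
    using C(3) by (meson le_less_trans mult_le_mono1 not_le)
  from short_factor_of_run[OF assms(1) C(1,2) this] obtain U where
    "U \<subseteq># S" "U \<noteq> {#}" "size U \<le> card C" "product_one G U" "product_one G (S - U)" by blast
  moreover from this have "size U < size S" using assms(6) C(3) by linarith
  ultimately show False using splits_of_part[OF assms(1)] assms(2) by blast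
qed

lemma product_one_remove_one:
  assumes "product_one G S" "\<one> \<in># S"
  shows "product_one G {#\<one>#}" "product_one G (S - {#\<one>#})"
proof -
  obtain xs where xs: "mset xs = S" "ordered_product G xs = \<one>" and sub: "set xs \<subseteq> carrier G"
    using assms by (auto simp: product_one_def seq_over_def)
  then obtain as bs where dec: "xs = as @ [\<one>] @ bs" using assms(2) split_list[of "\<one>" xs] by auto
  show "product_one G {#\<one>#}" by (simp add: product_one_iff)
  have "product_one G (mset (as @ bs))"
    using remove_block(2)[of as "[\<one>]" bs] sub xs dec by simp
  moreover have "S - {#\<one>#} = mset (as @ bs)" using xs(1) dec by auto
  ultimately show "product_one G (S - {#\<one>#})" by simp
qed

end

section \<open>Index at least four\<close>

context frobenius
begin

lemma exists_N: obtains u where "u \<in> N" "u \<noteq> \<one>"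
proof -
  have "card N \<noteq> 1" using q cardN by auto
  moreover have "card N = 1" if "N = {\<one>}" using that by simp
  ultimately have "\<exists>u\<in>N. u \<noteq> \<one>" using N_one by blast
  then show ?thesis using that by blast
qed

lemma q_ge: "q \<ge> 2"
  using q by (rule prime_ge_2_nat)

text \<open>The conjugates of one nontrivial \<open>u\<close> lie in \<open>N - {\<one>}\<close>,
  and elements conjugating \<open>u\<close> to the same element lie in one coset of
  \<open>N\<close>. So the group is covered by at most \<open>q - 1\<close> fibres of at most
  \<open>q\<close> elements.\<close>

lemma m_less_q: "m < q"
proof -
  obtain u where u: "u \<in> N" "u \<noteq> \<one>" by (rule exists_N)
  have uc: "u \<in> carrier G" using u N_carrier by simp
  define f where "f g = inv g \<otimes> u \<otimes> g" for g
  have img: "f ` carrier G \<subseteq> N - {\<one>}"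
  proof
    fix v assume "v \<in> f ` carrier G"
    then obtain g where g: "g \<in> carrier G" "v = f g" by blast
    have "v \<noteq> \<one>"
    proof
      assume "v = \<one>"
      then have "g \<otimes> (inv g \<otimes> u \<otimes> g) \<otimes> inv g = g \<otimes> \<one> \<otimes> inv g" using g by (simp add: f_def)
      then have "u = \<one>" using g(1) uc by (simp add: m_assoc)
      then show False using u by simp
    qed
    then show "v \<in> N - {\<one>}" using conj_N(2)[OF u(1) g(1)] g by (simp add: f_def)
  qed
  have fib: "card {h \<in> carrier G. f h = f g} \<le> q" if g: "g \<in> carrier G" for g
  proof -
    have "{h \<in> carrier G. f h = f g} \<subseteq> (\<lambda>n. n \<otimes> g) ` N"
    proof
      fix h assume "h \<in> {h \<in> carrier G. f h = f g}"
      then have h: "h \<in> carrier G" "f h = f g" by auto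
      have "inv (h \<otimes> inv g) \<otimes> u \<otimes> (h \<otimes> inv g) = g \<otimes> f h \<otimes> inv g"
        using g h(1) uc by (simp add: f_def inv_mult_group m_assoc)
      also have "\<dots> = u" unfolding h(2) using g uc by (simp add: f_def m_assoc)
      finally have "u \<otimes> (h \<otimes> inv g) = (h \<otimes> inv g) \<otimes> u"
        using conj_eq_iff_commutes[of u "h \<otimes> inv g"] uc g h(1) by simp
      then have "h \<otimes> inv g \<in> N" using fixed_point_free[OF u] g h(1) by simp
      moreover have "h = (h \<otimes> inv g) \<otimes> g" using g h(1) by (simp add: m_assoc)
      ultimately show "h \<in> (\<lambda>n. n \<otimes> g) ` N" by blast
    qed
    then have "card {h \<in> carrier G. f h = f g} \<le> card ((\<lambda>n. n \<otimes> g) ` N)" using finN by (intro card_mono) auto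
    also have "\<dots> \<le> q" using card_image_le[OF finN] cardN by simp
    finally show ?thesis .
  qed
  have "carrier G = (\<Union>y\<in>f ` carrier G. {h \<in> carrier G. f h = y})" by blast
  then have "q * m \<le> (\<Sum>y\<in>f ` carrier G. card {h \<in> carrier G. f h = y})"
    using card_UN_le[of "f ` carrier G" "\<lambda>y. {h \<in> carrier G. f h = y}"] fin order_eq by (simp add: order_def)
  also have "\<dots> \<le> (\<Sum>y\<in>f ` carrier G. q)" using fib by (intro sum_mono) auto
  also have "\<dots> \<le> q * card (N - {\<one>})"
    using card_mono[OF _ img] finN by (simp del: card_Diff_insert)
  also have "card (N - {\<one>}) = q - 1" using finN cardN by simp
  finally show ?thesis using q_ge by simp
qed

text \<open>By \<open>commute_trans\<close> commuting is an equivalence relation on nontrivial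
  elements. The centraliser names the class and serves as the colour in
  \<open>disjoint_nonmonochromatic\<close>.\<close>

lemma centralizer_eq_iff:
  assumes "g \<in> carrier G" "h \<in> carrier G" "g \<noteq> \<one>" "h \<noteq> \<one>"
  shows "centralizer g = centralizer h \<longleftrightarrow> g \<otimes> h = h \<otimes> g"
proof
  assume "centralizer g = centralizer h"
  moreover have "g \<in> centralizer g" using assms by (simp add: centralizer_def)
  ultimately show "g \<otimes> h = h \<otimes> g" by (auto simp: centralizer_def)
next
  assume gh: "g \<otimes> h = h \<otimes> g"
  then show "centralizer g = centralizer h"
    using commute_trans[OF _ assms(2,1,3)] commute_trans[OF _ assms(1,2,4)] unfolding centralizer_def
    by (intro Collect_cong conj_cong refl iffI) simp_all
qed

lemma centralizer_Int_N:
  assumes "y \<in> carrier G" "y \<notin> N"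
  shows "centralizer y \<inter> N = {\<one>}"
  using assms commutes_in_N by (auto simp: centralizer_def)

lemma finite_centralizer: "finite (centralizer y)"
  using fin by (simp add: centralizer_def)

text \<open>The centraliser meets \<open>N\<close> trivially and thus embeds into the quotient by
  \<open>N\<close>.\<close>

lemma card_centralizer:
  assumes y: "y \<in> carrier G" "y \<notin> N"
  shows "card (centralizer y) \<le> m"
proof -
  have "inj_on (\<lambda>g. N #> g) (centralizer y)"
  proof (rule inj_onI)
    fix g h assume gh: "g \<in> centralizer y" "h \<in> centralizer y" "N #> g = N #> h"
    then have c: "g \<in> carrier G" "h \<in> carrier G" by (auto simp: centralizer_def)
    have "g \<otimes> inv h \<in> N" using gh c by (simp add: coset_eq_iff)
    moreover have "g \<otimes> inv h \<in> centralizer y"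
      using gh subgroup_centralizer[OF y(1)] by (meson subgroup.m_closed subgroup.m_inv_closed)
    ultimately have "g \<otimes> inv h = \<one>" using centralizer_Int_N[OF y] by blast
    then show "g = h" using c by (metis inv_closed inv_equality inv_inv)
  qed
  moreover have "(\<lambda>g. N #> g) ` centralizer y \<subseteq> rcosets N"
    using subgroup.subset[OF subN] by (auto simp: centralizer_def intro!: rcosetsI)
  ultimately show ?thesis using card_inj_on_le[OF _ _ fin_rcosets] card_rcosets by metis
qed

text \<open>If more terms were left outside \<open>T\<close>, \<open>product_one_subsequence\<close>
  would find a product-one part among them, and \<open>T\<close> can repair the rest once that part
  is removed.\<close>

lemma full_bound:
  assumes S: "product_one G S" "\<not> splits G S" and T: "T \<subseteq># S" "T \<noteq> {#}" "q \<le> card (prods G T)"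
  shows "size S \<le> size T + q + m - 2"
proof (rule ccontr)
  assume "\<not> ?thesis"
  then have "q + m - 1 \<le> size (S - T)" using T(1) m q_ge by (simp add: size_Diff_submset)
  moreover have "set_mset (S - T) \<subseteq> carrier G" using product_one_over[OF S(1)] by (meson in_diffD subset_iff)
  ultimately obtain U where U: "U \<subseteq># S - T" "U \<noteq> {#}" "product_one G U"
    using product_one_subsequence by blast
  show False using splits_of_full[OF S(1) T(1,3,2) U] S(2) by simp
qed

lemma full_of_N_terms:
  assumes S: "set_mset S \<subseteq> carrier G" "\<one> \<notin># S" and y: "y \<in># S" "y \<notin> N"
    and t: "q - 1 \<le> size (filter_mset (\<lambda>x. x \<in> N) S)"
  shows "\<exists>A. A \<subseteq># filter_mset (\<lambda>x. x \<in> N) S \<and> size A = q - 1 \<and> add_mset y A \<subseteq># S \<and>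
    q \<le> card (prods G (add_mset y A))"
proof -
  obtain A where A: "A \<subseteq># filter_mset (\<lambda>x. x \<in> N) S" "size A = q - 1" using t exists_submultiset by blast
  have AN: "a \<in> N \<and> a \<noteq> \<one>" if "a \<in># A" for a using that A(1) S(2) by (metis filter_mset_eq_conv mem_Collect_eq mset_subset_eqD set_mset_filter)
  have yc: "y \<in> carrier G" using S y by auto
  have "min q (size A + 1) \<le> card (prods G (add_mset y A))"
    using AN commutes_in_N yc y by (intro card_prods_with_N_terms) auto
  then have "q \<le> card (prods G (add_mset y A))" using A(2) q_ge by simp
  moreover have "{#y#} \<subseteq># filter_mset (\<lambda>x. x \<notin> N) S" using y by simp
  then have "{#y#} + A \<subseteq># S" using A(1) by (metis multiset_partition subset_mset.add_mono union_commute)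
  ultimately show ?thesis using A by auto
qed

text \<open>A term \<open>\<one>\<close> splits off at once. A set of \<open>q - 1\<close> terms in
  \<open>N\<close> together with one term outside fills a coset with only \<open>q\<close> terms,
  and \<open>full_bound\<close> then limits the length to \<open>2q + m - 2\<close>.\<close>

lemma N_terms_bound:
  assumes S: "product_one G S" "\<not> splits G S" and size: "2 * q + m - 2 < size S"
  shows "\<one> \<notin># S" "size (filter_mset (\<lambda>x. x \<in> N) S) + 2 \<le> q"
proof -
  have sub: "set_mset S \<subseteq> carrier G" using S product_one_over by simp
  show one: "\<one> \<notin># S"
  proof
    assume "\<one> \<in># S"
    moreover have "1 < size S" using size q_ge by linarith
    ultimately show False
      using product_one_remove_one[OF S(1)] splits_of_part[OF S(1), of "{#\<one>#}"] S(2) by auto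
  qed
  have "q < size S" using size m by linarith
  then have "size S \<le> q * max 1 (size (filter_mset (\<lambda>x. x \<notin> N) S))"
    using size_le_of_not_splits[OF S subN finN] cardN by simp
  then have "size (filter_mset (\<lambda>x. x \<notin> N) S) \<noteq> 0" using \<open>q < size S\<close> by (metis max_0R mult.right_neutral not_le)
  then have "filter_mset (\<lambda>x. x \<notin> N) S \<noteq> {#}" by auto
  then obtain y where y: "y \<in># S" "y \<notin> N" by auto
  show "size (filter_mset (\<lambda>x. x \<in> N) S) + 2 \<le> q"
  proof (rule ccontr)
    assume "\<not> ?thesis"
    then have "q - 1 \<le> size (filter_mset (\<lambda>x. x \<in> N) S)" by simp
    from full_of_N_terms[OF sub one y this] obtain A where
      A: "size A = q - 1" "add_mset y A \<subseteq># S" "q \<le> card (prods G (add_mset y A))" by blast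
    then have "size S \<le> q + q + m - 2" using full_bound[OF S A(2) _ A(3)] q_ge by simp
    then show False using size by simp
  qed
qed

lemma centralizer_bound:
  assumes S: "product_one G S" "\<not> splits G S" and size: "m < size S" and y: "y \<in> carrier G" "y \<notin> N"
  shows "size S \<le> m * size (filter_mset (\<lambda>x. x \<notin> centralizer y) S)"
proof -
  have "size S \<le> m * max 1 (size (filter_mset (\<lambda>x. x \<notin> centralizer y) S))"
    using size_le_of_not_splits[OF S subgroup_centralizer[OF y(1)] finite_centralizer card_centralizer[OF y] size] .
  then show ?thesis using size
    by (cases "size (filter_mset (\<lambda>x. x \<notin> centralizer y) S)") auto
qed

text \<open>The product of \<open>u\<close> and its conjugate by \<open>y\<close> is an element of
  \<open>N\<close> fixed by \<open>y\<close>, hence trivial.\<close>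

lemma involution_inverts:
  assumes y: "y \<in> carrier G" "y \<notin> N" "y \<otimes> y = \<one>" and u: "u \<in> N"
  shows "y \<otimes> u \<otimes> y = inv u"
proof -
  have uc: "u \<in> carrier G" using u N_carrier by simp
  have iy: "inv y = y" using y by (metis inv_equality)
  let ?w = "y \<otimes> u \<otimes> y"
  have w: "?w \<in> N" using conj_N(1)[OF u y(1)] iy by simp
  have "(u \<otimes> ?w) \<otimes> y = u \<otimes> y \<otimes> u" using y uc by (simp add: m_assoc)
  moreover have "y \<otimes> (?w \<otimes> u) = u \<otimes> y \<otimes> u" using y uc by (metis iy cancel_inv(1) m_assoc m_closed)
  moreover have "u \<otimes> ?w = ?w \<otimes> u" using u w by (rule N_comm)
  ultimately have "(u \<otimes> ?w) \<otimes> y = y \<otimes> (u \<otimes> ?w)" by simp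
  then have "u \<otimes> ?w = \<one>" using commutes_in_N[of "u \<otimes> ?w" y] y u w N_mult by blast
  then show ?thesis using uc y by (metis inv_equality inv_inv inv_closed m_closed)
qed

text \<open>Both involutions invert \<open>N\<close>, so their product centralises \<open>N\<close>
  and lies in it. It also commutes with \<open>y\<close>, which leaves only the identity.\<close>

lemma involution_unique:
  assumes y: "y \<in> carrier G" "y \<notin> N" "y \<otimes> y = \<one>" and z: "z \<in> carrier G" "z \<notin> N" "z \<otimes> z = \<one>"
    and yz: "y \<otimes> z = z \<otimes> y"
  shows "y = z"
proof -
  obtain u where u: "u \<in> N" "u \<noteq> \<one>" by (rule exists_N)
  have uc: "u \<in> carrier G" using u N_carrier by simp
  have iz: "inv z = z" using z by (metis inv_equality)
  have "z \<otimes> (y \<otimes> u \<otimes> y) \<otimes> z = u"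
    using involution_inverts[OF z, of "inv u"] involution_inverts[OF y u(1)] u N_inv uc by simp
  then have "z \<otimes> (y \<otimes> u \<otimes> y) \<otimes> z \<otimes> (z \<otimes> y) = u \<otimes> (z \<otimes> y)" by simp
  moreover have "z \<otimes> (y \<otimes> u \<otimes> y) \<otimes> z \<otimes> (z \<otimes> y) = z \<otimes> y \<otimes> u \<otimes> y \<otimes> (z \<otimes> z) \<otimes> y"
    using uc y(1) z(1) by (simp add: m_assoc)
  moreover have "z \<otimes> y \<otimes> u \<otimes> y \<otimes> (z \<otimes> z) \<otimes> y = (z \<otimes> y) \<otimes> u" using uc y z by (simp add: m_assoc)
  ultimately have "u \<otimes> (z \<otimes> y) = (z \<otimes> y) \<otimes> u" by simp
  then have "z \<otimes> y \<in> N" using fixed_point_free[OF u] y z by simp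
  moreover have "(z \<otimes> y) \<otimes> y = y \<otimes> (z \<otimes> y)" using yz y z by (metis m_assoc)
  ultimately have "z \<otimes> y = \<one>" using commutes_in_N[of "z \<otimes> y" y] y by blast
  then show ?thesis using y(1) z(1) iz by (metis inv_equality inv_inv)
qed

text \<open>Each triple takes one term outside the centraliser of \<open>x\<close> and two inside.
  Requiring one of the inner terms not to be an involution meets the last hypothesis of
  \<open>card_prods_triple_commuting\<close>.\<close>

lemma triples_exist:
  assumes x: "x \<in> carrier G" "x \<noteq> \<one>"
  shows "size A = k \<Longrightarrow> size B = k \<Longrightarrow> size D = k \<Longrightarrow>
    (\<And>a. a \<in># A \<Longrightarrow> a \<in> carrier G \<and> a \<notin> centralizer x) \<Longrightarrow>
    (\<And>b. b \<in># B \<Longrightarrow> b \<in> centralizer x \<and> b \<otimes> b \<noteq> \<one>) \<Longrightarrow>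
    (\<And>d. d \<in># D \<Longrightarrow> d \<in> centralizer x \<and> d \<noteq> \<one>) \<Longrightarrow>
    \<exists>Fs. length Fs = k \<and> sum_list Fs = A + B + D \<and> (\<forall>F\<in>set Fs. set_mset F \<subseteq> carrier G \<and> 2 < card (prods G F))"
proof (induction k arbitrary: A B D)
  case 0
  then show ?case by (intro exI[of _ "[]"]) auto
next
  case (Suc k)
  obtain a A' where A: "A = add_mset a A'" using Suc.prems(1) by (metis size_eq_Suc_imp_eq_union)
  obtain b B' where B: "B = add_mset b B'" using Suc.prems(2) by (metis size_eq_Suc_imp_eq_union)
  obtain d D' where D: "D = add_mset d D'" using Suc.prems(3) by (metis size_eq_Suc_imp_eq_union)
  have "\<exists>Fs. length Fs = k \<and> sum_list Fs = A' + B' + D' \<and> (\<forall>F\<in>set Fs. set_mset F \<subseteq> carrier G \<and> 2 < card (prods G F))"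
    using Suc.prems unfolding A B D by (intro Suc.IH) auto
  then obtain Fs where Fs: "length Fs = k" "sum_list Fs = A' + B' + D'"
    "\<forall>F\<in>set Fs. set_mset F \<subseteq> carrier G \<and> 2 < card (prods G F)" by blast
  have a: "a \<in> carrier G" "a \<otimes> x \<noteq> x \<otimes> a" using Suc.prems(4)[of a] A by (auto simp: centralizer_def)
  have b: "b \<in> carrier G" "b \<otimes> x = x \<otimes> b" "b \<otimes> b \<noteq> \<one>" using Suc.prems(5)[of b] B by (auto simp: centralizer_def)
  have d: "d \<in> carrier G" "d \<otimes> x = x \<otimes> d" "d \<noteq> \<one>" using Suc.prems(6)[of d] D by (auto simp: centralizer_def)
  have b1: "b \<noteq> \<one>" using b by auto
  have bd: "b \<otimes> d = d \<otimes> b" using commute_trans[OF b(1) d(1) x b(2) d(2)] .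
  have ab: "a \<otimes> b \<noteq> b \<otimes> a" using commute_trans[OF a(1) x(1) b(1) b1] b(2) a(2) by metis
  have "2 < card (prods G {#a, b, d#})"
    using card_prods_triple_commuting[OF a(1) b(1) b1 d(1,3) bd ab] b by simp
  then show ?case using Fs a b d A B D by (intro exI[of _ "{#a, b, d#} # Fs"]) auto
qed

text \<open>If every centraliser of a term outside \<open>N\<close> misses at least
  \<open>q - 1\<close> terms, there are \<open>q - 1\<close> disjoint noncommuting pairs, which fill
  a coset with \<open>2(q - 1)\<close> terms. Otherwise most terms lie in the centraliser of one
  \<open>x\<close>, but still more than \<open>3q/4\<close> outside. Then \<open>(q - 1) / 2\<close>
  triples fill a coset, provided that the centraliser contains enough terms that are not
  involutions. If it does not, a single involution occurs too often.\<close>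

lemma splits_large_four:
  assumes m4: "m \<ge> 4" and S: "product_one G S" and size: "3 * (q * m) < 4 * size S"
  shows "splits G S"
proof (rule ccontr)
  assume ns: "\<not> splits G S"
  have sub: "set_mset S \<subseteq> carrier G" using S product_one_over by simp
  let ?n = "size S"
  obtain m' where m': "m = m' + 4" using m4 le_Suc_ex by (metis add.commute)
  have "2 * m' \<le> q * m'" using q_ge by (rule mult_le_mono1)
  moreover have "3 * (q * m) = 3 * (q * m') + 12 * q" unfolding m' by (simp add: distrib_left)
  \<comment> \<open>The number \<open>3q + m - 4\<close> is the limit that \<open>full_bound\<close>
    gives for a coset filled by \<open>2(q - 1)\<close> terms.\<close>
  ultimately have n: "?n > 3 * q + m - 4" using size m' by linarith
  have q5: "q \<ge> 5" using m_less_q m4 by simp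
  have N: "\<one> \<notin># S" "size (filter_mset (\<lambda>x. x \<in> N) S) + 2 \<le> q"
    using N_terms_bound[OF S ns] n q5 m4 by linarith+
  define k where "k = (q - 1) div 2"
  have "odd q" using q q5 prime_odd_nat by force
  then have k: "2 * k + 1 = q" by (auto simp: k_def elim: oddE)
  have ne1: "y \<in> carrier G \<and> y \<noteq> \<one>" if "y \<in># S" for y using that sub N(1) by auto
  show False
  proof (cases "\<forall>x\<in>#S. x \<notin> N \<longrightarrow> q - 1 \<le> size (filter_mset (\<lambda>y. y \<notin> centralizer x) S)")
    case True
    have "2 * (q - 1) \<le> ?n" using n m4 q5 by linarith
    moreover have "q - 1 \<le> size (filter_mset (\<lambda>y. centralizer y \<noteq> centralizer x) S)" if x: "x \<in># S" for x
    proof (cases "x \<in> N")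
      case True
      have "q - 1 \<le> size (filter_mset (\<lambda>y. y \<notin> N) S)"
        using N(2) n m4 size_filter_add[of "\<lambda>x. x \<in> N" S] by linarith
      also have "\<dots> \<le> size (filter_mset (\<lambda>y. centralizer y \<noteq> centralizer x) S)"
      proof (rule size_filter_mono)
        fix y assume "y \<in># S" "y \<notin> N"
        then show "centralizer y \<noteq> centralizer x"
          using centralizer_eq_iff[of y x] ne1[OF x] ne1[of y] commutes_in_N[OF True, of y] by metis
      qed
      finally show ?thesis .
    next
      case False
      then have "q - 1 \<le> size (filter_mset (\<lambda>y. y \<notin> centralizer x) S)" using True x by blast
      also have "\<dots> \<le> size (filter_mset (\<lambda>y. centralizer y \<noteq> centralizer x) S)"
      proof (rule size_filter_mono)
        fix y assume "y \<in># S" "y \<notin> centralizer x"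
        then show "centralizer y \<noteq> centralizer x"
          using centralizer_eq_iff[of y x] ne1[OF x] ne1[of y] by (simp add: centralizer_def)
      qed
      finally show ?thesis .
    qed
    ultimately obtain Fs where Fs: "length Fs = q - 1" "sum_list Fs \<subseteq># S"
      "\<forall>F\<in>set Fs. size F = 2 \<and> (\<exists>a b R. F = add_mset a (add_mset b R) \<and> centralizer a \<noteq> centralizer b)"
      using disjoint_nonmonochromatic[of 2 "q - 1" S centralizer] by blast
    have F2: "set_mset F \<subseteq> carrier G \<and> 1 < card (prods G F)" if F: "F \<in> set Fs" for F
    proof -
      obtain a b R where R: "F = add_mset a (add_mset b R)" "centralizer a \<noteq> centralizer b" "size F = 2"
        using Fs(3) F by blast
      then have F': "F = {#a, b#}" by simp
      have "F \<subseteq># sum_list Fs" using F by (metis in_set_conv_decomp mset_subset_eq_add_left mset_subset_eq_add_right sum_list.Cons sum_list_append subset_mset.order_trans)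
      then have FS: "F \<subseteq># S" using Fs(2) by (rule subset_mset.order_trans)
      then have ab: "a \<in># S" "b \<in># S" unfolding F' by (auto dest: mset_subset_eqD)
      have "2 \<le> card (prods G F)" unfolding F'
        using centralizer_eq_iff[of a b] ne1[OF ab(1)] ne1[OF ab(2)] R(2) by (intro two_le_card_prods) auto
      then show ?thesis using FS sub by (meson less_le_trans one_less_numeral_iff semiring_norm(76) set_mset_mono subset_trans)
    qed
    have "min q (1 + (q - 1) * 1) \<le> card (prods G (sum_list Fs))"
      using card_prods_sum_list[of Fs 1] F2 Fs(1) by simp
    then have full: "q \<le> card (prods G (sum_list Fs))" using q5 by simp
    have sz: "size (sum_list Fs) = 2 * (q - 1)" using size_sum_list_const[of Fs 2] Fs by simp
    then have "sum_list Fs \<noteq> {#}" using q5 by auto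
    from full_bound[OF S ns Fs(2) this full] show False using sz n m4 q5 by linarith
  next
    case False
    then obtain x where x: "x \<in># S" "x \<notin> N" and w: "size (filter_mset (\<lambda>y. y \<notin> centralizer x) S) < q - 1"
      by (meson not_le)
    let ?w = "size (filter_mset (\<lambda>y. y \<notin> centralizer x) S)"
    have xc: "x \<in> carrier G" "x \<noteq> \<one>" using ne1[OF x(1)] by auto
    have "m < ?n" using n q5 by linarith
    from centralizer_bound[OF S ns this xc(1) x(2)] have "3 * (q * m) < 4 * (m * ?w)" using size by linarith
    then have "m * (3 * q) < m * (4 * ?w)" by (simp add: ac_simps)
    then have w3: "3 * q < 4 * ?w" using nat_mult_less_cancel_disj by blast
    define E where "E = filter_mset (\<lambda>y. y \<in> centralizer x \<and> y \<otimes> y \<noteq> \<one>) S"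
    have v: "size (filter_mset (\<lambda>y. y \<in> centralizer x) S) + ?w = ?n" by (rule size_filter_add)
    show False
    proof (cases "k \<le> size E")
      case True
      obtain E' where E': "E' \<subseteq># E" "size E' = k" using True exists_submultiset by blast
      obtain A where A: "A \<subseteq># filter_mset (\<lambda>y. y \<notin> centralizer x) S" "size A = k"
        using exists_submultiset[of k "filter_mset (\<lambda>y. y \<notin> centralizer x) S"] w3 k by auto
      have "E \<subseteq># filter_mset (\<lambda>y. y \<in> centralizer x) S"
        unfolding E_def by (intro filter_mset_mono_strong) simp_all
      then have EC: "E' \<subseteq># filter_mset (\<lambda>y. y \<in> centralizer x) S"
        using E'(1) by (meson subset_mset.order_trans)
      have "k \<le> size (filter_mset (\<lambda>y. y \<in> centralizer x) S - E')"
        using EC E'(2) v w n k m4 by (simp add: size_Diff_submset)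
      then obtain D where D: "D \<subseteq># filter_mset (\<lambda>y. y \<in> centralizer x) S - E'" "size D = k"
        using exists_submultiset by blast
      have "E' + D \<subseteq># filter_mset (\<lambda>y. y \<in> centralizer x) S"
        using D(1) EC by (metis subset_mset.le_diff_conv2 union_commute)
      from subset_mset.add_mono[OF this A(1)] have "E' + D + A \<subseteq># S"
        using multiset_partition[of S "\<lambda>y. y \<in> centralizer x"] by simp
      then have TS: "A + E' + D \<subseteq># S" by (simp add: ac_simps)
      have "\<exists>Fs. length Fs = k \<and> sum_list Fs = A + E' + D \<and> (\<forall>F\<in>set Fs. set_mset F \<subseteq> carrier G \<and> 2 < card (prods G F))"
      proof (rule triples_exist[OF xc A(2) E'(2) D(2)])
        fix a assume "a \<in># A"
        then have "a \<in># filter_mset (\<lambda>y. y \<notin> centralizer x) S" using A(1) by (meson mset_subset_eqD)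
        then show "a \<in> carrier G \<and> a \<notin> centralizer x" using ne1 by auto
      next
        fix b assume "b \<in># E'"
        then have "b \<in># E" using E'(1) by (meson mset_subset_eqD)
        then show "b \<in> centralizer x \<and> b \<otimes> b \<noteq> \<one>" by (simp add: E_def)
      next
        fix d assume "d \<in># D"
        then have "d \<in># filter_mset (\<lambda>y. y \<in> centralizer x) S" using D(1) by (meson in_diffD mset_subset_eqD)
        then show "d \<in> centralizer x \<and> d \<noteq> \<one>" using ne1 by auto
      qed
      then obtain Fs where Fs: "length Fs = k" "sum_list Fs = A + E' + D"
        "\<forall>F\<in>set Fs. set_mset F \<subseteq> carrier G \<and> 2 < card (prods G F)" by blast
      have "min q (1 + k * 2) \<le> card (prods G (A + E' + D))"
        using card_prods_sum_list[of Fs 2] Fs by simp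
      then have full: "q \<le> card (prods G (A + E' + D))" using k by simp
      have sz: "size (A + E' + D) = 3 * k" using A E' D by simp
      moreover have "A + E' + D \<noteq> {#}" using sz k q5 by auto
      ultimately show False using full_bound[OF S ns TS _ full] n k m4 by linarith
    next
      case False
      let ?I = "filter_mset (\<lambda>y. y \<in> centralizer x \<and> y \<otimes> y = \<one>) S"
      have "size (filter_mset (\<lambda>y. y \<otimes> y = \<one>) (filter_mset (\<lambda>y. y \<in> centralizer x) S)) +
         size (filter_mset (\<lambda>y. \<not> y \<otimes> y = \<one>) (filter_mset (\<lambda>y. y \<in> centralizer x) S)) =
         size (filter_mset (\<lambda>y. y \<in> centralizer x) S)" by (rule size_filter_add)
      then have I: "size ?I + size E = size (filter_mset (\<lambda>y. y \<in> centralizer x) S)"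
        by (simp add: E_def filter_filter_mset conj_commute)
      then have "size ?I > 0" using v w False n k m4 by linarith
      then have "?I \<noteq> {#}" by (simp only: nonempty_has_size)
      then obtain i where i: "i \<in># S" "i \<in> centralizer x" "i \<otimes> i = \<one>" by auto
      have ic: "i \<in> carrier G" "i \<noteq> \<one>" using ne1[OF i(1)] by auto
      have outN: "y \<notin> N" if "y \<in> centralizer x" "y \<noteq> \<one>" for y
        using centralizer_Int_N[OF xc(1) x(2)] that by blast
      \<comment> \<open>All involutions among the terms commuting with \<open>x\<close> equal
        \<open>i\<close>. Outside \<open>{\<one>, i}\<close> there remain only the few terms outside
        the centraliser and those of \<open>E\<close>, so the run argument applies to this group of
        order two.\<close>
      have sg: "subgroup {\<one>, i} G"
        using ic i(3) by (intro subgroupI) (auto intro: inv_equality simp: inv_equality)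
      have "2 < ?n" using n m4 q5 by linarith
      then have le: "?n \<le> 2 * max 1 (size (filter_mset (\<lambda>y. y \<notin> {\<one>, i}) S))"
        using size_le_of_not_splits[OF S ns sg] ic by simp
      have "size (filter_mset (\<lambda>y. y \<notin> {\<one>, i}) S) \<le> size (filter_mset (\<lambda>y. y \<notin> centralizer x \<or> (y \<in> centralizer x \<and> y \<otimes> y \<noteq> \<one>)) S)"
      proof (rule size_filter_mono)
        fix y assume y: "y \<in># S" "y \<notin> {\<one>, i}"
        show "y \<notin> centralizer x \<or> (y \<in> centralizer x \<and> y \<otimes> y \<noteq> \<one>)"
        proof (rule ccontr)
          assume *: "\<not> ?thesis"
          then have yx: "y \<in> centralizer x" "y \<otimes> y = \<one>" by auto
          have "y \<otimes> i = i \<otimes> y" using yx i xc by (intro commute_trans[of y i x]) (auto simp: centralizer_def)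
          moreover have "y \<in> carrier G" "y \<noteq> \<one>" using ne1[OF y(1)] by auto
          ultimately have "y = i"
            using involution_unique[OF _ outN[OF yx(1)] yx(2) ic(1) outN[OF i(2) ic(2)] i(3)] by blast
          then show False using y by simp
        qed
      qed
      also have "\<dots> \<le> size (filter_mset (\<lambda>y. y \<notin> centralizer x) S + E)"
        unfolding E_def by (intro size_mset_mono) (auto simp: subseteq_mset_def)
      finally have "size (filter_mset (\<lambda>y. y \<notin> {\<one>, i}) S) \<le> ?w + size E" by simp
      then have "?n \<le> 2 * (?w + size E)" using le w3 q5 by (auto simp: max_def split: if_splits)
      \<comment> \<open>With \<open>?w \<le> q - 2\<close> and \<open>size E \<le> k - 1\<close> the
        preceding bound is at most \<open>3q - 7\<close>.\<close>
      moreover have "?w + 2 \<le> q" "size E + 1 \<le> k" "3 * q < ?n" using w False n m4 q5 by linarith+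
      ultimately show False using k by presburger
    qed
  qed
qed

end

lemma exists_count_ge_two:
  assumes "set_mset R \<subseteq> A" "finite A" "card A < size R"
  shows "\<exists>z\<in>A. 2 \<le> count R z"
proof (rule ccontr)
  assume "\<not> ?thesis"
  then have *: "count R z \<le> 1" if "z \<in> A" for z using that by force
  have "size R = (\<Sum>z\<in>set_mset R. count R z)" by (simp add: size_multiset_overloaded_eq)
  also have "\<dots> \<le> (\<Sum>z\<in>set_mset R. 1)" using * assms(1) by (intro sum_mono) auto
  also have "\<dots> \<le> card A" using assms by (simp add: card_mono)
  finally show False using assms by simp
qed

lemma two_copies: "2 \<le> count R z \<Longrightarrow> {#z, z#} \<subseteq># R"
  by (auto simp: subseteq_mset_def)

lemma mem_sum_list_subset: "F \<in> set Fs \<Longrightarrow> F \<subseteq># sum_list Fs"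
  by (induction Fs) (auto intro: subset_mset.order_trans)

section \<open>Index two\<close>

context frobenius
begin

lemma power_in_N:
  assumes "y \<in> carrier G"
  shows "\<exists>k. 0 < k \<and> k \<le> m \<and> y [^] (k :: nat) \<in> N"
proof -
  have op: "ordered_product G (replicate k y) = y [^] k" for k
    using assms by (induction k) (simp_all flip: nat_pow_Suc2)
  have "set (replicate m y) \<subseteq> carrier G" using assms by auto
  from block_mod_N[OF this] obtain as bs cs
    where *: "replicate m y = as @ bs @ cs" "bs \<noteq> []" "ordered_product G bs \<in> N" by auto
  have "set bs \<subseteq> {y}" using arg_cong[OF *(1), of set] by auto
  then have "bs = replicate (length bs) y" by (metis replicate_length_same singletonD subsetD)
  moreover have "length bs \<le> m" using arg_cong[OF *(1), of length] by simp
  ultimately show ?thesis using * op by (metis length_greater_0_conv)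
qed

lemma power_eq_one_of_in_N:
  assumes "y \<in> carrier G" "y \<notin> N" "y [^] (k :: nat) \<in> N"
  shows "y [^] k = \<one>"
proof (rule ccontr)
  assume "y [^] k \<noteq> \<one>"
  moreover have "y [^] k \<otimes> y = y \<otimes> y [^] k" using assms(1) by (metis nat_pow_Suc nat_pow_Suc2)
  ultimately show False using commutes_in_N[OF assms(3) _ assms(1,2)] by blast
qed

lemma card_outside_N: "card (carrier G - N) = q * (m - 1)"
proof -
  have "N \<subseteq> carrier G" using N_carrier by blast
  then have "card (carrier G - N) = q * m - q"
    using finN order_eq cardN by (simp add: card_Diff_subset order_def)
  then show ?thesis by (simp add: right_diff_distrib')
qed

lemma product_one_over_N:
  assumes "set_mset R \<subseteq> N" "q \<le> size R"
  shows "\<exists>U. U \<subseteq># R \<and> U \<noteq> {#} \<and> size U \<le> q \<and> product_one G U"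
proof -
  obtain xs where xs: "mset xs = R" using ex_mset by blast
  then have "set xs \<subseteq> N" "card N \<le> length xs" using assms cardN by auto
  from subgroup_block[OF subN finN this(2,1)] obtain as bs cs where
    b: "xs = as @ bs @ cs" "bs \<noteq> []" "length bs \<le> card N" "ordered_product G bs = \<one>" by blast
  have "set bs \<subseteq> carrier G" using b(1) \<open>set xs \<subseteq> N\<close> N_carrier by auto
  then have "product_one G (mset bs)"
    using b(4) unfolding product_one_def seq_over_def set_mset_mset by blast
  moreover have "mset bs \<subseteq># R" unfolding xs[symmetric] b(1) by (simp add: mset_subset_eq_add_right)
  ultimately show ?thesis using b cardN by (intro exI[of _ "mset bs"]) auto
qed

text \<open>Here every element outside \<open>N\<close> is an involution, and there are only
  \<open>q\<close> of them, so any \<open>q + 1\<close> terms outside \<open>N\<close> contain a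
  pair of equal terms with product one. It suffices to fill a coset with a part \<open>T\<close>
  that leaves either this many terms outside \<open>N\<close> or \<open>q\<close> terms inside
  \<open>N\<close>. The threshold \<open>3q\<close> is 3/2 of the order; no claim is made at 3/4 of
  it.\<close>

lemma short_factor_two:
  assumes m2: "m = 2" and S: "product_one G S" and size: "3 * q < size S"
  shows "\<exists>U. U \<subseteq># S \<and> U \<noteq> {#} \<and> size U \<le> q \<and> product_one G U \<and> product_one G (S - U)"
proof (rule ccontr)
  assume "\<not> ?thesis"
  then have no: "False" if "U \<subseteq># S" "U \<noteq> {#}" "size U \<le> q" "product_one G U" "product_one G (S - U)" for U
    using that by blast
  have sub: "set_mset S \<subseteq> carrier G" using S product_one_over by simp
  have q3: "q \<ge> 3" using m_less_q m2 by simp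
  have one: "\<one> \<notin># S"
    using no[of "{#\<one>#}"] product_one_remove_one[OF S] q3 by auto
  have inv: "y \<otimes> y = \<one>" if y: "y \<in> carrier G" "y \<notin> N" for y
  proof -
    obtain k :: nat where k: "0 < k" "k \<le> 2" "y [^] k \<in> N" using power_in_N[OF y(1)] m2 by auto
    have "k \<noteq> 1" using k y by auto
    then have "k = Suc (Suc 0)" using k by simp
    then show ?thesis using power_eq_one_of_in_N[OF y k(3)] y by simp
  qed
  define O' where "O' = filter_mset (\<lambda>x. x \<notin> N) S"
  define T' where "T' = filter_mset (\<lambda>x. x \<in> N) S"
  have part: "S = T' + O'" unfolding O'_def T'_def by (rule multiset_partition)
  have O'sub: "x \<in> carrier G \<and> x \<notin> N" if "x \<in># O'" for x using that sub by (auto simp: O'_def)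
  have T'sub: "x \<in> N \<and> x \<noteq> \<one>" if "x \<in># T'" for x using that one by (auto simp: T'_def)
  have st: "size S = size T' + size O'" using part by (metis size_union)
  have "O' \<noteq> {#}"
  proof
    assume "O' = {#}"
    then have "card N * max 1 (size (filter_mset (\<lambda>x. x \<notin> N) S)) < size S"
      using size cardN by (simp add: O'_def)
    from short_factor_of_run[OF S subN finN this] show False using no cardN by blast
  qed
  then obtain y where y: "y \<in># O'" by blast
  have yc: "y \<in> carrier G" "y \<notin> N" using O'sub[OF y] by auto
  have full: False if T: "T \<subseteq># S" "q \<le> card (prods G T)" and U: "U \<subseteq># S - T" "U \<noteq> {#}" "size U \<le> q" "product_one G U" for T U
  proof -
    have "product_one G (S - U)" using product_one_of_full[OF S T U(1,4)] .
    moreover have "U \<subseteq># S" using U(1) by (meson diff_subset_eq_self subset_mset.order_trans)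
    ultimately show False using no U by blast
  qed
  have copies: False if T: "T \<subseteq># S" "q \<le> card (prods G T)" and R: "R \<subseteq># S - T" "q < size R" "\<And>x. x \<in># R \<Longrightarrow> x \<in> carrier G - N" for T R
  proof -
    have "card (carrier G - N) < size R" using R(2) card_outside_N m2 by simp
    then obtain z where z: "z \<in> carrier G - N" "2 \<le> count R z"
      using exists_count_ge_two[of R "carrier G - N"] R(3) fin by blast
    have "{#z, z#} \<subseteq># S - T" using two_copies[OF z(2)] R(1) by (rule subset_mset.order_trans)
    moreover have "product_one G {#z, z#}"
      unfolding product_one_def seq_over_def using z inv[of z] by (auto intro!: exI[of _ "[z, z]"])
    ultimately show False using full[OF T, of "{#z, z#}"] q3 by simp
  qed
  have yS: "y \<in># S" using y part by simp
  show False
  proof (cases "q - 1 \<le> size T'")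
    case True
    from full_of_N_terms[OF sub one yS yc(2)] True obtain A where
      A: "A \<subseteq># T'" "size A = q - 1" "add_mset y A \<subseteq># S" "q \<le> card (prods G (add_mset y A))"
      unfolding T'_def by blast
    have y1: "{#y#} \<subseteq># O'" using y by simp
    have "S - add_mset y A = (T' - A) + (O' - {#y#})"
      using A(1) y1 unfolding part by (metis (no_types, lifting) add_mset_add_single diff_diff_add mset_subset_eq_multiset_union_diff_commute multiset_diff_union_assoc union_commute)
    then have sub2: "T' - A \<subseteq># S - add_mset y A" "O' - {#y#} \<subseteq># S - add_mset y A"
      by (simp_all add: mset_subset_eq_add_left mset_subset_eq_add_right)
    show False
    proof (cases "2 * q - 1 \<le> size T'")
      case True
      have "q \<le> size (T' - A)" using True A by (simp add: size_Diff_submset)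
      moreover have "set_mset (T' - A) \<subseteq> N" using T'sub by (meson in_diffD subsetI)
      ultimately obtain U where "U \<subseteq># T' - A" "U \<noteq> {#}" "size U \<le> q" "product_one G U"
        using product_one_over_N by blast
      then show False using full[OF A(3,4), of U] sub2 by (meson subset_mset.order_trans)
    next
      case False
      have "size (O' - {#y#}) = size O' - 1" using y by (simp add: size_Diff_singleton)
      then have "q < size (O' - {#y#})" using False st size by linarith
      then show False using copies[OF A(3,4) sub2(2)] O'sub by (meson DiffI in_diffD)
    qed
  next
    case False
    define t where "t = size T'"
    \<comment> \<open>All terms of \<open>N\<close> are used, together with one outside term. Each
      of them gains one product, and \<open>j\<close> noncommuting pairs supply the rest of the
      coset.\<close>
    define j where "j = q - 1 - t"
    have tj: "t + j + 1 = q" using False by (simp add: t_def j_def)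
    have c0: "min q (t + 1) \<le> card (prods G (add_mset y T'))"
      unfolding t_def using T'sub commutes_in_N yc by (intro card_prods_with_N_terms) auto
    define R where "R = O' - {#y#}"
    have OR: "O' = add_mset y R" using y by (simp add: R_def)
    have Rc: "x \<in> carrier G \<and> x \<notin> N" if "x \<in># R" for x using O'sub[of x] that OR by simp
    have sizeR: "size S = t + size R + 1" using st OR by (simp add: t_def)
    \<comment> \<open>By the run argument for \<open>{\<one>, x}\<close> at least half of the terms
      differ from \<open>x\<close>, and at most \<open>t + 1\<close> of these lie outside
      \<open>R\<close>.\<close>
    have co: "j \<le> size (filter_mset (\<lambda>v. v \<noteq> x) R)" if x: "x \<in># R" for x
    proof -
      have xc: "x \<in> carrier G" "x \<notin> N" using Rc[OF x] by auto
      have xx: "x \<otimes> x = \<one>" using inv xc by simp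
      have x1: "x \<noteq> \<one>" using xc by auto
      have sg: "subgroup {\<one>, x} G" using xc xx by (intro subgroupI) (auto simp: inv_equality)
      let ?w = "size (filter_mset (\<lambda>v. v \<notin> {\<one>, x}) S)"
      have "\<not> card {\<one>, x} * max 1 ?w < size S"
      proof
        assume "card {\<one>, x} * max 1 ?w < size S"
        from short_factor_of_run[OF S sg _ this] obtain U where
          U: "U \<subseteq># S" "U \<noteq> {#}" "size U \<le> card {\<one>, x}" "product_one G U" "product_one G (S - U)" by auto
        have "card {\<one>, x} \<le> 2" by (simp add: card_insert_if)
        then have "size U \<le> q" using U(3) q3 by linarith
        then show False using no[OF U(1,2) _ U(4,5)] by simp
      qed
      then have "size S \<le> 2 * max 1 ?w" using x1 by simp
      then have "size S \<le> 2 * ?w" using size q3 by (auto simp: max_def split: if_splits)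
      moreover have "?w \<le> size (filter_mset (\<lambda>v. v \<noteq> x) S)" by (rule size_filter_mono) simp
      moreover have "filter_mset (\<lambda>v. v \<noteq> x) S = filter_mset (\<lambda>v. v \<noteq> x) T' + filter_mset (\<lambda>v. v \<noteq> x) O'"
        by (subst part) simp
      then have "size (filter_mset (\<lambda>v. v \<noteq> x) S) \<le> t + 1 + size (filter_mset (\<lambda>v. v \<noteq> x) R)"
        using size_filter_mset_lesseq[of "\<lambda>v. v \<noteq> x" T'] by (simp add: OR t_def le_SucI)
      ultimately show ?thesis using size tj by linarith
    qed
    have "2 * j \<le> size R" using sizeR size tj by linarith
    from disjoint_nonmonochromatic[of 2 j R "\<lambda>x. x", OF _ this] co obtain Fs where Fs: "length Fs = j" "sum_list Fs \<subseteq># R"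
      "\<forall>F\<in>set Fs. size F = 2 \<and> (\<exists>a b R. F = add_mset a (add_mset b R) \<and> a \<noteq> b)" by auto
    have F2: "set_mset F \<subseteq> carrier G \<and> 1 < card (prods G F)" if F: "F \<in> set Fs" for F
    proof -
      obtain a b R' where R': "F = add_mset a (add_mset b R')" "a \<noteq> b" "size F = 2"
        using Fs(3) F by blast
      then have F': "F = {#a, b#}" by simp
      have "F \<subseteq># R" using mem_sum_list_subset[OF F] Fs(2) by (rule subset_mset.order_trans)
      then have ab: "a \<in># R" "b \<in># R" unfolding F' by (auto dest: mset_subset_eqD)
      have abc: "a \<in> carrier G" "a \<notin> N" "b \<in> carrier G" "b \<notin> N" using Rc[OF ab(1)] Rc[OF ab(2)] by auto
      have "a \<otimes> b \<noteq> b \<otimes> a" using involution_unique[OF abc(1,2) inv[OF abc(1,2)] abc(3,4) inv[OF abc(3,4)]] R'(2) by blast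
      from two_le_card_prods[OF abc(1,3) this] show ?thesis unfolding F' using abc by simp
    qed
    have Fs': "min q (1 + j) \<le> card (prods G (sum_list Fs))" "set_mset (sum_list Fs) \<subseteq> carrier G"
      using card_prods_sum_list[of Fs 1] F2 Fs(1) by auto
    have "set_mset (add_mset y T') \<subseteq> carrier G" using T'sub N_carrier yc by auto
    from card_prods_add[OF this Fs'(2)] have fullT: "q \<le> card (prods G (add_mset y T' + sum_list Fs))"
      using c0 Fs'(1) tj by linarith
    have S_eq: "S = (add_mset y T' + sum_list Fs) + (R - sum_list Fs)"
      using part OR Fs(2) by simp
    then have TS: "add_mset y T' + sum_list Fs \<subseteq># S" by (metis mset_subset_eq_add_left)
    have "S - (add_mset y T' + sum_list Fs) = R - sum_list Fs" by (subst S_eq) simp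
    then have RS: "R - sum_list Fs \<subseteq># S - (add_mset y T' + sum_list Fs)" by simp
    have "size (sum_list Fs) = 2 * j" using size_sum_list_const[of Fs 2] Fs by simp
    then have "q < size (R - sum_list Fs)" using Fs(2) sizeR size tj by (simp add: size_Diff_submset)
    then show False using copies[OF TS fullT RS] Rc by (meson DiffI in_diffD)
  qed
qed

end

section \<open>Index three\<close>

context frobenius
begin

context
  assumes m3: "m = 3"
begin

lemma q_ge_5: "5 \<le> q" and odd_q: "odd q"
proof -
  have "q \<ge> 4" using m_less_q m3 by simp
  then show "odd q" using q prime_odd_nat by force
  then show "5 \<le> q" using \<open>q \<ge> 4\<close> by (cases "q = 4") auto
qed

lemma order_odd: "odd (order G)"
  using odd_q order_eq m3 by simp

lemma square_neq_one:
  assumes "x \<in> carrier G" "x \<noteq> \<one>"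
  shows "x \<otimes> x \<noteq> \<one>"
proof
  assume "x \<otimes> x = \<one>"
  then have "x [^] (2 :: nat) = \<one>" using assms by (simp add: numeral_2_eq_2)
  then have "ord x dvd 2" using pow_eq_id[OF assms(1)] by blast
  moreover have "ord x dvd order G" using ord_dvd_group_order[OF assms(1)] .
  moreover have "coprime 2 (order G)" using order_odd by simp
  ultimately have "ord x = 1" by (metis coprime_common_divisor_nat nat_dvd_1_iff_1)
  then show False using ord_eq_1[OF assms(1)] assms(2) by blast
qed

lemma cube_eq_one:
  assumes "y \<in> carrier G" "y \<notin> N"
  shows "y \<otimes> y \<otimes> y = \<one>"
proof -
  obtain k :: nat where k: "0 < k" "k \<le> 3" "y [^] k \<in> N" using power_in_N[OF assms(1)] m3 by auto
  have y1: "y \<noteq> \<one>" using assms by auto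
  have p: "y [^] k = \<one>" using power_eq_one_of_in_N[OF assms k(3)] .
  consider "k = 1" | "k = 2" | "k = 3" using k by linarith
  then show ?thesis
  proof cases
    case 1 then show ?thesis using p assms by simp
  next
    case 2
    then show ?thesis using p square_neq_one[OF assms(1) y1] assms by (simp add: numeral_2_eq_2)
  next
    case 3 then show ?thesis using p assms by (simp add: numeral_3_eq_3)
  qed
qed

text \<open>Conjugation by \<open>y\<close> raises \<open>u\<close> to a power \<open>j\<close> with \<open>j\<^sup>3 = 1\<close> modulo \<open>q\<close>, which forces \<open>j = 1\<close> if \<open>q = 5\<close>.\<close>

lemma q_ge_7: "7 \<le> q"
proof (rule ccontr)
  assume "\<not> ?thesis"
  then have q5: "q = 5" using q_ge_5 odd_q by presburger
  have "card (carrier G - N) \<noteq> 0" using card_outside_N q5 m3 by simp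
  then obtain y where y: "y \<in> carrier G" "y \<notin> N" by (metis DiffE card.empty ex_in_conv)
  obtain u where u: "u \<in> N" "u \<noteq> \<one>" by (rule exists_N)
  have uc: "u \<in> carrier G" using u N_carrier by simp
  have ou: "ord u = 5" using generate_pow_card[OF uc] N_generated[OF u] cardN q5 by simp
  obtain j :: nat where j: "y \<otimes> u \<otimes> inv y = u [^] j" using N_pow[OF u conj_N(1)[OF u(1) y(1)]] .
  have step: "y \<otimes> u [^] (i :: nat) \<otimes> inv y = u [^] (j * i)" for i
    using conj_pow[OF y(1) uc, symmetric] j uc by (simp add: nat_pow_pow)
  have "u [^] (j * (j * j)) = y \<otimes> (y \<otimes> (y \<otimes> u \<otimes> inv y) \<otimes> inv y) \<otimes> inv y"
    unfolding j step ..
  also have "\<dots> = (y \<otimes> y \<otimes> y) \<otimes> u \<otimes> inv (y \<otimes> y \<otimes> y)" using y uc by (simp add: m_assoc inv_mult_group)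
  also have "\<dots> = u" using cube_eq_one[OF y] uc by simp
  finally have cube: "u [^] (j * (j * j)) = u" .
  have pred: "u [^] (int n - 1) = u [^] n \<otimes> inv u" for n using uc by (simp add: int_pow_diff int_pow_int)
  have "u [^] (int (j * (j * j)) - 1) = \<one>" unfolding pred cube using uc by simp
  then have d: "int 5 dvd int (j * (j * j)) - 1" using int_pow_eq_id[OF uc] ou by simp
  have "j * (j * j) mod 5 = 1"
    using d by presburger
  moreover have "j * (j * j) mod 5 = (j mod 5) * ((j mod 5) * (j mod 5) mod 5) mod 5"
    by (simp only: mod_mult_eq)
  moreover have "j mod 5 \<in> {0, 1, 2, 3, 4}" by auto
  ultimately have "j mod 5 = 1" by auto
  then have "int 5 dvd int j - 1" by presburger
  then have "u [^] (int j - 1) = \<one>" using int_pow_eq_id[OF uc] ou by simp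
  then have "u [^] j \<otimes> inv u \<otimes> u = u" unfolding pred using uc by simp
  then have "u [^] j = u" using uc by (simp add: m_assoc)
  then have "y \<otimes> u \<otimes> inv y = u" using j by simp
  then have "y \<otimes> u = u \<otimes> y" using y uc by (metis inv_solve_right m_closed)
  then show False using commutes_in_N[OF u y] by simp
qed

text \<open>Since the order is odd there are no involutions, so the exception in
  \<open>card_prods_triple_commuting\<close> does not arise, whichever pair commutes.\<close>

lemma card_prods_nonmonochromatic_triple:
  assumes F: "set_mset F \<subseteq> carrier G" "\<one> \<notin># F" "size F = 3"
    and ab: "F = add_mset a (add_mset b R)" "centralizer a \<noteq> centralizer b"
  shows "2 < card (prods G F)"
proof -
  have "size R = 1" using F(3) ab(1) by simp
  then obtain c where "R = {#c#}" by (metis size_1_singleton_mset)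
  then have F': "F = {#a, b, c#}" using ab by simp
  have a: "a \<in> carrier G" "a \<noteq> \<one>" and b: "b \<in> carrier G" "b \<noteq> \<one>" and c: "c \<in> carrier G" "c \<noteq> \<one>"
    using F(1,2) F' by auto
  have nab: "a \<otimes> b \<noteq> b \<otimes> a" using ab(2) centralizer_eq_iff a b by blast
  show ?thesis
  proof (cases "a \<otimes> c = c \<otimes> a")
    case True
    have "2 < card (prods G {#b, a, c#})"
      using card_prods_triple_commuting[OF b(1) a c True] nab square_neq_one[OF a] by metis
    then show ?thesis by (simp add: F' add_mset_commute)
  next
    case nac: False
    show ?thesis
    proof (cases "b \<otimes> c = c \<otimes> b")
      case True
      then show ?thesis unfolding F'
        using card_prods_triple_commuting[OF a(1) b c True nab] square_neq_one[OF b] by metis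
    next
      case False
      then show ?thesis unfolding F' using card_prods_triple_noncommuting[OF a(1) b(1) c(1) nab nac] by blast
    qed
  qed
qed

text \<open>A triple gains two products for three terms, which is cheaper than two noncommuting
  pairs with four terms. The smaller threshold of index three needs this economy.\<close>

lemma nonmonochromatic_triples:
  assumes S: "set_mset S \<subseteq> carrier G" "\<one> \<notin># S" and size: "3 * k \<le> size S"
    and co: "\<And>x. x \<in># S \<Longrightarrow> k \<le> size (filter_mset (\<lambda>y. y \<notin> centralizer x) S)"
  shows "\<exists>T. T \<subseteq># S \<and> size T = 3 * k \<and> min q (1 + 2 * k) \<le> card (prods G T)"
proof -
  have ne1: "y \<in> carrier G \<and> y \<noteq> \<one>" if "y \<in># S" for y using that S by auto
  have "k \<le> size (filter_mset (\<lambda>y. centralizer y \<noteq> centralizer x) S)" if x: "x \<in># S" for x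
  proof -
    have "size (filter_mset (\<lambda>y. y \<notin> centralizer x) S) \<le> size (filter_mset (\<lambda>y. centralizer y \<noteq> centralizer x) S)"
    proof (rule size_filter_mono)
      fix y assume "y \<in># S" "y \<notin> centralizer x"
      then show "centralizer y \<noteq> centralizer x"
        using centralizer_eq_iff[of y x] ne1[OF x] ne1[of y] by (simp add: centralizer_def)
    qed
    then show ?thesis using co[OF x] by linarith
  qed
  then obtain Fs where Fs: "length Fs = k" "sum_list Fs \<subseteq># S"
    "\<forall>F\<in>set Fs. size F = 3 \<and> (\<exists>a b R. F = add_mset a (add_mset b R) \<and> centralizer a \<noteq> centralizer b)"
    using disjoint_nonmonochromatic[of 3 k S centralizer] size by auto
  have "set_mset F \<subseteq> carrier G \<and> 2 < card (prods G F)" if F: "F \<in> set Fs" for F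
  proof -
    have "F \<subseteq># S" using mem_sum_list_subset[OF F] Fs(2) by (rule subset_mset.order_trans)
    then have "set_mset F \<subseteq> carrier G" "\<one> \<notin># F" using S by (auto dest: mset_subset_eqD)
    moreover obtain a b R where "size F = 3" "F = add_mset a (add_mset b R)" "centralizer a \<noteq> centralizer b"
      using Fs(3) F by blast
    ultimately show ?thesis using card_prods_nonmonochromatic_triple[of F a b R] by simp
  qed
  then have "min q (1 + 2 * k) \<le> card (prods G (sum_list Fs))"
    using card_prods_sum_list[of Fs 2] Fs(1) by (auto simp: mult.commute)
  moreover have "size (sum_list Fs) = 3 * k" using size_sum_list_const[of Fs 3] Fs by simp
  ultimately show ?thesis using Fs(2) by blast
qed

lemma centralizer_outside_N:
  assumes "y \<in> carrier G" "y \<notin> N"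
  shows "centralizer y = {\<one>, y, inv y}"
proof -
  have y1: "y \<noteq> \<one>" using assms by auto
  have "y \<noteq> inv y"
  proof
    assume "y = inv y"
    then have "y \<otimes> y = \<one>" using assms(1) by (metis r_inv)
    then show False using square_neq_one[OF assms(1) y1] by simp
  qed
  moreover have "inv y \<noteq> \<one>" using y1 assms by simp
  ultimately have "card {\<one>, y, inv y} = 3" using y1 by simp
  moreover have "{\<one>, y, inv y} \<subseteq> centralizer y" using assms by (auto simp: centralizer_def)
  ultimately show ?thesis
    using card_centralizer[OF assms] m3 card_seteq[OF finite_centralizer] by metis
qed

text \<open>If all pairwise products of three terms lay in \<open>N\<close>, the terms would agree
  modulo \<open>N\<close> and have squares in \<open>N\<close>. Such a square commutes with its
  root, hence is trivial, which odd order forbids.\<close>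

lemma exists_pair_outside:
  assumes R: "\<And>y. y \<in># R \<Longrightarrow> y \<in> carrier G \<and> y \<notin> N" and size: "3 \<le> size R"
  shows "\<exists>y z. {#y, z#} \<subseteq># R \<and> y \<otimes> z \<notin> N"
proof (rule ccontr)
  assume no: "\<not> ?thesis"
  obtain T where T: "T \<subseteq># R" "size T = 3" using exists_submultiset[OF size] by blast
  obtain y T1 where T1: "T = add_mset y T1" using T(2) by (metis numeral_3_eq_3 size_eq_Suc_imp_eq_union)
  obtain z T2 where T2: "T1 = add_mset z T2" using T(2) T1 by (metis add_left_cancel numeral_3_eq_3 size_add_mset size_eq_Suc_imp_eq_union plus_1_eq_Suc)
  obtain w T3 where T3: "T2 = add_mset w T3" using T(2) T1 T2 by (metis add_left_cancel numeral_3_eq_3 size_add_mset size_eq_Suc_imp_eq_union plus_1_eq_Suc)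
  have "T3 = {#}" using T(2) T1 T2 T3 by simp
  then have Te: "{#y, z, w#} \<subseteq># R" using T(1) T1 T2 T3 by simp
  have "{#y, z#} \<subseteq># R" "{#y, w#} \<subseteq># R" "{#z, w#} \<subseteq># R"
    by (rule subset_mset.order_trans[OF _ Te]; simp add: subseteq_mset_def)+
  then have N3: "y \<otimes> z \<in> N" "y \<otimes> w \<in> N" "z \<otimes> w \<in> N" using no by blast+
  have "y \<in># R" "z \<in># R" "w \<in># R" using Te by (auto dest: mset_subset_eqD)
  then have c: "y \<in> carrier G" "z \<in> carrier G" "w \<in> carrier G" "w \<notin> N" using R by auto
  have "(y \<otimes> z) \<otimes> inv (y \<otimes> w) \<in> N" using N3 N_mult N_inv by blast
  then have "y \<otimes> (z \<otimes> inv w) \<otimes> inv y \<in> N" using c by (simp add: inv_mult_group m_assoc)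
  from conj_N(2)[OF this c(1)] have "z \<otimes> inv w \<in> N" using c by (simp add: m_assoc)
  then have "inv (z \<otimes> inv w) \<otimes> (z \<otimes> w) \<in> N" using N3 N_mult N_inv by blast
  then have ww: "w \<otimes> w \<in> N" using c by (simp add: inv_mult_group m_assoc)
  have w1: "w \<noteq> \<one>" using c by auto
  have "(w \<otimes> w) \<otimes> w = w \<otimes> (w \<otimes> w)" using c by (simp add: m_assoc)
  then show False using commutes_in_N[OF ww square_neq_one[OF c(3) w1] c(3,4)] by simp
qed

text \<open>If the terms outside \<open>N\<close> contain \<open>y\<close> and \<open>inv y\<close>
  or three copies of \<open>y\<close>, this short product-one part is set aside, and triples from
  the rest fill a coset. Otherwise there are at most \<open>2q\<close> terms outside
  \<open>N\<close>, so terms of \<open>N\<close> are available. Two outside terms make each of these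
  gain two products, and triples complete the coset.\<close>

lemma splits_large_three:
  assumes S: "product_one G S" and size: "9 * q < 4 * size S"
  shows "splits G S"
proof (rule ccontr)
  assume ns: "\<not> splits G S"
  have sub: "set_mset S \<subseteq> carrier G" using S product_one_over by simp
  let ?n = "size S"
  note q7 = q_ge_7
  have N: "\<one> \<notin># S" "size (filter_mset (\<lambda>x. x \<in> N) S) + 2 \<le> q"
    using N_terms_bound[OF S ns] size q7 m3 by linarith+
  define k where "k = (q - 1) div 2"
  have k: "2 * k + 1 = q" using odd_q by (auto simp: k_def elim: oddE)
  have ne1: "y \<in> carrier G \<and> y \<noteq> \<one>" if "y \<in># S" for y using that sub N(1) by auto
  define T' where "T' = filter_mset (\<lambda>x. x \<in> N) S"
  define O' where "O' = filter_mset (\<lambda>x. x \<notin> N) S"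
  have part: "S = T' + O'" unfolding O'_def T'_def by (rule multiset_partition)
  then have st: "?n = size T' + size O'" by (metis size_union)
  have O'sub: "x \<in> carrier G \<and> x \<notin> N" if "x \<in># O'" for x using that sub by (auto simp: O'_def)
  have T'sub: "x \<in> N \<and> x \<noteq> \<one>" if "x \<in># T'" for x using that N(1) by (auto simp: T'_def)
  have co: "?n \<le> 3 * size (filter_mset (\<lambda>y. y \<notin> centralizer x) S)" if "x \<in> carrier G" "x \<notin> N" for x
    using centralizer_bound[OF S ns _ that] size q7 m3 by simp
  have coN: "size O' \<le> size (filter_mset (\<lambda>y. y \<notin> centralizer x) S)" if "x \<in> N" "x \<noteq> \<one>" for x
    unfolding O'_def
  proof (rule size_filter_mono)
    fix y assume "y \<in># S" "y \<notin> N"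
    then show "y \<notin> centralizer x" using commutes_in_N[OF that, of y] ne1[of y] by (auto simp: centralizer_def)
  qed
  show False
  proof (cases "\<exists>y\<in>#O'. inv y \<in># O' \<or> 3 \<le> count O' y")
    case True
    then obtain y where y: "y \<in># O'" "inv y \<in># O' \<or> 3 \<le> count O' y" by blast
    have yc: "y \<in> carrier G" "y \<notin> N" using O'sub[OF y(1)] by auto
    have y1: "y \<noteq> \<one>" using yc by auto
    have "\<exists>U. U \<subseteq># O' \<and> U \<noteq> {#} \<and> size U \<le> 3 \<and> product_one G U"
      using y(2)
    proof
      assume "inv y \<in># O'"
      moreover have "inv y \<noteq> y" using square_neq_one[OF yc(1) y1] yc by (metis r_inv)
      ultimately have "{#y, inv y#} \<subseteq># O'" using y(1) by (auto simp: subseteq_mset_def Suc_le_eq)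
      moreover have "product_one G {#y, inv y#}"
        unfolding product_one_def seq_over_def using yc by (auto intro!: exI[of _ "[y, inv y]"])
      ultimately show ?thesis by (intro exI[of _ "{#y, inv y#}"]) auto
    next
      assume "3 \<le> count O' y"
      then have "{#y, y, y#} \<subseteq># O'" by (auto simp: subseteq_mset_def)
      moreover have "product_one G {#y, y, y#}"
        unfolding product_one_def seq_over_def using yc cube_eq_one[OF yc]
        by (auto intro!: exI[of _ "[y, y, y]"] simp: m_assoc)
      ultimately show ?thesis by (intro exI[of _ "{#y, y, y#}"]) auto
    qed
    then obtain U where U: "U \<subseteq># O'" "U \<noteq> {#}" "size U \<le> 3" "product_one G U" by blast
    have US: "U \<subseteq># S" using U(1) part by (metis mset_subset_eq_add_right subset_mset.order_trans)
    let ?R = "S - U"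
    have Rsub: "set_mset ?R \<subseteq> carrier G" "\<one> \<notin># ?R" using sub N(1) by (auto dest: in_diffD)
    have sR: "3 * k \<le> size ?R" using US U(3) size k q7 by (simp add: size_Diff_submset)
    have coR: "k \<le> size (filter_mset (\<lambda>y. y \<notin> centralizer x) ?R)" if x: "x \<in># ?R" for x
    proof -
      have xS: "x \<in># S" using x by (rule in_diffD)
      have d: "size (filter_mset (\<lambda>y. y \<notin> centralizer x) S) \<le> size (filter_mset (\<lambda>y. y \<notin> centralizer x) ?R) + 3"
        using size_filter_diff[of "\<lambda>y. y \<notin> centralizer x" S U] U(3) by linarith
      show ?thesis
      proof (cases "x \<in> N")
        case True
        have "?n \<le> size (filter_mset (\<lambda>y. y \<notin> centralizer x) S) + q - 2"
          using coN[OF True] ne1[OF xS] N(2) st unfolding T'_def by linarith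
        then show ?thesis using d k size q7 by linarith
      next
        case False
        then have "?n \<le> 3 * size (filter_mset (\<lambda>y. y \<notin> centralizer x) S)" using co ne1[OF xS] by blast
        \<comment> \<open>This is tight at \<open>q = 7\<close>: there are at least 16 terms, so at
          least 6 outside the centraliser, of which 3 survive the removal of \<open>U\<close>, and
          \<open>k = 3\<close>. For \<open>q = 5\<close> the same estimate would give 1 where 2 are
          needed, which is why \<open>q_ge_7\<close> is proved.\<close>
        then show ?thesis using d k size q7 by linarith
      qed
    qed
    obtain T where T: "T \<subseteq># ?R" "size T = 3 * k" "min q (1 + 2 * k) \<le> card (prods G T)"
      using nonmonochromatic_triples[OF Rsub sR coR] by blast
    have "T \<noteq> {#}" using T(2) k q7 by auto
    moreover have "q \<le> card (prods G T)" using T(3) k by simp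
    moreover have "T + U \<subseteq># S" using T(1) US by (simp add: subset_mset.le_diff_conv2)
    then have "T \<subseteq># S" "U \<subseteq># S - T"
      by (metis mset_subset_eq_add_left subset_mset.order_trans,
          metis mset_subset_eq_add_left subset_mset.order_trans subset_mset.le_diff_conv2 union_commute)
    ultimately show False using splits_of_full[OF S] U(2,4) ns by blast
  next
    case False
    then have noinv: "inv y \<notin># O'" "count O' y \<le> 2" if "y \<in># O'" for y using that by force+
    \<comment> \<open>Of \<open>y\<close> and \<open>inv y\<close> at most one occurs, so at most
      half of the \<open>2q\<close> elements outside \<open>N\<close> occur, each at most
      twice.\<close>
    have s2q: "size O' \<le> 2 * q"
    proof -
      let ?Y = "set_mset O'"
      have "?Y \<inter> (\<lambda>y. inv y) ` ?Y = {}" using noinv by auto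
      then have "card (?Y \<union> (\<lambda>y. inv y) ` ?Y) = card ?Y + card ((\<lambda>y. inv y) ` ?Y)"
        by (intro card_Un_disjoint) auto
      moreover have "card ((\<lambda>y. inv y) ` ?Y) = card ?Y"
        using O'sub by (intro card_image inj_onI) (metis inv_inv)
      moreover have "?Y \<union> (\<lambda>y. inv y) ` ?Y \<subseteq> carrier G - N"
        using O'sub N_inv by (auto, metis inv_inv)
      then have "card (?Y \<union> (\<lambda>y. inv y) ` ?Y) \<le> q * 2"
        using card_mono[of "carrier G - N"] fin card_outside_N m3 by fastforce
      ultimately have "card ?Y \<le> q" by simp
      have "size O' = (\<Sum>z\<in>?Y. count O' z)" by (simp add: size_multiset_overloaded_eq)
      also have "\<dots> \<le> (\<Sum>z\<in>?Y. 2)" using noinv by (intro sum_mono) auto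
      finally show ?thesis using \<open>card ?Y \<le> q\<close> by simp
    qed
    have sO: "3 \<le> size O'" using st N(2) size q7 unfolding T'_def by linarith
    obtain y z where yz: "{#y, z#} \<subseteq># O'" "y \<otimes> z \<notin> N"
      using exists_pair_outside[OF O'sub sO] by blast
    have "y \<in># O'" "z \<in># O'" using yz(1) by (auto dest: mset_subset_eqD)
    then have yc: "y \<in> carrier G" "y \<notin> N" and zc: "z \<in> carrier G" "z \<notin> N" using O'sub by auto
    \<comment> \<open>The \<open>t\<close> terms of \<open>N\<close> give \<open>2t + 1\<close>
      products, the \<open>j\<close> triples give \<open>2j + 1\<close>, and together they reach
      \<open>2k + 1 = q\<close>.\<close>
    define t where "t = min (size T') k"
    define j where "j = k - t"
    obtain A where A: "A \<subseteq># T'" "size A = t" using exists_submultiset[of t T'] by (auto simp: t_def)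
    have Asub: "x \<in> N \<and> x \<noteq> \<one>" if "x \<in># A" for x using T'sub[OF mset_subset_eqD[OF A(1) that]] .
    have cA: "set_mset A \<subseteq> N" "\<one> \<notin># A" using Asub by blast+
    have c0: "min q (2 * t + 1) \<le> card (prods G (add_mset y (add_mset z A)))"
      using card_prods_two_with_N_terms[OF yc zc yz(2) cA] A(2) by simp
    define R where "R = O' - {#y, z#}"
    have OR: "O' = {#y, z#} + R" using yz(1) unfolding R_def by (rule subset_mset.add_diff_inverse[symmetric])
    have sR: "size O' = size R + 2" using OR by simp
    have RO: "x \<in> carrier G \<and> x \<notin> N" if "x \<in># R" for x using O'sub[of x] that OR by simp
    have Rsub: "set_mset R \<subseteq> carrier G" "\<one> \<notin># R" using RO RO[of "\<one>"] by auto
    have Rco: "j \<le> size (filter_mset (\<lambda>v. v \<notin> centralizer x) R)" if x: "x \<in># R" for x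
    proof -
      have xO: "x \<in># O'" using x OR by simp
      have xc: "x \<in> carrier G" "x \<notin> N" using O'sub[OF xO] by auto
      have "filter_mset (\<lambda>v. v \<in> centralizer x) R \<subseteq># replicate_mset (count R x) x"
      proof (rule mset_subset_eqI)
        fix a
        show "count (filter_mset (\<lambda>v. v \<in> centralizer x) R) a \<le> count (replicate_mset (count R x) x) a"
        proof (cases "a = x \<or> a \<notin># R")
          case True then show ?thesis by (auto simp: not_in_iff)
        next
          case False
          then have "a \<noteq> \<one>" "a \<noteq> inv x" using Rsub noinv(1)[OF xO] OR by auto
          then have "a \<notin> centralizer x" using False centralizer_outside_N[OF xc] by simp
          then show ?thesis by simp
        qed
      qed
      then have "size (filter_mset (\<lambda>v. v \<in> centralizer x) R) \<le> count R x" using size_mset_mono by fastforce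
      also have "\<dots> \<le> count O' x" unfolding OR count_union by (rule le_add2)
      also have "\<dots> \<le> 2" by (rule noinv(2)[OF xO])
      finally have "size R \<le> size (filter_mset (\<lambda>v. v \<notin> centralizer x) R) + 2"
        using size_filter_add[of "\<lambda>v. v \<in> centralizer x" R] by linarith
      then show ?thesis using sR st N(2) size q7 k unfolding T'_def[symmetric] j_def by linarith
    qed
    have "3 * j \<le> size R"
    proof (cases "k \<le> size T'")
      case True then show ?thesis by (simp add: j_def t_def)
    next
      case False
      then have "j + size T' = k" by (simp add: j_def t_def)
      then show ?thesis using sR st size k q7 by linarith
    qed
    then obtain D where D: "D \<subseteq># R" "size D = 3 * j" "min q (1 + 2 * j) \<le> card (prods G D)"
      using nonmonochromatic_triples[OF Rsub _ Rco] by blast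
    let ?T0 = "add_mset y (add_mset z A)"
    have Dsub: "set_mset D \<subseteq> carrier G" using D(1) Rsub by (meson set_mset_mono subset_trans)
    have T0sub: "set_mset ?T0 \<subseteq> carrier G" using yc zc Asub N_carrier by auto
    have tj: "t + j = k" by (simp add: j_def t_def)
    have full: "q \<le> card (prods G (?T0 + D))"
      using card_prods_add[OF T0sub Dsub] c0 D(3) tj k by linarith
    have "?T0 + D = A + ({#y, z#} + D)" by simp
    also have "\<dots> \<subseteq># T' + ({#y, z#} + R)" using A(1) D(1) by (intro subset_mset.add_mono) auto
    finally have TS: "?T0 + D \<subseteq># S" using part OR by simp
    have sz: "size (?T0 + D) = 2 + t + 3 * j" using A(2) D(2) by simp
    have bound: "?n \<le> 2 + t + 3 * j + q + 1" using full_bound[OF S ns TS _ full] sz m3 by simp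
    show False
    proof (cases "k \<le> size T'")
      case True
      then have "t = k" "j = 0" by (simp_all add: j_def t_def)
      then show False using bound size k q7 by linarith
    next
      case False
      then have "t = size T'" by (simp add: t_def)
      \<comment> \<open>The two bounds are \<open>n \<le> q + 3 + 3k - 2t\<close> and
        \<open>n \<le> t + 2q\<close>. Eliminating \<open>t\<close> gives
        \<open>3n \<le> 5q + 3k + 3\<close>, which is too small for \<open>4n > 9q\<close>.\<close>
      then show False using bound size k q7 st s2q tj by linarith
    qed
  qed
qed

end

end

section \<open>Subgroups and central extensions\<close>

lemma ordered_product_restrict [simp]: "ordered_product (G\<lparr>carrier := H\<rparr>) xs = ordered_product G xs"
  by (simp add: ordered_product_def)

lemma product_one_restrict:
  assumes "H \<subseteq> carrier G"
  shows "product_one (G\<lparr>carrier := H\<rparr>) S \<longleftrightarrow> set_mset S \<subseteq> H \<and> product_one G S"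
  using assms by (auto simp: product_one_def seq_over_def)

lemma splits_restrict:
  assumes "H \<subseteq> carrier G" "splits (G\<lparr>carrier := H\<rparr>) S"
  shows "splits G S"
  using assms by (auto simp: splits_def product_one_restrict)

text \<open>The contrapositive of the bound for minimal sequences, in a form that passes from a
  subgroup to the whole group.\<close>

definition (in group) three_quarters :: bool where
  "three_quarters \<longleftrightarrow> (\<forall>S. product_one G S \<longrightarrow> 3 * order G < 4 * size S \<longrightarrow> splits G S)"

lemma (in group) three_quarters_of_subgroup:
  assumes "finite (carrier G)" "subgroup H G" "group.three_quarters (G\<lparr>carrier := H\<rparr>)"
  shows "three_quarters"
proof -
  interpret H: group "G\<lparr>carrier := H\<rparr>" using assms(2) by (rule subgroup_imp_group)
  have sub: "H \<subseteq> carrier G" using assms(2) by (rule subgroup.subset)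
  have "splits G T" if "set_mset T \<subseteq> H" "product_one G T" "3 * card H < 4 * size T" for T
    using assms(3) that unfolding H.three_quarters_def
    by (intro splits_restrict[OF sub]) (auto simp: product_one_restrict[OF sub] order_def)
  then show ?thesis unfolding three_quarters_def using splits_of_subgroup[OF assms(1,2)] by blast
qed

lemma (in group) large_davenport_le_of_three_quarters:
  assumes "finite (carrier G)" "three_quarters"
  shows "real (large_davenport G) \<le> 3 / 4 * real (order G)"
proof -
  let ?L = "{size S | S. minimal_product_one G S}"
  have "Max ?L \<in> ?L" using finite_minimal_lengths[OF assms(1)] minimal_lengths_nonempty by (rule Max_in)
  then obtain S where S: "minimal_product_one G S" "large_davenport G = size S"
    by (auto simp: large_davenport_def)
  then have "\<not> splits G S" "product_one G S" by (auto simp: minimal_product_one_def splits_def)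
  then have "4 * size S \<le> 3 * order G" using assms(2) unfolding three_quarters_def by (meson not_le)
  then show ?thesis unfolding S(2) by linarith
qed

context group
begin

lemma size_le_order_of_not_splits:
  assumes "finite (carrier G)" "product_one G S" "\<not> splits G S"
  shows "size S \<le> order G"
proof (cases "S = {#}")
  case False
  then have "minimal_product_one G S" using assms by (auto simp: minimal_product_one_def splits_def)
  then show ?thesis using minimal_product_one_size_le assms(1) by blast
qed simp

lemma exists_decomposition:
  "product_one G S \<Longrightarrow> \<exists>Ts. S = sum_list Ts \<and> (\<forall>T\<in>set Ts. T \<noteq> {#} \<and> product_one G T \<and> \<not> splits G T)"
proof (induction "size S" arbitrary: S rule: less_induct)
  case less
  show ?case
  proof (cases "splits G S")
    case True
    then obtain A B where AB: "S = A + B" "A \<noteq> {#}" "B \<noteq> {#}" "product_one G A" "product_one G B"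
      by (auto simp: splits_def)
    then have "size A < size S" "size B < size S" by (simp_all add: nonempty_has_size)
    then obtain As Bs where
      "A = sum_list As" "\<forall>T\<in>set As. T \<noteq> {#} \<and> product_one G T \<and> \<not> splits G T"
      "B = sum_list Bs" "\<forall>T\<in>set Bs. T \<noteq> {#} \<and> product_one G T \<and> \<not> splits G T"
      using less.hyps AB(4,5) by metis
    then show ?thesis using AB(1) by (intro exI[of _ "As @ Bs"]) auto
  next
    case False
    show ?thesis
    proof (cases "S = {#}")
      case True then show ?thesis by (intro exI[of _ "[]"]) auto
    next
      case ne: False
      then show ?thesis using False less.prems by (intro exI[of _ "[S]"]) auto
    qed
  qed
qed

text \<open>The fraction \<open>d / c\<close> bounds the length of an unsplittable part; it is used
  with 3/4 of the order of the group.\<close>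

lemma many_parts:
  assumes po: "product_one G S"
    and bound: "\<And>T. product_one G T \<Longrightarrow> \<not> splits G T \<Longrightarrow> c * size T \<le> d"
    and size: "d * z < c * size S"
  shows "\<exists>Ts. S = sum_list Ts \<and> z < length Ts \<and> (\<forall>T\<in>set Ts. T \<noteq> {#} \<and> product_one G T)"
proof -
  obtain Ts where Ts: "S = sum_list Ts" "\<forall>T\<in>set Ts. T \<noteq> {#} \<and> product_one G T \<and> \<not> splits G T"
    using exists_decomposition[OF po] by blast
  have "c * size (sum_list Ts) \<le> d * length Ts" using Ts(2) bound
    by (induction Ts) (auto simp: distrib_left intro: add_mono)
  then have "c * size S \<le> d * length Ts" unfolding Ts(1) .
  with size have "d * z < d * length Ts" by (rule less_le_trans)
  then have "z < length Ts" by simp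
  then show ?thesis using Ts by blast
qed

text \<open>The products of the parts form a sequence over \<open>Z\<close> with product one and more than \<open>card Z\<close>
  terms, so a proper consecutive block of parts has product one.\<close>

lemma splits_of_parts:
  assumes Z: "subgroup Z G" "finite Z" and S: "set_mset S \<subseteq> carrier G"
    and prods: "\<And>v. v \<in> prods G S \<Longrightarrow> v \<in> Z \<Longrightarrow> v = \<one>"
    and Ss: "S = sum_list Ss" "card Z < length Ss" "\<And>T. T \<in> set Ss \<Longrightarrow> T \<noteq> {#} \<and> prods G T \<inter> Z \<noteq> {}"
  shows "splits G S"
proof -
  have "\<exists>xs. mset xs = T \<and> ordered_product G xs \<in> Z" if "T \<in> set Ss" for T
    using Ss(3)[OF that] by (auto simp: prods_def)
  then obtain f where f: "\<And>T. T \<in> set Ss \<Longrightarrow> mset (f T) = T \<and> ordered_product G (f T) \<in> Z" by metis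
  define xss where "xss = map f Ss"
  have mx: "mset (concat xss) = S"
    unfolding Ss(1) xss_def using f by (simp add: mset_concat o_def cong: map_cong)
  then have sub: "set (concat xss) \<subseteq> carrier G" using S by (metis set_mset_mset)
  let ?zs = "map (ordered_product G) xss"
  have zZ: "set ?zs \<subseteq> Z" using f by (auto simp: xss_def)
  have "card Z \<le> length ?zs" using Ss(2) by (simp add: xss_def)
  from subgroup_block[OF Z this zZ] obtain as bs cs where
    zs: "?zs = as @ bs @ cs" "bs \<noteq> []" "length bs \<le> card Z" "ordered_product G bs = \<one>" by blast
  from zs(1) obtain a r where ar: "xss = a @ r" "as = map (ordered_product G) a"
    "bs @ cs = map (ordered_product G) r" unfolding map_eq_append_conv by blast
  from ar(3)[symmetric] obtain b c where bc: "r = b @ c" "bs = map (ordered_product G) b"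
    "cs = map (ordered_product G) c" unfolding map_eq_append_conv by blast
  note abc = ar(1)[unfolded bc(1)] ar(2)[symmetric] bc(2,3)[symmetric]
  have csub: "set (concat a) \<subseteq> carrier G" "set (concat b) \<subseteq> carrier G" "set (concat c) \<subseteq> carrier G"
    using sub abc(1) by auto
  have "ordered_product G (concat xss) \<in> prods G S" using mx unfolding prods_def by blast
  moreover have "ordered_product G (concat xss) \<in> Z"
    using ordered_product_concat[OF sub] ordered_product_in_subgroup[OF Z(1) zZ] by simp
  ultimately have "ordered_product G (concat xss) = \<one>" using prods by blast
  then have tot: "ordered_product G (concat a @ concat b @ concat c) = \<one>" using abc(1) by simp
  have b1: "ordered_product G (concat b) = \<one>" using ordered_product_concat[OF csub(2)] abc(3) zs(4) by simp
  have po: "product_one G (mset (concat b))" "product_one G (mset (concat a @ concat c))"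
    using remove_block[OF _ tot b1] csub by auto
  have ne: "xs \<noteq> []" if "xs \<in> set xss" for xs using that f Ss(3) by (force simp: xss_def)
  have "b \<noteq> []" using zs(2) abc(3) by auto
  then have "hd b \<in> set b" by simp
  then have "concat b \<noteq> []" using ne[of "hd b"] abc(1) by auto
  moreover have "length (a @ c) > 0"
  proof -
    have "length xss = length (a @ c) + length b" using abc(1) by simp
    moreover have "length b \<le> card Z" using zs(3) abc(3) by auto
    moreover have "card Z < length xss" using Ss(2) by (simp add: xss_def)
    ultimately show ?thesis by linarith
  qed
  then have "hd (a @ c) \<in> set (a @ c)" by (metis hd_in_set length_greater_0_conv)
  then have "concat (a @ c) \<noteq> []" using ne[of "hd (a @ c)"] abc(1) unfolding concat_eq_Nil_conv by auto
  moreover have "S = mset (concat b) + mset (concat a @ concat c)" using mx abc(1) by (simp add: ac_simps)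
  ultimately show ?thesis using po unfolding splits_def
    by (intro exI[of _ "mset (concat b)"] exI[of _ "mset (concat a @ concat c)"]) simp
qed

end

section \<open>Lifting decompositions along a homomorphism\<close>

context group_hom
begin

lemma ordered_product_map:
  "set xs \<subseteq> carrier G \<Longrightarrow> ordered_product H (map h xs) = h (ordered_product G xs)"
  by (induction xs) (auto simp: G.ordered_product_closed)

lemma product_one_image:
  assumes "product_one G S"
  shows "product_one H (image_mset h S)"
proof -
  obtain xs where xs: "mset xs = S" "ordered_product G xs = \<one>" "set xs \<subseteq> carrier G"
    using assms by (auto simp: product_one_def seq_over_def)
  then have "mset (map h xs) = image_mset h S" "ordered_product H (map h xs) = \<one>\<^bsub>H\<^esub>"
    by (simp_all add: ordered_product_map)
  moreover have "set_mset (image_mset h S) \<subseteq> carrier H" using xs by auto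
  ultimately show ?thesis unfolding product_one_def seq_over_def by blast
qed

text \<open>An ordering of an image part with product one pulls back to an ordering with product in
  the kernel. The result is the input that \<open>splits_of_parts\<close> expects.\<close>

lemma lift_parts:
  assumes "set_mset S \<subseteq> carrier G" "image_mset h S = sum_list Ts"
    "\<forall>T\<in>set Ts. T \<noteq> {#} \<and> product_one H T"
  shows "\<exists>Ss. S = sum_list Ss \<and> length Ss = length Ts \<and>
    (\<forall>T\<in>set Ss. T \<noteq> {#} \<and> prods G T \<inter> kernel G H h \<noteq> {})"
  using assms
proof (induction Ts arbitrary: S)
  case Nil then show ?case by (intro exI[of _ "[]"]) auto
next
  case (Cons T Ts)
  then have "image_mset h S = T + sum_list Ts" by simp
  from image_mset_eq_plusD[OF this] obtain A B where AB: "S = A + B" "T = image_mset h A" "sum_list Ts = image_mset h B" by blast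
  have "\<exists>Ss. B = sum_list Ss \<and> length Ss = length Ts \<and> (\<forall>T\<in>set Ss. T \<noteq> {#} \<and> prods G T \<inter> kernel G H h \<noteq> {})"
    using Cons.prems AB by (intro Cons.IH) auto
  then obtain Ss where Ss: "B = sum_list Ss" "length Ss = length Ts"
    "\<forall>T\<in>set Ss. T \<noteq> {#} \<and> prods G T \<inter> kernel G H h \<noteq> {}" by blast
  have T: "T \<noteq> {#}" "product_one H T" using Cons.prems by auto
  then obtain ys where ys: "mset ys = image_mset h A" "ordered_product H ys = \<one>\<^bsub>H\<^esub>"
    using AB by (auto simp: product_one_def)
  from mset_eq_image_msetD[OF ys(1)] obtain xs where xs: "mset xs = A" "map h xs = ys" by blast
  have xsub: "set xs \<subseteq> carrier G" using xs(1) Cons.prems(1) AB(1) by auto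
  then have "h (ordered_product G xs) = \<one>\<^bsub>H\<^esub>" using ordered_product_map[OF xsub] xs ys by simp
  then have "ordered_product G xs \<in> prods G A \<inter> kernel G H h"
    using xs(1) G.ordered_product_closed[OF xsub] by (auto simp: kernel_def prods_def)
  then show ?case using Ss AB T by (intro exI[of _ "A # Ss"]) auto
qed

end

section \<open>Decompositions into many parts in a Frobenius group\<close>

context frobenius
begin

text \<open>Each further part costs at most \<open>q\<close> terms, within the budget of
  \<open>3q/2\<close>. For \<open>z = 2\<close> one short factor is removed, and more than
  \<open>2q\<close> terms remain, exceeding the order, so they split. For \<open>z = 1\<close> the
  claim would be the bound 3/4 for the Frobenius group itself.\<close>

lemma many_parts_two:
  assumes m2: "m = 2" and z: "2 \<le> z"
  shows "product_one G S \<Longrightarrow> 3 * q * z < 2 * size S \<Longrightarrow>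
    \<exists>Ts. S = sum_list Ts \<and> length Ts = z + 1 \<and> (\<forall>T\<in>set Ts. T \<noteq> {#} \<and> product_one G T)"
  using z
proof (induction z arbitrary: S rule: nat_induct_at_least)
  case base
  then have "3 * q < size S" by simp
  from short_factor_two[OF m2 base(1) this] obtain U where
    U: "U \<subseteq># S" "U \<noteq> {#}" "size U \<le> q" "product_one G U" "product_one G (S - U)" by blast
  have "order G < size (S - U)" using U(1,3) \<open>3 * q < size S\<close> order_eq m2 by (simp add: size_Diff_submset)
  then have "splits G (S - U)" using size_le_order_of_not_splits[OF fin U(5)] by linarith
  then obtain A B where AB: "S - U = A + B" "A \<noteq> {#}" "B \<noteq> {#}" "product_one G A" "product_one G B"
    by (auto simp: splits_def)
  then have "S = sum_list [U, A, B]" using U(1) by (metis add.right_neutral subset_mset.add_diff_inverse sum_list.Cons sum_list.Nil)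
  then show ?case using U AB by (intro exI[of _ "[U, A, B]"]) auto
next
  case (Suc z)
  have "3 * q * 2 \<le> 3 * q * z" using Suc.hyps by (intro mult_le_mono2)
  moreover have sz: "3 * q * z + 3 * q < 2 * size S" using Suc.prems(2) by simp
  ultimately have "3 * q < size S" by linarith
  from short_factor_two[OF m2 Suc.prems(1) this] obtain U where
    U: "U \<subseteq># S" "U \<noteq> {#}" "size U \<le> q" "product_one G U" "product_one G (S - U)" by blast
  have "3 * q * z < 2 * size (S - U)" using U(1,3) sz by (simp add: size_Diff_submset)
  from Suc.IH[OF U(5) this] obtain Ts where
    Ts: "S - U = sum_list Ts" "length Ts = z + 1" "\<forall>T\<in>set Ts. T \<noteq> {#} \<and> product_one G T" by blast
  have "S = sum_list (U # Ts)" using U(1) Ts(1) by (metis subset_mset.add_diff_inverse sum_list.Cons)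
  then show ?case using U Ts by (intro exI[of _ "U # Ts"]) auto
qed

lemma many_parts_frobenius:
  assumes z: "m = 2 \<Longrightarrow> 2 \<le> z" and po: "product_one G S" and size: "3 * (q * m * z) < 4 * size S"
  shows "\<exists>Ts. S = sum_list Ts \<and> z < length Ts \<and> (\<forall>T\<in>set Ts. T \<noteq> {#} \<and> product_one G T)"
proof (cases "m = 2")
  case True
  then have "3 * q * z < 2 * size S" using size by simp
  from many_parts_two[OF True z[OF True] po this] show ?thesis by (metis less_add_one)
next
  case False
  have "4 * size T \<le> 3 * (q * m)" if "product_one G T" "\<not> splits G T" for T
  proof (rule ccontr)
    assume "\<not> ?thesis"
    then have "3 * (q * m) < 4 * size T" by simp
    moreover have "m = 3 \<or> 4 \<le> m" using m False by linarith
    ultimately show False using splits_large_three[OF _ that(1)] splits_large_four[OF _ that(1)] that(2) by force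
  qed
  then show ?thesis using many_parts[OF po, of 4 "3 * (q * m)" z] size by (simp add: ac_simps)
qed

end

section \<open>Metacyclic subgroups\<close>

context group
begin

lemma subgroup_of_finite_closed:
  assumes "finite (carrier G)" "A \<subseteq> carrier G" "A \<noteq> {}" "\<And>a b. a \<in> A \<Longrightarrow> b \<in> A \<Longrightarrow> a \<otimes> b \<in> A"
  shows "subgroup A G"
proof (rule subgroupI)
  fix a assume a: "a \<in> A"
  then have ac: "a \<in> carrier G" using assms by blast
  have pow: "a [^] Suc k \<in> A" for k
    using a ac assms(4) by (induction k) auto
  have "ord a \<ge> 1" using ord_ge_1[OF assms(1) ac] .
  \<comment> \<open>The exponent \<open>2 * ord a - 1\<close> is positive even for
    \<open>ord a = 1\<close>; only positive powers are known to lie in \<open>A\<close>.\<close>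
  have "a [^] Suc (2 * ord a - 2) \<otimes> a = a [^] (2 * ord a)"
    using \<open>ord a \<ge> 1\<close> ac by (metis Suc_diff_Suc Suc_leI add_diff_cancel_left' diff_Suc_Suc mult_2 nat_pow_Suc numeral_2_eq_2 trans_le_add1 less_eq_Suc_le One_nat_def add_le_mono plus_1_eq_Suc)
  also have "\<dots> = \<one>" using ac by (simp add: mult_2 flip: nat_pow_mult)
  finally have "inv a = a [^] Suc (2 * ord a - 2)" using ac by (intro inv_equality) auto
  then show "inv a \<in> A" using pow by simp
qed (use assms in auto)

lemma pow_commute:
  assumes "x \<in> carrier G" "w \<in> carrier G" "x \<otimes> w = w \<otimes> x"
  shows "x [^] (k :: nat) \<otimes> w = w \<otimes> x [^] k"
  using assms by (metis group_commutes_pow)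

text \<open>Modulo its centre, the group generated by \<open>x\<close> and \<open>w\<close> is a Frobenius group with kernel of order \<open>ord x\<close>.
  The centre meets the commutator subgroup trivially, so decompositions lift.\<close>

lemma three_quarters_metacyclic_carrier:
  assumes fin: "finite (carrier G)" and x: "x \<in> carrier G" and q: "Factorial_Ring.prime (ord x)"
    and w: "w \<in> carrier G" and norm: "w \<otimes> x \<otimes> inv w \<in> generate G {x}"
    and nc: "w \<otimes> x \<noteq> x \<otimes> w" and ww: "w \<otimes> w \<noteq> \<one>"
    and carr: "\<And>g. g \<in> carrier G \<Longrightarrow> \<exists>n\<in>generate G {x}. \<exists>j :: nat. g = n \<otimes> w [^] j"
  shows "three_quarters"
proof -
  define N where "N = generate G {x}"
  define q where "q = ord x"
  have subN: "subgroup N G" unfolding N_def using x by (intro generate_is_subgroup) auto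
  have Nc: "n \<in> carrier G" if "n \<in> N" for n using subN that by (rule subgroup.mem_carrier)
  have Npow: "N = {x [^] k | k. k \<in> (UNIV :: nat set)}"
    unfolding N_def by (rule generate_pow_on_finite_carrier[OF fin x])
  have xN: "x \<in> N" unfolding N_def by (rule generate.incl) simp
  have cardN: "card N = q" unfolding N_def q_def using generate_pow_card[OF x] by simp
  have mult: "a \<otimes> b \<in> N" if "a \<in> N" "b \<in> N" for a b using subN that by (rule subgroup.m_closed)
  have inv: "inv a \<in> N" if "a \<in> N" for a using subN that by (rule subgroup.m_inv_closed)
  have conj_w: "w \<otimes> n \<otimes> inv w \<in> N" if "n \<in> N" for n
  proof -
    have "w \<otimes> x [^] (k :: nat) \<otimes> inv w \<in> N" for k
    proof (induction k)
      case 0 then show ?case using w subgroup.one_closed[OF subN] by simp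
    next
      case (Suc k)
      have "w \<otimes> x [^] Suc k \<otimes> inv w = (w \<otimes> x [^] k \<otimes> inv w) \<otimes> (w \<otimes> x \<otimes> inv w)"
        using w x by (simp add: m_assoc)
      then show ?case using Suc norm mult unfolding N_def by simp
    qed
    then show ?thesis using that Npow by auto
  qed
  have conj_wj: "w [^] (j :: nat) \<otimes> n \<otimes> inv (w [^] j) \<in> N" if "n \<in> N" for n j
  proof (induction j)
    case 0 then show ?case using that Nc by simp
  next
    case (Suc j)
    have "w [^] Suc j \<otimes> n \<otimes> inv (w [^] Suc j) = w \<otimes> (w [^] j \<otimes> n \<otimes> inv (w [^] j)) \<otimes> inv w"
      unfolding nat_pow_Suc2[OF w] using w Nc[OF that] by (simp add: inv_mult_group m_assoc)
    then show ?case using conj_w Suc by simp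
  qed
  have rep: "\<exists>n\<in>N. \<exists>j :: nat. g = n \<otimes> w [^] j" if "g \<in> carrier G" for g
    using carr[OF that] by (simp add: N_def)
  have normal: "N \<lhd> G"
  proof (rule normal_invI[OF subN])
    fix g n assume gn: "g \<in> carrier G" "n \<in> N"
    then obtain n' j where g: "n' \<in> N" "g = n' \<otimes> w [^] (j :: nat)" using rep by blast
    have "g \<otimes> n \<otimes> inv g = n' \<otimes> (w [^] j \<otimes> n \<otimes> inv (w [^] j)) \<otimes> inv n'"
      using g gn w Nc by (simp add: inv_mult_group m_assoc)
    then show "g \<otimes> n \<otimes> inv g \<in> N" using conj_wj[OF gn(2)] g mult inv by simp
  qed
  have comm: "a \<otimes> b \<otimes> inv (b \<otimes> a) \<in> N" if cab: "a \<in> carrier G" "b \<in> carrier G" for a b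
  proof -
    have *: "\<exists>n\<in>N. a \<otimes> b = n \<otimes> w [^] (i + j)" if "a = n1 \<otimes> w [^] i" "b = n2 \<otimes> w [^] j" "n1 \<in> N" "n2 \<in> N"
      for a b n1 n2 and i j :: nat
    proof
      show "n1 \<otimes> (w [^] i \<otimes> n2 \<otimes> inv (w [^] i)) \<in> N" using that conj_wj mult by simp
      show "a \<otimes> b = n1 \<otimes> (w [^] i \<otimes> n2 \<otimes> inv (w [^] i)) \<otimes> w [^] (i + j)"
        using that w Nc by (simp add: m_assoc flip: nat_pow_mult)
    qed
    obtain n1 and i :: nat where a: "n1 \<in> N" "a = n1 \<otimes> w [^] i" using rep[OF cab(1)] by blast
    obtain n2 and j :: nat where b: "n2 \<in> N" "b = n2 \<otimes> w [^] j" using rep[OF cab(2)] by blast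
    note ab = a b
    obtain c where c: "c \<in> N" "a \<otimes> b = c \<otimes> w [^] (i + j)" using *[OF ab(2,4,1,3)] by blast
    obtain d where d: "d \<in> N" "b \<otimes> a = d \<otimes> w [^] (i + j)" using *[OF ab(4,2,3,1)] by (auto simp: add.commute)
    have "a \<otimes> b \<otimes> inv (b \<otimes> a) = c \<otimes> inv d" unfolding c d
      using c d w Nc by (simp add: inv_mult_group m_assoc)
    then show ?thesis using c d mult inv by simp
  qed
  interpret PN: prime_normal G N q
    by (intro prime_normal.intro prime_normal_axioms.intro is_group)
      (use fin normal cardN q comm in \<open>simp_all add: q_def\<close>)
  define Z where "Z = centralizer x \<inter> centralizer w"
  have subZ: "subgroup Z G" unfolding Z_def using subgroup_centralizer x w by (intro subgroups_Inter_pair)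
  have Zc: "z \<in> carrier G" if "z \<in> Z" for z using that by (simp add: Z_def centralizer_def)
  have central: "z \<otimes> g = g \<otimes> z" if zg: "z \<in> Z" "g \<in> carrier G" for z g
  proof -
    obtain n j where g: "n \<in> N" "g = n \<otimes> w [^] (j :: nat)" using rep[OF zg(2)] by blast
    obtain k :: nat where k: "n = x [^] k" using g(1) Npow by blast
    have "x [^] k \<otimes> z = z \<otimes> x [^] k" "w [^] j \<otimes> z = z \<otimes> w [^] j"
      using zg(1) x w pow_commute[of x z] pow_commute[of w z] by (auto simp: Z_def centralizer_def)
    then have "g \<otimes> z = z \<otimes> g" unfolding g(2) k using x w Zc[OF zg(1)] by (intro commutes_mult) auto
    then show ?thesis by simp
  qed
  have normZ: "Z \<lhd> G"
  proof (rule normal_invI[OF subZ])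
    fix g z assume gz: "g \<in> carrier G" "z \<in> Z"
    have "g \<otimes> z \<otimes> inv g = z \<otimes> g \<otimes> inv g" using central[OF gz(2,1)] by simp
    also have "\<dots> = z" using gz(1) Zc[OF gz(2)] by (simp add: m_assoc)
    finally show "g \<otimes> z \<otimes> inv g \<in> Z" using gz(2) by simp
  qed
  have xpow: "\<exists>k :: nat. x = u [^] k" if "u \<in> N" "u \<noteq> \<one>" for u
    using PN.N_pow[OF that xN] by blast
  have commN: "g \<otimes> x = x \<otimes> g" if u: "u \<in> N" "u \<noteq> \<one>" and g: "g \<in> carrier G" "g \<otimes> u = u \<otimes> g" for u g
  proof -
    obtain k :: nat where "x = u [^] k" using xpow[OF u] by blast
    then show ?thesis using pow_commute[OF Nc[OF u(1)] g(1)] g(2) by simp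
  qed
  \<comment> \<open>A nontrivial element of \<open>N\<close> has \<open>x\<close> as a power, so if
    it were central then \<open>x\<close> would commute with \<open>w\<close>.\<close>
  have NZ: "n = \<one>" if "n \<in> N" "n \<in> Z" for n
  proof (rule ccontr)
    assume "n \<noteq> \<one>"
    then show False using commN[OF that(1) _ w] central[OF that(2) w] nc by simp
  qed
  interpret Zn: normal Z G by (rule normZ)
  interpret K: group "G Mod Z" by (rule Zn.factorgroup_is_group)
  define h where "h = (\<lambda>g. Z #> g)"
  interpret h: group_hom G "G Mod Z" h
    unfolding h_def by unfold_locales (rule Zn.r_coset_hom_Mod)
  have h_eq: "h a = h b \<longleftrightarrow> a \<otimes> inv b \<in> Z" if "a \<in> carrier G" "b \<in> carrier G" for a b
    unfolding h_def using that
    by (metis is_group rcos_self repr_independence subZ subgroup.rcos_module)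
  note [simp del] = one_FactGroup mult_FactGroup
  have "h a = \<one>\<^bsub>G Mod Z\<^esub> \<longleftrightarrow> a \<in> Z" if "a \<in> carrier G" for a
    using h_eq[OF that one_closed] that unfolding h.hom_one by simp
  then have ker: "kernel G (G Mod Z) h = Z" using Zc unfolding kernel_def by blast
  have carrK: "carrier (G Mod Z) = h ` carrier G" by (simp add: carrier_FactGroup h_def)
  have finK: "finite (carrier (G Mod Z))" using fin carrK by simp
  define N' where "N' = h ` N"
  have injN: "inj_on h N"
  proof (rule inj_onI)
    fix a b assume ab: "a \<in> N" "b \<in> N" "h a = h b"
    then have "a \<otimes> inv b \<in> Z" using h_eq Nc by simp
    then have "a \<otimes> inv b = \<one>" using NZ mult inv ab by simp
    then show "a = b" using ab Nc by (metis inv_closed inv_equality inv_inv)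
  qed
  have subN': "subgroup N' (G Mod Z)" unfolding N'_def by (rule h.subgroup_img_is_subgroup[OF subN])
  have normN': "N' \<lhd> G Mod Z"
  proof (rule K.normal_invI[OF subN'])
    fix g n assume "g \<in> carrier (G Mod Z)" "n \<in> N'"
    then obtain a b where ab: "a \<in> carrier G" "g = h a" "b \<in> N" "n = h b" by (auto simp: carrK N'_def)
    then have "g \<otimes>\<^bsub>G Mod Z\<^esub> n \<otimes>\<^bsub>G Mod Z\<^esub> inv\<^bsub>G Mod Z\<^esub> g = h (a \<otimes> b \<otimes> inv a)"
      using Nc by (simp flip: h.hom_mult h.hom_inv)
    then show "g \<otimes>\<^bsub>G Mod Z\<^esub> n \<otimes>\<^bsub>G Mod Z\<^esub> inv\<^bsub>G Mod Z\<^esub> g \<in> N'"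
      using PN.conj_N(1)[OF ab(3,1)] by (auto simp: N'_def)
  qed
  define m where "m = card (rcosets\<^bsub>G Mod Z\<^esub> N')"
  have cardN': "card N' = q" unfolding N'_def using card_image[OF injN] cardN by simp
  have orderK: "order (G Mod Z) = q * m" using K.lagrange[OF subN'] cardN' by (simp add: m_def mult.commute)
  have hw: "h w \<notin> N'"
  proof
    assume "h w \<in> N'"
    then obtain n where n: "n \<in> N" "h w = h n" by (auto simp: N'_def)
    then have "w \<otimes> inv n \<in> Z" using h_eq w Nc by simp
    then have c: "(w \<otimes> inv n) \<otimes> x = x \<otimes> (w \<otimes> inv n)" using central x by simp
    have "n \<otimes> x = x \<otimes> n" using PN.N_comm n xN by simp
    from commutes_mult[OF _ _ x c this] have "((w \<otimes> inv n) \<otimes> n) \<otimes> x = x \<otimes> ((w \<otimes> inv n) \<otimes> n)"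
      using w n Nc by simp
    then show False using nc w n Nc by (simp add: m_assoc)
  qed
  have hwc: "h w \<in> carrier (G Mod Z)" using w by simp
  have "m \<noteq> 0" using orderK finK K.order_gt_0_iff_finite by force
  moreover have "m \<noteq> 1"
  proof
    assume "m = 1"
    then have "card N' = card (carrier (G Mod Z))" using orderK cardN' by (simp add: order_def)
    then have "N' = carrier (G Mod Z)" using card_subset_eq[OF finK] subgroup.subset[OF subN'] by blast
    then show False using hw hwc by simp
  qed
  ultimately have m2: "2 \<le> m" by simp
  interpret K: frobenius "G Mod Z" N' q m
  proof (intro frobenius.intro prime_normal.intro prime_normal_axioms.intro frobenius_axioms.intro)
    show "group (G Mod Z)" by (rule K.is_group)
    show "finite (carrier (G Mod Z))" by (rule finK)
    show "N' \<lhd> G Mod Z" by (rule normN')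
    show "card N' = q" by (rule cardN')
    show "Factorial_Ring.prime q" using q by (simp add: q_def)
    show "order (G Mod Z) = q * m" by (rule orderK)
    show "2 \<le> m" by (rule m2)
  next
    fix a b assume "a \<in> carrier (G Mod Z)" "b \<in> carrier (G Mod Z)"
    then obtain a' b' where ab: "a' \<in> carrier G" "a = h a'" "b' \<in> carrier G" "b = h b'" by (auto simp: carrK)
    then have eq: "a \<otimes>\<^bsub>G Mod Z\<^esub> b \<otimes>\<^bsub>G Mod Z\<^esub> inv\<^bsub>G Mod Z\<^esub> (b \<otimes>\<^bsub>G Mod Z\<^esub> a) = h (a' \<otimes> b' \<otimes> inv (b' \<otimes> a'))"
      by (simp flip: h.hom_mult h.hom_inv del: K.inv_mult_group)
    show "a \<otimes>\<^bsub>G Mod Z\<^esub> b \<otimes>\<^bsub>G Mod Z\<^esub> inv\<^bsub>G Mod Z\<^esub> (b \<otimes>\<^bsub>G Mod Z\<^esub> a) \<in> N'"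
      unfolding eq N'_def using comm[OF ab(1,3)] by (rule imageI)
  next
    fix u g assume u: "u \<in> N'" "u \<noteq> \<one>\<^bsub>G Mod Z\<^esub>" and g: "g \<in> carrier (G Mod Z)"
      and ug: "u \<otimes>\<^bsub>G Mod Z\<^esub> g = g \<otimes>\<^bsub>G Mod Z\<^esub> u"
    obtain n g' where n: "n \<in> N" "u = h n" and g': "g' \<in> carrier G" "g = h g'" using u g by (auto simp: N'_def carrK)
    have n1: "n \<noteq> \<one>" using u(2) n h.hom_one by metis
    have nc': "n \<in> carrier G" using n Nc by simp
    have "h (g' \<otimes> n) = h (n \<otimes> g')" using ug n g' nc' by simp
    then have "g' \<otimes> n \<otimes> inv (n \<otimes> g') \<in> Z"
      using h_eq[of "g' \<otimes> n" "n \<otimes> g'"] g'(1) nc' by blast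
    \<comment> \<open>The commutator lies in \<open>N\<close> and, by assumption, in
      \<open>Z\<close>, so commuting modulo \<open>Z\<close> is commuting in the group. Then the
      power of \<open>w\<close> in the representation of \<open>g'\<close> is central, which leaves
      \<open>g'\<close> in the product of \<open>N\<close> and \<open>Z\<close>.\<close>
    moreover have "g' \<otimes> n \<otimes> inv (n \<otimes> g') \<in> N" using comm g' nc' by simp
    ultimately have "g' \<otimes> n \<otimes> inv (n \<otimes> g') = \<one>" using NZ by blast
    then have "g' \<otimes> n = n \<otimes> g'" using g' nc' by (metis inv_closed inv_equality inv_inv m_closed)
    then have gx: "g' \<otimes> x = x \<otimes> g'" using commN[OF n(1) n1 g'(1)] by simp
    obtain n' j where r: "n' \<in> N" "g' = n' \<otimes> w [^] (j :: nat)" using rep g' by blast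
    have "n' \<otimes> x = x \<otimes> n'" using PN.N_comm r xN by simp
    then have "inv n' \<otimes> x = x \<otimes> inv n'" using commutes_inv Nc[OF r(1)] x by simp
    from commutes_mult[OF _ _ x this gx] have c1: "(inv n' \<otimes> g') \<otimes> x = x \<otimes> (inv n' \<otimes> g')"
      using Nc[OF r(1)] g' by simp
    have wj: "inv n' \<otimes> g' = w [^] j" unfolding r(2) using Nc[OF r(1)] w by simp
    have c2: "w [^] j \<otimes> w = w \<otimes> w [^] j" by (rule pow_commute[OF w w refl])
    have wZ: "w [^] j \<in> Z" unfolding Z_def centralizer_def using nat_pow_closed[OF w] c1[unfolded wj] c2 by blast
    have "g' \<otimes> inv n' = n' \<otimes> (w [^] j \<otimes> inv n')" unfolding r(2) using Nc[OF r(1)] w by (simp add: m_assoc)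
    also have "w [^] j \<otimes> inv n' = inv n' \<otimes> w [^] j" using central[OF wZ] Nc[OF r(1)] by simp
    finally have "g' \<otimes> inv n' \<in> Z" using wZ Nc[OF r(1)] w by simp
    then have "g = h n'" using h_eq g' Nc[OF r(1)] by simp
    then show "g \<in> N'" using r(1) by (simp add: N'_def)
  qed
  have finZ: "finite Z" using Zc fin by (meson finite_subset subsetI)
  have orderG: "order G = q * m * card Z"
    using lagrange[OF subZ] orderK by (simp add: order_def FactGroup_def)
  \<comment> \<open>With index two the square of \<open>w\<close> is trivial modulo
    \<open>Z\<close>, so the hypothesis \<open>ww\<close> provides a nontrivial element of
    \<open>Z\<close>.\<close>
  have z2: "2 \<le> card Z" if m_eq: "m = 2"
  proof -
    obtain k :: nat where k: "0 < k" "k \<le> 2" "h w [^]\<^bsub>G Mod Z\<^esub> k \<in> N'"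
      using K.power_in_N[OF hwc] unfolding m_eq by blast
    have "k \<noteq> 1" using k(3) hw hwc by auto
    then have "k = Suc (Suc 0)" using k by simp
    then have "h w \<otimes>\<^bsub>G Mod Z\<^esub> h w = \<one>\<^bsub>G Mod Z\<^esub>"
      using K.power_eq_one_of_in_N[OF hwc hw k(3)] hwc by simp
    then have "w \<otimes> w \<in> Z" using ker w by (auto simp: kernel_def)
    then have "{\<one>, w \<otimes> w} \<subseteq> Z" using subgroup.one_closed[OF subZ] by simp
    then have "card {\<one>, w \<otimes> w} \<le> card Z" using finZ by (intro card_mono)
    then show ?thesis using ww by simp
  qed
  show ?thesis unfolding three_quarters_def
  proof (intro allI impI)
    fix S assume S: "product_one G S" "3 * order G < 4 * size S"
    have sub: "set_mset S \<subseteq> carrier G" using S product_one_over by simp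
    have "3 * (q * m * card Z) < 4 * size (image_mset h S)" using S(2) orderG by simp
    from K.many_parts_frobenius[OF z2 h.product_one_image[OF S(1)] this] obtain Ts where
      Ts: "image_mset h S = sum_list Ts" "card Z < length Ts" "\<forall>T\<in>set Ts. T \<noteq> {#} \<and> product_one (G Mod Z) T" by blast
    from h.lift_parts[OF sub Ts(1,3)] ker obtain Ss where
      Ss: "S = sum_list Ss" "length Ss = length Ts" "\<forall>T\<in>set Ss. T \<noteq> {#} \<and> prods G T \<inter> Z \<noteq> {}" by auto
    \<comment> \<open>All products of \<open>S\<close> lie in the coset of \<open>\<one>\<close>,
      which is \<open>N\<close>, and \<open>N\<close> meets \<open>Z\<close> trivially.\<close>
    have "v = \<one>" if v: "v \<in> prods G S" "v \<in> Z" for v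
    proof -
      have "\<one> \<in> prods G S" using S(1) by (simp add: product_one_iff)
      then have "N #> v = N #> \<one>" using PN.prods_coset_eq[OF sub v(1)] by blast
      then have "v \<in> N" using PN.coset_eq_iff[of v \<one>] Zc[OF v(2)] by simp
      then show ?thesis using NZ v(2) by blast
    qed
    then show "splits G S" using Ss Ts(2) by (intro splits_of_parts[OF subZ finZ sub _ Ss(1)]) auto
  qed
qed

text \<open>Passing to the subgroup of all \<open>n \<otimes> w [^] j\<close> supplies the
  hypothesis on the carrier.\<close>

lemma three_quarters_metacyclic:
  assumes fin: "finite (carrier G)" and x: "x \<in> carrier G" and q: "Factorial_Ring.prime (ord x)"
    and w: "w \<in> carrier G" and norm: "w \<otimes> x \<otimes> inv w \<in> generate G {x}"
    and nc: "w \<otimes> x \<noteq> x \<otimes> w" and ww: "w \<otimes> w \<noteq> \<one>"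
  shows "three_quarters"
proof -
  define N where "N = generate G {x}"
  have subN: "subgroup N G" unfolding N_def using x by (intro generate_is_subgroup) auto
  have Nc: "n \<in> carrier G" if "n \<in> N" for n using subN that by (rule subgroup.mem_carrier)
  have Npow: "N = {x [^] k | k. k \<in> (UNIV :: nat set)}"
    unfolding N_def by (rule generate_pow_on_finite_carrier[OF fin x])
  have mult: "a \<otimes> b \<in> N" if "a \<in> N" "b \<in> N" for a b using subN that by (rule subgroup.m_closed)
  have conj_w: "w \<otimes> n \<otimes> inv w \<in> N" if "n \<in> N" for n
  proof -
    have "w \<otimes> x [^] (k :: nat) \<otimes> inv w \<in> N" for k
    proof (induction k)
      case 0 then show ?case using w subgroup.one_closed[OF subN] by simp
    next
      case (Suc k)
      have "w \<otimes> x [^] Suc k \<otimes> inv w = (w \<otimes> x [^] k \<otimes> inv w) \<otimes> (w \<otimes> x \<otimes> inv w)"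
        using w x by (simp add: m_assoc)
      then show ?case using Suc norm mult unfolding N_def by simp
    qed
    then show ?thesis using that Npow by auto
  qed
  have move: "\<exists>n'\<in>N. w [^] (j :: nat) \<otimes> n = n' \<otimes> w [^] j" if "n \<in> N" for n j
  proof (induction j)
    case 0 then show ?case using that Nc by auto
  next
    case (Suc j)
    then obtain n' where n': "n' \<in> N" "w [^] j \<otimes> n = n' \<otimes> w [^] j" by blast
    have "w [^] Suc j \<otimes> n = w \<otimes> (w [^] j \<otimes> n)"
      unfolding nat_pow_Suc2[OF w] using w Nc[OF that] by (simp add: m_assoc)
    also have "\<dots> = (w \<otimes> n' \<otimes> inv w) \<otimes> w [^] Suc j"
      unfolding n'(2) nat_pow_Suc2[OF w] using w Nc[OF n'(1)] by (simp add: m_assoc)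
    finally show ?case using conj_w[OF n'(1)] by blast
  qed
  define H where "H = {n \<otimes> w [^] (j :: nat) | n j. n \<in> N}"
  have subH: "subgroup H G"
  proof (rule subgroup_of_finite_closed[OF fin])
    show "H \<subseteq> carrier G" using Nc w by (auto simp: H_def)
    show "H \<noteq> {}" using subgroup.one_closed[OF subN] by (auto simp: H_def)
    fix a b assume "a \<in> H" "b \<in> H"
    then obtain n1 n2 and i j :: nat where ab: "a = n1 \<otimes> w [^] i" "n1 \<in> N" "b = n2 \<otimes> w [^] j" "n2 \<in> N"
      by (auto simp: H_def)
    obtain n' where n': "n' \<in> N" "w [^] i \<otimes> n2 = n' \<otimes> w [^] i" using move[OF ab(4)] by blast
    have "a \<otimes> b = n1 \<otimes> (w [^] i \<otimes> n2) \<otimes> w [^] j" unfolding ab using ab Nc w by (simp add: m_assoc)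
    also have "\<dots> = (n1 \<otimes> n') \<otimes> w [^] (i + j)"
      unfolding n'(2) using ab Nc n'(1) w by (simp add: m_assoc nat_pow_mult)
    finally show "a \<otimes> b \<in> H" using mult ab n' unfolding H_def by blast
  qed
  interpret H: group "G\<lparr>carrier := H\<rparr>" using subH by (rule subgroup_imp_group)
  have Hc: "H \<subseteq> carrier G" using subH by (rule subgroup.subset)
  have xH: "x \<in> H"
  proof -
    have "x \<in> N" unfolding N_def by (rule generate.incl) simp
    moreover have "x = x \<otimes> w [^] (0 :: nat)" using x by simp
    ultimately show ?thesis unfolding H_def by blast
  qed
  have wH: "w \<in> H"
  proof -
    have "w = \<one> \<otimes> w [^] (1 :: nat)" using w by simp
    then show ?thesis unfolding H_def using subgroup.one_closed[OF subN] by blast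
  qed
  have gen: "generate (G\<lparr>carrier := H\<rparr>) {x} = N"
    unfolding N_def using generate_consistent[of "{x}" H] xH subH by simp
  have invw: "inv\<^bsub>G\<lparr>carrier := H\<rparr>\<^esub> w = inv w" using m_inv_consistent[OF subH wH] by simp
  have ordx: "group.ord (G\<lparr>carrier := H\<rparr>) x = ord x"
    using H.generate_pow_card[of x] generate_pow_card[OF x] xH gen by (simp add: N_def)
  have "H.three_quarters"
  proof (rule H.three_quarters_metacyclic_carrier[of x w])
    fix g assume "g \<in> carrier (G\<lparr>carrier := H\<rparr>)"
    then show "\<exists>n\<in>generate (G\<lparr>carrier := H\<rparr>) {x}. \<exists>j :: nat. g = n \<otimes>\<^bsub>G\<lparr>carrier := H\<rparr>\<^esub> w [^]\<^bsub>G\<lparr>carrier := H\<rparr>\<^esub> j"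
      unfolding gen by (auto simp: H_def simp flip: nat_pow_consistent)
  qed (use fin Hc xH wH q ordx norm nc ww gen invw in \<open>auto simp: N_def intro: finite_subset\<close>)
  then show ?thesis by (rule three_quarters_of_subgroup[OF fin subH])
qed

section \<open>Elementary abelian subgroups of rank two\<close>

lemma ordered_product_comm:
  assumes comm: "\<And>a b. a \<in> carrier G \<Longrightarrow> b \<in> carrier G \<Longrightarrow> a \<otimes> b = b \<otimes> a"
  shows "mset xs = mset ys \<Longrightarrow> set xs \<subseteq> carrier G \<Longrightarrow> ordered_product G xs = ordered_product G ys"
proof (induction xs arbitrary: ys)
  case Nil then show ?case by simp
next
  case (Cons x xs)
  then have "x \<in> set ys" by (metis list.set_intros(1) mset_eq_setD)
  then obtain as bs where ys: "ys = as @ x # bs" by (metis split_list)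
  have eq: "mset xs = mset (as @ bs)" using Cons.prems ys by simp
  have sub: "set ys \<subseteq> carrier G" using Cons.prems by (metis set_mset_mset)
  have c: "x \<in> carrier G" "ordered_product G as \<in> carrier G"
    "ordered_product G bs \<in> carrier G" "set as \<subseteq> carrier G" "set bs \<subseteq> carrier G"
    using Cons.prems sub ys by (auto intro!: ordered_product_closed)
  have "ordered_product G xs = ordered_product G (as @ bs)" using Cons.IH[OF eq] Cons.prems by simp
  then have "ordered_product G (x # xs) = (x \<otimes> ordered_product G as) \<otimes> ordered_product G bs"
    using c by (simp add: ordered_product_append m_assoc)
  also have "x \<otimes> ordered_product G as = ordered_product G as \<otimes> x" using comm c by simp
  finally show ?case using c by (simp add: ys ordered_product_append m_assoc)
qed

lemma product_one_remove_ones: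
  assumes "product_one G S"
  shows "product_one G (filter_mset (\<lambda>x. x \<noteq> \<one>) S)"
proof -
  obtain xs where xs: "mset xs = S" "ordered_product G xs = \<one>" "set xs \<subseteq> carrier G"
    using assms by (auto simp: product_one_def seq_over_def)
  have "ordered_product G (filter (\<lambda>x. x \<noteq> \<one>) xs) = ordered_product G xs"
    using xs(3) by (induction xs) (auto simp: ordered_product_closed)
  then have "ordered_product G (filter (\<lambda>x. x \<noteq> \<one>) xs) = \<one>" using xs by simp
  moreover have "mset (filter (\<lambda>x. x \<noteq> \<one>) xs) = filter_mset (\<lambda>x. x \<noteq> \<one>) S" using xs(1) by auto
  moreover have "set_mset (filter_mset (\<lambda>x. x \<noteq> \<one>) S) \<subseteq> carrier G" using xs by auto
  ultimately show ?thesis unfolding product_one_def seq_over_def by blast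
qed

lemma sum_size_filter:
  assumes "finite A"
  shows "(\<Sum>g\<in>A. size (filter_mset (\<lambda>s. P g s) S)) = (\<Sum>s\<in>#S. card {g \<in> A. P g s})"
proof (induction S)
  case empty then show ?case by simp
next
  case (add s S)
  have "(\<Sum>g\<in>A. size (filter_mset (P g) (add_mset s S))) =
     (\<Sum>g\<in>A. (if P g s then 1 else 0) + size (filter_mset (P g) S))"
    by (intro sum.cong) auto
  also have "\<dots> = card {g \<in> A. P g s} + (\<Sum>g\<in>A. size (filter_mset (P g) S))"
    using assms by (simp add: sum.distrib sum.If_cases Int_def)
  finally show ?case using add by simp
qed

lemma generate_prime_eq:
  assumes fin: "finite (carrier G)" and g: "g \<in> carrier G" "Factorial_Ring.prime (ord g)" and u: "u \<in> generate G {g}" "u \<noteq> \<one>"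
  shows "generate G {u} = generate G {g}"
proof -
  have uc: "u \<in> carrier G" using u(1) g(1) generate_incl[of "{g}"] by auto
  have "generate G {u} \<subseteq> generate G {g}"
    using u g by (intro generate_subgroup_incl generate_is_subgroup) auto
  moreover have "finite (generate G {g})" using fin g(1) generate_incl[of "{g}"] by (auto intro: finite_subset)
  moreover have "card (generate G {u}) = card (generate G {g})"
  proof -
    obtain k :: nat where k: "u = g [^] k" using u(1) generate_pow_on_finite_carrier[OF fin g(1)] by auto
    have "u [^] ord g = (g [^] ord g) [^] k" unfolding k nat_pow_pow[OF g(1)] by (simp add: mult.commute)
    then have "u [^] ord g = \<one>" using g(1) by simp
    then have "ord u dvd ord g" using pow_eq_id[OF uc] by simp
    moreover have "ord u \<noteq> 1" using ord_eq_1[OF uc] u(2) by simp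
    ultimately have "ord u = ord g" using g(2) by (auto simp: prime_nat_iff)
    then show ?thesis using generate_pow_card[OF uc] generate_pow_card[OF g(1)] by simp
  qed
  ultimately show ?thesis by (intro card_subset_eq) auto
qed

text \<open>Some cyclic subgroup \<open>C\<close> contains at least \<open>1 / (p + 1)\<close> of the terms. Modulo \<open>C\<close> these are
  parts of length one, and the remaining parts have length at most \<open>p\<close>.\<close>

lemma three_quarters_elementary_carrier:
  assumes fin: "finite (carrier G)" and comm: "\<And>a b. a \<in> carrier G \<Longrightarrow> b \<in> carrier G \<Longrightarrow> a \<otimes> b = b \<otimes> a"
    and p: "Factorial_Ring.prime p" and order: "order G = p * p"
    and exponent: "\<And>g. g \<in> carrier G \<Longrightarrow> g \<noteq> \<one> \<Longrightarrow> ord g = p"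
  shows "three_quarters"
  unfolding three_quarters_def
proof (intro allI impI)
  fix S assume S: "product_one G S" "3 * order G < 4 * size S"
  have sub: "set_mset S \<subseteq> carrier G" using S product_one_over by simp
  have p2: "2 \<le> p" using p by (rule prime_ge_2_nat)
  let ?n = "size S"
  show "splits G S"
  proof (rule ccontr)
    assume ns: "\<not> splits G S"
    have "4 \<le> p * p" using p2 mult_le_mono[of 2 p 2 p] by simp
    then have n1: "1 < ?n" using S(2) order by linarith
    have one: "\<one> \<notin># S"
    proof
      assume "\<one> \<in># S"
      then show False
        using product_one_remove_one[OF S(1)] splits_of_part[OF S(1), of "{#\<one>#}"] ns n1 by auto
    qed
    \<comment> \<open>The average is taken over generators: each of the \<open>p + 1\<close>
      subgroups of order \<open>p\<close> is counted \<open>p - 1\<close> times, and no list of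
      subgroups is needed.\<close>
    let ?A = "carrier G - {\<one>}"
    have cg: "card (generate G {g} - {\<one>}) = p - 1" if g: "g \<in> ?A" for g
    proof -
      have "card (generate G {g}) = p" using generate_pow_card[of g] exponent[of g] g by simp
      moreover have "\<one> \<in> generate G {g}" by (rule generate.one)
      ultimately show ?thesis by (simp add: card_Diff_singleton)
    qed
    have "card {g \<in> ?A. s \<in> generate G {g}} = p - 1" if "s \<in># S" for s
    proof -
      have s: "s \<in> ?A" using that sub one by auto
      have "{g \<in> ?A. s \<in> generate G {g}} = generate G {s} - {\<one>}"
      proof (intro equalityI subsetI)
        fix g assume "g \<in> {g \<in> ?A. s \<in> generate G {g}}"
        then have "generate G {s} = generate G {g}" "g \<noteq> \<one>"
          using generate_prime_eq[OF fin, of g s] exponent[of g] p s by auto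
        then show "g \<in> generate G {s} - {\<one>}" using generate.incl[of g "{g}"] by simp
      next
        fix g assume g: "g \<in> generate G {s} - {\<one>}"
        then have "generate G {g} = generate G {s}" using generate_prime_eq[OF fin, of s g] exponent[of s] p s by auto
        moreover have "g \<in> carrier G" using g s generate_incl[of "{s}"] by auto
        ultimately show "g \<in> {g \<in> ?A. s \<in> generate G {g}}" using g generate.incl[of s "{s}"] by simp
      qed
      then show ?thesis using cg[OF s] by simp
    qed
    then have "(\<Sum>s\<in>#S. card {g \<in> ?A. s \<in> generate G {g}}) = (\<Sum>s\<in>#S. p - 1)"
      by (intro arg_cong[of _ _ sum_mset] image_mset_cong)
    then have sum_eq: "(\<Sum>g\<in>?A. size (filter_mset (\<lambda>s. s \<in> generate G {g}) S)) = ?n * (p - 1)"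
      using sum_size_filter[of ?A "\<lambda>g s. s \<in> generate G {g}" S] fin by simp
    have "\<exists>g\<in>?A. ?n \<le> (p + 1) * size (filter_mset (\<lambda>s. s \<in> generate G {g}) S)"
    proof (rule ccontr)
      assume no: "\<not> ?thesis"
      have cA: "card ?A = (p + 1) * (p - 1)"
        using fin order p2 by (simp add: order_def algebra_simps)
      then have "?A \<noteq> {}" using p2 by (metis card.empty add_is_0 diff_is_0_eq mult_is_0 not_one_le_zero numeral_2_eq_2 Suc_n_not_le_n le_trans One_nat_def)
      then have "(\<Sum>g\<in>?A. (p + 1) * size (filter_mset (\<lambda>s. s \<in> generate G {g}) S)) < (\<Sum>g\<in>?A. ?n)"
        using no fin by (intro sum_strict_mono) (auto simp only: not_le bex_simps ball_simps finite_Diff)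
      then have "(p + 1) * (?n * (p - 1)) < card ?A * ?n"
        unfolding sum_eq[symmetric] by (simp only: sum_distrib_left sum_constant of_nat_id)
      then have "(p + 1) * (?n * (p - 1)) < (p + 1) * (p - 1) * ?n" unfolding cA .
      then show False by (simp only: mult.assoc mult.left_commute mult.commute less_irrefl)
    qed
    then obtain g where g: "g \<in> ?A" and v: "?n \<le> (p + 1) * size (filter_mset (\<lambda>s. s \<in> generate G {g}) S)" by blast
    define C where "C = generate G {g}"
    have subC: "subgroup C G" unfolding C_def using g by (intro generate_is_subgroup) auto
    have cardC: "card C = p" unfolding C_def using generate_pow_card[of g] exponent[of g] g by simp
    have finC: "finite C" using cardC p2 by (metis card.infinite not_numeral_le_zero)
    have Cc: "c \<in> carrier G" if "c \<in> C" for c using subC that by (rule subgroup.mem_carrier)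
    have "C \<lhd> G"
    proof (rule normal_invI[OF subC])
      fix a c assume ac: "a \<in> carrier G" "c \<in> C"
      have "a \<otimes> c \<otimes> inv a = c \<otimes> a \<otimes> inv a" using comm[of a c] ac Cc by simp
      also have "\<dots> = c" using ac Cc by (simp add: m_assoc)
      finally show "a \<otimes> c \<otimes> inv a \<in> C" using ac by simp
    qed
    then interpret Cn: normal C G .
    interpret K: group "G Mod C" by (rule Cn.factorgroup_is_group)
    define h where "h = (\<lambda>g. C #> g)"
    interpret h: group_hom G "G Mod C" h
      unfolding h_def by unfold_locales (rule Cn.r_coset_hom_Mod)
    note [simp del] = one_FactGroup mult_FactGroup
    have h1: "h a = \<one>\<^bsub>G Mod C\<^esub> \<longleftrightarrow> a \<in> C" if "a \<in> carrier G" for a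
      using that coset_join1[OF _ that subC] coset_join2[OF that subC] subgroup.subset[OF subC]
      unfolding h_def one_FactGroup by blast
    then have ker: "kernel G (G Mod C) h = C" using Cc unfolding kernel_def by blast
    have finK: "finite (carrier (G Mod C))" using fin by (simp add: carrier_FactGroup)
    have orderK: "order (G Mod C) = p"
    proof -
      have "order (G Mod C) * p = p * p" using lagrange[OF subC] order cardC by (simp add: order_def FactGroup_def)
      then show ?thesis using p2 by simp
    qed
    define T where "T = image_mset h S"
    define v where "v = size (filter_mset (\<lambda>s. s \<in> C) S)"
    let ?T1 = "filter_mset (\<lambda>x. x = \<one>\<^bsub>G Mod C\<^esub>) T" and ?T2 = "filter_mset (\<lambda>x. x \<noteq> \<one>\<^bsub>G Mod C\<^esub>) T"
    have poT: "product_one (G Mod C) T" unfolding T_def by (rule h.product_one_image[OF S(1)])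
    have "filter_mset (\<lambda>s. h s = \<one>\<^bsub>G Mod C\<^esub>) S = filter_mset (\<lambda>s. s \<in> C) S"
      using sub h1 by (intro filter_mset_cong) auto
    then have s1: "size ?T1 = v" by (simp add: T_def v_def filter_mset_image_mset)
    have T1: "?T1 = replicate_mset v \<one>\<^bsub>G Mod C\<^esub>" using s1 by (metis filter_eq_replicate_mset size_replicate_mset)
    have T12: "T = ?T1 + ?T2" by (rule multiset_partition)
    then have s2: "v + size ?T2 = ?n" using s1 by (metis T_def size_image_mset size_union)
    obtain Ts where Ts: "?T2 = sum_list Ts" "\<forall>U\<in>set Ts. U \<noteq> {#} \<and> product_one (G Mod C) U \<and> \<not> splits (G Mod C) U"
      using K.exists_decomposition[OF K.product_one_remove_ones[OF poT]] by blast
    have "size (sum_list Ts) \<le> p * length Ts"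
      using Ts(2) K.size_le_order_of_not_splits[OF finK] orderK by (induction Ts) (auto intro: add_mono)
    then have L: "?n \<le> v + p * length Ts" using s2 Ts(1) by simp
    define Us where "Us = replicate v {#\<one>\<^bsub>G Mod C\<^esub>#} @ Ts"
    have "sum_list (replicate v {#\<one>\<^bsub>G Mod C\<^esub>#}) = ?T1" unfolding T1 by (induction v) auto
    then have sum_Us: "sum_list Us = ?T1 + ?T2" by (simp only: Us_def sum_list_append Ts(1))
    have UT: "image_mset h S = sum_list Us" unfolding T_def[symmetric] sum_Us by (rule T12)
    have "product_one (G Mod C) {#\<one>\<^bsub>G Mod C\<^esub>#}" by (simp add: K.product_one_iff)
    then have Us: "\<forall>U\<in>set Us. U \<noteq> {#} \<and> product_one (G Mod C) U" using Ts(2) by (auto simp: Us_def)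
    have len: "p < length Us"
    proof (rule ccontr)
      assume "\<not> ?thesis"
      then have le: "v + length Ts \<le> p" by (simp add: Us_def)
      have v': "?n \<le> (p + 1) * v" using v by (simp add: v_def C_def)
      \<comment> \<open>With \<open>L = length Ts\<close>, the three bounds
        \<open>n \<le> v + pL\<close>, \<open>v + L \<le> p\<close> and
        \<open>n \<le> (p + 1)v\<close> combine to \<open>2n \<le> p(p + 1)\<close>. This
        contradicts \<open>4n > 3p^2\<close> because \<open>2p \<le> p^2\<close>, with equality at
        \<open>p = 2\<close>.\<close>
      obtain d where d: "p = Suc d" using p2 by (cases p) auto
      have "?n + d * v \<le> p * (v + length Ts)" using L d by (simp add: algebra_simps)
      also have "\<dots> \<le> p * p" using le by simp
      finally have e1: "?n + d * v \<le> p * p" .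
      have "(p + 1) * ?n + d * ?n \<le> (p + 1) * ?n + d * ((p + 1) * v)" using v' by simp
      also have "\<dots> = (p + 1) * (?n + d * v)" by (simp add: algebra_simps)
      also have "\<dots> \<le> (p + 1) * (p * p)" using e1 by (rule mult_le_mono2)
      finally have "2 * p * ?n \<le> (p + 1) * (p * p)" using d by (simp add: algebra_simps)
      then have "p * (2 * ?n) \<le> p * ((p + 1) * p)" by (simp add: ac_simps)
      then have "2 * ?n \<le> (p + 1) * p" using p2 by simp
      moreover have "3 * (p * p) < 4 * ?n" using S(2) order by simp
      moreover have "2 * p \<le> p * p" using p2 by simp
      ultimately show False by (simp add: distrib_right)
    qed
    from h.lift_parts[OF sub UT Us] ker obtain Ss where
      Ss: "S = sum_list Ss" "length Ss = length Us" "\<forall>T\<in>set Ss. T \<noteq> {#} \<and> prods G T \<inter> C \<noteq> {}" by auto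
    have "w = \<one>" if wS: "w \<in> prods G S" for w
    proof -
      obtain xs where xs: "mset xs = S" "w = ordered_product G xs" using wS by (auto simp: prods_def)
      obtain ys where ys: "mset ys = S" "ordered_product G ys = \<one>" using S(1) by (auto simp: product_one_def)
      have "set xs \<subseteq> carrier G" using xs(1) sub by auto
      then show ?thesis using ordered_product_comm[OF comm, of xs ys] xs ys by simp
    qed
    then have "splits G S" using Ss len cardC by (intro splits_of_parts[OF subC finC sub _ Ss(1)]) auto
    then show False using ns by simp
  qed
qed

lemma three_quarters_elementary:
  assumes fin: "finite (carrier G)" and a: "a \<in> carrier G" and b: "b \<in> carrier G" and ab: "a \<otimes> b = b \<otimes> a"
    and p: "Factorial_Ring.prime p" "ord a = p" "ord b = p" and nb: "b \<notin> generate G {a}"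
  shows "three_quarters"
proof -
  define H where "H = {a [^] (i :: nat) \<otimes> b [^] (j :: nat) | i j. True}"
  have pw: "a [^] p = \<one>" "b [^] p = \<one>" using p a b pow_ord_eq_1 by metis+
  have pc: "b [^] (j :: nat) \<otimes> a [^] (i :: nat) = a [^] i \<otimes> b [^] j" for i j
    using pow_commute[of a "b [^] j" i] pow_commute[of b a j] a b ab by simp
  have mult: "(a [^] (i :: nat) \<otimes> b [^] (j :: nat)) \<otimes> (a [^] (k :: nat) \<otimes> b [^] (l :: nat)) = a [^] (i + k) \<otimes> b [^] (j + l)" for i j k l
  proof -
    have "(a [^] i \<otimes> b [^] j) \<otimes> (a [^] k \<otimes> b [^] l) = a [^] i \<otimes> (b [^] j \<otimes> a [^] k) \<otimes> b [^] l"
      using a b by (simp add: m_assoc)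
    also have "\<dots> = (a [^] i \<otimes> a [^] k) \<otimes> (b [^] j \<otimes> b [^] l)" unfolding pc using a b by (simp add: m_assoc)
    finally show ?thesis using a b by (simp add: nat_pow_mult)
  qed
  have subH: "subgroup H G"
  proof (rule subgroup_of_finite_closed[OF fin])
    show "H \<subseteq> carrier G" using a b by (auto simp: H_def)
    show "H \<noteq> {}" by (auto simp: H_def)
    fix x y assume "x \<in> H" "y \<in> H"
    then show "x \<otimes> y \<in> H" unfolding H_def using mult by blast
  qed
  have Hc: "H \<subseteq> carrier G" using subH by (rule subgroup.subset)
  have powH: "(a [^] (i :: nat) \<otimes> b [^] (j :: nat)) [^] p = \<one>" for i j
  proof -
    have "a [^] i \<otimes> b [^] j = b [^] j \<otimes> a [^] i" using pc by simp
    then have "(a [^] i \<otimes> b [^] j) [^] p = (a [^] i) [^] p \<otimes> (b [^] j) [^] p"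
      using a b by (intro pow_mult_distrib) auto
    also have "\<dots> = (a [^] p) [^] i \<otimes> (b [^] p) [^] j" using a b by (simp add: nat_pow_pow mult.commute)
    finally show ?thesis using pw by simp
  qed
  have ga: "generate G {a} = {a [^] k | k. k \<in> (UNIV :: nat set)}" by (rule generate_pow_on_finite_carrier[OF fin a])
  have gb: "generate G {b} = {b [^] k | k. k \<in> (UNIV :: nat set)}" by (rule generate_pow_on_finite_carrier[OF fin b])
  have suba: "subgroup (generate G {a}) G" and subb: "subgroup (generate G {b}) G"
    using a b by (auto intro!: generate_is_subgroup)
  have int: "u = \<one>" if "u \<in> generate G {a}" "u \<in> generate G {b}" for u
  proof (rule ccontr)
    assume "u \<noteq> \<one>"
    then have "generate G {u} = generate G {a}" "generate G {u} = generate G {b}"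
      using generate_prime_eq[OF fin a _ that(1)] generate_prime_eq[OF fin b _ that(2)] p by simp_all
    then have "b \<in> generate G {a}" using generate.incl[of b "{b}" G] by simp
    then show False using nb by simp
  qed
  have "card H = p * p"
  proof -
    let ?f = "\<lambda>(u, v). u \<otimes> v"
    have "H = ?f ` (generate G {a} \<times> generate G {b})" unfolding H_def ga gb by auto
    moreover have "inj_on ?f (generate G {a} \<times> generate G {b})"
    proof (rule inj_onI, clarify)
      fix u v u' v' assume *: "u \<in> generate G {a}" "v \<in> generate G {b}" "u' \<in> generate G {a}" "v' \<in> generate G {b}"
        "u \<otimes> v = u' \<otimes> v'"
      then have c: "u \<in> carrier G" "v \<in> carrier G" "u' \<in> carrier G" "v' \<in> carrier G"
        using suba subb subgroup.mem_carrier by metis+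
      have "inv u' \<otimes> (u \<otimes> v) \<otimes> inv v = inv u' \<otimes> (u' \<otimes> v') \<otimes> inv v" using * by simp
      then have "inv u' \<otimes> u = v' \<otimes> inv v" using c by (simp add: m_assoc)
      moreover have "inv u' \<otimes> u \<in> generate G {a}" using * suba by (simp add: subgroup.m_closed subgroup.m_inv_closed)
      moreover have "v' \<otimes> inv v \<in> generate G {b}" using * subb by (simp add: subgroup.m_closed subgroup.m_inv_closed)
      ultimately have "inv u' \<otimes> u = \<one>" "v' \<otimes> inv v = \<one>" using int by auto
      then show "u = u' \<and> v = v'" using c by (metis inv_closed inv_equality inv_inv)
    qed
    ultimately have "card H = card (generate G {a}) * card (generate G {b})"
      by (simp add: card_image card_cartesian_product)
    then show ?thesis using generate_pow_card a b p by simp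
  qed
  interpret H: group "G\<lparr>carrier := H\<rparr>" using subH by (rule subgroup_imp_group)
  have "H.three_quarters"
  proof (rule H.three_quarters_elementary_carrier[OF _ _ p(1)])
    show "finite (carrier (G\<lparr>carrier := H\<rparr>))" using fin Hc by (auto intro: finite_subset)
    show "order (G\<lparr>carrier := H\<rparr>) = p * p" using \<open>card H = p * p\<close> by (simp add: order_def)
  next
    fix x y assume "x \<in> carrier (G\<lparr>carrier := H\<rparr>)" "y \<in> carrier (G\<lparr>carrier := H\<rparr>)"
    then obtain i j k l :: nat where "x = a [^] i \<otimes> b [^] j" "y = a [^] k \<otimes> b [^] l" by (auto simp: H_def)
    then show "x \<otimes>\<^bsub>G\<lparr>carrier := H\<rparr>\<^esub> y = y \<otimes>\<^bsub>G\<lparr>carrier := H\<rparr>\<^esub> x" using mult by (simp add: add.commute)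
  next
    fix g assume g: "g \<in> carrier (G\<lparr>carrier := H\<rparr>)" "g \<noteq> \<one>\<^bsub>G\<lparr>carrier := H\<rparr>\<^esub>"
    then have "g [^] p = \<one>" using powH by (auto simp: H_def)
    then have "g [^]\<^bsub>G\<lparr>carrier := H\<rparr>\<^esub> p = \<one>\<^bsub>G\<lparr>carrier := H\<rparr>\<^esub>" by (simp flip: nat_pow_consistent)
    then have "H.ord g dvd p" using H.pow_eq_id[OF g(1)] by blast
    moreover have "H.ord g \<noteq> 1" using H.ord_eq_1[OF g(1)] g(2) by blast
    ultimately show "H.ord g = p" using p(1) by (auto simp: prime_nat_iff)
  qed
  then show ?thesis by (rule three_quarters_of_subgroup[OF fin subH])
qed

section \<open>Quaternion subgroups\<close>

text \<open>Each of the \<open>i * j\<close> exchanges of a \<open>w\<close> with a \<open>c\<close>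
  produces one central \<open>z\<close>.\<close>

lemma swap_powers:
  assumes c: "c \<in> carrier G" and w: "w \<in> carrier G" and z: "z \<in> carrier G"
    and zc: "z \<otimes> c = c \<otimes> z" and zw: "z \<otimes> w = w \<otimes> z" and wc: "w \<otimes> c = z \<otimes> c \<otimes> w"
  shows "w [^] (j :: nat) \<otimes> c [^] (i :: nat) = z [^] (i * j) \<otimes> (c [^] i \<otimes> w [^] j)"
proof (induction j)
  case 0 then show ?case using c by simp
next
  case (Suc j)
  have zwk: "z [^] (k :: nat) \<otimes> w = w \<otimes> z [^] k" for k
    by (rule pow_commute[OF z w zw])
  have one: "w \<otimes> c [^] (i :: nat) = z [^] i \<otimes> (c [^] i \<otimes> w)" for i
  proof (induction i)
    case 0 then show ?case using w by simp
  next
    case (Suc i)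
    have "w \<otimes> c [^] Suc i = (w \<otimes> c [^] i) \<otimes> c" using w c by (simp add: m_assoc)
    also have "\<dots> = z [^] i \<otimes> (c [^] i \<otimes> (w \<otimes> c))" unfolding Suc using w c z by (simp add: m_assoc)
    also have "\<dots> = z [^] i \<otimes> ((c [^] i \<otimes> z) \<otimes> (c \<otimes> w))" unfolding wc using w c z by (simp add: m_assoc)
    also have "c [^] i \<otimes> z = z \<otimes> c [^] i" using pow_commute[OF c z zc[symmetric]] .
    also have "z [^] i \<otimes> ((z \<otimes> c [^] i) \<otimes> (c \<otimes> w)) = z [^] Suc i \<otimes> (c [^] Suc i \<otimes> w)"
      using w c z by (simp add: m_assoc)
    finally show ?case .
  qed
  have "w [^] Suc j \<otimes> c [^] i = w \<otimes> (w [^] j \<otimes> c [^] i)" unfolding nat_pow_Suc2[OF w] using w c by (simp add: m_assoc)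
  also have "\<dots> = (w \<otimes> z [^] (i * j)) \<otimes> (c [^] i \<otimes> w [^] j)" unfolding Suc using w c z by (simp add: m_assoc)
  also have "w \<otimes> z [^] (i * j) = z [^] (i * j) \<otimes> w" by (rule zwk[symmetric])
  also have "(z [^] (i * j) \<otimes> w) \<otimes> (c [^] i \<otimes> w [^] j) = z [^] (i * j) \<otimes> ((w \<otimes> c [^] i) \<otimes> w [^] j)"
    using w c z by (simp add: m_assoc)
  also have "\<dots> = (z [^] (i * j) \<otimes> z [^] i) \<otimes> (c [^] i \<otimes> (w \<otimes> w [^] j))" unfolding one using w c z by (simp add: m_assoc)
  also have "\<dots> = z [^] (i * Suc j) \<otimes> (c [^] i \<otimes> w [^] Suc j)"
    unfolding nat_pow_Suc2[OF w] using z by (simp add: nat_pow_mult add.commute)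
  finally show ?case .
qed

text \<open>The collection formula in class two: each of the \<open>n(n - 1)/2\<close> pairs of
  factors contributes one exchange of \<open>w\<close> with \<open>c [^] i\<close>, that is
  \<open>z [^] i\<close>.\<close>

lemma power_of_product:
  assumes c: "c \<in> carrier G" and w: "w \<in> carrier G" and z: "z \<in> carrier G"
    and zc: "z \<otimes> c = c \<otimes> z" and zw: "z \<otimes> w = w \<otimes> z" and wc: "w \<otimes> c = z \<otimes> c \<otimes> w"
  shows "(c [^] (i :: nat) \<otimes> w) [^] (n :: nat) = z [^] (i * (n * (n - 1) div 2)) \<otimes> (c [^] (i * n) \<otimes> w [^] n)"
proof (induction n)
  case 0 then show ?case by simp
next
  case (Suc n)
  let ?e = "i * (n * (n - 1) div 2)"
  have zck: "c [^] (k :: nat) \<otimes> z [^] (l :: nat) = z [^] l \<otimes> c [^] k" for k l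
    using pow_commute[of c "z [^] l" k] pow_commute[OF z c zc, of l] c z by simp
  have "(c [^] i \<otimes> w) [^] Suc n = (z [^] ?e \<otimes> (c [^] (i * n) \<otimes> w [^] n)) \<otimes> (c [^] i \<otimes> w)" using Suc by simp
  also have "\<dots> = z [^] ?e \<otimes> (c [^] (i * n) \<otimes> ((w [^] n \<otimes> c [^] i) \<otimes> w))" using w c z by (simp add: m_assoc)
  also have "w [^] n \<otimes> c [^] i = z [^] (i * n) \<otimes> (c [^] i \<otimes> w [^] n)" by (rule swap_powers[OF c w z zc zw wc])
  also have "z [^] ?e \<otimes> (c [^] (i * n) \<otimes> ((z [^] (i * n) \<otimes> (c [^] i \<otimes> w [^] n)) \<otimes> w)) =
     z [^] ?e \<otimes> ((c [^] (i * n) \<otimes> z [^] (i * n)) \<otimes> ((c [^] i \<otimes> w [^] n) \<otimes> w))" using w c z by (simp add: m_assoc)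
  also have "c [^] (i * n) \<otimes> z [^] (i * n) = z [^] (i * n) \<otimes> c [^] (i * n)" by (rule zck)
  also have "z [^] ?e \<otimes> ((z [^] (i * n) \<otimes> c [^] (i * n)) \<otimes> ((c [^] i \<otimes> w [^] n) \<otimes> w)) =
    (z [^] ?e \<otimes> z [^] (i * n)) \<otimes> ((c [^] (i * n) \<otimes> c [^] i) \<otimes> (w [^] n \<otimes> w))" using w c z by (simp add: m_assoc)
  also have "\<dots> = z [^] (?e + i * n) \<otimes> (c [^] (i * n + i) \<otimes> w [^] Suc n)" using c z by (simp add: nat_pow_mult)
  also have "?e + i * n = i * (Suc n * (Suc n - 1) div 2)"
  proof -
    have "n * (n - 1) div 2 + n = Suc n * (Suc n - 1) div 2"
    proof (cases n)
      case (Suc k)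
      have "n * (n - 1) div 2 + n = (n * (n - 1) + n * 2) div 2" by simp
      also have "n * (n - 1) + n * 2 = Suc n * (Suc n - 1)" using Suc by (simp add: algebra_simps)
      finally show ?thesis .
    qed simp
    then show ?thesis by (metis distrib_left)
  qed
  finally show ?case by (simp add: add.commute)
qed

text \<open>A noncommuting pair of terms already has both possible products, and any five terms contain
  a product-one subsequence.\<close>

lemma three_quarters_quaternion_carrier:
  assumes fin: "finite (carrier G)" and order: "order G = 8"
    and z: "z \<in> carrier G" "z \<noteq> \<one>" "z \<otimes> z = \<one>" and central: "\<And>g. g \<in> carrier G \<Longrightarrow> z \<otimes> g = g \<otimes> z"
    and square: "\<And>g. g \<in> carrier G \<Longrightarrow> g \<noteq> \<one> \<Longrightarrow> g \<noteq> z \<Longrightarrow> g \<otimes> g = z"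
  shows "three_quarters"
  unfolding three_quarters_def
proof (intro allI impI)
  fix S assume S: "product_one G S" "3 * order G < 4 * size S"
  have sub: "set_mset S \<subseteq> carrier G" using S product_one_over by simp
  have n7: "7 \<le> size S" using S(2) order by simp
  define N where "N = {\<one>, z}"
  have inv_z: "inv z = z" using z by (simp add: inv_equality)
  have subN: "subgroup N G" unfolding N_def using z inv_z by (intro subgroupI) auto
  have zz: "z \<otimes> (z \<otimes> g) = g" if "g \<in> carrier G" for g using that z by (metis m_assoc l_one)
  \<comment> \<open>As \<open>g\<close>, \<open>h\<close> and \<open>g \<otimes> h\<close> all have
    square \<open>z\<close>, writing \<open>h \<otimes> g\<close> as \<open>inv g \<otimes> (g
    \<otimes> h) \<otimes> (g \<otimes> h) \<otimes> inv h\<close> makes \<open>g\<close> and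
    \<open>h\<close> anticommute.\<close>
  have gh: "g \<otimes> h = z \<otimes> (h \<otimes> g)" if gh: "g \<in> carrier G" "h \<in> carrier G" "g \<notin> N" "h \<notin> N" "g \<otimes> h \<notin> N" for g h
  proof -
    have sq: "g \<otimes> g = z" "h \<otimes> h = z" "(g \<otimes> h) \<otimes> (g \<otimes> h) = z"
      using gh square[of g] square[of h] square[of "g \<otimes> h"] by (auto simp: N_def)
    have "h \<otimes> g = inv g \<otimes> ((g \<otimes> h) \<otimes> (g \<otimes> h)) \<otimes> inv h" using gh by (simp add: m_assoc)
    also have "\<dots> = inv g \<otimes> z \<otimes> inv h" unfolding sq(3) ..
    also have "inv g = z \<otimes> g" using gh sq(1) z zz[of \<one>] by (intro inv_equality) (auto simp: m_assoc)
    also have "z \<otimes> g \<otimes> z = g" using gh(1) z central[of g] by (metis m_assoc m_closed zz)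
    also have "inv h = z \<otimes> h" using gh sq(2) z by (intro inv_equality) (auto simp: m_assoc)
    also have "g \<otimes> (z \<otimes> h) = z \<otimes> (g \<otimes> h)" using gh z central[of g] by (metis m_assoc)
    finally show ?thesis using gh zz[of "g \<otimes> h"] by simp
  qed
  have Nc: "n \<in> carrier G" if "n \<in> N" for n using that z by (auto simp: N_def)
  have Ncentral: "n \<otimes> g = g \<otimes> n" if "n \<in> N" "g \<in> carrier G" for n g using that central by (auto simp: N_def)
  have N_mult: "n \<otimes> n' \<in> N" if "n \<in> N" "n' \<in> N" for n n' using that subN by (meson subgroup.m_closed)
  have comm: "a \<otimes> b = b \<otimes> a \<or> a \<otimes> b = z \<otimes> (b \<otimes> a)" if ab: "a \<in> carrier G" "b \<in> carrier G" for a b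
  proof (cases "a \<in> N \<or> b \<in> N \<or> a \<otimes> b \<in> N")
    case False then show ?thesis using gh[OF ab] by blast
  next
    case True
    then consider "a \<in> N" | "b \<in> N" | "a \<otimes> b \<in> N" by blast
    then show ?thesis
    proof cases
      case 3
      have "b \<otimes> a = inv a \<otimes> (a \<otimes> b) \<otimes> a" using ab by (simp add: m_assoc)
      also have "\<dots> = inv a \<otimes> (a \<otimes> (a \<otimes> b))" using Ncentral[OF 3 ab(1)] ab by (simp add: m_assoc)
      also have "\<dots> = a \<otimes> b" using ab by simp
      finally show ?thesis by simp
    qed (use Ncentral ab in metis)+
  qed
  have normal: "N \<lhd> G"
  proof (rule normal_invI[OF subN])
    fix g n assume gn: "g \<in> carrier G" "n \<in> N"
    have "g \<otimes> n \<otimes> inv g = n \<otimes> g \<otimes> inv g" using Ncentral[OF gn(2,1)] by simp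
    also have "\<dots> = n" using gn Nc by (simp add: m_assoc)
    finally show "g \<otimes> n \<otimes> inv g \<in> N" using gn by simp
  qed
  \<comment> \<open>With \<open>q = 2\<close> a coset has two elements, so one noncommuting pair
    already fills it.\<close>
  interpret PN: prime_normal G N 2
  proof (intro prime_normal.intro prime_normal_axioms.intro is_group)
    show "finite (carrier G)" "N \<lhd> G" by (fact fin normal)+
    show "card N = 2" using z by (simp add: N_def)
    show "Factorial_Ring.prime (2 :: nat)" by (rule two_is_prime_nat)
    fix a b assume ab: "a \<in> carrier G" "b \<in> carrier G"
    have ba: "b \<otimes> a \<in> carrier G" using ab by simp
    show "a \<otimes> b \<otimes> inv (b \<otimes> a) \<in> N"
      using comm[OF ab]
    proof
      assume "a \<otimes> b = b \<otimes> a"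
      then show ?thesis using r_inv[OF ba] by (simp only: N_def insertI1)
    next
      assume "a \<otimes> b = z \<otimes> (b \<otimes> a)"
      then have "a \<otimes> b \<otimes> inv (b \<otimes> a) = z \<otimes> ((b \<otimes> a) \<otimes> inv (b \<otimes> a))"
        using z(1) ba inv_closed[OF ba] by (simp only: m_assoc)
      then show ?thesis unfolding r_inv[OF ba] using z(1) by (simp add: N_def)
    qed
  qed
  have pair: "\<one> \<in> prods G {#g, h#} \<or> z \<in> prods G {#g, h#}" if "g \<in> carrier G" "h \<in> carrier G" "g \<otimes> h \<in> N" for g h
    using that prods_mult[of "{#g#}" "{#h#}" g h] by (auto simp: N_def add_mset_commute)
  have three: "\<exists>U. U \<subseteq># R \<and> U \<noteq> {#} \<and> (\<one> \<in> prods G U \<or> (size U \<le> 2 \<and> z \<in> prods G U))"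
    if R: "set_mset R \<subseteq> carrier G" "3 \<le> size R" for R
  proof -
    obtain T where T: "T \<subseteq># R" "size T = 3" using exists_submultiset[OF R(2)] by blast
    obtain g T1 where T1: "T = add_mset g T1" using T(2) by (metis numeral_3_eq_3 size_eq_Suc_imp_eq_union)
    have "size T1 = 2" using T(2) T1 by simp
    then obtain h T2 where T2: "T1 = add_mset h T2" by (metis numeral_2_eq_2 size_eq_Suc_imp_eq_union)
    have "size T2 = 1" using \<open>size T1 = 2\<close> T2 by simp
    then obtain k where T3: "T2 = {#k#}" by (metis size_1_singleton_mset)
    have Te: "{#g, h, k#} \<subseteq># R" using T(1) T1 T2 T3 by simp
    have "{#g#} \<subseteq># R" "{#h#} \<subseteq># R" "{#k#} \<subseteq># R" "{#g, h#} \<subseteq># R" "{#g, k#} \<subseteq># R" "{#h, k#} \<subseteq># R"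
      by (rule subset_mset.order_trans[OF _ Te]; simp add: subseteq_mset_def)+
    note subs = this
    have c: "g \<in> carrier G" "h \<in> carrier G" "k \<in> carrier G" using subs(1-3) R(1) by auto
    show ?thesis
    proof (cases "g \<in> N \<or> h \<in> N \<or> k \<in> N")
      case True
      then obtain x where x: "x \<in> N" "{#x#} \<subseteq># R" using subs by blast
      then have "\<one> \<in> prods G {#x#} \<or> z \<in> prods G {#x#}" using Nc[OF x(1)] by (auto simp: N_def)
      then show ?thesis using x(2) by (intro exI[of _ "{#x#}"]) auto
    next
      case out: False
      show ?thesis
      proof (cases "g \<otimes> h \<in> N \<or> g \<otimes> k \<in> N \<or> h \<otimes> k \<in> N")
        case True
        then obtain x y where "{#x, y#} \<subseteq># R" "x \<in> carrier G" "y \<in> carrier G" "x \<otimes> y \<in> N" using subs(4-6) c by blast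
        then show ?thesis using pair[of x y] by (intro exI[of _ "{#x, y#}"]) auto
      next
        case False
        have ghk: "g \<otimes> h \<otimes> k \<in> N"
        proof (rule ccontr)
          assume nN: "g \<otimes> h \<otimes> k \<notin> N"
          \<comment> \<open>Otherwise \<open>\<one>\<close>, \<open>g\<close>, \<open>h\<close>,
            \<open>k\<close> and \<open>g \<otimes> h\<close> would represent five cosets of
            \<open>N\<close>, whose index is 4.\<close>
          have inj: "inj_on (\<lambda>g. N #> g) {\<one>, g, h, k, g \<otimes> h}"
          proof -
            have e: "a \<otimes> inv b \<in> N \<longleftrightarrow> a \<otimes> b \<in> N" if "a \<in> carrier G" "b \<in> carrier G" "b \<notin> N" for a b
            proof -
              have bb: "b \<otimes> b = z" using square[of b] that by (auto simp: N_def)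
              have "inv b = z \<otimes> b" using that bb z by (intro inv_equality) (auto simp: m_assoc)
              then have "a \<otimes> inv b = z \<otimes> (a \<otimes> b)" using that z central[of a] by (metis m_assoc)
              moreover have "z \<otimes> (a \<otimes> b) \<in> N \<longleftrightarrow> a \<otimes> b \<in> N"
                using N_mult[of z "a \<otimes> b"] N_mult[of z "z \<otimes> (a \<otimes> b)"] zz[of "a \<otimes> b"] that by (auto simp: N_def)
              ultimately show ?thesis by simp
            qed
            have ne: "N #> a \<noteq> N #> b" if "a \<in> carrier G" "b \<in> carrier G" "b \<notin> N" "a \<otimes> b \<notin> N" for a b
              using PN.coset_eq_iff[of a b] e that by simp
            have sq: "g \<otimes> g = z" "h \<otimes> h = z" using square[of g] square[of h] c out by (auto simp: N_def)
            have ghh: "g \<otimes> h \<otimes> h \<notin> N"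
            proof
              assume "g \<otimes> h \<otimes> h \<in> N"
              then have "g \<otimes> z \<in> N" using c sq by (simp add: m_assoc)
              then have "(g \<otimes> z) \<otimes> z \<in> N" using N_mult[of "g \<otimes> z" z] by (simp add: N_def)
              then show False using out c z by (simp add: m_assoc)
            qed
            have ghg: "g \<otimes> h \<otimes> g \<notin> N"
            proof
              assume "g \<otimes> h \<otimes> g \<in> N"
              moreover have "g \<otimes> h \<otimes> g = h \<or> g \<otimes> h \<otimes> g = z \<otimes> h"
                using gh[of h g] gh[of g h] False out c comm[of h g] comm[of g h] sq(1) central[of h] z zz
                by (metis m_assoc m_closed)
              ultimately have "h \<in> N \<or> z \<otimes> h \<in> N" by auto
              then show False using out N_mult[of z "z \<otimes> h"] zz[of h] c by (auto simp: N_def)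
            qed
            have d: "N #> \<one> \<noteq> N #> g" "N #> \<one> \<noteq> N #> h" "N #> \<one> \<noteq> N #> k" "N #> \<one> \<noteq> N #> (g \<otimes> h)"
              "N #> g \<noteq> N #> h" "N #> g \<noteq> N #> k" "N #> h \<noteq> N #> k" "N #> (g \<otimes> h) \<noteq> N #> g"
              "N #> (g \<otimes> h) \<noteq> N #> h" "N #> (g \<otimes> h) \<noteq> N #> k"
              by (rule ne; use c out False nN ghh ghg in simp)+
            then show ?thesis unfolding inj_on_def by (auto simp: eq_commute)
          qed
          have "card {\<one>, g, h, k, g \<otimes> h} = card ((\<lambda>g. N #> g) ` {\<one>, g, h, k, g \<otimes> h})"
            by (rule card_image[OF inj, symmetric])
          also have "\<dots> \<le> card (rcosets N)"
          proof (rule card_mono)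
            show "finite (rcosets N)" using fin by (simp add: RCOSETS_def)
            show "(\<lambda>g. N #> g) ` {\<one>, g, h, k, g \<otimes> h} \<subseteq> rcosets N"
              by (intro image_subsetI rcosetsI subgroup.subset[OF subN]) (use c in auto)
          qed
          also have "card (rcosets N) = 4" using lagrange[OF subN] order z by (simp add: N_def)
          finally have "card {\<one>, g, h, k, g \<otimes> h} \<le> 4" .
          moreover have "\<one> \<notin> {g, h, k, g \<otimes> h}" using out False PN.N_one by (metis empty_iff insert_iff)
          moreover have "g \<otimes> g \<in> N" "h \<otimes> h \<in> N" using square[of g] square[of h] c out by (auto simp: N_def)
          then have "g \<noteq> h" "g \<noteq> k" "h \<noteq> k" using False by auto
          moreover have "g \<otimes> h \<noteq> g" "g \<otimes> h \<noteq> h" using c out PN.N_one by auto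
          moreover have "g \<otimes> h \<noteq> k"
          proof
            assume "g \<otimes> h = k"
            then have "g \<otimes> h \<otimes> k = k \<otimes> k" by simp
            then show False using nN square[of k] c out by (auto simp: N_def)
          qed
          ultimately show False by auto
        qed
        have "g \<otimes> h \<otimes> k = z \<otimes> (h \<otimes> g \<otimes> k)" using gh[of g h] False out c z by (simp add: m_assoc)
        moreover have "g \<otimes> h \<otimes> k \<in> prods G {#g, h, k#}"
          unfolding prods_def using c by (intro CollectI exI[of _ "[g, h, k]"]) (simp add: m_assoc)
        moreover have "h \<otimes> g \<otimes> k \<in> prods G {#g, h, k#}"
          unfolding prods_def using c by (intro CollectI exI[of _ "[h, g, k]"]) (simp add: m_assoc add_mset_commute)
        ultimately have "\<one> \<in> prods G {#g, h, k#}"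
          using ghk zz[of "h \<otimes> g \<otimes> k"] c z by (auto simp: N_def)
        then show ?thesis using Te by (intro exI[of _ "{#g, h, k#}"]) auto
      qed
    qed
  qed
  \<comment> \<open>If no product is 1, two of the terms or fewer give the product \<open>z\<close>,
    and at least three are left, which give \<open>z\<close> once more. The square of
    \<open>z\<close> is 1.\<close>
  have five: "\<exists>U. U \<subseteq># R \<and> U \<noteq> {#} \<and> product_one G U" if R: "set_mset R \<subseteq> carrier G" "5 \<le> size R" for R
  proof (rule ccontr)
    assume no: "\<not> ?thesis"
    have no1: "\<one> \<notin> prods G U" if "U \<subseteq># R" "U \<noteq> {#}" for U
      using no that R(1) by (meson product_one_iff set_mset_mono subset_trans)
    obtain U where U: "U \<subseteq># R" "U \<noteq> {#}" "size U \<le> 2" "z \<in> prods G U" using three[OF R(1)] R(2) no1 by fastforce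
    have "set_mset (R - U) \<subseteq> carrier G" using R(1) by (meson in_diffD subset_iff)
    moreover have "3 \<le> size (R - U)" using U R(2) by (simp add: size_Diff_submset)
    moreover have "R - U \<subseteq># R" by simp
    ultimately obtain V where V: "V \<subseteq># R - U" "V \<noteq> {#}" "z \<in> prods G V"
      using three[of "R - U"] no1 by (meson subset_mset.order_trans)
    have UV: "U + V \<subseteq># R" using V(1) U(1) by (metis subset_mset.le_diff_conv2 union_commute)
    have "set_mset U \<subseteq> carrier G" "set_mset V \<subseteq> carrier G"
      using UV R(1) set_mset_mono by fastforce+
    from prods_mult[OF this U(4) V(3)] show False using no1[OF UV] U(2) z(3) by simp
  qed
  show "splits G S"
  proof (rule ccontr)
    assume ns: "\<not> splits G S"
    show False
    proof (cases "\<exists>a\<in>#S. \<exists>b\<in>#S. a \<otimes> b \<noteq> b \<otimes> a")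
      case True
      then obtain a b where ab: "a \<in># S" "b \<in># S" "a \<otimes> b \<noteq> b \<otimes> a" by blast
      then have "a \<noteq> b" by auto
      then have T: "{#a, b#} \<subseteq># S" using ab by (auto simp: subseteq_mset_def Suc_le_eq)
      have ac: "a \<in> carrier G" "b \<in> carrier G" using ab sub by auto
      have "5 \<le> size (S - {#a, b#})" using T n7 by (simp add: size_Diff_submset)
      moreover have "set_mset (S - {#a, b#}) \<subseteq> carrier G" using sub by (meson in_diffD subset_iff)
      ultimately obtain U where "U \<subseteq># S - {#a, b#}" "U \<noteq> {#}" "product_one G U" using five by blast
      then show False using PN.splits_of_full[OF S(1) T two_le_card_prods[OF ac ab(3)]] ns by simp
    next
      case False
      \<comment> \<open>If all terms commute, they lie in a subgroup of order at most 4, namely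
        \<open>N\<close> or the centraliser of a term, which is too small for 7 terms.\<close>
      have bound: False if C: "subgroup C G" "card C \<le> 4" "set_mset S \<subseteq> C" for C
      proof -
        have finC: "finite C" using C(1) fin subgroup.subset finite_subset by blast
        have "filter_mset (\<lambda>x. x \<notin> C) S = {#}" using C(3) by auto
        then show False using size_le_of_not_splits[OF S(1) ns C(1) finC C(2)] n7 by simp
      qed
      show False
      proof (cases "set_mset S \<subseteq> N")
        case True
        then show False using bound[OF subN] z by (simp add: N_def)
      next
        case out: False
        then obtain g where g: "g \<in># S" "g \<notin> N" by blast
        have gc: "g \<in> carrier G" using g sub by auto
        have "centralizer g \<subseteq> {\<one>, z, g, z \<otimes> g}"
        proof
          fix h assume "h \<in> centralizer g"
          then have h: "h \<in> carrier G" "h \<otimes> g = g \<otimes> h" by (auto simp: centralizer_def)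
          show "h \<in> {\<one>, z, g, z \<otimes> g}"
          proof (rule ccontr)
            assume nh: "h \<notin> {\<one>, z, g, z \<otimes> g}"
            then have hN: "h \<notin> N" by (auto simp: N_def)
            have gg: "g \<otimes> g = z" using square[OF gc] g by (auto simp: N_def)
            have "g \<otimes> h \<in> N"
            proof (rule ccontr)
              assume "g \<otimes> h \<notin> N"
              then have "g \<otimes> h = z \<otimes> (g \<otimes> h)" using gh[OF gc h(1) g(2) hN] h(2) by simp
              then show False using gc h z by simp
            qed
            then have "g \<otimes> (g \<otimes> h) = g \<or> g \<otimes> (g \<otimes> h) = g \<otimes> z" using gc by (auto simp: N_def)
            moreover have "g \<otimes> (g \<otimes> h) = z \<otimes> h" using gc h(1) gg by (simp flip: m_assoc)
            ultimately have "z \<otimes> (z \<otimes> h) = z \<otimes> g \<or> z \<otimes> (z \<otimes> h) = z \<otimes> (z \<otimes> g)" using central[OF gc] by metis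
            then show False using zz[OF h(1)] zz[OF gc] nh by auto
          qed
        qed
        then have "card (centralizer g) \<le> card {\<one>, z, g, z \<otimes> g}" by (intro card_mono) auto
        also have "\<dots> \<le> 4" by (simp add: card_insert_if)
        finally have "card (centralizer g) \<le> 4" .
        moreover have "set_mset S \<subseteq> centralizer g" using False g sub by (auto simp: centralizer_def)
        ultimately show False using bound[OF subgroup_centralizer[OF gc]] by blast
      qed
    qed
  qed
qed

text \<open>The relations give the normal form \<open>z\<close>, \<open>c\<close>, \<open>w\<close>
  with exponents 0 or 1, so \<open>c\<close> and \<open>w\<close> generate at most 8 elements. The
  order is a multiple of \<open>ord c = 4\<close> and is not 4, since a power of \<open>c\<close>
  would commute with \<open>c\<close> and \<open>w\<close> does not.\<close>

lemma three_quarters_quaternion: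
  assumes fin: "finite (carrier G)" and c: "c \<in> carrier G" and w: "w \<in> carrier G"
    and cw: "w \<otimes> w = c \<otimes> c" and z1: "c \<otimes> c \<noteq> \<one>" and zz: "(c \<otimes> c) \<otimes> (c \<otimes> c) = \<one>"
    and wc: "w \<otimes> c = (c \<otimes> c) \<otimes> c \<otimes> w"
  shows "three_quarters"
proof -
  define z where "z = c \<otimes> c"
  have z: "z \<in> carrier G" "z \<noteq> \<one>" "z \<otimes> z = \<one>" using c z1 zz by (simp_all add: z_def)
  have zc: "z \<otimes> c = c \<otimes> z" using c by (simp add: z_def m_assoc)
  have zw: "z \<otimes> w = w \<otimes> z" using w by (simp add: z_def m_assoc flip: cw)
  have wc': "w \<otimes> c = z \<otimes> c \<otimes> w" using wc by (simp add: z_def)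
  define f where "f n i j = z [^] (n :: nat) \<otimes> (c [^] (i :: nat) \<otimes> w [^] (j :: nat))" for n i j
  have fc: "f n i j \<in> carrier G" for n i j using z c w by (simp add: f_def)
  have zpow: "z [^] (n :: nat) \<otimes> g = g \<otimes> z [^] n" if "g \<in> carrier G" "z \<otimes> g = g \<otimes> z" for n g
    using pow_commute[OF z(1) that] .
  have zcw: "z \<otimes> (c [^] (i :: nat) \<otimes> w [^] (j :: nat)) = (c [^] i \<otimes> w [^] j) \<otimes> z" for i j
    using commutes_mult[of "c [^] i" "w [^] j" z] pow_commute[OF c z(1), of i] pow_commute[OF w z(1), of j] z c w zc zw by simp
  have mult: "f n i j \<otimes> f n' i' j' = f (n + n' + i' * j) (i + i') (j + j')" for n i j n' i' j'
  proof -
    have "f n i j \<otimes> f n' i' j' = z [^] n \<otimes> (((c [^] i \<otimes> w [^] j) \<otimes> z [^] n') \<otimes> (c [^] i' \<otimes> w [^] j'))"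
      using z c w by (simp add: f_def m_assoc)
    also have "(c [^] i \<otimes> w [^] j) \<otimes> z [^] n' = z [^] n' \<otimes> (c [^] i \<otimes> w [^] j)"
      using zpow[OF _ zcw] c w by simp
    also have "z [^] n \<otimes> ((z [^] n' \<otimes> (c [^] i \<otimes> w [^] j)) \<otimes> (c [^] i' \<otimes> w [^] j')) =
       (z [^] n \<otimes> z [^] n') \<otimes> (c [^] i \<otimes> ((w [^] j \<otimes> c [^] i') \<otimes> w [^] j'))" using z c w by (simp add: m_assoc)
    also have "w [^] j \<otimes> c [^] i' = z [^] (i' * j) \<otimes> (c [^] i' \<otimes> w [^] j)" by (rule swap_powers[OF c w z(1) zc zw wc'])
    also have "(z [^] n \<otimes> z [^] n') \<otimes> (c [^] i \<otimes> ((z [^] (i' * j) \<otimes> (c [^] i' \<otimes> w [^] j)) \<otimes> w [^] j')) =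
       (z [^] n \<otimes> z [^] n') \<otimes> ((c [^] i \<otimes> z [^] (i' * j)) \<otimes> (c [^] i' \<otimes> (w [^] j \<otimes> w [^] j')))" using z c w by (simp add: m_assoc)
    also have "c [^] i \<otimes> z [^] (i' * j) = z [^] (i' * j) \<otimes> c [^] i"
      using zpow[of "c [^] i"] pow_commute[OF c z(1) zc[symmetric], of i] c by simp
    also have "(z [^] n \<otimes> z [^] n') \<otimes> ((z [^] (i' * j) \<otimes> c [^] i) \<otimes> (c [^] i' \<otimes> (w [^] j \<otimes> w [^] j'))) =
      (z [^] n \<otimes> z [^] n' \<otimes> z [^] (i' * j)) \<otimes> ((c [^] i \<otimes> c [^] i') \<otimes> (w [^] j \<otimes> w [^] j'))" using z c w by (simp add: m_assoc)
    also have "\<dots> = f (n + n' + i' * j) (i + i') (j + j')" using z c w by (simp add: f_def nat_pow_mult)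
    finally show ?thesis .
  qed
  define H where "H = {f n i j | n i j. True}"
  have subH: "subgroup H G"
  proof (rule subgroup_of_finite_closed[OF fin])
    show "H \<subseteq> carrier G" using fc by (auto simp: H_def)
    show "H \<noteq> {}" by (auto simp: H_def)
    fix a b assume "a \<in> H" "b \<in> H"
    then show "a \<otimes> b \<in> H" unfolding H_def using mult by blast
  qed
  have Hc: "H \<subseteq> carrier G" using subH by (rule subgroup.subset)
  have c2: "c [^] (2 :: nat) = z" using c by (simp add: numeral_2_eq_2 z_def)
  have w2: "w [^] (2 :: nat) = z" using w cw by (simp add: numeral_2_eq_2 z_def)
  have z2: "z [^] (2 :: nat) = \<one>" using z by (simp add: numeral_2_eq_2)
  have zmod: "z [^] (n :: nat) = z [^] (n mod 2)" for n
  proof -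
    have "z [^] n = z [^] (2 * (n div 2) + n mod 2)" by simp
    also have "\<dots> = (z [^] (2 :: nat)) [^] (n div 2) \<otimes> z [^] (n mod 2)" using z(1) by (simp only: nat_pow_mult[symmetric] nat_pow_pow)
    finally show ?thesis using z by (simp add: z2)
  qed
  have red: "f n i j = f ((n + i div 2 + j div 2) mod 2) (i mod 2) (j mod 2)" for n i j
  proof -
    have ci: "c [^] i = z [^] (i div 2) \<otimes> c [^] (i mod 2)"
    proof -
      have "c [^] i = c [^] (2 * (i div 2) + i mod 2)" by simp
      also have "\<dots> = (c [^] (2 :: nat)) [^] (i div 2) \<otimes> c [^] (i mod 2)" using c by (simp only: nat_pow_mult[symmetric] nat_pow_pow)
      finally show ?thesis by (simp only: c2)
    qed
    have wj: "w [^] j = z [^] (j div 2) \<otimes> w [^] (j mod 2)"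
    proof -
      have "w [^] j = w [^] (2 * (j div 2) + j mod 2)" by simp
      also have "\<dots> = (w [^] (2 :: nat)) [^] (j div 2) \<otimes> w [^] (j mod 2)" using w by (simp only: nat_pow_mult[symmetric] nat_pow_pow)
      finally show ?thesis by (simp only: w2)
    qed
    have "f n i j = z [^] n \<otimes> (z [^] (i div 2) \<otimes> ((c [^] (i mod 2) \<otimes> z [^] (j div 2)) \<otimes> w [^] (j mod 2)))"
      unfolding f_def ci wj using z c w by (simp add: m_assoc)
    also have "c [^] (i mod 2) \<otimes> z [^] (j div 2) = z [^] (j div 2) \<otimes> c [^] (i mod 2)"
      using zpow[of "c [^] (i mod 2)"] pow_commute[OF c z(1) zc[symmetric], of "i mod 2"] c by simp
    also have "z [^] n \<otimes> (z [^] (i div 2) \<otimes> ((z [^] (j div 2) \<otimes> c [^] (i mod 2)) \<otimes> w [^] (j mod 2))) =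
       f (n + i div 2 + j div 2) (i mod 2) (j mod 2)"
      using z c w by (simp add: f_def m_assoc flip: nat_pow_mult)
    also have "\<dots> = f ((n + i div 2 + j div 2) mod 2) (i mod 2) (j mod 2)" unfolding f_def by (subst zmod) simp
    finally show ?thesis .
  qed
  have "H \<subseteq> (\<lambda>(n, i, j). f n i j) ` ({0, 1} \<times> {0, 1} \<times> {0, 1})"
  proof
    fix g assume "g \<in> H"
    then obtain n i j where "g = f n i j" by (auto simp: H_def)
    then have geq: "g = f ((n + i div 2 + j div 2) mod 2) (i mod 2) (j mod 2)" using red by simp
    have m: "k mod 2 \<in> {0, 1}" for k :: nat by auto
    have mem: "((n + i div 2 + j div 2) mod 2, i mod 2, j mod 2) \<in> {0, 1} \<times> {0, 1} \<times> {0, 1}" by (intro SigmaI m)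
    show "g \<in> (\<lambda>(n, i, j). f n i j) ` ({0, 1} \<times> {0, 1} \<times> {0, 1})"
      by (rule rev_image_eqI[OF mem]) (use geq in \<open>simp only: case_prod_conv\<close>)
  qed
  then have "card H \<le> card ((\<lambda>(n, i, j). f n i j) ` ({0, 1} \<times> {0, 1} \<times> {0, 1 :: nat}))" by (intro card_mono) auto
  also have "\<dots> \<le> card ({0, 1} \<times> {0, 1} \<times> {0, 1 :: nat} :: (nat \<times> nat \<times> nat) set)" by (intro card_image_le) auto
  also have "\<dots> = 8" by (simp add: card_cartesian_product)
  finally have card8: "card H \<le> 8" .
  have ordc: "ord c = 4"
  proof -
    have "c [^] (4 :: nat) = (c [^] (2 :: nat)) [^] (2 :: nat)" using c by (simp add: nat_pow_pow)
    then have "ord c dvd 4" using pow_eq_id[OF c] by (simp add: c2 z2)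
    then have "ord c dvd 2 ^ 2" by simp
    then obtain k where k: "k \<le> 2" "ord c = 2 ^ k" using divides_primepow_nat[OF two_is_prime_nat] by blast
    have "\<not> ord c dvd 2" using pow_eq_id[OF c, of 2] c2 z by simp
    then have "k \<noteq> 0" "k \<noteq> 1" unfolding k(2) by (metis one_dvd power_0, metis dvd_refl power_one_right)
    then show ?thesis using k by (simp add: numeral_2_eq_2 le_Suc_eq)
  qed
  have cH: "c \<in> H" "w \<in> H" "z \<in> H"
  proof -
    have "c = f 0 1 0" "w = f 0 0 1" "z = f 1 0 0" using c w z by (simp_all add: f_def)
    then show "c \<in> H" "w \<in> H" "z \<in> H" unfolding H_def by blast+
  qed
  have subgc: "subgroup (generate G {c}) G" using c by (intro generate_is_subgroup) auto
  have gcH: "generate G {c} \<subseteq> H" using cH subH by (intro generate_subgroup_incl) auto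
  interpret H: group "G\<lparr>carrier := H\<rparr>" using subH by (rule subgroup_imp_group)
  have "subgroup (generate G {c}) (G\<lparr>carrier := H\<rparr>)" using subgroup_incl[OF subgc subH gcH] .
  from H.lagrange[OF this] have "4 dvd card H" using generate_pow_card[OF c] ordc by (simp add: order_def) (metis dvd_triv_right)
  moreover have finH: "finite H" using fin Hc by (rule finite_subset[rotated])
  moreover have "card H \<noteq> 4"
  proof
    assume "card H = 4"
    then have "generate G {c} = H" using card_subset_eq[OF finH gcH] generate_pow_card[OF c] ordc by simp
    then obtain k :: nat where "w = c [^] k" using cH(2) generate_pow_on_finite_carrier[OF fin c] by auto
    then have "w \<otimes> c = c \<otimes> w" using pow_commute[OF c c refl] by simp
    then show False using wc' z c w by (simp add: m_assoc)
  qed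
  moreover have "card H \<noteq> 0" using finH cH by auto
  ultimately have order8: "card H = 8" using card8 by presburger
  have "H.three_quarters"
  proof (rule H.three_quarters_quaternion_carrier[of z])
    show "finite (carrier (G\<lparr>carrier := H\<rparr>))" using finH by simp
    show "order (G\<lparr>carrier := H\<rparr>) = 8" using order8 by (simp add: order_def)
    show "z \<in> carrier (G\<lparr>carrier := H\<rparr>)" using cH by simp
    show "z \<noteq> \<one>\<^bsub>G\<lparr>carrier := H\<rparr>\<^esub>" "z \<otimes>\<^bsub>G\<lparr>carrier := H\<rparr>\<^esub> z = \<one>\<^bsub>G\<lparr>carrier := H\<rparr>\<^esub>" using z by simp_all
  next
    fix g assume "g \<in> carrier (G\<lparr>carrier := H\<rparr>)"
    then obtain n i j where g: "g = f n i j" by (auto simp: H_def)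
    have "z = f 1 0 0" using z by (simp add: f_def)
    then show "z \<otimes>\<^bsub>G\<lparr>carrier := H\<rparr>\<^esub> g = g \<otimes>\<^bsub>G\<lparr>carrier := H\<rparr>\<^esub> z" using mult[of 1 0 0 n i j] mult[of n i j 1 0 0] g by simp
  next
    fix g assume "g \<in> carrier (G\<lparr>carrier := H\<rparr>)" and g1: "g \<noteq> \<one>\<^bsub>G\<lparr>carrier := H\<rparr>\<^esub>" "g \<noteq> z"
    then obtain n0 i0 j0 where "g = f n0 i0 j0" by (auto simp: H_def)
    then obtain n i j where g: "g = f (n mod 2) (i mod 2) (j mod 2)" using red by metis
    have ij: "i mod 2 = 1 \<or> j mod 2 = 1"
    proof (rule ccontr)
      assume "\<not> ?thesis"
      then have "g = z [^] (n mod 2)" using g z by (simp add: f_def)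
      moreover have "n mod 2 = 0 \<or> n mod 2 = 1" by auto
      ultimately have "g = \<one> \<or> g = z" using z by auto
      then show False using g1 by simp
    qed
    have "g \<otimes> g = f (n mod 2 + n mod 2 + i mod 2 * (j mod 2)) (i mod 2 + i mod 2) (j mod 2 + j mod 2)"
      unfolding g by (rule mult)
    also have "\<dots> = f ((n mod 2 + n mod 2 + i mod 2 * (j mod 2) + (i mod 2 + i mod 2) div 2 + (j mod 2 + j mod 2) div 2) mod 2) 0 0"
      by (subst red) simp
    also have "(n mod 2 + n mod 2 + i mod 2 * (j mod 2) + (i mod 2 + i mod 2) div 2 + (j mod 2 + j mod 2) div 2) mod 2 = 1"
    proof -
      have "i mod 2 = 0 \<or> i mod 2 = 1" "j mod 2 = 0 \<or> j mod 2 = 1" "n mod 2 = 0 \<or> n mod 2 = 1" by auto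
      then show ?thesis using ij by (elim disjE) simp_all
    qed
    also have "f 1 0 0 = z" using z by (simp add: f_def)
    finally show "g \<otimes>\<^bsub>G\<lparr>carrier := H\<rparr>\<^esub> g = z" by simp
  qed
  then show ?thesis by (rule three_quarters_of_subgroup[OF fin subH])
qed

section \<open>Groups without the three kinds of subgroups\<close>

text \<open>Cauchy's theorem, obtained from Sylow's existence theorem for the exponent 1; every
  nontrivial element of the subgroup found has order \<open>p\<close>.\<close>

lemma exists_prime_order:
  assumes fin: "finite (carrier G)" and H: "subgroup H G" and p: "Factorial_Ring.prime p" "p dvd card H"
  shows "\<exists>u\<in>H. ord u = p"
proof -
  interpret H: group "G\<lparr>carrier := H\<rparr>" using H by (rule subgroup_imp_group)
  have Hc: "H \<subseteq> carrier G" using H by (rule subgroup.subset)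
  obtain m where "card H = p ^ 1 * m" using p(2) by (auto simp: dvd_def)
  then have "order (G\<lparr>carrier := H\<rparr>) = p ^ 1 * m" by (simp add: order_def)
  from sylow_thm[OF p(1) H.is_group this] obtain K where K: "subgroup K (G\<lparr>carrier := H\<rparr>)" "card K = p"
    using fin Hc finite_subset by auto
  have KG: "subgroup K G" using incl_subgroup[OF H K(1)] .
  have KH: "K \<subseteq> H" using subgroup.subset[OF K(1)] by simp
  have "\<exists>u\<in>K. u \<noteq> \<one>"
  proof (rule ccontr)
    assume "\<not> ?thesis"
    then have "K \<subseteq> {\<one>}" by blast
    then have "card K \<le> card {\<one>}" by (rule card_mono[rotated]) simp
    then show False using K(2) prime_ge_2_nat[OF p(1)] by simp
  qed
  then obtain u where u: "u \<in> K" "u \<noteq> \<one>" by blast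
  have uc: "u \<in> carrier G" using u KH Hc by blast
  interpret K: group "G\<lparr>carrier := K\<rparr>" using KG by (rule subgroup_imp_group)
  have "generate G {u} \<subseteq> K" using u KG by (intro generate_subgroup_incl) auto
  moreover have "subgroup (generate G {u}) G" using uc by (intro generate_is_subgroup) auto
  ultimately have "subgroup (generate G {u}) (G\<lparr>carrier := K\<rparr>)" using KG subgroup_incl by blast
  from K.lagrange[OF this] have "card (generate G {u}) dvd card K" by (simp add: order_def) (metis dvd_triv_right)
  then have "ord u dvd p" using generate_pow_card[OF uc] K(2) by simp
  moreover have "ord u \<noteq> 1" using ord_eq_1[OF uc] u(2) by blast
  ultimately have "ord u = p" using p(1) by (auto simp: prime_nat_iff)
  then show ?thesis using u KH by blast
qed

lemma ord_prime_eq: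
  assumes "u \<in> carrier G" "Factorial_Ring.prime r" "u [^] r = \<one>" "u \<noteq> \<one>"
  shows "ord u = r"
proof -
  have "ord u dvd r" using pow_eq_id assms by blast
  moreover have "ord u \<noteq> 1" using ord_eq_1 assms by blast
  ultimately show ?thesis using assms(2) by (auto simp: prime_nat_iff)
qed

lemma mem_generateE:
  assumes "finite (carrier G)" "u \<in> carrier G" "v \<in> generate G {u}"
  obtains k :: nat where "v = u [^] k"
  using generate_pow_on_finite_carrier[OF assms(1,2)] assms(3) by blast

lemma pow_in_generate: "u [^] (k :: nat) \<in> generate G {u}" if "u \<in> carrier G"
  using subgroup_int_pow_closed[OF generate_is_subgroup generate.incl, of "{u}" u "int k"] that by (simp add: int_pow_int)

lemma square_one_of_odd:
  assumes "x \<in> carrier G" "odd (ord x)" "x \<otimes> x = \<one>"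
  shows "x = \<one>"
proof -
  have "x [^] (2 :: nat) = \<one>" using assms by (simp add: numeral_2_eq_2)
  then have "ord x dvd 2" using pow_eq_id assms by blast
  then have "ord x = 1" using assms(2) by (metis dvd_refl prime_nat_iff two_is_prime_nat even_numeral)
  then show ?thesis using ord_eq_1 assms by blast
qed

end

text \<open>The negated property is used only through the next three lemmas, one for each kind of
  good subgroup.\<close>

locale counterexample = group +
  assumes fin: "finite (carrier G)" and not_three_quarters: "\<not> three_quarters"
begin

lemma prime_unique:
  assumes "a \<in> carrier G" "b \<in> carrier G" "a \<otimes> b = b \<otimes> a" "Factorial_Ring.prime p" "ord a = p" "ord b = p"
  shows "b \<in> generate G {a}"
  using three_quarters_elementary[OF fin assms] not_three_quarters by blast

lemma noncommuting_involution:
  assumes "x \<in> carrier G" "w \<in> carrier G" "Factorial_Ring.prime (ord x)" "w \<otimes> x \<otimes> inv w \<in> generate G {x}"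
    and "w \<otimes> x \<noteq> x \<otimes> w"
  shows "w \<otimes> w = \<one>"
  using three_quarters_metacyclic[OF fin assms(1,3,2,4,5)] not_three_quarters by blast

lemma no_quaternion:
  assumes "c \<in> carrier G" "w \<in> carrier G" "w \<otimes> w = c \<otimes> c" "c \<otimes> c \<noteq> \<one>" "(c \<otimes> c) \<otimes> (c \<otimes> c) = \<one>"
  shows "w \<otimes> c \<noteq> (c \<otimes> c) \<otimes> c \<otimes> w"
  using three_quarters_quaternion[OF fin assms] not_three_quarters by blast

text \<open>Replacing \<open>w\<close> by a suitable product \<open>c\<^sup>iw\<close> lowers its order, unless the two elements generate
  a quaternion group.\<close>

lemma no_class_two_pair:
  assumes r: "Factorial_Ring.prime r" and c: "c \<in> carrier G" and w: "w \<in> carrier G" and z: "z \<in> carrier G" "ord z = r"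
    and zc: "z \<otimes> c = c \<otimes> z" and zw: "z \<otimes> w = w \<otimes> z" and wc: "w \<otimes> c = z \<otimes> c \<otimes> w"
    and ord: "ord c = r ^ a" "ord w = r ^ b"
  shows False
  using c w z zc zw wc ord
proof (induction "a + b" arbitrary: a b c w z rule: less_induct)
  case less
  \<comment> \<open>The symmetric roles of \<open>c\<close> and \<open>w\<close> are ordered so that
    the element of no larger order, \<open>w\<close>, is the one replaced.\<close>
  have main: False if le: "b' \<le> a'" and ab: "a' + b' = a + b"
    and c: "c \<in> carrier G" and w: "w \<in> carrier G" and z: "z \<in> carrier G" "ord z = r"
    and zc: "z \<otimes> c = c \<otimes> z" and zw: "z \<otimes> w = w \<otimes> z" and wc: "w \<otimes> c = z \<otimes> c \<otimes> w"
    and ord: "ord c = r ^ a'" "ord w = r ^ b'" for a' b' c w z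
  proof -
    have r2: "2 \<le> r" using r by (rule prime_ge_2_nat)
    have z1: "z \<noteq> \<one>" using z(2) r2 ord_eq_1[OF z(1)] by auto
    have nc: "w \<otimes> c \<noteq> c \<otimes> w" using wc z1 z(1) c w by (simp add: m_assoc)
    have "b' \<noteq> 0" using ord(2) ord_eq_1[OF w] nc c by auto
    moreover have "b' \<noteq> 1"
    proof
      assume "b' = 1"
      then have "w \<in> generate G {z}" using prime_unique[OF z(1) w zw r z(2)] ord by simp
      then obtain k :: nat where "w = z [^] k" using mem_generateE[OF fin z(1)] by blast
      then show False using pow_commute[OF z(1) c zc] nc by simp
    qed
    ultimately have b2: "2 \<le> b'" by simp
    then have a2: "2 \<le> a'" using le by simp
    define u where "u = c [^] (r ^ (a' - 1))"
    define v where "v = w [^] (r ^ (b' - 1))"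
    have uc: "u \<in> carrier G" and vc: "v \<in> carrier G" using c w by (simp_all add: u_def v_def)
    have ordu: "ord u = r"
    proof (rule ord_prime_eq[OF uc r])
      have "u [^] r = c [^] (r ^ (a' - 1) * r)" using c by (simp add: u_def nat_pow_pow)
      also have "r ^ (a' - 1) * r = ord c" using a2 ord by (metis mult.commute power_eq_if not_numeral_le_zero)
      finally show "u [^] r = \<one>" using c by simp
      show "u \<noteq> \<one>" unfolding u_def using pow_eq_id[OF c] ord(1) a2 r2 by (simp add: dvd_power_iff_le)
    qed
    have ordv: "ord v = r"
    proof (rule ord_prime_eq[OF vc r])
      have "v [^] r = w [^] (r ^ (b' - 1) * r)" using w by (simp add: v_def nat_pow_pow)
      also have "r ^ (b' - 1) * r = ord w" using b2 ord by (metis mult.commute power_eq_if not_numeral_le_zero)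
      finally show "v [^] r = \<one>" using w by simp
      show "v \<noteq> \<one>" unfolding v_def using pow_eq_id[OF w] ord(2) b2 r2 by (simp add: dvd_power_iff_le)
    qed
    have uz: "u \<in> generate G {z}"
      unfolding u_def using ordu pow_commute[OF c z(1) zc[symmetric]] c
      by (intro prime_unique[OF z(1) _ _ r z(2)]) (auto simp: u_def)
    have vz: "v \<in> generate G {z}"
      unfolding v_def using ordv pow_commute[OF w z(1) zw[symmetric]] w
      by (intro prime_unique[OF z(1) _ _ r z(2)]) (auto simp: v_def)
    have u1: "u \<noteq> \<one>" and v1: "v \<noteq> \<one>" using ordu ordv r2 ord_id by auto
    have "generate G {u} = generate G {z}" using generate_prime_eq[OF fin z(1) _ uz u1] z(2) r by simp
    then obtain l :: nat where l: "v = u [^] l" using mem_generateE[OF fin uc] vz by metis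
    \<comment> \<open>Both \<open>u\<close> and \<open>v\<close> generate the group of
      \<open>z\<close>, and \<open>v = u [^] l\<close>. This exponent turns
      \<open>c [^] (i * n)\<close> into \<open>u [^] ((r - 1) * l)\<close>, the inverse of
      \<open>w [^] n = v\<close>.\<close>
    define i where "i = (r - 1) * l * r ^ (a' - b')"
    define n where "n = r ^ (b' - 1)"
    have "c [^] (i * n) = u [^] ((r - 1) * l)"
    proof -
      have "r ^ (a' - b') * n = r ^ (a' - 1)" unfolding n_def using le b2 by (simp flip: power_add)
      then have "i * n = r ^ (a' - 1) * ((r - 1) * l)" by (simp add: i_def ac_simps)
      then show ?thesis using c by (simp add: u_def nat_pow_pow)
    qed
    then have "c [^] (i * n) \<otimes> w [^] n = u [^] ((r - 1) * l) \<otimes> u [^] l" using l by (simp add: v_def n_def)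
    also have "\<dots> = u [^] ((r - 1) * l + l)" using uc by (simp add: nat_pow_mult)
    also have "(r - 1) * l + l = ord u * l" using ordu r2 by (metis add.commute mult_eq_if not_numeral_le_zero)
    also have "u [^] (ord u * l) = \<one>" using uc by (simp flip: nat_pow_pow)
    finally have cw1: "c [^] (i * n) \<otimes> w [^] n = \<one>" .
    show False
    proof (cases "r dvd i * (n * (n - 1) div 2)")
      case True
      then have "z [^] (i * (n * (n - 1) div 2)) = \<one>" using pow_eq_id[OF z(1)] z(2) by simp
      then have wn: "(c [^] i \<otimes> w) [^] n = \<one>"
        using power_of_product[OF c w z(1) zc zw wc, of i n] cw1 by simp
      define w' where "w' = c [^] i \<otimes> w"
      have w'c: "w' \<in> carrier G" using c w by (simp add: w'_def)
      have "ord w' dvd r ^ (b' - 1)" using wn pow_eq_id[OF w'c] by (simp add: w'_def n_def)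
      then obtain k where k: "k \<le> b' - 1" "ord w' = r ^ k" using divides_primepow_nat[OF r] by blast
      have zci: "c [^] i \<otimes> z = z \<otimes> c [^] i" using pow_commute[OF c z(1) zc[symmetric]] .
      have "w' \<otimes> c = c [^] i \<otimes> (z \<otimes> c \<otimes> w)" using c w by (simp add: w'_def m_assoc flip: wc)
      also have "\<dots> = (c [^] i \<otimes> z) \<otimes> (c \<otimes> w)" using c w z by (simp add: m_assoc)
      also have "\<dots> = z \<otimes> ((c [^] i \<otimes> c) \<otimes> w)" unfolding zci using c w z by (simp add: m_assoc)
      also have "c [^] i \<otimes> c = c \<otimes> c [^] i" using pow_commute[OF c c refl] .
      finally have w'cc: "w' \<otimes> c = z \<otimes> c \<otimes> w'" using c w z by (simp add: w'_def m_assoc)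
      have "w' \<otimes> z = z \<otimes> w'" unfolding w'_def using c w z(1) zci zw by (intro commutes_mult) auto
      moreover have "a' + k < a + b" using k ab b2 by linarith
      ultimately show False using less.hyps[of a' k c w' z] c w'c z zc w'cc ord(1) k(2) by simp
    next
      case False
      \<comment> \<open>In the collection formula a power of \<open>z\<close> survives only if the
        exponent is prime to \<open>r\<close>. Since \<open>r\<close> divides \<open>n\<close>, this
        forces \<open>r = 2\<close> and \<open>n = 2\<close>, and then \<open>i\<close> is odd, so
        that \<open>a' = b' = 2\<close>: the quaternion relations.\<close>
      have rn: "r dvd n" unfolding n_def using b2 by (simp add: dvd_power)
      have "even (n * (n - 1))" by (cases n) auto
      then have two: "2 * (n * (n - 1) div 2) = n * (n - 1)" by simp
      have r_eq: "r = 2"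
      proof (rule ccontr)
        assume "r \<noteq> 2"
        then have "odd r" using r prime_odd_nat r2 by force
        moreover have "r dvd 2 * (n * (n - 1) div 2)" unfolding two using rn by simp
        ultimately have "r dvd n * (n - 1) div 2" using r by (metis prime_dvd_mult_iff primes_dvd_imp_eq two_is_prime_nat \<open>r \<noteq> 2\<close>)
        then show False using False by simp
      qed
      have b_eq: "b' = 2"
      proof (rule ccontr)
        assume "b' \<noteq> 2"
        then obtain d where d: "b' = d + 3" using b2 by (metis Suc_1 add.commute eval_nat_numeral(3) le_Suc_ex le_antisym not_less_eq_eq)
        have "n = 2 * (2 * 2 ^ d)" unfolding n_def r_eq d by simp
        then have "n * (n - 1) div 2 = 2 * 2 ^ d * (n - 1)" by simp
        then show False using False r_eq by simp
      qed
      have a_eq: "a' = 2"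
      proof (rule ccontr)
        assume "a' \<noteq> 2"
        then have "2 dvd (2 :: nat) ^ (a' - b')" using a2 b_eq by (simp add: dvd_power)
        then have "2 dvd i" by (simp add: i_def r_eq)
        then show False using False r_eq by simp
      qed
      have cc: "c \<otimes> c = u" and ww: "w \<otimes> w = v" using c w by (simp_all add: u_def v_def a_eq b_eq r_eq numeral_2_eq_2)
      have zz: "z \<otimes> z = \<one>" using z r_eq pow_ord_eq_1[OF z(1)] by (simp add: numeral_2_eq_2)
      have gz: "g = z" if "g \<in> generate G {z}" "g \<noteq> \<one>" for g
      proof -
        obtain k :: nat where k: "g = z [^] k" using mem_generateE[OF fin z(1)] \<open>g \<in> generate G {z}\<close> by blast
        have "z [^] (k :: nat) = \<one> \<or> z [^] k = z" for k
          by (induction k) (use z zz in auto)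
        then show ?thesis using k that(2) by metis
      qed
      have "u = z" "v = z" using gz uz vz u1 v1 by blast+
      then show False using no_quaternion[OF c w] cc ww z1 zz wc by simp
    qed
  qed
  show False
  proof (cases "b \<le> a")
    case True
    show False using main[OF True refl less.prems] .
  next
    case False
    \<comment> \<open>Exchanging \<open>c\<close> and \<open>w\<close> replaces their commutator
      \<open>z\<close> by its inverse.\<close>
    have iz: "inv z \<in> carrier G" "ord (inv z) = r" using less.prems by simp_all
    have "inv z \<otimes> (w \<otimes> c) = c \<otimes> w" unfolding less.prems(7) using less.prems(1-3) by (simp add: m_assoc)
    then have wc: "c \<otimes> w = inv z \<otimes> w \<otimes> c" using less.prems(1-3) by (simp add: m_assoc)
    show False
      by (rule main[of a b w c "inv z"]) (use False wc iz less.prems commutes_inv in \<open>auto simp: add.commute\<close>)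
  qed
qed

text \<open>For a prime \<open>p\<close> dividing the order, the kernel of the \<open>p\<close>-th
  power map lies in one group of order \<open>p\<close> by \<open>prime_unique\<close>, so the image
  \<open>K\<close> has at least \<open>card H / p\<close> elements. By induction
  \<open>a [^] p\<close> generates \<open>K\<close>. If \<open>p\<close> divides
  \<open>ord a\<close>, then \<open>a\<close> has order \<open>card H\<close>; otherwise the product
  of \<open>a\<close> with an element \<open>u\<close> of order \<open>p\<close> does.\<close>

lemma abelian_cyclic:
  assumes H: "subgroup H G" and comm: "\<And>x y. x \<in> H \<Longrightarrow> y \<in> H \<Longrightarrow> x \<otimes> y = y \<otimes> x"
  shows "\<exists>c\<in>H. H = generate G {c}"
  using H comm
proof (induction "card H" arbitrary: H rule: less_induct)
  case less
  note H = less.prems(1) and comm = less.prems(2)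
  have Hc: "h \<in> carrier G" if "h \<in> H" for h using H that by (rule subgroup.mem_carrier)
  have finH: "finite H" using Hc fin by (meson finite_subset subsetI)
  have oneH: "\<one> \<in> H" using H by (rule subgroup.one_closed)
  show ?case
  proof (cases "card H = 1")
    case True
    then have "H = {\<one>}" using oneH by (metis card_1_singletonE singletonD)
    then show ?thesis using generate_one by auto
  next
    case False
    moreover have "card H \<noteq> 0" using oneH finH by auto
    ultimately obtain p where p: "Factorial_Ring.prime p" "p dvd card H" using prime_factor_nat by blast
    obtain u where u: "u \<in> H" "ord u = p" using exists_prime_order[OF fin H p] by blast
    have uc: "u \<in> carrier G" using u Hc by simp
    have u1: "u \<noteq> \<one>" using u(2) p(1) by auto
    have up: "u [^] p = \<one>" using u(2) uc pow_ord_eq_1 by blast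
    define f where "f h = h [^] p" for h
    have fm: "f (x \<otimes> y) = f x \<otimes> f y" if "x \<in> H" "y \<in> H" for x y
      unfolding f_def using that comm Hc by (intro pow_mult_distrib) auto
    have powH: "h [^] (k :: nat) \<in> H" if "h \<in> H" for h k
      using subgroup_int_pow_closed[OF H that, of "int k"] by (simp add: int_pow_int)
    define K where "K = f ` H"
    have KH: "K \<subseteq> H" using powH by (auto simp: K_def f_def)
    have K: "subgroup K G"
    proof (rule subgroup_of_finite_closed[OF fin])
      show "K \<subseteq> carrier G" using KH Hc by blast
      show "K \<noteq> {}" using oneH by (auto simp: K_def)
      fix a b assume "a \<in> K" "b \<in> K"
      then show "a \<otimes> b \<in> K" using fm subgroup.m_closed[OF H] unfolding K_def by (metis (no_types, lifting) imageE imageI)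
    qed
    have fiber: "card {x \<in> H. f x = f h} \<le> p" if h: "h \<in> H" for h
    proof -
      have "{x \<in> H. f x = f h} \<subseteq> (\<lambda>k. k \<otimes> h) ` generate G {u}"
      proof
        fix x assume "x \<in> {x \<in> H. f x = f h}"
        then have x: "x \<in> H" "f x = f h" by auto
        let ?k = "x \<otimes> inv h"
        have kH: "?k \<in> H" using H x h by (simp add: subgroup.m_closed subgroup.m_inv_closed)
        have xk: "x = ?k \<otimes> h" using x h Hc by (simp add: m_assoc)
        have "f ?k \<otimes> f h = f h" using fm[OF kH h] xk x(2) by simp
        then have k1: "?k [^] p = \<one>" using Hc[OF kH] Hc[OF h] by (simp add: f_def)
        have "?k \<in> generate G {u}"
        proof (cases "?k = \<one>")
          case True then show ?thesis by (simp add: generate.one)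
        next
          case False
          then have "ord ?k = p" using ord_prime_eq[OF Hc[OF kH] p(1) k1] by simp
          then show ?thesis using prime_unique[OF uc Hc[OF kH] comm[OF u(1) kH] p(1) u(2)] by simp
        qed
        then show "x \<in> (\<lambda>k. k \<otimes> h) ` generate G {u}" using xk by blast
      qed
      moreover have fing: "finite (generate G {u})" using generate_incl[of "{u}"] uc fin by (auto intro: finite_subset)
      ultimately have "card {x \<in> H. f x = f h} \<le> card ((\<lambda>k. k \<otimes> h) ` generate G {u})" by (intro card_mono) auto
      also have "\<dots> \<le> card (generate G {u})" using fing by (rule card_image_le)
      also have "\<dots> = p" using generate_pow_card[OF uc] u(2) by simp
      finally show ?thesis .
    qed
    have "H = (\<Union>y\<in>K. {x \<in> H. f x = y})" by (auto simp: K_def)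
    then have "card H \<le> (\<Sum>y\<in>K. card {x \<in> H. f x = y})"
      using card_UN_le[of K "\<lambda>y. {x \<in> H. f x = y}"] finH by (simp add: K_def)
    also have "\<dots> \<le> (\<Sum>y\<in>K. p)" using fiber by (intro sum_mono) (auto simp: K_def)
    finally have HK: "card H \<le> p * card K" by (simp add: mult.commute)
    have "K \<noteq> H"
    proof
      assume "K = H"
      then have "card (f ` H) = card H" by (simp add: K_def)
      then have "inj_on f H" using finH by (simp add: eq_card_imp_inj_on)
      moreover have "f u = f \<one>" using up by (simp add: f_def)
      ultimately show False using u(1) oneH u1 by (meson inj_onD)
    qed
    then have "card K < card H" using KH finH by (simp add: psubset_card_mono psubsetI)
    then obtain b where b: "b \<in> K" "K = generate G {b}" using less.hyps[OF _ K] comm KH by blast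
    then obtain a where a: "a \<in> H" "b = a [^] p" by (auto simp: K_def f_def)
    have ac: "a \<in> carrier G" using a Hc by simp
    have bc: "b \<in> carrier G" using a ac by simp
    have cardK: "card K = ord b" using b generate_pow_card[OF bc] by simp
    have ordb: "ord b = ord a div gcd (ord a) p"
      unfolding a(2) using ord_pow_gen[OF ac, of p] prime_gt_0_nat[OF p(1)] by simp
    have big: "H = generate G {c}" if c: "c \<in> H" "card H \<le> ord c" for c
    proof -
      have "generate G {c} \<subseteq> H" using c H by (intro generate_subgroup_incl) auto
      then have "generate G {c} = H"
        using card_seteq[OF finH, of "generate G {c}"] c generate_pow_card[OF Hc[OF c(1)]] by simp
      then show ?thesis by simp
    qed
    show ?thesis
    proof (cases "p dvd ord a")
      case True
      then have "ord a = p * ord b" using ordb prime_gt_0_nat[OF p(1)] by (simp add: gcd_nat.absorb2)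
      then show ?thesis using big[OF a(1)] HK cardK a(1) by auto
    next
      case False
      then have cop: "coprime (ord a) p" using p(1) by (metis coprime_commute prime_imp_coprime_nat)
      then have ordba: "ord b = ord a" using ordb by simp
      define c where "c = a \<otimes> u"
      have cH: "c \<in> H" unfolding c_def using H a u by (simp add: subgroup.m_closed)
      have cc: "c \<in> carrier G" using cH Hc by simp
      have "c [^] p = b" using fm[OF a(1) u(1)] up bc a by (simp add: c_def f_def)
      then have bg: "b \<in> generate G {c}" using pow_in_generate[OF cc] by metis
      have subc: "subgroup (generate G {c}) G" using cc by (intro generate_is_subgroup) auto
      have fing: "finite (generate G {x})" if "x \<in> carrier G" for x using generate_incl[of "{x}"] that fin by (auto intro: finite_subset)
      have "generate G {b} \<subseteq> generate G {a}"
        unfolding a(2) using ac pow_in_generate[OF ac] by (intro generate_subgroup_incl generate_is_subgroup) auto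
      then have "generate G {b} = generate G {a}"
        using card_subset_eq[OF fing[OF ac]] generate_pow_card[OF ac] generate_pow_card[OF bc] ordba by simp
      moreover have "generate G {b} \<subseteq> generate G {c}" using bg subc by (intro generate_subgroup_incl) auto
      moreover have "a \<in> generate G {a}" by (rule generate.incl) simp
      ultimately have ag: "a \<in> generate G {c}" by blast
      have "c \<in> generate G {c}" by (rule generate.incl) simp
      then have "inv a \<otimes> c \<in> generate G {c}" using ag subc by (simp add: subgroup.m_closed subgroup.m_inv_closed)
      then have ug: "u \<in> generate G {c}" using ac uc by (simp add: c_def)
      have div: "ord x dvd ord c" if "x \<in> generate G {c}" "x \<in> carrier G" for x
      proof -
        obtain k :: nat where k: "x = c [^] k" using mem_generateE[OF fin cc \<open>x \<in> generate G {c}\<close>] .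
        have "x [^] ord c = (c [^] ord c) [^] k" unfolding k nat_pow_pow[OF cc] by (simp add: mult.commute)
        then have "x [^] ord c = \<one>" using cc by simp
        then show ?thesis using pow_eq_id[OF that(2)] by blast
      qed
      have "ord a * p dvd ord c" using div[OF ag ac] div[OF ug uc] cop u(2) by (simp add: divides_mult)
      moreover have "ord c > 0" using ord_ge_1[OF fin cc] by simp
      ultimately have "ord a * p \<le> ord c" by (rule dvd_imp_le)
      then have "card H \<le> ord c" using HK cardK ordba by (simp add: mult.commute)
      then show ?thesis using big[OF cH] cH by blast
    qed
  qed
qed

end

section \<open>Conjugate centralisers\<close>

context group
begin

definition centralizer_in :: "'a set \<Rightarrow> 'a \<Rightarrow> 'a set" where
  "centralizer_in H g = H \<inter> centralizer g"

definition center_of :: "'a set \<Rightarrow> 'a set" where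
  "center_of H = {z \<in> H. \<forall>h\<in>H. z \<otimes> h = h \<otimes> z}"

text \<open>The normaliser of \<open>centralizer_in H g\<close> in \<open>H\<close>, since conjugation by \<open>h\<close> carries
  the centraliser of \<open>g\<close> to that of \<open>h \<otimes> g \<otimes> inv h\<close>.\<close>

definition normalizer_in :: "'a set \<Rightarrow> 'a \<Rightarrow> 'a set" where
  "normalizer_in H g = {h \<in> H. centralizer_in H (h \<otimes> g \<otimes> inv h) = centralizer_in H g}"

lemma ord_dvd_card_subgroup:
  assumes "finite (carrier G)" "subgroup C G" "x \<in> C"
  shows "ord x dvd card C"
proof -
  interpret C: group "G\<lparr>carrier := C\<rparr>" using assms(2) by (rule subgroup_imp_group)
  have xc: "x \<in> carrier G" using assms subgroup.mem_carrier by metis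
  have "generate G {x} \<subseteq> C" using assms by (intro generate_subgroup_incl) auto
  moreover have "subgroup (generate G {x}) G" using xc by (intro generate_is_subgroup) auto
  ultimately have "subgroup (generate G {x}) (G\<lparr>carrier := C\<rparr>)" using assms subgroup_incl by blast
  from C.lagrange[OF this] have "card (generate G {x}) dvd card C" by (simp add: order_def) (metis dvd_triv_right)
  then show ?thesis using generate_pow_card[OF xc] by simp
qed

lemma card_subgroup_dvd:
  assumes "subgroup A G" "subgroup B G" "A \<subseteq> B"
  shows "card A dvd card B"
proof -
  interpret B: group "G\<lparr>carrier := B\<rparr>" using assms(2) by (rule subgroup_imp_group)
  have "subgroup A (G\<lparr>carrier := B\<rparr>)" using assms subgroup_incl by blast
  from B.lagrange[OF this] show ?thesis by (simp add: order_def) (metis dvd_triv_right)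
qed

context
  fixes H assumes H: "subgroup H G" and fin: "finite (carrier G)"
begin

lemma mem_H: "h \<in> H \<Longrightarrow> h \<in> carrier G"
  using H by (rule subgroup.mem_carrier)

lemma H_mult: "a \<in> H \<Longrightarrow> b \<in> H \<Longrightarrow> a \<otimes> b \<in> H"
  using H by (rule subgroup.m_closed)

lemma H_inv: "a \<in> H \<Longrightarrow> inv a \<in> H"
  using H by (rule subgroup.m_inv_closed)

lemma finite_H: "finite H"
  using mem_H fin by (meson finite_subset subsetI)

lemma centralizer_in_iff: "x \<in> centralizer_in H g \<longleftrightarrow> x \<in> H \<and> x \<otimes> g = g \<otimes> x"
  using mem_H by (auto simp: centralizer_in_def centralizer_def)

lemma subgroup_centralizer_in: "g \<in> H \<Longrightarrow> subgroup (centralizer_in H g) G"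
  unfolding centralizer_in_def by (rule subgroups_Inter_pair[OF H subgroup_centralizer[OF mem_H]])

lemma conj_closed: "h \<in> H \<Longrightarrow> x \<in> H \<Longrightarrow> h \<otimes> x \<otimes> inv h \<in> H"
  using H_mult H_inv by blast

lemma conj_centralizer_in_iff:
  assumes h: "h \<in> H" and x: "x \<in> H" and v: "v \<in> H"
  shows "h \<otimes> v \<otimes> inv h \<in> centralizer_in H (h \<otimes> x \<otimes> inv h) \<longleftrightarrow> v \<in> centralizer_in H x"
proof -
  have c: "h \<in> carrier G" "x \<in> carrier G" "v \<in> carrier G" using assms mem_H by auto
  have "(h \<otimes> v \<otimes> inv h) \<otimes> (h \<otimes> x \<otimes> inv h) = h \<otimes> (v \<otimes> x) \<otimes> inv h"
    "(h \<otimes> x \<otimes> inv h) \<otimes> (h \<otimes> v \<otimes> inv h) = h \<otimes> (x \<otimes> v) \<otimes> inv h" using c by (simp_all add: m_assoc)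
  moreover have "h \<otimes> (v \<otimes> x) \<otimes> inv h = h \<otimes> (x \<otimes> v) \<otimes> inv h \<longleftrightarrow> v \<otimes> x = x \<otimes> v" using c by simp
  ultimately show ?thesis using conj_closed[OF h v] v by (simp add: centralizer_in_iff)
qed

lemma conj_conj:
  assumes "h \<in> H" "x \<in> H"
  shows "h \<otimes> (inv h \<otimes> x \<otimes> inv (inv h)) \<otimes> inv h = x" "inv h \<otimes> (h \<otimes> x \<otimes> inv h) \<otimes> inv (inv h) = x"
  using assms mem_H by (simp_all add: m_assoc)

lemma centralizer_in_conj_cong:
  assumes "h \<in> H" "x \<in> H" "y \<in> H" "centralizer_in H x = centralizer_in H y"
  shows "centralizer_in H (h \<otimes> x \<otimes> inv h) = centralizer_in H (h \<otimes> y \<otimes> inv h)"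
proof -
  have "v \<in> centralizer_in H (h \<otimes> x \<otimes> inv h) \<longleftrightarrow> inv h \<otimes> v \<otimes> inv (inv h) \<in> centralizer_in H x"
    if "v \<in> H" "x \<in> H" for v x
    using conj_centralizer_in_iff[OF assms(1) that(2), of "inv h \<otimes> v \<otimes> inv (inv h)"]
      conj_closed[OF H_inv[OF assms(1)] that(1)] conj_conj(1)[OF assms(1) that(1)] by simp
  then show ?thesis using assms by (metis centralizer_in_iff subsetI subset_antisym)
qed

lemma center_of_conj:
  assumes "h \<in> H" "x \<in> H" "h \<otimes> x \<otimes> inv h \<in> center_of H"
  shows "x \<in> center_of H"
proof -
  have "(h \<otimes> x \<otimes> inv h) \<otimes> h = h \<otimes> (h \<otimes> x \<otimes> inv h)" using assms by (simp add: center_of_def)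
  then have "h \<otimes> x = h \<otimes> (h \<otimes> x \<otimes> inv h)" using assms mem_H by (simp add: m_assoc)
  then have "x = h \<otimes> x \<otimes> inv h" using assms(1,2) mem_H by simp
  then show ?thesis using assms(3) by simp
qed

lemma subgroup_normalizer_in:
  assumes g: "g \<in> H"
  shows "subgroup (normalizer_in H g) G"
proof (rule subgroup_of_finite_closed[OF fin])
  show "normalizer_in H g \<subseteq> carrier G" using mem_H by (auto simp: normalizer_in_def)
  have "\<one> \<in> normalizer_in H g" using g mem_H subgroup.one_closed[OF H] by (simp add: normalizer_in_def)
  then show "normalizer_in H g \<noteq> {}" by blast
  fix h k assume "h \<in> normalizer_in H g" "k \<in> normalizer_in H g"
  then have hk: "h \<in> H" "centralizer_in H (h \<otimes> g \<otimes> inv h) = centralizer_in H g"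
    "k \<in> H" "centralizer_in H (k \<otimes> g \<otimes> inv k) = centralizer_in H g" by (auto simp: normalizer_in_def)
  have "(h \<otimes> k) \<otimes> g \<otimes> inv (h \<otimes> k) = h \<otimes> (k \<otimes> g \<otimes> inv k) \<otimes> inv h"
    using hk g mem_H by (simp add: inv_mult_group m_assoc)
  then have "centralizer_in H ((h \<otimes> k) \<otimes> g \<otimes> inv (h \<otimes> k)) = centralizer_in H (h \<otimes> g \<otimes> inv h)"
    using centralizer_in_conj_cong[OF hk(1) conj_closed[OF hk(3) g] g hk(4)] by simp
  then show "h \<otimes> k \<in> normalizer_in H g" using hk H_mult by (simp add: normalizer_in_def)
qed

lemma subgroup_center_of: "subgroup (center_of H) G"
proof (rule subgroup_of_finite_closed[OF fin])
  show "center_of H \<subseteq> carrier G" using mem_H by (auto simp: center_of_def)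
  show "center_of H \<noteq> {}" using subgroup.one_closed[OF H] mem_H by (auto simp: center_of_def)
  fix a b assume ab: "a \<in> center_of H" "b \<in> center_of H"
  then have abH: "a \<in> H" "b \<in> H" by (simp_all add: center_of_def)
  have "(a \<otimes> b) \<otimes> h = h \<otimes> (a \<otimes> b)" if "h \<in> H" for h
    using ab that by (intro commutes_mult mem_H abH) (simp_all add: center_of_def)
  then show "a \<otimes> b \<in> center_of H" using H_mult[OF abH] unfolding center_of_def by blast
qed

lemma centralizer_in_subset_normalizer_in:
  assumes "g \<in> H"
  shows "centralizer_in H g \<subseteq> normalizer_in H g"
proof
  fix h assume "h \<in> centralizer_in H g"
  then have h: "h \<in> H" "h \<otimes> g = g \<otimes> h" by (auto simp: centralizer_in_iff)
  then have "h \<otimes> g \<otimes> inv h = g" using assms mem_H by (simp add: m_assoc)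
  then show "h \<in> normalizer_in H g" using h by (simp add: normalizer_in_def)
qed

context
  assumes abel: "\<And>g x y. g \<in> H - center_of H \<Longrightarrow> x \<in> centralizer_in H g \<Longrightarrow> y \<in> centralizer_in H g \<Longrightarrow> x \<otimes> y = y \<otimes> x"
begin

text \<open>With abelian centralisers commuting is transitive on noncentral elements, so different
  centralisers meet only in the centre.\<close>

lemma centralizer_in_eq:
  assumes "g \<in> H - center_of H" "x \<in> centralizer_in H g" "x \<notin> center_of H"
  shows "centralizer_in H x = centralizer_in H g"
proof -
  have x: "x \<in> H - center_of H" and gx: "g \<in> centralizer_in H x"
    using assms by (auto simp: centralizer_in_iff)
  have "y \<in> centralizer_in H x \<longleftrightarrow> y \<in> centralizer_in H g" if "y \<in> H" for y
    using abel[OF x _ gx, of y] abel[OF assms(1) _ assms(2), of y] that by (auto simp: centralizer_in_iff)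
  then show ?thesis by (metis centralizer_in_iff subsetI subset_antisym)
qed

text \<open>The union of the conjugates of \<open>centralizer_in H g\<close> without the centre. An
  element belongs to the conjugate by \<open>k\<close> exactly when it has the centraliser of
  \<open>k \<otimes> g \<otimes> inv k\<close>.\<close>

definition conj_class :: "'a \<Rightarrow> 'a set" where
  "conj_class g = {y \<in> H - center_of H. \<exists>k\<in>H. centralizer_in H y = centralizer_in H (k \<otimes> g \<otimes> inv k)}"

text \<open>The class is the image of the pairs \<open>(k, x)\<close>, with \<open>x\<close>
  noncentral in the centraliser of \<open>g\<close>, under conjugation of \<open>x\<close> by
  \<open>k\<close>. Every fibre has as many elements as the normaliser.\<close>

lemma card_conj_class:
  assumes g: "g \<in> H - center_of H"
  shows "card (conj_class g) * card (normalizer_in H g) = card H * (card (centralizer_in H g) - card (center_of H))"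
proof -
  let ?Z = "center_of H" and ?C = "centralizer_in H g" and ?N = "normalizer_in H g"
  define A where "A = H \<times> (?C - ?Z)"
  define f where "f = (\<lambda>(k, x). k \<otimes> x \<otimes> inv k)"
  have gH: "g \<in> H" using g by simp
  have C_eq: "centralizer_in H x = ?C" if "x \<in> ?C - ?Z" for x using centralizer_in_eq[OF g] that by simp
  have CH: "x \<in> H" if "x \<in> ?C" for x using that by (simp add: centralizer_in_iff)
  have finA: "finite A" unfolding A_def using finite_H by (auto simp: centralizer_in_def)
  have img: "f ` A = conj_class g"
  proof (intro equalityI subsetI)
    fix y assume "y \<in> f ` A"
    then obtain k x where kx: "k \<in> H" "x \<in> ?C - ?Z" "y = k \<otimes> x \<otimes> inv k" by (auto simp: A_def f_def)
    have xH: "x \<in> H" using kx CH by simp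
    have "y \<in> H" using conj_closed kx xH by simp
    moreover have "y \<notin> ?Z" using center_of_conj[OF kx(1) xH] kx by auto
    moreover have "centralizer_in H y = centralizer_in H (k \<otimes> g \<otimes> inv k)"
      unfolding kx(3) by (rule centralizer_in_conj_cong[OF kx(1) xH gH C_eq[OF kx(2)]])
    ultimately show "y \<in> conj_class g" using kx(1) by (auto simp: conj_class_def)
  next
    fix y assume "y \<in> conj_class g"
    then obtain k where k: "y \<in> H" "y \<notin> ?Z" "k \<in> H" "centralizer_in H y = centralizer_in H (k \<otimes> g \<otimes> inv k)"
      by (auto simp: conj_class_def)
    define x where "x = inv k \<otimes> y \<otimes> inv (inv k)"
    have xH: "x \<in> H" unfolding x_def using k H_inv by (intro conj_closed)
    have kx: "k \<otimes> x \<otimes> inv k = y" unfolding x_def using conj_conj(1) k by simp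
    have "y \<in> centralizer_in H y" using k(1) by (simp add: centralizer_in_iff)
    then have "y \<in> centralizer_in H (k \<otimes> g \<otimes> inv k)" unfolding k(4) .
    then have "x \<in> ?C" using conj_centralizer_in_iff[OF k(3) gH xH] kx by simp
    moreover have "x \<notin> ?Z"
    proof
      assume xZ: "x \<in> ?Z"
      then have "k \<otimes> x \<otimes> inv k = x \<otimes> k \<otimes> inv k" using k(3) by (simp add: center_of_def)
      also have "\<dots> = x" using mem_H[OF k(3)] mem_H[OF xH] by (simp add: m_assoc)
      finally have "k \<otimes> x \<otimes> inv k = x" .
      then show False using k(2) kx xZ by simp
    qed
    ultimately have "(k, x) \<in> A" using k(3) by (simp add: A_def)
    moreover have "y = f (k, x)" using kx by (simp add: f_def)
    ultimately show "y \<in> f ` A" by (rule rev_image_eqI)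
  qed
  have fiber: "card {a \<in> A. f a = y} = card ?N" if yA: "y \<in> f ` A" for y
  proof -
    obtain k0 x0 where k0: "k0 \<in> H" "x0 \<in> ?C - ?Z" "y = k0 \<otimes> x0 \<otimes> inv k0" using yA by (auto simp: A_def f_def)
    have x0H: "x0 \<in> H" using k0 CH by simp
    \<comment> \<open>Two pairs give the same \<open>y\<close> exactly when their first components
      differ by an element \<open>n\<close> of the normaliser, which then determines the second
      component.\<close>
    define F where "F n = (k0 \<otimes> n, inv n \<otimes> x0 \<otimes> inv (inv n))" for n
    have "{a \<in> A. f a = y} = F ` ?N"
    proof (intro equalityI subsetI)
      fix a assume "a \<in> {a \<in> A. f a = y}"
      then obtain k x where kx: "a = (k, x)" "k \<in> H" "x \<in> ?C - ?Z" "k \<otimes> x \<otimes> inv k = y" by (auto simp: A_def f_def)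
      have xH: "x \<in> H" using kx CH by simp
      define n where "n = inv k0 \<otimes> k"
      have nH: "n \<in> H" unfolding n_def using k0 kx H_mult H_inv by blast
      have kn: "k = k0 \<otimes> n" using k0 kx mem_H by (simp add: n_def)
      have "inv k0 \<otimes> (k \<otimes> x \<otimes> inv k) \<otimes> k0 = inv k0 \<otimes> (k0 \<otimes> x0 \<otimes> inv k0) \<otimes> k0" using kx k0 by simp
      then have x0: "n \<otimes> x \<otimes> inv n = x0"
        using k0(1) kx(2) x0H xH mem_H by (simp add: n_def inv_mult_group m_assoc)
      have "centralizer_in H (n \<otimes> g \<otimes> inv n) = centralizer_in H (n \<otimes> x \<otimes> inv n)"
        using centralizer_in_conj_cong[OF nH xH gH C_eq[OF kx(3)]] by simp
      then have "n \<in> ?N" using x0 C_eq[OF k0(2)] nH by (simp add: normalizer_in_def)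
      moreover have "inv n \<otimes> x0 \<otimes> inv (inv n) = x" using conj_conj(2)[OF nH xH] x0 by simp
      ultimately show "a \<in> F ` ?N" unfolding kx(1) kn F_def by blast
    next
      fix a assume "a \<in> F ` ?N"
      then obtain n where n: "n \<in> ?N" "a = F n" by blast
      have nH: "n \<in> H" "centralizer_in H (n \<otimes> g \<otimes> inv n) = ?C" using n(1) by (auto simp: normalizer_in_def)
      let ?x = "inv n \<otimes> x0 \<otimes> inv (inv n)"
      have xH: "?x \<in> H" using nH x0H H_inv by (intro conj_closed)
      have nx: "n \<otimes> ?x \<otimes> inv n = x0" using conj_conj(1)[OF nH(1) x0H] .
      have "?x \<in> ?C" using conj_centralizer_in_iff[OF nH(1) gH xH] nx nH(2) k0(2) by simp
      moreover have "?x \<notin> ?Z" using center_of_conj[OF H_inv[OF nH(1)] x0H] k0(2) by blast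
      moreover have "k0 \<otimes> n \<in> H" using k0 nH H_mult by simp
      moreover have "(k0 \<otimes> n) \<otimes> ?x \<otimes> inv (k0 \<otimes> n) = k0 \<otimes> (n \<otimes> ?x \<otimes> inv n) \<otimes> inv k0"
        using mem_H[OF k0(1)] mem_H[OF nH(1)] mem_H[OF xH] by (simp only: inv_mult_group m_assoc m_closed inv_closed)
      ultimately show "a \<in> {a \<in> A. f a = y}" unfolding n(2) F_def nx using k0(3) by (simp add: A_def f_def)
    qed
    moreover have "inj_on F ?N"
      using mem_H k0(1) by (auto simp: inj_on_def F_def normalizer_in_def)
    ultimately show ?thesis by (simp add: card_image)
  qed
  have "card A = (\<Sum>y\<in>f ` A. card {a \<in> A. f a = y})"
    using sum.image_gen[OF finA, of "\<lambda>_. 1 :: nat" f] by simp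
  also have "\<dots> = card (conj_class g) * card ?N" using fiber img by simp
  also have "card A = card H * card (?C - ?Z)" by (simp add: A_def card_cartesian_product)
  also have "card (?C - ?Z) = card ?C - card ?Z"
  proof (rule card_Diff_subset)
    show "?Z \<subseteq> ?C" using gH by (auto simp: center_of_def centralizer_in_iff)
    then show "finite ?Z" using finite_H by (auto simp: centralizer_in_def intro: finite_subset)
  qed
  finally show ?thesis by simp
qed

lemma conj_class_disjoint:
  assumes g: "g \<in> H - center_of H" "g' \<in> H - center_of H" "g' \<notin> conj_class g"
  shows "conj_class g \<inter> conj_class g' = {}"
proof (rule ccontr)
  assume "\<not> ?thesis"
  then obtain y where "y \<in> conj_class g" "y \<in> conj_class g'" by blast
  then obtain k k' where k: "k \<in> H" "k' \<in> H" "centralizer_in H (k' \<otimes> g' \<otimes> inv k') = centralizer_in H (k \<otimes> g \<otimes> inv k)"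
    by (auto simp: conj_class_def)
  have gH: "g \<in> H" "g' \<in> H" using g by auto
  have "centralizer_in H (inv k' \<otimes> (k' \<otimes> g' \<otimes> inv k') \<otimes> inv (inv k')) = centralizer_in H (inv k' \<otimes> (k \<otimes> g \<otimes> inv k) \<otimes> inv (inv k'))"
    using k gH H_inv conj_closed by (intro centralizer_in_conj_cong) auto
  moreover have "inv k' \<otimes> (k \<otimes> g \<otimes> inv k) \<otimes> inv (inv k') = (inv k' \<otimes> k) \<otimes> g \<otimes> inv (inv k' \<otimes> k)"
    using k gH mem_H by (simp add: inv_mult_group m_assoc)
  ultimately have "centralizer_in H g' = centralizer_in H ((inv k' \<otimes> k) \<otimes> g \<otimes> inv (inv k' \<otimes> k))"
    using conj_conj(2)[OF k(2) gH(2)] by simp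
  moreover have "inv k' \<otimes> k \<in> H" using k H_mult H_inv by blast
  ultimately show False using g by (auto simp: conj_class_def)
qed

text \<open>If no centraliser is normal in \<open>H\<close>, then the conjugates of a self-normalising centraliser cover at least
  half of \<open>H\<close>, and the conjugates of any other one at least a third. Three disjoint classes cannot exist,
  but two do not suffice.\<close>

lemma exists_normal_centralizer:
  assumes nonab: "center_of H \<noteq> H"
    and norm: "\<And>g. g \<in> H - center_of H \<Longrightarrow> normalizer_in H g \<noteq> H \<Longrightarrow> normalizer_in H g \<noteq> centralizer_in H g \<Longrightarrow>
      card (normalizer_in H g) = 2 * card (centralizer_in H g) \<and> odd (card (centralizer_in H g))"
  shows "\<exists>g\<in>H - center_of H. normalizer_in H g = H"
proof (rule ccontr)
  assume "\<not> ?thesis"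
  then have nn: "normalizer_in H g \<noteq> H" if "g \<in> H - center_of H" for g using that by blast
  let ?Z = "center_of H" and ?C = "centralizer_in H" and ?N = "normalizer_in H" and ?U = conj_class
  define h where "h = card H"
  define z where "z = card ?Z"
  have ZH: "?Z \<subseteq> H" by (auto simp: center_of_def)
  have finZ: "finite ?Z" using ZH finite_H finite_subset by blast
  have z1: "1 \<le> z" unfolding z_def using finZ subgroup.one_closed[OF subgroup_center_of] by (simp add: Suc_le_eq card_gt_0_iff) blast
  have cardHZ: "card (H - ?Z) = h - z" "z \<le> h"
    using ZH finZ finite_H by (simp_all add: card_Diff_subset card_mono h_def z_def)
  have ZC: "?Z \<subseteq> ?C g" if "g \<in> H - ?Z" for g using that by (auto simp: center_of_def centralizer_in_iff)
  have finC: "finite (?C g)" for g using finite_H by (simp add: centralizer_in_def)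
  have zc: "z dvd card (?C g)" "z < card (?C g)" if g: "g \<in> H - ?Z" for g
  proof -
    show "z dvd card (?C g)" unfolding z_def
      using g by (intro card_subgroup_dvd subgroup_center_of subgroup_centralizer_in ZC) auto
    have "g \<in> ?C g" using g by (simp add: centralizer_in_iff)
    then have "?Z \<subset> ?C g" using ZC[OF g] g by blast
    then show "z < card (?C g)" unfolding z_def using finC by (rule psubset_card_mono[rotated])
  qed
  have c2: "2 * z \<le> card (?C g)" if g: "g \<in> H - ?Z" for g
  proof -
    obtain d where d: "card (?C g) = z * d" using zc(1)[OF g] by (auto simp: dvd_def)
    have "d \<noteq> 0" "d \<noteq> 1" using zc(2)[OF g] d by auto
    then have "2 \<le> d" by simp
    then show ?thesis using d by (metis mult.commute mult_le_mono2)
  qed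
  have c3: "3 * z \<le> card (?C g)" if g: "g \<in> H - ?Z" and ne: "card (?C g) \<noteq> 2 * z" for g
  proof -
    obtain d where d: "card (?C g) = z * d" using zc(1)[OF g] by (auto simp: dvd_def)
    have "d \<noteq> 0" "d \<noteq> 1" "d \<noteq> 2" using zc(2)[OF g] d ne by auto
    then have "3 \<le> d" by simp
    then show ?thesis using d by (metis mult.commute mult_le_mono2)
  qed
  have U: "?U g \<subseteq> H - ?Z" for g by (auto simp: conj_class_def)
  have finU: "finite (?U g)" for g using U finite_H by (meson finite_Diff finite_subset)
  have one: "card (?U g) * card (?C g) = h * (card (?C g) - z)" if "g \<in> H - ?Z" "?N g = ?C g" for g
    using card_conj_class[OF that(1)] that(2) by (simp add: h_def z_def)
  have two: "card (?U g) * (2 * card (?C g)) = h * (card (?C g) - z)" "odd (card (?C g))" if "g \<in> H - ?Z" "?N g \<noteq> ?C g" for g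
    using card_conj_class[OF that(1)] norm[OF that(1) nn[OF that(1)] that(2)] by (simp_all add: h_def z_def)
  have half: "h \<le> 2 * card (?U g)" if g: "g \<in> H - ?Z" "?N g = ?C g" for g
  proof -
    have "card (?C g) \<le> 2 * (card (?C g) - z)" using c2[OF g(1)] by linarith
    then have "h * card (?C g) \<le> h * (2 * (card (?C g) - z))" by (rule mult_le_mono2)
    also have "\<dots> = (2 * card (?U g)) * card (?C g)" using one[OF g] by simp
    finally show ?thesis using zc(2)[OF g(1)] by simp
  qed
  have third: "h \<le> 3 * card (?U g)" if g: "g \<in> H - ?Z" for g
  proof (cases "?N g = ?C g")
    case True then show ?thesis using half[OF g] by simp
  next
    case False
    \<comment> \<open>Odd order excludes \<open>2 * z\<close> and thus raises the lower bound to
      \<open>3 * z\<close>; this compensates in part for the factor 2 in the index of the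
      normaliser.\<close>
    have "card (?C g) \<noteq> 2 * z" using two(2)[OF g False] by auto
    then have "2 * card (?C g) \<le> 3 * (card (?C g) - z)" using c3[OF g] by linarith
    then have "h * (2 * card (?C g)) \<le> h * (3 * (card (?C g) - z))" by (rule mult_le_mono2)
    also have "\<dots> = 3 * (h * (card (?C g) - z))" by simp
    also have "\<dots> = (3 * card (?U g)) * (2 * card (?C g))" unfolding two(1)[OF g False, symmetric] by simp
    finally show ?thesis using zc(2)[OF g] by simp
  qed
  have "\<exists>g\<in>H - ?Z. ?N g = ?C g"
  proof -
    obtain g where g: "g \<in> H - ?Z" using nonab ZH by blast
    show ?thesis
    proof (cases "?N g = ?C g")
      case False
      note n = norm[OF g nn[OF g] False]
      \<comment> \<open>The normaliser has even order and the centraliser odd order, so there is an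
        involution \<open>t\<close> outside. Its own centraliser has even order and must therefore
        be self-normalising.\<close>
      have "2 dvd card (?N g)" using n by simp
      then obtain t where t: "t \<in> ?N g" "ord t = 2"
        using exists_prime_order[OF fin subgroup_normalizer_in two_is_prime_nat] g by blast
      have tH: "t \<in> H" using t by (simp add: normalizer_in_def)
      have "t \<notin> ?C g"
        using ord_dvd_card_subgroup[OF fin subgroup_centralizer_in, of g t] g n t(2) by auto
      then have tZ: "t \<in> H - ?Z" using tH ZC[OF g] by blast
      have "t \<in> ?C t" using tH by (simp add: centralizer_in_iff)
      then have "even (card (?C t))"
        using ord_dvd_card_subgroup[OF fin subgroup_centralizer_in[OF tH]] t(2) by metis
      then show ?thesis using two(2)[OF tZ] tZ by blast
    qed (use g in blast)
  qed
  then obtain g1 where g1: "g1 \<in> H - ?Z" "?N g1 = ?C g1" by blast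
  define u1 where "u1 = card (?U g1)"
  define c1 where "c1 = card (?C g1)"
  have "?C g1 \<subset> H" using nn[OF g1(1)] g1(2) by (auto simp: centralizer_in_def)
  then have c1h: "c1 < h" unfolding c1_def h_def using finite_H by (rule psubset_card_mono[rotated])
  have zc1: "z < c1" using zc(2)[OF g1(1)] by (simp add: c1_def)
  have e1: "u1 * c1 + h * z = h * c1"
    using one[OF g1] zc1 unfolding u1_def[symmetric] c1_def[symmetric]
    by (metis distrib_left le_add_diff_inverse2 less_imp_le_nat)
  have "(u1 + z) * c1 < h * c1"
  proof -
    have "z * c1 < h * z" using c1h z1 by (simp add: mult.commute)
    then show ?thesis unfolding distrib_right using e1 by linarith
  qed
  then have u1h: "u1 + z < h" by simp
  have ex: "\<exists>g\<in>H - ?Z. g \<notin> A" if "finite A" "card A < h - z" for A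
  proof (rule ccontr)
    assume "\<not> ?thesis"
    then have "card (H - ?Z) \<le> card A" using that(1) by (intro card_mono) auto
    then show False using that(2) cardHZ by simp
  qed
  have "card (?U g1) < h - z" using u1h by (simp add: u1_def)
  then obtain g2 where g2: "g2 \<in> H - ?Z" "g2 \<notin> ?U g1" using ex[OF finU] by blast
  define u2 where "u2 = card (?U g2)"
  have d12: "?U g1 \<inter> ?U g2 = {}" by (rule conj_class_disjoint[OF g1(1) g2])
  have s12: "card (?U g1 \<union> ?U g2) = u1 + u2"
    unfolding u1_def u2_def using d12 finU by (intro card_Un_disjoint) auto
  have "card (?U g1 \<union> ?U g2) \<le> h - z"
    unfolding cardHZ(1)[symmetric] using U finite_H by (intro card_mono) auto
  then have le12: "u1 + u2 + z \<le> h" using s12 cardHZ(2) by simp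
  have h1: "h \<le> 2 * u1" using half[OF g1] by (simp add: u1_def)
  \<comment> \<open>Two disjoint classes with half of the elements each would leave no room for the
    centre.\<close>
  have n2: "?N g2 \<noteq> ?C g2"
  proof
    assume "?N g2 = ?C g2"
    then have "h \<le> 2 * u2" using half[OF g2(1)] by (simp add: u2_def)
    then show False using h1 le12 z1 by linarith
  qed
  have h2: "h \<le> 3 * u2" using third[OF g2(1)] by (simp add: u2_def)
  \<comment> \<open>A centraliser of order at least \<open>3 * z\<close> would make the first class
    cover two thirds, and with the second third no room would be left for the centre.\<close>
  have "c1 = 2 * z"
  proof (rule ccontr)
    assume "c1 \<noteq> 2 * z"
    then have "3 * z \<le> c1" using c3[OF g1(1)] by (simp add: c1_def)
    then have "h * (3 * z) \<le> h * c1" by (rule mult_le_mono2)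
    then have "3 * (h * z) \<le> h * c1" by (simp only: mult.left_commute)
    then have "2 * (h * c1) \<le> 3 * (u1 * c1)" using e1 by linarith
    then have "(2 * h) * c1 \<le> (3 * u1) * c1" by (simp only: mult.assoc)
    then have "2 * h \<le> 3 * u1" using zc1 by (simp only: mult_le_cancel2)
    then show False using h2 le12 z1 by linarith
  qed
  define c2 where "c2 = card (?C g2)"
  have zc2: "z < c2" using zc(2)[OF g2(1)] by (simp add: c2_def)
  have e2: "2 * u2 * c2 + h * z = h * c2"
    using two(1)[OF g2(1) n2] zc2 unfolding u2_def[symmetric] c2_def[symmetric]
    by (metis (no_types, lifting) add_mult_distrib2 le_add_diff_inverse2 less_imp_le_nat mult.assoc mult.commute)
  have "?N g2 \<subset> H" using nn[OF g2(1)] by (auto simp: normalizer_in_def)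
  then have "card (?N g2) < h" unfolding h_def using finite_H by (rule psubset_card_mono[rotated])
  then have c2h: "2 * c2 < h" using norm[OF g2(1) nn[OF g2(1)] n2] by (simp add: c2_def)
  have "(2 * u2 + 2 * z) * c2 < h * c2"
  proof -
    have "z * (2 * c2) < z * h" by (rule mult_less_mono2) (use c2h z1 in simp_all)
    moreover have "(2 * u2 + 2 * z) * c2 = 2 * u2 * c2 + z * (2 * c2)" by (simp add: distrib_right)
    moreover have "z * h = h * z" by (rule mult.commute)
    ultimately show ?thesis using e2 by linarith
  qed
  then have u2h: "2 * u2 + 2 * z < h" by simp
  have "u1 * (2 * z) + h * z = h * (2 * z)" using e1 \<open>c1 = 2 * z\<close> by simp
  then have "z * (2 * u1 + h) = z * (2 * h)" by (simp add: algebra_simps)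
  \<comment> \<open>Now the first class is exactly half of \<open>H\<close>, and the second together
    with the centre is less than half. So a third class exists, and \<open>1/2 + 1/3 + 1/3\<close>
    exceeds 1.\<close>
  then have u1eq: "2 * u1 = h" using z1 by simp
  have "u1 + u2 < h - z" using u1eq u2h by linarith
  then obtain g3 where g3: "g3 \<in> H - ?Z" "g3 \<notin> ?U g1 \<union> ?U g2"
    using ex[of "?U g1 \<union> ?U g2"] s12 finU by auto
  have d3: "(?U g1 \<union> ?U g2) \<inter> ?U g3 = {}"
    using conj_class_disjoint[OF g1(1) g3(1)] conj_class_disjoint[OF g2(1) g3(1)] g3(2) by blast
  have "card ((?U g1 \<union> ?U g2) \<union> ?U g3) = u1 + u2 + card (?U g3)"
    unfolding s12[symmetric] using d3 finU by (intro card_Un_disjoint) auto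
  moreover have "card ((?U g1 \<union> ?U g2) \<union> ?U g3) \<le> h - z"
    unfolding cardHZ(1)[symmetric] using U finite_H by (intro card_mono) auto
  ultimately show False using u1eq h2 third[OF g3(1)] z1 cardHZ(2) by linarith
qed

end

end

end

section \<open>Dihedral groups of twice odd order\<close>

text \<open>Excluding \<open>c = \<one>\<close> guarantees a trivial centre.\<close>

definition (in group) odd_dihedral_pair :: "'a \<Rightarrow> 'a \<Rightarrow> bool" where
  "odd_dihedral_pair c t \<longleftrightarrow> c \<in> carrier G \<and> t \<in> carrier G \<and> odd (ord c) \<and> c \<noteq> \<one> \<and>
     t \<otimes> t = \<one> \<and> t \<otimes> c \<otimes> t = inv c"

definition (in group) odd_dihedral :: "'a set \<Rightarrow> bool" where
  "odd_dihedral H \<longleftrightarrow> (\<exists>c t. odd_dihedral_pair c t \<and> H = generate G {c} \<union> (\<lambda>x. t \<otimes> x) ` generate G {c})"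

context group
begin

lemma subgroup_generate_single: "c \<in> carrier G \<Longrightarrow> subgroup (generate G {c}) G"
  by (intro generate_is_subgroup) auto

lemma ord_dvd_of_mem_generate:
  assumes "finite (carrier G)" "c \<in> carrier G" "x \<in> generate G {c}"
  shows "ord x dvd ord c"
  using ord_dvd_card_subgroup[OF assms(1) subgroup_generate_single[OF assms(2)] assms(3)]
    generate_pow_card[OF assms(2)] by simp

lemma generate_comm:
  assumes "finite (carrier G)" "c \<in> carrier G" "x \<in> generate G {c}" "y \<in> generate G {c}"
  shows "x \<otimes> y = y \<otimes> x"
proof -
  obtain k l :: nat where "x = c [^] k" "y = c [^] l" using mem_generateE[OF assms(1,2)] assms(3,4) by metis
  then show ?thesis using assms(2) by (simp add: nat_pow_mult add.commute)
qed

context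
  fixes c t assumes fin: "finite (carrier G)" and ct: "odd_dihedral_pair c t"
begin

lemma pair_closed: "c \<in> carrier G" "t \<in> carrier G"
  using ct by (auto simp: odd_dihedral_pair_def)

lemma mem_generate_closed: "x \<in> generate G {c} \<Longrightarrow> x \<in> carrier G"
  using subgroup.mem_carrier[OF subgroup_generate_single[OF pair_closed(1)]] .

lemma t_eq_inv: "inv t = t"
  using ct by (intro inv_equality) (auto simp: odd_dihedral_pair_def)

lemma t_cancel: "x \<in> carrier G \<Longrightarrow> t \<otimes> (t \<otimes> x) = x"
  using cancel_inv(1)[OF pair_closed(2)] t_eq_inv by simp

lemma reflection_inverts:
  assumes "x \<in> generate G {c}"
  shows "t \<otimes> x \<otimes> t = inv x"
proof -
  obtain k :: nat where k: "x = c [^] k" using mem_generateE[OF fin pair_closed(1) assms] .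
  have "t \<otimes> x \<otimes> t = (t \<otimes> c \<otimes> inv t) [^] k"
    unfolding k using conj_pow[OF pair_closed(2,1), of k] t_eq_inv by simp
  also have "\<dots> = (inv c) [^] k" using ct t_eq_inv by (simp add: odd_dihedral_pair_def)
  also have "\<dots> = inv x" unfolding k using pair_closed(1) by (simp add: nat_pow_inv)
  finally show ?thesis .
qed

lemma odd_generate:
  assumes "x \<in> generate G {c}" "x \<otimes> x = \<one>"
  shows "x = \<one>"
proof -
  have "odd (ord x)" using ord_dvd_of_mem_generate[OF fin pair_closed(1) assms(1)] ct
    by (auto simp: odd_dihedral_pair_def)
  then show ?thesis using square_one_of_odd mem_generate_closed assms by blast
qed

lemma commutes_t:
  assumes "x \<in> generate G {c}" "t \<otimes> x = x \<otimes> t"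
  shows "x = \<one>"
proof -
  have xc: "x \<in> carrier G" using assms mem_generate_closed by simp
  have "inv x = x \<otimes> t \<otimes> t" using reflection_inverts[OF assms(1)] assms(2) by simp
  also have "\<dots> = x" using xc pair_closed(2) ct by (simp add: m_assoc odd_dihedral_pair_def)
  finally have "x \<otimes> x = \<one>" using xc by (metis r_inv)
  then show ?thesis using odd_generate assms(1) by blast
qed

lemma c_mem: "c \<in> generate G {c}"
  by (rule generate.incl) simp

lemma t_not_mem: "t \<notin> generate G {c}"
proof
  assume "t \<in> generate G {c}"
  then have "t \<otimes> c = c \<otimes> t" using generate_comm[OF fin pair_closed(1) _ c_mem] by blast
  then show False using commutes_t[OF c_mem] ct by (simp add: odd_dihedral_pair_def)
qed

lemma reflection_commutes:
  assumes x: "x \<in> generate G {c}" and y: "y \<in> generate G {c}" and comm: "(t \<otimes> x) \<otimes> y = y \<otimes> (t \<otimes> x)"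
  shows "y = \<one>"
proof -
  have c: "x \<in> carrier G" "y \<in> carrier G" using x y mem_generate_closed by auto
  have "(t \<otimes> y) \<otimes> x = (t \<otimes> x) \<otimes> y" using generate_comm[OF fin pair_closed(1) x y] c pair_closed(2) by (simp add: m_assoc)
  also have "\<dots> = (y \<otimes> t) \<otimes> x" unfolding comm using c pair_closed(2) by (simp add: m_assoc)
  finally have "t \<otimes> y = y \<otimes> t" using c pair_closed(2) by simp
  then show ?thesis using commutes_t[OF y] by simp
qed

lemma center_trivial:
  assumes g: "g \<in> generate G {c} \<union> (\<lambda>x. t \<otimes> x) ` generate G {c}" and gc: "g \<otimes> c = c \<otimes> g" and gt: "g \<otimes> t = t \<otimes> g"
  shows "g = \<one>"
  using g
proof
  assume "g \<in> generate G {c}"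
  then show ?thesis using commutes_t gt by simp
next
  assume "g \<in> (\<lambda>x. t \<otimes> x) ` generate G {c}"
  then obtain x where x: "x \<in> generate G {c}" "g = t \<otimes> x" by blast
  then have "c = \<one>" using reflection_commutes[OF x(1) c_mem] gc by simp
  then show ?thesis using ct by (simp add: odd_dihedral_pair_def)
qed

end

text \<open>The trivial centre is what tells the two alternatives of the classification apart: a
  subgroup with a nontrivial element in its own centre has to be cyclic.\<close>

lemma odd_dihedral_center:
  assumes "finite (carrier G)" "odd_dihedral H" "g \<in> H" "\<And>h. h \<in> H \<Longrightarrow> g \<otimes> h = h \<otimes> g"
  shows "g = \<one>"
proof -
  obtain c t where ct: "odd_dihedral_pair c t" and H: "H = generate G {c} \<union> (\<lambda>x. t \<otimes> x) ` generate G {c}"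
    using assms(2) by (auto simp: odd_dihedral_def)
  note [simp] = pair_closed[OF assms(1) ct]
  have "c \<in> H" unfolding H using c_mem[OF assms(1) ct] by blast
  moreover have "t = t \<otimes> \<one>" by simp
  then have "t \<in> H" unfolding H using generate.one by blast
  ultimately show ?thesis using center_trivial[OF assms(1) ct] assms(3,4) unfolding H by blast
qed

text \<open>The element \<open>g\<close> is a rotation. If it were a reflection, its conjugate
  \<open>g \<otimes> (inv c \<otimes> inv c)\<close> by \<open>c\<close> would lie in the abstractly
  equal centraliser and commute with \<open>g\<close>, forcing the square of \<open>inv c\<close> to
  be 1 against odd order. Then the centraliser is the whole rotation group, which has odd order and
  index two.\<close>

lemma odd_dihedral_normalizer:
  assumes fin: "finite (carrier G)" and H: "subgroup H G" and g: "g \<in> H - center_of H"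
    and N: "odd_dihedral (normalizer_in H g)"
  shows "card (normalizer_in H g) = 2 * card (centralizer_in H g) \<and> odd (card (centralizer_in H g))"
proof -
  let ?N = "normalizer_in H g" and ?C = "centralizer_in H g"
  obtain c t where ct: "odd_dihedral_pair c t" and N_eq: "?N = generate G {c} \<union> (\<lambda>x. t \<otimes> x) ` generate G {c}"
    using N by (auto simp: odd_dihedral_def)
  have cc: "c \<in> carrier G" "t \<in> carrier G" using pair_closed[OF fin ct] by auto
  have gH: "g \<in> H" using g by simp
  have g1: "g \<noteq> \<one>"
  proof
    assume "g = \<one>"
    then have "g \<in> center_of H" using gH mem_H[OF H fin] by (simp add: center_of_def)
    then show False using g by simp
  qed
  have CN: "?C \<subseteq> ?N" using centralizer_in_subset_normalizer_in[OF H fin gH] .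
  have gC: "g \<in> ?C" using gH by (simp add: centralizer_in_iff[OF H fin])
  have iff: "x \<in> ?C \<longleftrightarrow> x \<in> H \<and> x \<otimes> g = g \<otimes> x" for x by (rule centralizer_in_iff[OF H fin])
  have NH: "?N \<subseteq> H" by (auto simp: normalizer_in_def)
  have grot: "g \<in> generate G {c}"
  proof (rule ccontr)
    assume "g \<notin> generate G {c}"
    then obtain x where x: "x \<in> generate G {c}" "g = t \<otimes> x" using gC CN N_eq by blast
    have xc: "x \<in> carrier G" using x mem_generate_closed[OF fin ct] by simp
    have "c \<in> ?N" unfolding N_eq using c_mem[OF fin ct] by blast
    then have cH: "c \<in> H" and "centralizer_in H (c \<otimes> g \<otimes> inv c) = ?C" by (auto simp: normalizer_in_def)
    have "c \<otimes> g \<otimes> inv c \<in> centralizer_in H (c \<otimes> g \<otimes> inv c)"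
      using conj_closed[OF H fin cH gH] centralizer_in_iff[OF H fin] by blast
    then have yC: "c \<otimes> g \<otimes> inv c \<in> ?C" using \<open>centralizer_in H (c \<otimes> g \<otimes> inv c) = ?C\<close> by simp
    have ct': "c \<otimes> t = t \<otimes> inv c"
    proof -
      have "t \<otimes> (t \<otimes> c \<otimes> t) = c \<otimes> t" using t_cancel[OF fin ct, of "c \<otimes> t"] cc by (simp add: m_assoc)
      then show ?thesis using reflection_inverts[OF fin ct c_mem[OF fin ct]] by simp
    qed
    have icx: "inv c \<otimes> x = x \<otimes> inv c"
      using generate_comm[OF fin cc(1) c_mem[OF fin ct] x(1)] cc xc commutes_inv[of c x] by simp
    have "c \<otimes> g \<otimes> inv c = (c \<otimes> t) \<otimes> x \<otimes> inv c" unfolding x(2) using cc xc by (simp add: m_assoc)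
    also have "\<dots> = t \<otimes> (inv c \<otimes> x) \<otimes> inv c" unfolding ct' using cc xc by (simp add: m_assoc)
    also have "\<dots> = g \<otimes> (inv c \<otimes> inv c)" unfolding icx x(2) using cc xc by (simp add: m_assoc)
    finally have y: "c \<otimes> g \<otimes> inv c = g \<otimes> (inv c \<otimes> inv c)" .
    have gc: "g \<in> carrier G" using gH mem_H[OF H fin] by simp
    have "g \<otimes> (inv c \<otimes> inv c) \<otimes> g = g \<otimes> (g \<otimes> (inv c \<otimes> inv c))" using yC unfolding y iff by simp
    then have "g \<otimes> ((inv c \<otimes> inv c) \<otimes> g) = g \<otimes> (g \<otimes> (inv c \<otimes> inv c))" using gc cc by (simp add: m_assoc)
    then have "(t \<otimes> x) \<otimes> (inv c \<otimes> inv c) = (inv c \<otimes> inv c) \<otimes> (t \<otimes> x)" using gc cc x(2) by simp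
    moreover have "inv c \<otimes> inv c \<in> generate G {c}"
      using subgroup_generate_single[OF cc(1)] c_mem[OF fin ct] by (simp add: subgroup.m_closed subgroup.m_inv_closed)
    ultimately have "inv c \<otimes> inv c = \<one>" using reflection_commutes[OF fin ct x(1)] by blast
    moreover have "inv c \<in> generate G {c}"
      using subgroup_generate_single[OF cc(1)] c_mem[OF fin ct] by (simp add: subgroup.m_inv_closed)
    ultimately have "inv c = \<one>" using odd_generate[OF fin ct] by blast
    then show False using ct cc by (simp add: odd_dihedral_pair_def)
  qed
  have "?C = generate G {c}"
  proof (intro equalityI subsetI)
    fix y assume y: "y \<in> generate G {c}"
    then have "y \<in> H" using N_eq NH by blast
    then show "y \<in> ?C" using iff generate_comm[OF fin cc(1) y grot] by simp
  next
    fix y assume yC: "y \<in> ?C"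
    show "y \<in> generate G {c}"
    proof (rule ccontr)
      assume "y \<notin> generate G {c}"
      then obtain x where x: "x \<in> generate G {c}" "y = t \<otimes> x" using yC CN N_eq by blast
      then have "g = \<one>" using reflection_commutes[OF fin ct x(1) grot] yC iff by simp
      then show False using g1 by simp
    qed
  qed
  moreover have "card ?N = 2 * card (generate G {c})"
  proof -
    have fing: "finite (generate G {c})" using mem_generate_closed[OF fin ct] fin by (meson finite_subset subsetI)
    have "generate G {c} \<inter> (\<lambda>x. t \<otimes> x) ` generate G {c} = {}"
    proof (rule ccontr)
      assume "\<not> ?thesis"
      then obtain x where x: "x \<in> generate G {c}" "t \<otimes> x \<in> generate G {c}" by blast
      then have "(t \<otimes> x) \<otimes> inv x \<in> generate G {c}"
        using subgroup_generate_single[OF cc(1)] by (simp add: subgroup.m_closed subgroup.m_inv_closed)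
      then show False using t_not_mem[OF fin ct] mem_generate_closed[OF fin ct x(1)] cc by (simp add: m_assoc)
    qed
    moreover have "card ((\<lambda>x. t \<otimes> x) ` generate G {c}) = card (generate G {c})"
      using mem_generate_closed[OF fin ct] cc by (intro card_image) (auto simp: inj_on_def)
    ultimately show ?thesis unfolding N_eq using fing by (simp add: card_Un_disjoint)
  qed
  moreover have "odd (card (generate G {c}))"
    using generate_pow_card[OF cc(1)] ct by (simp add: odd_dihedral_pair_def)
  ultimately show ?thesis by simp
qed

lemma iso_dihedral_group:
  assumes fin: "finite (carrier G)" and G: "odd_dihedral (carrier G)"
  shows "\<exists>n. odd n \<and> G \<cong> dihedral_group n"
proof -
  obtain c t where ct: "odd_dihedral_pair c t" and carr: "carrier G = generate G {c} \<union> (\<lambda>x. t \<otimes> x) ` generate G {c}"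
    using G by (auto simp: odd_dihedral_def)
  have cc: "c \<in> carrier G" "t \<in> carrier G" and tt: "t \<otimes> t = \<one>" and odd: "odd (ord c)"
    using ct by (auto simp: odd_dihedral_pair_def)
  define n where "n = ord c"
  have n0: "n > 0" using odd by (auto simp: n_def intro: Nat.gr0I)
  interpret D: group "dihedral_group n" using dihedral_group_is_group[OF n0] .
  define f where "f = (\<lambda>(a :: int, s). c [^] a \<otimes> (if s then t else \<one>))"
  have gen: "generate G {c} = {c [^] k | k. k \<in> (UNIV :: int set)}" by (rule generate_pow[OF cc(1)])
  have cmod: "c [^] (a mod int n) = c [^] a" for a :: int
  proof -
    have "c [^] a = c [^] (int n * (a div int n) + a mod int n)" by simp
    also have "\<dots> = c [^] (int n * (a div int n)) \<otimes> c [^] (a mod int n)" using cc by (simp only: int_pow_mult)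
    also have "c [^] (int n * (a div int n)) = \<one>" using int_pow_eq_id[OF cc(1)] by (simp add: n_def)
    finally show ?thesis using cc by simp
  qed
  have tc: "t \<otimes> c [^] b = c [^] (- b) \<otimes> t" for b :: int
  proof -
    have "c [^] b \<in> generate G {c}" using gen by blast
    from reflection_inverts[OF fin ct this] have "(t \<otimes> c [^] b \<otimes> t) \<otimes> t = c [^] (- b) \<otimes> t" using cc by (simp add: int_pow_neg)
    then show ?thesis using cc tt by (simp add: m_assoc)
  qed
  have "f \<in> hom (dihedral_group n) G"
  proof (rule homI)
    fix x assume "x \<in> carrier (dihedral_group n)"
    then show "f x \<in> carrier G" using cc by (auto simp: f_def split: prod.split)
  next
    fix x y assume "x \<in> carrier (dihedral_group n)" "y \<in> carrier (dihedral_group n)"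
    obtain a s where x: "x = (a, s)" by (cases x)
    obtain b u where y: "y = (b, u)" by (cases y)
    show "f (x \<otimes>\<^bsub>dihedral_group n\<^esub> y) = f x \<otimes> f y"
    proof (cases s)
      case True
      have "f x \<otimes> f y = c [^] a \<otimes> (t \<otimes> c [^] b) \<otimes> (if u then t else \<one>)"
        using cc True by (simp add: f_def x y m_assoc)
      also have "\<dots> = c [^] (a - b) \<otimes> (t \<otimes> (if u then t else \<one>))"
      proof -
        have "c [^] (a - b) = c [^] a \<otimes> c [^] (- b)" using int_pow_mult[OF cc(1), of a "- b"] by simp
        then show ?thesis unfolding tc using cc by (simp add: m_assoc)
      qed
      also have "t \<otimes> (if u then t else \<one>) = (if s \<noteq> u then t else \<one>)" using True tt cc by simp
      finally show ?thesis using True by (simp add: x y f_def dihedral_group_def cmod)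
    next
      case False
      have "f x \<otimes> f y = c [^] (a + b) \<otimes> (if u then t else \<one>)"
        using cc False by (simp add: f_def x y m_assoc int_pow_mult)
      then show ?thesis using False by (simp add: x y f_def dihedral_group_def cmod)
    qed
  qed
  moreover have "f ` carrier (dihedral_group n) = carrier G"
  proof (intro equalityI subsetI)
    fix g assume "g \<in> f ` carrier (dihedral_group n)"
    then show "g \<in> carrier G" using cc by (auto simp: f_def split: prod.splits)
  next
    have sur: "c [^] a \<otimes> (if s then t else \<one>) \<in> f ` carrier (dihedral_group n)" for a :: int and s
    proof (rule rev_image_eqI)
      show "(a mod int n, s) \<in> carrier (dihedral_group n)" using n0 by (simp add: dihedral_group_def)
      show "c [^] a \<otimes> (if s then t else \<one>) = f (a mod int n, s)" by (simp add: f_def cmod)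
    qed
    fix g assume "g \<in> carrier G"
    then show "g \<in> f ` carrier (dihedral_group n)"
      unfolding carr
    proof
      assume "g \<in> generate G {c}"
      then obtain a :: int where "g = c [^] a" using gen by blast
      then show ?thesis using sur[of a False] cc by simp
    next
      assume "g \<in> (\<lambda>x. t \<otimes> x) ` generate G {c}"
      then obtain x where x: "x \<in> generate G {c}" "g = t \<otimes> x" by blast
      from x(1) obtain a :: int where "x = c [^] a" unfolding gen by blast
      then have "g = t \<otimes> c [^] a" using x(2) by simp
      then show ?thesis using sur[of "- a" True] tc by simp
    qed
  qed
  moreover have "inj_on f (carrier (dihedral_group n))"
  proof (rule inj_onI)
    fix x y assume x: "x \<in> carrier (dihedral_group n)" and y: "y \<in> carrier (dihedral_group n)" and eq: "f x = f y"
    obtain a s where xe: "x = (a, s)" by (cases x)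
    obtain b u where ye: "y = (b, u)" by (cases y)
    have ab: "0 \<le> a" "a < int n" "0 \<le> b" "b < int n" using x y by (auto simp: xe ye dihedral_group_def)
    have mem: "c [^] k \<in> generate G {c}" for k :: int using gen by blast
    have e: "c [^] a \<otimes> (if s then t else \<one>) = c [^] b \<otimes> (if u then t else \<one>)" using eq by (simp add: f_def xe ye)
    have "s = u"
    proof (rule ccontr)
      assume "s \<noteq> u"
      then have "\<exists>(k :: int) (l :: int). c [^] k \<otimes> t = c [^] l" 
      proof (cases s)
        case True
        then have "c [^] a \<otimes> t = c [^] b" using e \<open>s \<noteq> u\<close> cc by simp
        then show ?thesis by blast
      next
        case False
        then have "c [^] b \<otimes> t = c [^] a" using e \<open>s \<noteq> u\<close> cc by simp
        then show ?thesis by blast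
      qed
      then obtain k l :: int where "c [^] k \<otimes> t = c [^] l" by blast
      then have "inv (c [^] k) \<otimes> (c [^] k \<otimes> t) = inv (c [^] k) \<otimes> c [^] l" by simp
      then have "t = inv (c [^] k) \<otimes> c [^] l" using cc by simp
      then have "t \<in> generate G {c}" using mem subgroup_generate_single[OF cc(1)]
        by (metis subgroup.m_closed subgroup.m_inv_closed)
      then show False using t_not_mem[OF fin ct] by simp
    qed
    then have "c [^] a = c [^] b" using e cc by (auto split: if_splits)
    then have "c [^] (a - b) = \<one>" using cc by (simp add: int_pow_diff)
    then have "int n dvd a - b" using int_pow_eq_id[OF cc(1)] by (simp add: n_def)
    then have "a = b" using ab by (metis mod_eq_dvd_iff mod_pos_pos_trivial)
    then show "x = y" using xe ye \<open>s = u\<close> by simp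
  qed
  ultimately have "f \<in> iso (dihedral_group n) G" by (simp add: iso_def bij_betw_def)
  then have "dihedral_group n \<cong> G" by (rule is_isoI)
  then have "G \<cong> dihedral_group n" by (rule D.iso_sym)
  then show ?thesis using odd unfolding n_def by blast
qed

text \<open>If two primes \<open>r\<close> and \<open>s\<close> divided \<open>ord w\<close>,
  Bezout's identity would write \<open>w\<close> as a product of powers of \<open>w [^] r\<close>
  and \<open>w [^] s\<close>, which lie in \<open>B\<close>. The lemma is applied to elements of
  least order outside a centraliser.\<close>

lemma minimal_outside_subgroup:
  assumes B: "subgroup B G" and w: "w \<in> carrier G" "w \<notin> B" and fin: "finite (carrier G)"
    and min: "\<And>r. Factorial_Ring.prime r \<Longrightarrow> r dvd ord w \<Longrightarrow> w [^] r \<in> B"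
  shows "\<exists>r b. Factorial_Ring.prime r \<and> ord w = r ^ b \<and> w [^] r \<in> B"
proof -
  have "w \<noteq> \<one>" using w subgroup.one_closed[OF B] by auto
  then have "ord w \<noteq> 1" using ord_eq_1[OF w(1)] by simp
  then obtain r where r: "Factorial_Ring.prime r" "r dvd ord w" using prime_factor_nat by blast
  have ow: "ord w \<noteq> 0" using ord_ge_1[OF fin w(1)] by simp
  have uniq: "s = r" if s: "Factorial_Ring.prime s" "s dvd ord w" for s
  proof (rule ccontr)
    assume "s \<noteq> r"
    then have "coprime r s" using r s primes_coprime by blast
    then have "gcd (int r) (int s) = 1" by (simp flip: coprime_iff_gcd_eq_1)
    then obtain x y where xy: "x * int r + y * int s = 1" using bezout_int[of "int r" "int s"] by auto
    have "w = w [^] (int r * x + int s * y)" using xy w(1) by (simp add: mult.commute)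
    also have "\<dots> = (w [^] r) [^] x \<otimes> (w [^] s) [^] y"
      using w(1) by (simp add: int_pow_pow flip: int_pow_mult int_pow_int)
    also have "\<dots> \<in> B" using min[OF r] min[OF s] B subgroup_int_pow_closed[OF B] by (simp add: subgroup.m_closed)
    finally show False using w(2) by simp
  qed
  obtain d where d: "ord w = r ^ multiplicity r (ord w) * d" "\<not> r dvd d"
    using multiplicity_decompose'[of "ord w" r] ow r(1) not_prime_unit by metis
  have "d = 1"
  proof (rule ccontr)
    assume "d \<noteq> 1"
    then obtain s where s: "Factorial_Ring.prime s" "s dvd d" using prime_factor_nat by blast
    then have "s dvd ord w" using d(1) by (metis dvd_mult)
    then show False using uniq[OF s(1)] s(2) d(2) by simp
  qed
  then show ?thesis using r min[OF r] d(1) by (metis mult.right_neutral)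
qed

end

section \<open>Classification of the subgroups of a counterexample\<close>

context counterexample
begin

text \<open>Stated for all subgroups so that the induction reaches the centralisers and normalisers
  inside \<open>H\<close>.\<close>

lemma cyclic_or_odd_dihedral:
  assumes "subgroup H G"
  shows "(\<exists>c\<in>H. H = generate G {c}) \<or> odd_dihedral H"
  using assms
proof (induction "card H" arbitrary: H rule: less_induct)
  case less
  note H = less.prems
  note mH = mem_H[OF H fin] and cin_iff = centralizer_in_iff[OF H fin]
  have finH: "finite H" by (rule finite_H[OF H fin])
  have cyc_comm: "x \<otimes> y = y \<otimes> x" if "c \<in> carrier G" "A = generate G {c}" "x \<in> A" "y \<in> A" for A c x y
    using generate_comm[OF fin that(1)] that by blast
  have small: "(\<exists>c\<in>A. A = generate G {c}) \<or> odd_dihedral A" if "subgroup A G" "A \<subset> H" for A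
    using less.hyps[OF psubset_card_mono[OF finH that(2)] that(1)] .
  have central_cyclic: "\<exists>c\<in>A. A = generate G {c}"
    if A: "subgroup A G" "A \<subset> H" "g \<in> A" "g \<noteq> \<one>" "\<And>a. a \<in> A \<Longrightarrow> g \<otimes> a = a \<otimes> g" for A g
    using small[OF A(1,2)] odd_dihedral_center[OF fin _ A(3,5)] A(4) by blast
  show ?case
  proof (cases "center_of H = H")
    case True
    have "x \<otimes> y = y \<otimes> x" if "x \<in> H" "y \<in> H" for x y
      using that True unfolding center_of_def by blast
    then show ?thesis using abelian_cyclic[OF H] by blast
  next
    case False
    let ?Z = "center_of H"
    have one_Z: "\<one> \<in> ?Z" using subgroup.one_closed[OF subgroup_center_of[OF H fin]] .
    have cen_cyc: "\<exists>c\<in>centralizer_in H g. centralizer_in H g = generate G {c}" if g: "g \<in> H" "g \<notin> ?Z" for g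
    proof (rule central_cyclic)
      show "subgroup (centralizer_in H g) G" using subgroup_centralizer_in[OF H fin] g by simp
      show "g \<in> centralizer_in H g" using g by (simp add: cin_iff)
      show "g \<noteq> \<one>" using g one_Z by auto
      show "g \<otimes> a = a \<otimes> g" if "a \<in> centralizer_in H g" for a using that by (simp add: cin_iff)
      show "centralizer_in H g \<subset> H"
      proof -
        obtain h where h: "h \<in> H" "g \<otimes> h \<noteq> h \<otimes> g" using g by (auto simp: center_of_def)
        then have "h \<notin> centralizer_in H g" by (auto simp: cin_iff)
        then show ?thesis using h(1) by (auto simp: centralizer_in_def)
      qed
    qed
    have abel: "x \<otimes> y = y \<otimes> x" if g: "g \<in> H - ?Z" and "x \<in> centralizer_in H g" "y \<in> centralizer_in H g" for g x y
    proof -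
      obtain c where c: "c \<in> centralizer_in H g" "centralizer_in H g = generate G {c}" using cen_cyc g by blast
      have "c \<in> carrier G" using c(1) mH unfolding centralizer_in_def by blast
      then show ?thesis using cyc_comm c(2) that(2,3) by blast
    qed
    have norm: "card (normalizer_in H g) = 2 * card (centralizer_in H g) \<and> odd (card (centralizer_in H g))"
      if g: "g \<in> H - ?Z" and nH: "normalizer_in H g \<noteq> H" and nC: "normalizer_in H g \<noteq> centralizer_in H g" for g
    proof -
      have gH: "g \<in> H" using g by simp
      have sN: "subgroup (normalizer_in H g) G" by (rule subgroup_normalizer_in[OF H fin gH])
      have CN: "centralizer_in H g \<subseteq> normalizer_in H g" by (rule centralizer_in_subset_normalizer_in[OF H fin gH])
      have "normalizer_in H g \<subset> H" using nH by (auto simp: normalizer_in_def)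
      from small[OF sN this] show ?thesis
      proof
        assume "\<exists>c\<in>normalizer_in H g. normalizer_in H g = generate G {c}"
        then obtain c where c: "c \<in> normalizer_in H g" "normalizer_in H g = generate G {c}" by blast
        have cc: "c \<in> carrier G" using c(1) sN subgroup.mem_carrier by metis
        have "g \<in> normalizer_in H g" using CN gH by (auto simp: cin_iff)
        have "normalizer_in H g \<subseteq> centralizer_in H g"
        proof
          fix x assume x: "x \<in> normalizer_in H g"
          then have "x \<in> H" by (simp add: normalizer_in_def)
          moreover have "g \<otimes> x = x \<otimes> g" "x \<otimes> g = g \<otimes> x"
            using cyc_comm[OF cc c(2)] x \<open>g \<in> normalizer_in H g\<close> by blast+
          ultimately show "x \<in> centralizer_in H g" unfolding cin_iff by blast
        qed
        then show ?thesis using CN nC by blast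
      next
        assume "odd_dihedral (normalizer_in H g)"
        then show ?thesis by (intro odd_dihedral_normalizer[OF fin H g])
      qed
    qed
    have "\<exists>g\<in>H - ?Z. normalizer_in H g = H"
    proof (rule exists_normal_centralizer[OF H fin])
      show "x \<otimes> y = y \<otimes> x" if "g \<in> H - ?Z" "x \<in> centralizer_in H g" "y \<in> centralizer_in H g" for g x y
        using that by (rule abel)
      show "center_of H \<noteq> H" by (rule False)
      show "card (normalizer_in H g) = 2 * card (centralizer_in H g) \<and> odd (card (centralizer_in H g))"
        if "g \<in> H - center_of H" "normalizer_in H g \<noteq> H" "normalizer_in H g \<noteq> centralizer_in H g" for g
        using that by (rule norm)
    qed
    then obtain g where g: "g \<in> H - ?Z" and gN: "normalizer_in H g = H" by (rule bexE)
    define C where "C = centralizer_in H g"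
    have gH: "g \<in> H" using g by auto
    have sC: "subgroup C G" unfolding C_def by (rule subgroup_centralizer_in[OF H fin gH])
    have CH: "x \<in> H" if "x \<in> C" for x using that by (simp add: C_def cin_iff)
    have Cc: "x \<in> carrier G" if "x \<in> C" for x using CH mH that by blast
    have Ccomm: "x \<otimes> y = y \<otimes> x" if "x \<in> C" "y \<in> C" for x y using abel[OF g] that by (simp add: C_def)
    have gC: "g \<in> C" using gH by (simp add: C_def cin_iff)
    have conjC: "h \<otimes> x \<otimes> inv h \<in> C" if h: "h \<in> H" and x: "x \<in> C" for h x
    proof -
      have "h \<in> normalizer_in H g" using gN h by simp
      then have "centralizer_in H (h \<otimes> g \<otimes> inv h) = C" by (simp add: normalizer_in_def C_def)
      moreover have "h \<otimes> x \<otimes> inv h \<in> centralizer_in H (h \<otimes> g \<otimes> inv h)"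
        using conj_centralizer_in_iff[OF H fin h gH CH[OF x]] x by (simp add: C_def)
      ultimately show ?thesis by simp
    qed
    show ?thesis
    proof (cases "\<exists>x\<in>C. Factorial_Ring.prime (ord x) \<and> (\<exists>w\<in>H. w \<otimes> x \<noteq> x \<otimes> w)")
      case True
      then obtain x t where x: "x \<in> C" "Factorial_Ring.prime (ord x)" and t: "t \<in> H" "t \<otimes> x \<noteq> x \<otimes> t" by blast
      have xH: "x \<in> H" and xc: "x \<in> carrier G" using x CH Cc by auto
      have x1: "x \<noteq> \<one>" using t mH by auto
      \<comment> \<open>Conjugation by \<open>w\<close> keeps \<open>x\<close> inside the abelian
        group \<open>C\<close>, where a second element of the same prime order is a power of
        \<open>x\<close>. So \<open>w\<close> normalises the group of \<open>x\<close>, and a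
        counterexample allows this only for involutions.\<close>
      have invol: "w \<otimes> w = \<one>" if w: "w \<in> H" "w \<otimes> x \<noteq> x \<otimes> w" for w
      proof -
        have wc: "w \<in> carrier G" using w mH by simp
        let ?y = "w \<otimes> x \<otimes> inv w"
        have yC: "?y \<in> C" using conjC w x by simp
        have "?y [^] ord x = \<one>" unfolding conj_pow[OF wc xc] using xc wc by simp
        moreover have "?y \<noteq> \<one>"
        proof
          assume "?y = \<one>"
          then have "?y \<otimes> w = w" using wc by simp
          then show False using x1 wc xc by (simp add: m_assoc)
        qed
        ultimately have "ord ?y = ord x" using ord_prime_eq[OF Cc[OF yC] x(2)] by blast
        then have "?y \<in> generate G {x}" using prime_unique[OF xc Cc[OF yC] Ccomm[OF x(1) yC] x(2) refl] by simp
        then show ?thesis using noncommuting_involution[OF xc wc x(2) _ w(2)] by simp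
      qed
      have tc: "t \<in> carrier G" using t mH by simp
      have tt: "t \<otimes> t = \<one>" using invol t by simp
      define A where "A = centralizer_in H x"
      have xZ: "x \<notin> ?Z"
      proof
        assume "x \<in> ?Z"
        then have "x \<otimes> t = t \<otimes> x" using t(1) unfolding center_of_def by blast
        then show False using t(2) by metis
      qed
      obtain a where a: "a \<in> A" "A = generate G {a}" using cen_cyc[OF xH xZ] by (auto simp: A_def)
      have sA: "subgroup A G" unfolding A_def by (rule subgroup_centralizer_in[OF H fin xH])
      have AH: "b \<in> H" and Ac: "b \<in> carrier G" and Ax: "b \<otimes> x = x \<otimes> b" if "b \<in> A" for b
        using that mH by (auto simp: A_def cin_iff)
      \<comment> \<open>The element \<open>t \<otimes> b\<close> fails to commute with
        \<open>x\<close> as well, so it is an involution too, and this means that \<open>t\<close>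
        inverts \<open>b\<close>.\<close>
      have tinv: "t \<otimes> b \<otimes> t = inv b" if b: "b \<in> A" for b
      proof -
        have bc: "b \<in> carrier G" using Ac b by simp
        have "(t \<otimes> b) \<otimes> x \<noteq> x \<otimes> (t \<otimes> b)"
        proof
          assume "(t \<otimes> b) \<otimes> x = x \<otimes> (t \<otimes> b)"
          from commutes_mult[OF _ _ xc this commutes_inv[OF bc xc Ax[OF b]]]
          have "((t \<otimes> b) \<otimes> inv b) \<otimes> x = x \<otimes> ((t \<otimes> b) \<otimes> inv b)" using tc bc by simp
          then show False using t(2) tc bc by (simp add: m_assoc)
        qed
        then have "(t \<otimes> b) \<otimes> (t \<otimes> b) = \<one>" using invol[OF H_mult[OF H fin t(1) AH[OF b]]] by simp
        then have "(t \<otimes> b \<otimes> t) \<otimes> b = \<one>" using tc bc by (simp add: m_assoc)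
        then show ?thesis using tc bc by (metis inv_equality inv_inv inv_closed m_closed)
      qed
      have t1: "t \<noteq> \<one>" using t xc by auto
      have tA: "t \<notin> A" using t by (auto simp: A_def cin_iff)
      have ordt: "ord t = 2" using ord_prime_eq[OF tc two_is_prime_nat] tt t1 tc by (simp add: numeral_2_eq_2)
      have "odd (ord a)"
      proof
        assume "even (ord a)"
        then have "2 dvd card A" using generate_pow_card[OF Ac[OF a(1)]] a(2) by simp
        \<comment> \<open>An involution in \<open>A\<close> is inverted, hence fixed, by
          \<open>t\<close>. By uniqueness of commuting subgroups of order two it would equal
          \<open>t\<close>, which is not in \<open>A\<close>.\<close>
        then obtain s where s: "s \<in> A" "ord s = 2" using exists_prime_order[OF fin sA two_is_prime_nat] by blast
        have sc: "s \<in> carrier G" using Ac s by simp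
        have "s [^] (2 :: nat) = \<one>" using pow_ord_eq_1[OF sc] s(2) by simp
        then have "inv s = s" using sc by (intro inv_equality) (simp_all add: numeral_2_eq_2)
        then have "(t \<otimes> s \<otimes> t) \<otimes> t = s \<otimes> t" using tinv[OF s(1)] by simp
        then have "t \<otimes> s = s \<otimes> t" using tc sc tt by (simp add: m_assoc)
        then have "s \<in> generate G {t}" using prime_unique[OF tc sc _ two_is_prime_nat ordt s(2)] by simp
        then obtain k :: nat where k: "s = t [^] k" using mem_generateE[OF fin tc] by blast
        have "t [^] (k :: nat) = \<one> \<or> t [^] k = t" for k by (induction k) (use tc tt in auto)
        then have "s = \<one> \<or> s = t" using k by metis
        then show False using s tA ord_id by auto
      qed
      moreover have "a \<noteq> \<one>"
      proof
        assume "a = \<one>"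
        moreover have "x \<in> A" using xH by (simp add: A_def cin_iff)
        ultimately show False using a(2) generate_one x1 by auto
      qed
      ultimately have "odd_dihedral_pair a t"
        using Ac[OF a(1)] tc tt tinv[OF a(1)] by (simp add: odd_dihedral_pair_def)
      moreover have "H = A \<union> (\<lambda>x. t \<otimes> x) ` A"
      proof (intro equalityI subsetI)
        fix w assume w: "w \<in> H"
        have wc: "w \<in> carrier G" using w mH by simp
        show "w \<in> A \<union> (\<lambda>x. t \<otimes> x) ` A"
        proof (cases "w \<otimes> x = x \<otimes> w")
          case True then show ?thesis using w by (simp add: A_def cin_iff)
        next
          case False
          \<comment> \<open>Both \<open>w\<close> and \<open>t\<close> invert \<open>x\<close>, so
            \<open>t \<otimes> w\<close> centralises \<open>x\<close> and lies in
            \<open>A\<close>.\<close>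
          have ww: "w \<otimes> w = \<one>" using invol[OF w False] .
          have "(w \<otimes> x) \<otimes> x \<noteq> x \<otimes> (w \<otimes> x)"
          proof
            assume "(w \<otimes> x) \<otimes> x = x \<otimes> (w \<otimes> x)"
            then have "(w \<otimes> x) \<otimes> x = (x \<otimes> w) \<otimes> x" using wc xc by (simp add: m_assoc)
            then show False using False wc xc by simp
          qed
          then have "(w \<otimes> x) \<otimes> (w \<otimes> x) = \<one>" using invol[OF H_mult[OF H fin w xH]] by simp
          then have "(w \<otimes> x \<otimes> w) \<otimes> x = \<one>" using wc xc by (simp add: m_assoc)
          then have wxw: "w \<otimes> x \<otimes> w = inv x" using wc xc by (metis inv_equality inv_inv inv_closed m_closed)
          have txtx: "t \<otimes> x \<otimes> t = inv x" using tinv xH by (simp add: A_def cin_iff)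
          have "(t \<otimes> w) \<otimes> x = t \<otimes> (w \<otimes> x \<otimes> w) \<otimes> w" using wc xc tc ww by (simp add: m_assoc)
          also have "\<dots> = t \<otimes> (t \<otimes> x \<otimes> t) \<otimes> w" unfolding wxw txtx ..
          also have "\<dots> = (t \<otimes> t) \<otimes> x \<otimes> t \<otimes> w" using wc xc tc by (simp add: m_assoc)
          also have "\<dots> = x \<otimes> (t \<otimes> w)" unfolding tt using wc xc tc by (simp add: m_assoc)
          finally have "t \<otimes> w \<in> A" using H_mult[OF H fin t(1) w] by (simp add: A_def cin_iff)
          moreover have "w = (t \<otimes> t) \<otimes> w" unfolding tt using wc by simp
          then have "w = t \<otimes> (t \<otimes> w)" using wc tc by (simp add: m_assoc)
          ultimately show ?thesis by blast
        qed
      next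
        fix w assume "w \<in> A \<union> (\<lambda>x. t \<otimes> x) ` A"
        then show "w \<in> H" using AH H_mult[OF H fin t(1)] by blast
      qed
      ultimately have "odd_dihedral H" unfolding odd_dihedral_def using a(2) by blast
      then show ?thesis ..
    next
      case False
      then have prime_central: "w \<otimes> x = x \<otimes> w" if "x \<in> C" "Factorial_Ring.prime (ord x)" "w \<in> H" for x w
        using that by blast
      obtain w0 where w0: "w0 \<in> H" "w0 \<otimes> g \<noteq> g \<otimes> w0" using g by (auto simp: center_of_def)
      have gc: "g \<in> carrier G" using gH mH by simp
      have ord_less: "ord (y [^] r) < ord y" if "y \<in> carrier G" "Factorial_Ring.prime r" "r dvd ord y" for y r
      proof -
        have "ord (y [^] r) = ord y div r"
          using ord_pow_gen[OF that(1), of r] that(2,3) prime_gt_0_nat[OF that(2)] by (simp add: gcd_nat.absorb2)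
        moreover have "ord y > 0" using ord_ge_1[OF fin that(1)] by simp
        ultimately show ?thesis using prime_ge_2_nat[OF that(2)] by simp
      qed
      have powH: "y [^] (k :: nat) \<in> A" if "subgroup A G" "y \<in> A" for A y k
        using subgroup_int_pow_closed[OF that, of "int k"] by (simp add: int_pow_int)
      \<comment> \<open>The orders of \<open>w\<close> and then of \<open>c\<close> are chosen
        least. Both become prime powers, \<open>w [^] r\<close> commutes with \<open>g\<close>, and
        \<open>c [^] s\<close> commutes with \<open>w\<close>.\<close>
      define P where "P w \<longleftrightarrow> w \<in> H \<and> w \<otimes> g \<noteq> g \<otimes> w" for w
      obtain w where w: "P w" and wmin: "\<And>w'. P w' \<Longrightarrow> ord w \<le> ord w'"
        using ex_has_least_nat[of P w0 ord] w0 unfolding P_def by blast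
      have wH: "w \<in> H" "w \<otimes> g \<noteq> g \<otimes> w" and wc: "w \<in> carrier G" using w mH by (auto simp: P_def)
      have "\<exists>r b. Factorial_Ring.prime r \<and> ord w = r ^ b \<and> w [^] r \<in> centralizer g"
      proof (rule minimal_outside_subgroup[OF subgroup_centralizer[OF gc] wc _ fin])
        show "w \<notin> centralizer g" using wH by (simp add: centralizer_def)
        fix r assume r: "Factorial_Ring.prime r" "r dvd ord w"
        have "\<not> P (w [^] r)" using wmin[of "w [^] r"] ord_less[OF wc r] by linarith
        then show "w [^] r \<in> centralizer g" using powH[OF H wH(1)] wc by (simp add: P_def centralizer_def)
      qed
      then obtain r b where r: "Factorial_Ring.prime r" "ord w = r ^ b" "w [^] r \<in> centralizer g" by blast
      define Q where "Q c \<longleftrightarrow> c \<in> C \<and> w \<otimes> c \<noteq> c \<otimes> w" for c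
      obtain c where c: "Q c" and cmin: "\<And>c'. Q c' \<Longrightarrow> ord c \<le> ord c'"
        using ex_has_least_nat[of Q g ord] gC wH(2) unfolding Q_def by blast
      have cC: "c \<in> C" "w \<otimes> c \<noteq> c \<otimes> w" and cc: "c \<in> carrier G" using c Cc by (auto simp: Q_def)
      have "\<exists>s a. Factorial_Ring.prime s \<and> ord c = s ^ a \<and> c [^] s \<in> centralizer w"
      proof (rule minimal_outside_subgroup[OF subgroup_centralizer[OF wc] cc _ fin])
        show "c \<notin> centralizer w" using cC by (auto simp: centralizer_def)
        fix s assume s: "Factorial_Ring.prime s" "s dvd ord c"
        have "\<not> Q (c [^] s)" using cmin[of "c [^] s"] ord_less[OF cc s] by linarith
        then show "c [^] s \<in> centralizer w" using powH[OF sC cC(1)] cc by (auto simp: Q_def centralizer_def)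
      qed
      then obtain s a where s: "Factorial_Ring.prime s" "ord c = s ^ a" "c [^] s \<in> centralizer w" by blast
      \<comment> \<open>The commutator lies in the normal abelian group \<open>C\<close>. Its order
        is \<open>s\<close> because \<open>c [^] s\<close> commutes with \<open>w\<close>, and
        elements of prime order in \<open>C\<close> are central here.\<close>
      define z where "z = (w \<otimes> c \<otimes> inv w) \<otimes> inv c"
      have wcC: "w \<otimes> c \<otimes> inv w \<in> C" using conjC wH cC by simp
      have zC: "z \<in> C" unfolding z_def using wcC cC sC by (simp add: subgroup.m_closed subgroup.m_inv_closed)
      have zcar: "z \<in> carrier G" using Cc zC by simp
      have wc_eq: "w \<otimes> c = z \<otimes> c \<otimes> w" unfolding z_def using wc cc by (simp add: m_assoc)
      have z1: "z \<noteq> \<one>" using wc_eq cC(2) wc cc by auto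
      have "z [^] s = (w \<otimes> c \<otimes> inv w) [^] s \<otimes> (inv c) [^] s"
      proof -
        have "inv c \<in> C" using cC sC by (simp add: subgroup.m_inv_closed)
        then show ?thesis unfolding z_def
          using Ccomm[OF wcC] wc cc by (intro pow_mult_distrib) auto
      qed
      also have "\<dots> = (w \<otimes> c [^] s \<otimes> inv w) \<otimes> inv (c [^] s)"
        unfolding conj_pow[OF wc cc] using cc by (simp add: nat_pow_inv)
      also have "w \<otimes> c [^] s \<otimes> inv w = c [^] s \<otimes> w \<otimes> inv w" using s(3) by (simp add: centralizer_def)
      also have "\<dots> \<otimes> inv (c [^] s) = \<one>" using wc cc by (simp add: m_assoc)
      finally have "ord z = s" using ord_prime_eq[OF zcar s(1) _ z1] by simp
      then have zw: "z \<otimes> w = w \<otimes> z" using prime_central[OF zC _ wH(1)] s(1) by simp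
      have zc: "z \<otimes> c = c \<otimes> z" by (rule Ccomm[OF zC cC(1)])
      \<comment> \<open>As \<open>w [^] r\<close> lies in \<open>C\<close> it commutes with
        \<open>c\<close>, whereas \<open>swap_powers\<close> produces \<open>z [^] r\<close>. So
        \<open>z [^] r = \<one>\<close>, and the primes \<open>r\<close> and \<open>s\<close>
        agree.\<close>
      have "w [^] r \<otimes> c = c \<otimes> w [^] r"
      proof -
        have "w [^] r \<in> C" unfolding C_def using r(3) powH[OF H wH(1)] by (simp add: centralizer_in_def)
        then show ?thesis using Ccomm cC(1) by simp
      qed
      moreover have "w [^] r \<otimes> c = z [^] r \<otimes> (c \<otimes> w [^] r)"
        using swap_powers[OF cc wc zcar zc zw wc_eq, of r 1] cc by simp
      ultimately have "z [^] r \<otimes> (c \<otimes> w [^] r) = c \<otimes> w [^] r" by simp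
      then have "z [^] r = \<one>" using zcar cc wc by simp
      then have "s dvd r" using pow_eq_id[OF zcar] \<open>ord z = s\<close> by simp
      then have "s = r" using r(1) s(1) primes_dvd_imp_eq by blast
      then show ?thesis
        using no_class_two_pair[OF r(1) cc wc zcar _ zc zw wc_eq] \<open>ord z = s\<close> s(2) r(2) by blast
    qed
  qed
qed

end

theorem theorem7p2:
  fixes G :: "('a, 'b) monoid_scheme"
  assumes "group G"
    and "finite (carrier G)"
    and "\<not> cyclic_group G"
    and "\<not> (\<exists>n::nat. odd n \<and> G \<cong> dihedral_group n)"
  shows "real (large_davenport G) \<le> 3 / 4 * real (order G)"
proof -
  interpret group G by (rule assms(1))
  have "three_quarters"
  proof (rule ccontr)
    assume "\<not> three_quarters"
    then interpret counterexample G by unfold_locales (rule assms(2))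
    from cyclic_or_odd_dihedral[OF subgroup_self] show False
    proof
      assume "\<exists>c\<in>carrier G. carrier G = generate G {c}"
      then obtain c where c: "c \<in> carrier G" "carrier G = generate G {c}" by blast
      have "carrier G = range (\<lambda>n :: int. c [^]\<^bsub>G\<^esub> n)" using generate_pow[OF c(1)] c(2) by auto
      then show False using assms(3) cyclic_group c(1) by blast
    next
      assume "odd_dihedral (carrier G)"
      then show False using iso_dihedral_group[OF assms(2)] assms(4) by blast
    qed
  qed
  then show ?thesis by (rule large_davenport_le_of_three_quarters[OF assms(2)])
qed

end
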